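(* Let $-\infty<a<b<+\infty$, let $f,g$ be continuous real functions on $[a,b]$ with $f(x)<g(x)$ for all $x\in[a,b]$, and let $\boldsymbol{Q}=(Q;z_1,z_2,z_3,z_4)$ be the quadrilateral whose domain $Q$ is bounded by the vertical segments $[z_1,z_2]$, $[z_3,z_4]$ and the curves $\Gamma_1=\{x+iy: y=f(x),\ a\le x\le b\}$, $\Gamma_2=\{x+iy: y=g(x),\ a\le x\le b\}$, where $z_1=a+ig(a)$, $z_2=a+if(a)$, $z_3=b+if(b)$, $z_4=b+ig(b)$. Suppose that $Q$ is symmetric with respect to both coordinate axes. For $H>0$ let $f_H(x+iy)=Hx+iy$ and let $\boldsymbol{Q}_H=(f_H(Q);f_H(z_1),f_H(z_2),f_H(z_3),f_H(z_4))$. Then $$\operatorname{ExtMod}(\boldsymbol{Q}_H)\sim \frac{1}{\pi}\log H\quad\text{as } H\to\infty,$$ i.e. the ratio of the two sides tends to $1$.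
   Context: A quadrilateral $(Q;w_1,w_2,w_3,w_4)$ is a Jordan domain $Q$ on the Riemann sphere together with four distinct boundary points (vertices) $w_1,w_2,w_3,w_4$ listed in the order of positive traversal of $\partial Q$ (with respect to $Q$). Its conformal modulus $\operatorname{Mod}$ is the extremal length of the family of curves in $Q$ joining the boundary arcs $(w_1,w_2)$ and $(w_3,w_4)$; equivalently, it is the number $m>0$ such that $Q$ can be mapped conformally onto the rectangle $\{0<\operatorname{Re}w<1,\ 0<\operatorname{Im}w<m\}$ with the vertices $w_1,w_2,w_3,w_4$ going to the corners and the arcs $(w_1,w_2)$, $(w_3,w_4)$ going to the horizontal sides. If $\overline{Q}$ does not contain $\infty$, the exterior conformal modulus $\operatorname{ExtMod}(Q;w_1,w_2,w_3,w_4)$ is the conformal modulus of the quadrilateral $(\overline{\mathbb C}\setminus \overline{Q}\,;w_4,w_3,w_2,w_1)$ (the complement of $Q$ in the extended plane, with vertices in reversed order). Notation $A(H)\sim B(H)$ means $A(H)/B(H)\to1$. *)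

theory Defs
  imports "HOL-Complex_Analysis.Complex_Analysis" "HOL-Library.Landau_Symbols"
begin

definition rect :: "real \<Rightarrow> complex set" where
  "rect m = {z. 0 < Re z \<and> Re z < 1 \<and> 0 < Im z \<and> Im z < m}"

text \<open>Exterior conformal modulus of a quadrilateral (Q; w1,w2,w3,w4) with Q a bounded
  Jordan domain in the plane: the conformal modulus of the quadrilateral
  (sphere minus closure Q; w4,w3,w2,w1).  That is the number m > 0 such that the
  closed exterior (the complement of Q in the plane, together with the point at infinity)
  is mapped homeomorphically onto the closed rectangle, conformally on the interior,
  with w4, w3, w2, w1 going to the corners 0, 1, 1 + i m, i m respectively (so the arcs
  (w4,w3), (w2,w1) go to the horizontal sides).  The point at infinity is mapped to an
  interior point c of the rectangle, which is expressed by the limit at infinity.\<close>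
definition ext_mod :: "complex set \<Rightarrow> complex \<Rightarrow> complex \<Rightarrow> complex \<Rightarrow> complex \<Rightarrow> real" where
  "ext_mod Q w1 w2 w3 w4 =
     (THE m. m > 0 \<and>
        (\<exists>\<Phi> c. c \<in> rect m \<and>
           continuous_on (- Q) \<Phi> \<and> inj_on \<Phi> (- Q) \<and>
           \<Phi> ` (- Q) = closure (rect m) - {c} \<and>
           \<Phi> holomorphic_on (- closure Q) \<and>
           (\<Phi> \<longlongrightarrow> c) at_infinity \<and>
           \<Phi> w4 = 0 \<and> \<Phi> w3 = 1 \<and> \<Phi> w2 = Complex 1 m \<and> \<Phi> w1 = Complex 0 m))"

definition graph_domain :: "real \<Rightarrow> real \<Rightarrow> (real \<Rightarrow> real) \<Rightarrow> (real \<Rightarrow> real) \<Rightarrow> complex set" where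
  "graph_domain a b f g = {z. a < Re z \<and> Re z < b \<and> f (Re z) < Im z \<and> Im z < g (Re z)}"

definition stretch :: "real \<Rightarrow> complex \<Rightarrow> complex" where
  "stretch H z = Complex (H * Re z) (Im z)"

end

theory Submission
  imports Defs
begin

text \<open>By the symmetries, the exterior of the stretched quadrilateral consists of four reflected copies
  of a quarter domain \<open>T\<close>, the quadrant minus the points below the graph of a function \<open>h\<close> over
  \<open>[0, L]\<close> with \<open>L = H b\<close>. The Riemann map of \<open>T\<close> onto the upper half plane extends
  homeomorphically to the boundary and can be normalised to send the end points \<open>i h(0)\<close>, \<open>L\<close>
  and infinity to 0, 1 and infinity; the corner \<open>L + i h(L)\<close> then goes to some
  \<open>\<mu> \<in> (0, 1)\<close>. A square root, a Schwarz--Christoffel map with parameter \<open>l = \<surd>\<mu>\<close> and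
  reflection turn this into a conformal map of the whole exterior onto a rectangle, so that the
  exterior modulus is a quotient \<open>a / b\<close> of complete elliptic integrals, where
  \<open>a = - ln (1 - l) / 2 + O(1)\<close> and \<open>b \<rightarrow> \<pi> / 2\<close> as \<open>l \<rightarrow> 1\<close>. Comparing harmonic measures in
  \<open>T\<close> and in quadrants gives \<open>1 - \<mu> = \<Theta>(1/H)\<close>, hence the modulus is asymptotic to
  \<open>ln H / \<pi>\<close>.\<close>

section \<open>Boundary behaviour of conformal maps\<close>

text \<open>\<open>ext_mod\<close> is a definite description of a map on the closed exterior, and
  this shapes the proof in two ways. The Riemann map of the quarter domain must be a homeomorphism
  up to the boundary, infinity included; this is derived from the maximum principle, with a crossing
  estimate in place of length-area arguments. And the number must be unique; for this the exterior
  is inverted to a compact set and two rectangles are compared through a mixed boundary value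
  problem. The quarter domain has exactly one vertex of the quadrilateral on its boundary; three
  normalised boundary points leave the single parameter \<mu>, the position of that vertex. The axes
  become the midlines of the rectangle and infinity its centre. Only the order of magnitude of
  \<open>1 - \<mu>\<close> matters: the modulus depends on it through a logarithm, so constant
  factors become bounded terms that vanish after division by \<open>ln H\<close>. The order is
  visible in the coordinate \<open>z\<^sup>2\<close> of the quadrant: there the obstacle has size
  about \<open>L\<^sup>2\<close>, its vertical side at distance \<open>L\<close> has size about
  \<open>L\<close>, and the quotient is \<open>1 / L\<close>.\<close>

lemma fashoda_complex:
  fixes f g :: "real \<Rightarrow> complex"
  assumes "path f" "path g" "path_image f \<subseteq> cbox a b" "path_image g \<subseteq> cbox a b"
    and "Re (pathstart f) = Re a" "Re (pathfinish f) = Re b"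
    and "Im (pathstart g) = Im a" "Im (pathfinish g) = Im b"
  obtains z where "z \<in> path_image f" "z \<in> path_image g"
proof -
  define h :: "complex \<Rightarrow> real^2" where "h z = vector [Re z, Im z]" for z
  have h1[simp]: "h z $ 1 = Re z" and h2[simp]: "h z $ 2 = Im z" for z
    by (auto simp: h_def)
  have injh: "h x = h y \<Longrightarrow> x = y" for x y
    by (metis complex_eqI h1 h2)
  have h': "h = (\<lambda>z. \<chi> i. if i = 1 then Re z else Im z)"
    by (auto simp: fun_eq_iff vec_eq_iff forall_2)
  have conth: "continuous_on S h" for S
    unfolding h' by (rule continuous_on_vec_lambda, rename_tac i, case_tac "i = 1") (auto intro!: continuous_on_Re continuous_on_Im)
  have box: "h ` cbox a b \<subseteq> cbox (h a) (h b)"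
    by (auto simp: in_cbox_complex_iff mem_box_cart forall_2)
  have "path (h \<circ> f)" "path (h \<circ> g)"
    using assms(1,2) conth path_continuous_image by blast+
  moreover have "path_image (h \<circ> f) \<subseteq> cbox (h a) (h b)" "path_image (h \<circ> g) \<subseteq> cbox (h a) (h b)"
    using assms(3,4) box by (auto simp: path_image_compose)
  moreover have "(pathstart (h \<circ> f))$1 = h a$1" "(pathfinish (h \<circ> f))$1 = h b$1"
     "(pathstart (h \<circ> g))$2 = h a$2" "(pathfinish (h \<circ> g))$2 = h b$2"
    using assms by (auto simp: pathstart_compose pathfinish_compose)
  ultimately obtain y where "y \<in> path_image (h \<circ> f)" "y \<in> path_image (h \<circ> g)"
    by (rule fashoda)
  then show thesis
    using injh that by (auto simp: path_image_compose)
qed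

section \<open>Curves crossing a strip\<close>

text \<open>A harmonic function on the box \<open>\<bar>Re z\<bar> < 1\<close>,
  \<open>0 < Im z < 3\<close> that is positive inside and vanishes on every side except the bottom
  one; it is the barrier in \<open>koebe_box\<close>.\<close>

lemma Re_barrier:
  "Re (\<i> * sin (of_real (pi/2) * (z - 3*\<i>))) = cos (pi/2 * Re z) * sinh (pi/2 * (3 - Im z))"
proof -
  have e: "of_real (pi/2) * (z - 3*\<i>) = Complex (pi/2 * Re z) (pi/2 * (Im z - 3))"
    by (simp add: complex_eq_iff algebra_simps)
  have "Im (sin (Complex x y)) = cos x * sinh y" for x y
    by (simp add: Im_sin sinh_def field_simps)
  then show ?thesis
    unfolding e using sinh_minus[of "pi/2 * (3 - Im z)"] by (simp add: algebra_simps)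
qed

text \<open>A two-constants estimate: in the part of the box above the crossing curve,
  \<open>Re F\<close> plus a multiple of the barrier is nonpositive on the whole boundary, since the
  barrier vanishes on the sides and the top of the box and is absorbed by \<open>N\<close> on the
  curve. The height 3 lies between \<open>pi/2\<close> and \<open>pi\<close>: the box reaches above
  the evaluation point and its top stays in the strip.\<close>

lemma koebe_box:
  assumes F: "F holomorphic_on {z. 0 < Im z \<and> Im z < pi}"
    and neg: "\<And>z. 0 < Im z \<Longrightarrow> Im z < pi \<Longrightarrow> Re (F z) \<le> 0"
    and path: "path \<gamma>" and box: "\<And>z. z \<in> path_image \<gamma> \<Longrightarrow> \<bar>Re z\<bar> \<le> 1 \<and> 0 < Im z \<and> Im z < pi/2"
    and ends: "Re (pathstart \<gamma>) = -1" "Re (pathfinish \<gamma>) = 1"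
    and small: "\<And>z. z \<in> path_image \<gamma> \<Longrightarrow> Re (F z) \<le> - N" and "0 \<le> N"
  shows "Re (F (\<i> * of_real (pi/2))) \<le> - N * (sinh (pi/2 * (3 - pi/2)) / sinh (pi/2 * 3))"
proof -
  define B where "B = box (-1) (Complex 1 3)"
  have inB: "z \<in> B \<longleftrightarrow> -1 < Re z \<and> Re z < 1 \<and> 0 < Im z \<and> Im z < 3" for z
    by (auto simp: B_def in_box_complex_iff)
  define K where "K = path_image \<gamma>"
  have K: "compact K" "K \<noteq> {}" using path by (auto simp: K_def compact_path_image)
  have pi: "pi > 3" "pi < 4" using pi_gt3 pi_less_4 by auto
  define zs where "zs = \<i> * of_real (pi/2)"
  have zs: "Re zs = 0" "Im zs = pi/2" by (auto simp: zs_def)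
  define C where "C = connected_component_set (B - K) zs"
  have zsBK: "zs \<in> B - K" using box[of zs] pi by (auto simp: inB zs K_def)
  have oBK: "open (B - K)" using K by (auto simp: B_def intro!: open_Diff compact_imp_closed open_box)
  have C: "open C" "connected C" "zs \<in> C" "C \<subseteq> B - K"
    using oBK zsBK by (auto simp: C_def open_connected_component connected_component_subset)
  have "path_connected C" using C by (simp add: connected_open_path_connected)
  obtain z0 where z0: "z0 \<in> K" "\<And>z. z \<in> K \<Longrightarrow> Im z0 \<le> Im z"
    using continuous_attains_inf[OF K continuous_on_Im[OF continuous_on_id]] by blast
  have z0pos: "Im z0 > 0" using box[of z0] z0(1) by (simp add: K_def)
  \<comment> \<open>A point of \<open>C\<close> below the lowest point of the curve would yield a
    path from the bottom of the box to its top that avoids the curve, against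
    \<open>fashoda_complex\<close>. Hence \<open>closure C\<close> stays at positive height, where
    \<open>F\<close> is defined.\<close>
  have low: "Im z0 \<le> Im z" if zC: "z \<in> C" for z
  proof (rule ccontr)
    assume lt: "\<not> Im z0 \<le> Im z"
    obtain p where p: "path p" "path_image p \<subseteq> C" "pathstart p = z" "pathfinish p = zs"
      using \<open>path_connected C\<close> zC C(3) unfolding path_connected_def by meson
    define g where "g = linepath (of_real (Re z)) z +++ (p +++ linepath zs (3*\<i>))"
    have zB: "z \<in> B" using that C by auto
    have pg: "path g" "Im (pathstart g) = 0" "Im (pathfinish g) = 3"
      using p by (auto simp: g_def)
    have img: "path_image g = closed_segment (of_real (Re z)) z \<union> (path_image p \<union> closed_segment zs (3*\<i>))"
      using p by (simp add: g_def path_image_join)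
    have cv: "convex (cbox (-1) (Complex 1 3))" by simp
    have "closed_segment (of_real (Re z)) z \<subseteq> cbox (-1) (Complex 1 3)"
      using zB by (intro closed_segment_subset cv) (auto simp: in_cbox_complex_iff inB)
    moreover have "closed_segment zs (3*\<i>) \<subseteq> cbox (-1) (Complex 1 3)"
      using pi by (intro closed_segment_subset cv) (auto simp: in_cbox_complex_iff zs)
    moreover have "path_image p \<subseteq> cbox (-1) (Complex 1 3)"
      using p C box_subset_cbox unfolding B_def by blast
    ultimately have "path_image g \<subseteq> cbox (-1) (Complex 1 3)" using img by blast
    moreover have "path_image \<gamma> \<subseteq> cbox (-1) (Complex 1 3)"
      using box pi by (force simp: in_cbox_complex_iff abs_le_iff)
    ultimately obtain y where y: "y \<in> path_image \<gamma>" "y \<in> path_image g"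
      using fashoda_complex[OF path pg(1), of "-1" "Complex 1 3"] ends pg by auto
    have "y \<in> K" using y by (simp add: K_def)
    from y(2) consider "y \<in> closed_segment (of_real (Re z)) z" | "y \<in> path_image p" | "y \<in> closed_segment zs (3*\<i>)"
      unfolding img by blast
    then show False
    proof cases
      case 1
      have "closed_segment (of_real (Re z)) z \<subseteq> {w. Im w \<le> Im z}"
        using zB by (intro closed_segment_subset convex_halfspace_Im_le) (auto simp: inB)
      then show ?thesis using 1 lt z0(2)[OF \<open>y \<in> K\<close>] by auto
    next
      case 2 then show ?thesis using p C \<open>y \<in> K\<close> by blast
    next
      case 3
      have "closed_segment zs (3*\<i>) \<subseteq> {w. Im w \<ge> pi/2}"
        using pi by (intro closed_segment_subset convex_halfspace_Im_ge) (auto simp: zs)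
      then show ?thesis using 3 box[of y] y by auto
    qed
  qed
  have clC: "closure C \<subseteq> {z. -1 \<le> Re z \<and> Re z \<le> 1 \<and> Im z0 \<le> Im z \<and> Im z \<le> 3}"
  proof (rule closure_minimal)
    show "closed {z. -1 \<le> Re z \<and> Re z \<le> 1 \<and> Im z0 \<le> Im z \<and> Im z \<le> 3}"
      by (intro closed_Collect_conj closed_Collect_le continuous_intros)
    show "C \<subseteq> {z. -1 \<le> Re z \<and> Re z \<le> 1 \<and> Im z0 \<le> Im z \<and> Im z \<le> 3}"
    proof
      fix z assume "z \<in> C"
      then have "z \<in> B" "Im z0 \<le> Im z" using C low by auto
      then show "z \<in> {z. -1 \<le> Re z \<and> Re z \<le> 1 \<and> Im z0 \<le> Im z \<and> Im z \<le> 3}" by (simp add: inB)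
    qed
  qed
  \<comment> \<open>The maximum of the barrier on the closed box, so that \<open>N / c\<close> times
    the barrier is at most \<open>N\<close> on the curve.\<close>
  define c where "c = sinh (pi/2 * 3)"
  have cpos: "c > 0" using pi by (simp add: c_def)
  define G where "G z = F z + of_real (N / c) * (\<i> * sin (of_real (pi/2) * (z - 3*\<i>)))" for z
  have ReG: "Re (G z) = Re (F z) + N / c * (cos (pi/2 * Re z) * sinh (pi/2 * (3 - Im z)))" for z
    unfolding G_def using Re_barrier[of z] by simp
  have clin: "closure C \<subseteq> {z. 0 < Im z \<and> Im z < pi}" using clC z0pos pi by auto
  have holG: "G holomorphic_on closure C"
  proof -
    have 1: "F holomorphic_on closure C" by (rule holomorphic_on_subset[OF F clin])
    have 2: "(\<lambda>z. of_real (N / c) * (\<i> * sin (of_real (pi/2) * (z - 3*\<i>)))) holomorphic_on closure C"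
      by (intro holomorphic_on_mult holomorphic_on_sin' holomorphic_on_diff holomorphic_on_const holomorphic_on_ident)
    show ?thesis unfolding G_def by (rule holomorphic_on_add[OF 1 2])
  qed
  have "Re (G zs) \<le> 0"
  proof (rule maximum_real_frontier[of G C])
    show "G holomorphic_on interior C"
      by (rule holomorphic_on_subset[OF holG order_trans[OF interior_subset closure_subset]])
    show "continuous_on (closure C) G" using holG by (rule holomorphic_on_imp_continuous_on)
    show "bounded C" using C bounded_subset[OF bounded_box] unfolding B_def by blast
    show "zs \<in> C" by fact
    fix z assume z: "z \<in> frontier C"
    then have zc: "z \<in> closure C" "z \<notin> C" using C by (auto simp: frontier_def interior_open)
    have zz: "-1 \<le> Re z" "Re z \<le> 1" "Im z0 \<le> Im z" "Im z \<le> 3" using zc clC by auto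
    have F0: "Re (F z) \<le> 0" using neg[of z] zc clin by auto
    show "Re (G z) \<le> 0"
    proof (cases "z \<in> K")
      case True
      have "cos (pi/2 * Re z) * sinh (pi/2 * (3 - Im z)) \<le> 1 * c"
        unfolding c_def using zz z0pos by (intro mult_mono) auto
      then have "N / c * (cos (pi/2 * Re z) * sinh (pi/2 * (3 - Im z))) \<le> N / c * c"
        using \<open>0 \<le> N\<close> cpos by (intro mult_left_mono) auto
      also have "\<dots> = N" using cpos by simp
      finally show ?thesis unfolding ReG using small[of z] True by (auto simp: K_def)
    next
      case False
      have "z \<notin> B"
      proof
        assume "z \<in> B"
        then have "z \<in> B - K" using False by auto
        define C' where "C' = connected_component_set (B - K) z"
        have C': "open C'" "z \<in> C'" using oBK \<open>z \<in> B - K\<close> by (auto simp: C'_def open_connected_component)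
        then have "C' \<inter> C \<noteq> {}" using zc(1) open_Int_closure_eq_empty[of C' C] by blast
        then obtain y where y: "y \<in> C'" "y \<in> C" by blast
        have "C = C'" using connected_component_eq[OF y(2)[unfolded C_def]] connected_component_eq[OF y(1)[unfolded C'_def]]
          by (simp add: C_def C'_def)
        then show False using C' zc by auto
      qed
      then have "Re z = -1 \<or> Re z = 1 \<or> Im z = 3" using zz z0pos by (auto simp: inB)
      then have e: "cos (pi/2 * Re z) * sinh (pi/2 * (3 - Im z)) = 0" by auto
      show ?thesis unfolding ReG e using F0 by simp
    qed
  qed
  then have "Re (F zs) \<le> - (N / c * (cos (pi/2 * Re zs) * sinh (pi/2 * (3 - Im zs))))"
    unfolding ReG by simp
  then show ?thesis unfolding zs by (simp add: zs_def c_def)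
qed

text \<open>The piece ends at the first visit to \<open>Re = 1\<close> and starts at the last visit
  to \<open>Re = -1\<close> before it; intermediate values keep it in the strip.\<close>

lemma path_trim_vertical_strip:
  fixes \<gamma> :: "real \<Rightarrow> complex"
  assumes "path \<gamma>" "Re (pathstart \<gamma>) < -1" "Re (pathfinish \<gamma>) > 1"
  obtains \<eta> where "path \<eta>" "path_image \<eta> \<subseteq> path_image \<gamma>" "Re (pathstart \<eta>) = -1" "Re (pathfinish \<eta>) = 1"
    "\<And>z. z \<in> path_image \<eta> \<Longrightarrow> \<bar>Re z\<bar> \<le> 1"
proof -
  define f where "f t = Re (\<gamma> t)" for t
  have contf: "continuous_on {0..1} f"
    using assms(1) unfolding f_def path_def by (intro continuous_intros)
  have f0: "f 0 < -1" and f1: "f 1 > 1" using assms by (auto simp: f_def pathstart_def pathfinish_def)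
  define A where "A = {t\<in>{0..1}. f t = 1}"
  have "closed A" unfolding A_def using contf by (intro continuous_closed_preimage_constant) auto
  moreover have "A \<subseteq> {0..1}" by (auto simp: A_def)
  ultimately have cA: "compact A" using compact_Icc compact_Int_closed[of "{0..1}" A] by (simp add: Int_absorb1)
  have neA: "A \<noteq> {}" using IVT'[of f 0 1 1] f0 f1 contf by (auto simp: A_def)
  obtain t1 where t1: "t1 \<in> A" "\<And>t. t \<in> A \<Longrightarrow> t1 \<le> t"
    using compact_attains_inf[OF cA neA] by blast
  have t1': "0 \<le> t1" "t1 \<le> 1" "f t1 = 1" using t1 by (auto simp: A_def)
  have before: "f t \<le> 1" if "0 \<le> t" "t \<le> t1" for t
  proof (rule ccontr)
    assume "\<not> f t \<le> 1"
    then have "\<exists>x\<ge>0. x \<le> t \<and> f x = 1"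
      using f0 that t1' by (intro IVT' continuous_on_subset[OF contf]) auto
    then obtain x where x: "0 \<le> x" "x \<le> t" "f x = 1" by blast
    then have "t1 \<le> x" using t1' that by (intro t1) (auto simp: A_def)
    then have "t = x" using x that by simp
    then show False using x \<open>\<not> f t \<le> 1\<close> by simp
  qed
  define B where "B = {t\<in>{0..t1}. f t = -1}"
  have contf1: "continuous_on {0..t1} f" using contf t1' by (auto intro: continuous_on_subset)
  have "closed B" unfolding B_def using contf1 by (intro continuous_closed_preimage_constant) auto
  moreover have "B \<subseteq> {0..t1}" by (auto simp: B_def)
  ultimately have cB: "compact B" using compact_Icc compact_Int_closed[of "{0..t1}" B] by (simp add: Int_absorb1)
  have neB: "B \<noteq> {}" using IVT'[of f 0 "-1" t1] f0 t1' contf1 by (auto simp: B_def)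
  obtain t0 where t0: "t0 \<in> B" "\<And>t. t \<in> B \<Longrightarrow> t \<le> t0"
    using compact_attains_sup[OF cB neB] by blast
  have t0': "0 \<le> t0" "t0 \<le> t1" "f t0 = -1" using t0 by (auto simp: B_def)
  have after: "f t \<ge> -1" if "t0 \<le> t" "t \<le> t1" for t
  proof (rule ccontr)
    assume "\<not> f t \<ge> -1"
    then have "\<exists>x\<ge>t. x \<le> t1 \<and> f x = -1"
      using that t0' t1' by (intro IVT' continuous_on_subset[OF contf1]) auto
    then obtain x where x: "t \<le> x" "x \<le> t1" "f x = -1" by blast
    then have "x \<le> t0" using that t0' by (intro t0) (auto simp: B_def)
    then have "t = x" using x that by simp
    then show False using x \<open>\<not> f t \<ge> -1\<close> by simp
  qed
  show thesis
  proof (rule that[of "subpath t0 t1 \<gamma>"])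
    show "path (subpath t0 t1 \<gamma>)" using assms t0' t1' by auto
    show "path_image (subpath t0 t1 \<gamma>) \<subseteq> path_image \<gamma>"
      using t0' t1' by (intro path_image_subpath_subset) auto
    show "Re (pathstart (subpath t0 t1 \<gamma>)) = -1" "Re (pathfinish (subpath t0 t1 \<gamma>)) = 1"
      using t0' t1' by (auto simp: f_def)
    show "\<bar>Re z\<bar> \<le> 1" if "z \<in> path_image (subpath t0 t1 \<gamma>)" for z
      using that t0' before after by (auto simp: path_image_subpath f_def abs_le_iff minus_le_iff)
  qed
qed

text \<open>Koebe's lemma in logarithmic form. If curves arbitrarily close to \<open>p\<close> had
  images stretching across \<open>\<bar>Re\<bar> \<le> 1\<close>, then the harmonic function
  \<open>ln \<bar>\<phi> - p\<bar>\<close>, bounded above and finite at the centre of the strip,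
  would be arbitrarily negative on them, and \<open>koebe_box\<close> would push its value at the
  centre below any bound.\<close>

lemma no_short_crossing:
  fixes D :: "complex set" and h \<phi> :: "complex \<Rightarrow> complex"
  defines "S \<equiv> {z. 0 < Im z \<and> Im z < pi}"
  assumes "bounded D" "p \<notin> D" and conth: "continuous_on D h" and hS: "h ` D \<subseteq> S"
    and hol: "\<phi> holomorphic_on S" and \<phi>D: "\<phi> ` S \<subseteq> D" and \<phi>h: "\<And>z. z \<in> D \<Longrightarrow> \<phi> (h z) = z"
    and paths: "\<And>e. e > 0 \<Longrightarrow> \<exists>\<gamma>. path \<gamma> \<and> path_image \<gamma> \<subseteq> D \<inter> ball p e \<and>
                  Re (h (pathstart \<gamma>)) < -1 \<and> Re (h (pathfinish \<gamma>)) > 1"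
  shows False
proof -
  have S: "convex S" "open S"
  proof -
    have "S = {z. Im z > 0} \<inter> {z. Im z < pi}" by (auto simp: S_def)
    then show "convex S" "open S"
      by (auto intro!: convex_Int open_Int convex_halfspace_Im_lt convex_halfspace_Im_gt
                 open_halfspace_Im_lt open_halfspace_Im_gt)
  qed
  obtain M0 where M0: "\<And>z. z \<in> D \<Longrightarrow> norm z \<le> M0" using \<open>bounded D\<close> unfolding bounded_iff by blast
  define M where "M = \<bar>M0\<bar> + norm p + 1"
  have M: "M > 0" "\<And>z. z \<in> D \<Longrightarrow> norm (z - p) \<le> M"
  proof -
    fix z assume "z \<in> D"
    then show "norm (z - p) \<le> M" using M0[of z] norm_triangle_ineq4[of z p] by (auto simp: M_def)
  qed (auto simp: M_def intro: add_nonneg_pos)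
  have ne: "\<phi> z - p \<noteq> 0" if "z \<in> S" for z using that \<phi>D \<open>p \<notin> D\<close> by auto
  have "(\<lambda>z. \<phi> z - p) holomorphic_on S" using hol by (intro holomorphic_intros)
  then obtain G where G: "G holomorphic_on S" "\<And>z. z \<in> S \<Longrightarrow> \<phi> z - p = exp (G z)"
    using contractible_imp_holomorphic_log[OF _ convex_imp_contractible[OF S(1)], of "\<lambda>z. \<phi> z - p"] ne by blast
  define F where "F z = G z - of_real (ln M)" for z
  have ReF: "Re (F z) = ln (norm (\<phi> z - p)) - ln M" if "z \<in> S" for z
    using G(2)[OF that] by (simp add: F_def)
  have holF: "F holomorphic_on S" unfolding F_def by (intro holomorphic_intros G)
  have Fneg: "Re (F z) \<le> 0" if "z \<in> S" for z
    using M(2)[of "\<phi> z"] that \<phi>D ne[OF that] M(1) unfolding ReF[OF that] by auto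
  define c where "c = \<i> * complex_of_real (pi/2)"
  define k where "k = sinh (pi/2 * (3 - pi/2)) / sinh (pi/2 * 3)"
  have k: "k > 0" unfolding k_def using pi_less_4 by (intro divide_pos_pos) auto
  \<comment> \<open>A compact piece of the strip around its midline. Its image under
    \<open>\<phi>\<close> keeps a distance from \<open>p\<close>, so the image curve cannot meet the
    midline and lies in one half of the strip.\<close>
  define C where "C = cbox (Complex (-1) (pi/4)) (Complex 1 (3*pi/4))"
  have CS: "C \<subseteq> S"
  proof
    fix z assume "z \<in> C"
    then have "pi/4 \<le> Im z" "Im z \<le> 3*pi/4" by (auto simp: C_def in_cbox_complex_iff)
    then have "0 < Im z" "Im z < pi" using pi_gt_zero by linarith+
    then show "z \<in> S" by (simp add: S_def)
  qed
  have "continuous_on C \<phi>" by (rule holomorphic_on_imp_continuous_on[OF holomorphic_on_subset[OF hol CS]])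
  moreover have "compact C" by (simp add: C_def compact_cbox)
  ultimately have "compact (\<phi> ` C)" by (rule compact_continuous_image)
  moreover have "p \<notin> \<phi> ` C" using CS \<phi>D \<open>p \<notin> D\<close> by blast
  ultimately obtain d where d: "d > 0" "\<And>z. z \<in> \<phi> ` C \<Longrightarrow> d \<le> dist p z"
    using separate_point_closed[of "\<phi> ` C" p] compact_imp_closed by blast
  \<comment> \<open>Chosen so that the conclusion of \<open>koebe_box\<close> becomes
    \<open>Re (F c) \<le> Re (F c) - 1\<close>.\<close>
  define N where "N = (1 - Re (F c)) / k"
  have cS: "c \<in> S" by (auto simp: c_def S_def)
  have N: "N \<ge> 0" using Fneg[OF cS] k by (auto simp: N_def)
  define e where "e = min d (M * exp (-N))"
  have e: "e > 0" using d M by (auto simp: e_def)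
  obtain \<gamma> where \<gamma>: "path \<gamma>" "path_image \<gamma> \<subseteq> D \<inter> ball p e" "Re (h (pathstart \<gamma>)) < -1" "Re (h (pathfinish \<gamma>)) > 1"
    using paths[OF e] by blast
  have "path (h \<circ> \<gamma>)" using \<gamma> conth by (intro path_continuous_image) (auto intro: continuous_on_subset)
  then obtain \<eta> where \<eta>: "path \<eta>" "path_image \<eta> \<subseteq> path_image (h \<circ> \<gamma>)" "Re (pathstart \<eta>) = -1" "Re (pathfinish \<eta>) = 1"
    "\<And>z. z \<in> path_image \<eta> \<Longrightarrow> \<bar>Re z\<bar> \<le> 1"
    using path_trim_vertical_strip[of "h \<circ> \<gamma>"] \<gamma> by (auto simp: pathstart_compose pathfinish_compose)
  have near: "z \<in> S \<and> norm (\<phi> z - p) < e" if z: "z \<in> path_image \<eta>" for z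
  proof -
    obtain y where y: "y \<in> path_image \<gamma>" "z = h y" using z \<eta>(2) by (auto simp: path_image_compose)
    have yD: "y \<in> D" "norm (y - p) < e" using y(1) \<gamma>(2) by (auto simp: dist_norm norm_minus_commute)
    show ?thesis unfolding y(2) \<phi>h[OF yD(1)] using yD hS by blast
  qed
  have small: "Re (F z) \<le> -N" if "z \<in> path_image \<eta>" for z
  proof -
    have *: "z \<in> S" "norm (\<phi> z - p) \<le> M * exp (-N)" using near[OF that] by (auto simp: e_def)
    have "ln (norm (\<phi> z - p)) \<le> ln (M * exp (-N))"
      using *(2) ne[OF *(1)] by (intro ln_mono) auto
    also have "\<dots> = ln M - N" using M(1) by (subst ln_mult_pos) auto
    finally show ?thesis using ReF[OF *(1)] by simp
  qed
  have avoid: "Im z \<noteq> pi/2" if "z \<in> path_image \<eta>" for z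
  proof
    assume "Im z = pi/2"
    then have "pi/4 \<le> Im z" "Im z \<le> 3*pi/4" using pi_gt_zero by linarith+
    then have "z \<in> C" using \<eta>(5)[OF that] by (simp add: C_def in_cbox_complex_iff abs_le_iff)
    then have "d \<le> norm (\<phi> z - p)" using d(2)[of "\<phi> z"] by (simp add: dist_norm norm_minus_commute)
    then show False using near[OF that] by (simp add: e_def)
  qed
  have "connected (path_image \<eta>)" using \<eta> by auto
  then have conn: "connected (Im ` path_image \<eta>)"
    by (intro connected_continuous_image continuous_on_Im continuous_on_id)
  have "(\<forall>z\<in>path_image \<eta>. Im z < pi/2) \<or> (\<forall>z\<in>path_image \<eta>. Im z > pi/2)"
  proof (rule ccontr)
    assume "\<not> ?thesis"
    then obtain z1 z2 where z: "z1 \<in> path_image \<eta>" "z2 \<in> path_image \<eta>" "Im z1 \<ge> pi/2" "Im z2 \<le> pi/2"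
      by (auto simp: not_less)
    then have "pi/2 \<in> Im ` path_image \<eta>" using connectedD_interval[OF conn, of "Im z2" "Im z1" "pi/2"] by blast
    then show False using avoid by (metis imageE)
  qed
  then have "Re (F c) \<le> -N * k"
  proof
    assume low: "\<forall>z\<in>path_image \<eta>. Im z < pi/2"
    show ?thesis unfolding c_def k_def
    proof (rule koebe_box[of F \<eta>])
      show "F holomorphic_on {z. 0 < Im z \<and> Im z < pi}" using holF by (simp add: S_def)
      show "Re (F z) \<le> 0" if "0 < Im z" "Im z < pi" for z
        using Fneg[of z] that by (simp add: S_def)
      show "\<bar>Re z\<bar> \<le> 1 \<and> 0 < Im z \<and> Im z < pi/2" if "z \<in> path_image \<eta>" for z
        using \<eta>(5)[OF that] near[OF that] low that by (auto simp: S_def)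
    qed fact+
  next
    assume high: "\<forall>z\<in>path_image \<eta>. Im z > pi/2"
    \<comment> \<open>The half turn about the centre \<open>c\<close> exchanges the two halves of
      the strip; it also exchanges left and right, hence the reversed path.\<close>
    define r where "r z = \<i> * of_real pi - z" for z
    have rS: "r z \<in> S \<longleftrightarrow> z \<in> S" for z by (auto simp: r_def S_def)
    have rr: "r (r z) = z" for z by (simp add: r_def)
    have rim: "r ` path_image \<eta> = path_image (r \<circ> reversepath \<eta>)" by (simp add: path_image_compose)
    have Fr: "(F \<circ> r) holomorphic_on S"
    proof (rule holomorphic_on_compose)
      show "r holomorphic_on S" unfolding r_def by (intro holomorphic_intros)
      show "F holomorphic_on r ` S" using rS by (intro holomorphic_on_subset[OF holF]) auto
    qed
    have "Re ((F \<circ> r) c) \<le> -N * k" unfolding c_def k_def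
    proof (rule koebe_box[of _ "r \<circ> reversepath \<eta>"])
      show "(F \<circ> r) holomorphic_on {z. 0 < Im z \<and> Im z < pi}" using Fr by (simp add: S_def)
      show "path (r \<circ> reversepath \<eta>)"
        unfolding r_def by (intro path_continuous_image continuous_intros) (use \<eta>(1) in simp)
      show "Re ((F \<circ> r) z) \<le> 0" if "0 < Im z" "Im z < pi" for z
        using Fneg[of "r z"] rS[of z] that by (auto simp: S_def)
      show "\<bar>Re z\<bar> \<le> 1 \<and> 0 < Im z \<and> Im z < pi/2" if "z \<in> path_image (r \<circ> reversepath \<eta>)" for z
      proof -
        have "z \<in> r ` path_image \<eta>" using that by (simp only: rim)
        then obtain y where y: "z = r y" "y \<in> path_image \<eta>" by (rule imageE)
        have "\<bar>Re y\<bar> \<le> 1" "Im y < pi" "pi/2 < Im y" 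
          using \<eta>(5)[OF y(2)] near[OF y(2)] high y(2) by (simp_all add: S_def)
        then show ?thesis using y(1) by (simp add: r_def)
      qed
      show "Re (pathstart (r \<circ> reversepath \<eta>)) = -1" "Re (pathfinish (r \<circ> reversepath \<eta>)) = 1"
        using \<eta>(3,4) by (simp_all add: pathstart_compose pathfinish_compose r_def)
      show "Re ((F \<circ> r) z) \<le> - N" if "z \<in> path_image (r \<circ> reversepath \<eta>)" for z
      proof -
        have "z \<in> r ` path_image \<eta>" using that by (simp only: rim)
        then obtain y where y: "z = r y" "y \<in> path_image \<eta>" by (rule imageE)
        show ?thesis using small[OF y(2)] y(1) by (simp add: rr)
      qed
      show "0 \<le> N" by fact
    qed
    moreover have "r c = c" by (simp add: r_def c_def complex_eq_iff)
    ultimately show ?thesis by simp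
  qed
  also have "-N * k = Re (F c) - 1" using k by (simp add: N_def)
  finally show False by simp
qed

section \<open>Extension of a conformal map to the boundary\<close>

text \<open>For a boundary point \<open>p\<close> this says that \<open>D\<close> reaches
  \<open>p\<close> from one side only: points of \<open>D\<close> close to \<open>p\<close> can be
  joined inside \<open>D\<close> without going far from \<open>p\<close>. The connected set
  \<open>N\<close> may leave \<open>V\<close>, so no neighbourhood of \<open>p\<close> has to have a
  connected trace on \<open>D\<close>.\<close>

definition locally_connected_at :: "complex set \<Rightarrow> complex \<Rightarrow> bool" where
  "locally_connected_at D p \<longleftrightarrow> (\<forall>U. open U \<and> p \<in> U \<longrightarrow>
     (\<exists>V N. open V \<and> p \<in> V \<and> open N \<and> connected N \<and> D \<inter> V \<subseteq> N \<and> N \<subseteq> D \<inter> U))"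

lemma eventually_less_lim:
  fixes f g :: "'a \<Rightarrow> real"
  assumes "(f \<longlongrightarrow> a) F" "(g \<longlongrightarrow> b) F" "a < b"
  shows "\<forall>\<^sub>F x in F. f x < g x"
  using order_tendstoD(1)[OF tendsto_diff[OF assms(2,1)], of 0] assms(3) by simp

locale disc_map =
  fixes D :: "complex set" and f g :: "complex \<Rightarrow> complex"
  assumes D: "open D" "bounded D"
    and f: "f holomorphic_on D" "\<And>z. z \<in> D \<Longrightarrow> f z \<in> ball 0 1"
    and g: "g holomorphic_on ball 0 1" "\<And>w. w \<in> ball 0 1 \<Longrightarrow> g w \<in> D"
    and gf: "\<And>z. z \<in> D \<Longrightarrow> g (f z) = z" and fg: "\<And>w. w \<in> ball 0 1 \<Longrightarrow> f (g w) = w"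
begin

text \<open>A limit inside the disc would be carried by the continuous inverse \<open>g\<close> to
  \<open>p\<close>, which would then lie in \<open>D\<close>.\<close>

lemma cluster_norm:
  assumes "p \<notin> D" "\<And>n. x n \<in> D" "x \<longlonglongrightarrow> p" "(\<lambda>n. f (x n)) \<longlonglongrightarrow> \<zeta>"
  shows "norm \<zeta> = 1"
proof (rule ccontr)
  assume "norm \<zeta> \<noteq> 1"
  moreover have "norm \<zeta> \<le> 1"
    using f(2)[OF assms(2)] by (intro LIMSEQ_le_const2[OF tendsto_norm[OF assms(4)]]) (auto simp: less_imp_le)
  ultimately have \<zeta>: "\<zeta> \<in> ball 0 1" by simp
  then have "isCont g \<zeta>" using g(1) by (meson continuous_on_eq_continuous_at holomorphic_on_imp_continuous_on open_ball)
  then have "(\<lambda>n. g (f (x n))) \<longlonglongrightarrow> g \<zeta>" using assms(4) by (rule isCont_tendsto_compose)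
  then have "x \<longlonglongrightarrow> g \<zeta>" using gf assms(2) by simp
  then have "p = g \<zeta>" using assms(3) LIMSEQ_unique by blast
  then show False using g(2)[OF \<zeta>] assms(1) by simp
qed

text \<open>The Moebius map \<open>M\<close> takes the upper half plane to the disc with \<open>M 0 = \<zeta>1\<close> and
  \<open>M \<infinity> = \<zeta>2\<close>; taking logarithms turns two distinct cluster values into the two ends of a strip.\<close>

lemma cluster_unique:
  assumes p: "p \<notin> D" "locally_connected_at D p"
    and x: "\<And>n. x n \<in> D" "x \<longlonglongrightarrow> p" "(\<lambda>n. f (x n)) \<longlonglongrightarrow> \<zeta>1"
    and y: "\<And>n. y n \<in> D" "y \<longlonglongrightarrow> p" "(\<lambda>n. f (y n)) \<longlonglongrightarrow> \<zeta>2"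
  shows "\<zeta>1 = \<zeta>2"
proof (rule ccontr)
  assume ne: "\<zeta>1 \<noteq> \<zeta>2"
  have n1: "norm \<zeta>1 = 1" by (rule cluster_norm[OF p(1) x])
  have n2: "norm \<zeta>2 = 1" by (rule cluster_norm[OF p(1) y])
  have z2: "\<zeta>2 \<noteq> 0" using n2 by auto
  define S where "S = {z. 0 < Im z \<and> Im z < pi}"
  define \<alpha> where "\<alpha> = Arg2pi (\<zeta>1 / \<zeta>2)"
  \<comment> \<open>The square root of \<open>\<zeta>1 / \<zeta>2\<close> in the open upper half
    plane. It is the image of the centre of the disc under \<open>m\<close>, and this choice makes
    \<zeta>1 the zero and \<zeta>2 the pole of \<open>m\<close>.\<close>
  define q where "q = cis (\<alpha>/2)"
  have q2: "q * q = \<zeta>1 / \<zeta>2"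
  proof -
    have "\<zeta>1 / \<zeta>2 = of_real (norm (\<zeta>1 / \<zeta>2)) * exp (\<i> * of_real \<alpha>)"
      unfolding \<alpha>_def by (rule Arg2pi_eq)
    then have "\<zeta>1 / \<zeta>2 = cis \<alpha>" using n1 n2 by (simp add: norm_divide cis_conv_exp)
    then show ?thesis by (simp add: q_def cis_mult)
  qed
  have \<alpha>: "0 \<le> \<alpha>" "\<alpha> < 2 * pi" unfolding \<alpha>_def using Arg2pi_ge_0 Arg2pi_lt_2pi by auto
  have "\<alpha> \<noteq> 0"
  proof
    assume "\<alpha> = 0"
    then have "\<zeta>1 / \<zeta>2 = 1" using q2 by (simp add: q_def)
    then show False using ne z2 by simp
  qed
  then have Imq: "Im q > 0" using \<alpha> by (auto simp: q_def intro!: sin_gt_zero)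
  have nq: "q * cnj q = 1" by (simp add: q_def cis_cnj cis_mult)
  define m where "m d = (q - cnj q * (d/\<zeta>2)) / (1 - d/\<zeta>2)" for d
  define M where "M w = \<zeta>2 * ((w - q) / (w - cnj q))" for w
  have qq: "q \<noteq> cnj q" using Imq by (auto simp: complex_eq_iff)
  have lt1: "norm (d/\<zeta>2) < 1" if "d \<in> ball 0 1" for d using that n2 by (simp add: norm_divide)
  have ne1: "1 - d/\<zeta>2 \<noteq> 0" if "d \<in> ball 0 1" for d using lt1[OF that] by auto
  have Imm: "Im (m d) > 0" if "d \<in> ball 0 1" for d
  proof -
    define e where "e = d/\<zeta>2"
    have e: "norm e < 1" "1 - e \<noteq> 0" using lt1[OF that] ne1[OF that] by (auto simp: e_def)
    have "m d = (q - cnj q * e) * cnj (1 - e) / of_real ((norm (1 - e))\<^sup>2)"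
      unfolding m_def e_def[symmetric] by (subst complex_div_cnj) simp
    then have "Im (m d) = Im ((q - cnj q * e) * cnj (1 - e)) / (norm (1 - e))\<^sup>2"
      by (simp only: Im_divide_of_real)
    also have "Im ((q - cnj q * e) * cnj (1 - e)) = Im q * (1 - ((Re e)\<^sup>2 + (Im e)\<^sup>2))"
      by (simp add: algebra_simps power2_eq_square)
    also have "(Re e)\<^sup>2 + (Im e)\<^sup>2 = (norm e)\<^sup>2" by (simp add: cmod_power2)
    finally have "Im (m d) = Im q * (1 - (norm e)\<^sup>2) / (norm (1 - e))\<^sup>2" .
    moreover have "(norm e)\<^sup>2 < 1" using e(1) by (simp add: power_less_one_iff abs_square_less_1)
    ultimately show ?thesis using e Imq by simp
  qed
  have Mm: "M (m d) = d" if "d \<in> ball 0 1" for d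
  proof -
    define e where "e = d/\<zeta>2"
    have e: "1 - e \<noteq> 0" "d = \<zeta>2 * e" using ne1[OF that] z2 by (auto simp: e_def)
    have m: "m d = (q - cnj q * e) / (1 - e)" by (simp add: m_def e_def)
    have "m d - q = e * (q - cnj q) / (1 - e)" "m d - cnj q = (q - cnj q) / (1 - e)"
      unfolding m using e(1) by (simp_all add: field_simps)
    then have "(m d - q) / (m d - cnj q) = e" using e(1) qq by simp
    then show ?thesis using e(2) by (simp add: M_def)
  qed
  have Mball: "M w \<in> ball 0 1" if "Im w > 0" for w
  proof -
    have w: "w - cnj q \<noteq> 0" using that Imq by (auto simp: complex_eq_iff)
    have "(norm (w - q))\<^sup>2 < (norm (w - cnj q))\<^sup>2"
      unfolding cmod_power2 using mult_pos_pos[OF that Imq] by (simp add: power2_eq_square algebra_simps)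
    then have "norm (w - q) < norm (w - cnj q)" by (simp add: power2_less_imp_less)
    then show ?thesis using w n2 by (simp add: M_def norm_mult norm_divide)
  qed
  define h where "h z = Ln (m (f z))" for z
  define \<phi> where "\<phi> z = g (M (exp z))" for z
  have mnz: "m (f z) \<noteq> 0" if "z \<in> D" for z using Imm[OF f(2)[OF that]] by auto
  have expIm: "Im (exp z) > 0" if "z \<in> S" for z
    using that by (auto simp: S_def Im_exp intro!: mult_pos_pos sin_gt_zero)
  show False
  proof (rule no_short_crossing[of D p h \<phi>])
    show "bounded D" "p \<notin> D" by (fact D p)+
    have "continuous_on D (\<lambda>z. m (f z))" unfolding m_def
      using z2 ne1 f(2)
      by (intro continuous_intros holomorphic_on_imp_continuous_on[OF f(1)]) auto
    then show "continuous_on D h" unfolding h_def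
    proof (rule continuous_on_Ln')
      fix z assume "z \<in> D"
      then show "m (f z) \<notin> \<real>\<^sub>\<le>\<^sub>0" using Imm[OF f(2)] by (force simp: complex_nonpos_Reals_iff)
    qed
    show "h ` D \<subseteq> {z. 0 < Im z \<and> Im z < pi}"
    proof (clarsimp simp: h_def)
      fix z assume "z \<in> D"
      then show "0 < Im (Ln (m (f z))) \<and> Im (Ln (m (f z))) < pi"
        using Imm[OF f(2)] mnz Im_Ln_pos_lt_imp by (meson Im_Ln_pos_lt)
    qed
    have 1: "(\<lambda>z. M (exp z)) holomorphic_on S" unfolding M_def
    proof (intro holomorphic_on_mult holomorphic_on_divide holomorphic_on_diff holomorphic_on_const holomorphic_on_exp)
      fix z assume "z \<in> S" then show "exp z - cnj q \<noteq> 0" using expIm[of z] Imq by (auto simp: complex_eq_iff)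
    qed
    have "(g \<circ> (\<lambda>z. M (exp z))) holomorphic_on S"
      by (rule holomorphic_on_compose_gen[OF 1 g(1)]) (use Mball expIm in auto)
    then show "\<phi> holomorphic_on {z. 0 < Im z \<and> Im z < pi}" unfolding \<phi>_def by (simp add: S_def o_def)
    show "\<phi> ` {z. 0 < Im z \<and> Im z < pi} \<subseteq> D"
      using g(2) Mball expIm unfolding \<phi>_def S_def by blast
    show "\<phi> (h z) = z" if "z \<in> D" for z
      using mnz[OF that] Mm[OF f(2)[OF that]] gf[OF that] by (simp add: \<phi>_def h_def)
    fix e :: real assume "e > 0"
    then obtain V N where VN: "open V" "p \<in> V" "open N" "connected N" "D \<inter> V \<subseteq> N" "N \<subseteq> D \<inter> ball p e"
      using p(2) unfolding locally_connected_at_def by (metis centre_in_ball open_ball)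
    have "\<forall>\<^sub>F n in sequentially. x n \<in> V" "\<forall>\<^sub>F n in sequentially. y n \<in> V"
      using x(2) y(2) VN(1,2) by (auto dest: topological_tendstoD)
    \<comment> \<open>Multiplied out, this is \<open>\<bar>m (f (x n))\<bar> < exp (-1)\<close>,
      that is \<open>Re (h (x n)) < -1\<close>; the inequality after it is the counterpart for
      \<open>y\<close> at the other end of the strip.\<close>
    moreover have "\<forall>\<^sub>F n in sequentially. norm (q - cnj q * (f (x n)/\<zeta>2)) * exp 1 < norm (1 - f (x n)/\<zeta>2)"
    proof -
      have 1: "(\<lambda>n. norm (q - cnj q * (f (x n)/\<zeta>2)) * exp 1) \<longlonglongrightarrow> norm (q - cnj q * (\<zeta>1/\<zeta>2)) * exp 1"
        using z2 by (intro tendsto_intros x) auto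
      have 2: "(\<lambda>n. norm (1 - f (x n)/\<zeta>2)) \<longlonglongrightarrow> norm (1 - \<zeta>1/\<zeta>2)"
        using z2 by (intro tendsto_intros x) auto
      have "q - cnj q * (\<zeta>1/\<zeta>2) = 0" unfolding q2[symmetric] using nq by (simp add: algebra_simps)
      moreover have "1 - \<zeta>1/\<zeta>2 \<noteq> 0" using ne z2 by auto
      ultimately have "norm (q - cnj q * (\<zeta>1/\<zeta>2)) * exp 1 < norm (1 - \<zeta>1/\<zeta>2)" by simp
      then show ?thesis by (rule eventually_less_lim[OF 1 2])
    qed
    moreover have "\<forall>\<^sub>F n in sequentially. norm (1 - f (y n)/\<zeta>2) * exp 1 < norm (q - cnj q * (f (y n)/\<zeta>2))"
    proof -
      have 1: "(\<lambda>n. norm (1 - f (y n)/\<zeta>2) * exp 1) \<longlonglongrightarrow> norm (1 - \<zeta>2/\<zeta>2) * exp 1"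
        using z2 by (intro tendsto_intros y) auto
      have 2: "(\<lambda>n. norm (q - cnj q * (f (y n)/\<zeta>2))) \<longlonglongrightarrow> norm (q - cnj q * (\<zeta>2/\<zeta>2))"
        using z2 by (intro tendsto_intros y) auto
      have "norm (1 - \<zeta>2/\<zeta>2) * exp 1 < norm (q - cnj q * (\<zeta>2/\<zeta>2))" using z2 qq by simp
      then show ?thesis by (rule eventually_less_lim[OF 1 2])
    qed
    ultimately have "\<forall>\<^sub>F n in sequentially. x n \<in> V \<and> y n \<in> V \<and>
        norm (q - cnj q * (f (x n)/\<zeta>2)) * exp 1 < norm (1 - f (x n)/\<zeta>2) \<and>
        norm (1 - f (y n)/\<zeta>2) * exp 1 < norm (q - cnj q * (f (y n)/\<zeta>2))"
      by eventually_elim simp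
    then obtain n where n: "x n \<in> V" "y n \<in> V"
        "norm (q - cnj q * (f (x n)/\<zeta>2)) * exp 1 < norm (1 - f (x n)/\<zeta>2)"
        "norm (1 - f (y n)/\<zeta>2) * exp 1 < norm (q - cnj q * (f (y n)/\<zeta>2))"
      using eventually_happens'[OF sequentially_bot] by blast
    have Reh: "Re (h z) = ln (norm (m (f z)))" if "z \<in> D" for z using mnz[OF that] by (simp add: h_def)
    have nm: "norm (m d) = norm (q - cnj q * (d/\<zeta>2)) / norm (1 - d/\<zeta>2)" for d
      by (simp add: m_def norm_divide)
    have "Re (h (x n)) < -1"
    proof -
      have "0 < norm (m (f (x n)))" using mnz[OF x(1)] by simp
      moreover have "norm (m (f (x n))) < exp (-1)" unfolding nm
        using n(3) ne1[OF f(2)[OF x(1)[of n]]] by (simp add: exp_minus field_simps)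
      ultimately have "ln (norm (m (f (x n)))) < ln (exp (-1))" by (intro ln_less_cancel_iff[THEN iffD2]) auto
      then show ?thesis using Reh[OF x(1)] by simp
    qed
    moreover have "Re (h (y n)) > 1"
    proof -
      have "norm (m (f (y n))) > exp 1" unfolding nm
        using n(4) ne1[OF f(2)[OF y(1)[of n]]] by (simp add: field_simps)
      then have "ln (exp 1) < ln (norm (m (f (y n))))" by (intro ln_less_cancel_iff[THEN iffD2]) (auto intro: less_trans)
      then show ?thesis using Reh[OF y(1)] by simp
    qed
    moreover have "x n \<in> N" "y n \<in> N" using n x y VN by blast+
    moreover have "path_connected N" using VN by (simp add: connected_open_path_connected)
    ultimately show "\<exists>\<gamma>. path \<gamma> \<and> path_image \<gamma> \<subseteq> D \<inter> ball p e \<and> Re (h (pathstart \<gamma>)) < -1 \<and> Re (h (pathfinish \<gamma>)) > 1"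
      using VN(6) unfolding path_connected_def by (metis subset_trans)
  qed
qed

text \<open>By compactness of the closed disc every sequence in \<open>D\<close> tending to
  \<open>p\<close> has a subsequence with convergent images, and \<open>cluster_unique\<close> makes
  all these limits equal.\<close>

lemma boundary_limit:
  assumes p: "p \<in> closure D" "p \<notin> D" "locally_connected_at D p"
  obtains \<zeta> where "norm \<zeta> = 1" "(f \<longlongrightarrow> \<zeta>) (at p within D)"
proof -
  obtain x where x: "\<And>n. x n \<in> D" "x \<longlonglongrightarrow> p" using p(1) unfolding closure_sequential by blast
  have sub: "\<exists>l r. strict_mono r \<and> ((\<lambda>n. f (u n)) \<circ> r) \<longlonglongrightarrow> l" if "\<And>n. u n \<in> D" for u :: "nat \<Rightarrow> complex"
  proof -
    have "\<forall>n. f (u n) \<in> cball 0 1" using f(2)[OF that] by (auto simp: less_imp_le)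
    then show ?thesis using compact_cball[of "0::complex" 1] unfolding compact_def by metis
  qed
  obtain \<zeta> r where r: "strict_mono r" "((\<lambda>n. f (x n)) \<circ> r) \<longlonglongrightarrow> \<zeta>" using sub[of x, OF x(1)] by blast
  have x': "\<And>n. (x \<circ> r) n \<in> D" "(x \<circ> r) \<longlonglongrightarrow> p" "(\<lambda>n. f ((x \<circ> r) n)) \<longlonglongrightarrow> \<zeta>"
    using x r LIMSEQ_subseq_LIMSEQ[OF x(2) r(1)] by (auto simp: o_def)
  have "(f \<longlongrightarrow> \<zeta>) (at p within D)"
  proof (rule ccontr)
    assume "\<not> ?thesis"
    then obtain e where e: "e > 0" "\<And>d. d > 0 \<Longrightarrow> \<exists>z\<in>D. z \<noteq> p \<and> dist z p < d \<and> e \<le> dist (f z) \<zeta>"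
      unfolding Lim_within by (metis not_less zero_less_dist_iff)
    have "\<exists>z\<in>D. dist z p < inverse (real (Suc n)) \<and> e \<le> dist (f z) \<zeta>" for n
      using e(2)[of "inverse (real (Suc n))"] by auto
    then obtain y where y: "\<And>n. y n \<in> D" "\<And>n. dist (y n) p < inverse (real (Suc n))" "\<And>n. e \<le> dist (f (y n)) \<zeta>"
      by metis
    have "(\<lambda>n. dist (y n) p) \<longlonglongrightarrow> 0"
      by (rule tendsto_sandwich[OF _ _ tendsto_const LIMSEQ_inverse_real_of_nat])
         (simp_all add: y(2) less_imp_le always_eventually del: of_nat_Suc)
    then have yp: "y \<longlonglongrightarrow> p" by (rule iffD2[OF tendsto_dist_iff])
    obtain \<zeta>2 s where s: "strict_mono s" "((\<lambda>n. f (y n)) \<circ> s) \<longlonglongrightarrow> \<zeta>2" using sub[of y, OF y(1)] by blast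
    have y': "\<And>n. (y \<circ> s) n \<in> D" "(y \<circ> s) \<longlonglongrightarrow> p" "(\<lambda>n. f ((y \<circ> s) n)) \<longlonglongrightarrow> \<zeta>2"
      using y s LIMSEQ_subseq_LIMSEQ[OF yp s(1)] by (auto simp: o_def)
    have "\<zeta>2 = \<zeta>" using cluster_unique[OF p(2,3) y' x'] .
    then have "(\<lambda>n. dist (f ((y \<circ> s) n)) \<zeta>) \<longlonglongrightarrow> 0" using iffD1[OF tendsto_dist_iff y'(3)] by simp
    then have "e \<le> 0" by (rule LIMSEQ_le_const) (simp add: y(3))
    then show False using e(1) by simp
  qed
  moreover have "norm \<zeta> = 1" by (rule cluster_norm[OF p(2) x'])
  ultimately show thesis using that by blast
qed

end

context disc_map
begin

text \<open>Local connectedness at every boundary point gives the continuous extension. Injectivity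
  needs more: the set where a boundary value \<open>\<zeta>\<close> is taken is a continuum, and the
  assumption \<open>un\<close> says that no boundary continuum with two points carries a constant
  limit.\<close>

lemma boundary_homeomorphism:
  assumes lc: "\<And>p. p \<in> frontier D \<Longrightarrow> locally_connected_at D p"
    and un: "\<And>K \<zeta> p q. \<lbrakk>K \<subseteq> frontier D; connected K; closed K; p \<in> K; q \<in> K; p \<noteq> q; norm \<zeta> = 1;
               \<And>x. x \<in> K \<Longrightarrow> (f \<longlongrightarrow> \<zeta>) (at x within D)\<rbrakk> \<Longrightarrow> False"
  obtains F where "continuous_on (closure D) F" "inj_on F (closure D)" "F ` closure D = cball 0 1"
    "\<And>z. z \<in> D \<Longrightarrow> F z = f z" "\<And>z. z \<in> frontier D \<Longrightarrow> norm (F z) = 1"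
proof -
  have fr: "frontier D = closure D - D" using D(1) by (simp add: frontier_def interior_open)
  define F where "F z = (if z \<in> D then f z else Lim (at z within D) f)" for z
  have bot: "at z within D \<noteq> bot" if "z \<in> closure D" for z
  proof (cases "z \<in> D")
    case True
    have "z islimpt D" by (rule interior_limit_point) (use True D(1) in \<open>simp add: interior_open\<close>)
    then show ?thesis by (simp add: trivial_limit_within)
  next
    case False then show ?thesis using that by (simp add: trivial_limit_within closure_def)
  qed
  have FD: "F z = f z" if "z \<in> D" for z using that by (simp add: F_def)
  have lim: "(f \<longlongrightarrow> F z) (at z within D) \<and> (z \<notin> D \<longrightarrow> norm (F z) = 1)" if z: "z \<in> closure D" for z
  proof (cases "z \<in> D")
    case True
    then have "continuous_on D f" using f(1) by (simp add: holomorphic_on_imp_continuous_on)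
    then show ?thesis using True by (simp add: F_def continuous_on_def)
  next
    case False
    have "locally_connected_at D z" using lc z False fr by blast
    then obtain \<zeta> where \<zeta>: "norm \<zeta> = 1" "(f \<longlongrightarrow> \<zeta>) (at z within D)"
      using boundary_limit[OF z False] by blast
    then have "Lim (at z within D) f = \<zeta>" using bot[OF z] by (intro tendsto_Lim)
    then show ?thesis using \<zeta> False by (simp add: F_def)
  qed
  have cont: "continuous_on (closure D) F"
    unfolding continuous_on_iff
  proof (intro ballI allI impI)
    fix p and e :: real assume p: "p \<in> closure D" and e: "e > 0"
    have "(f \<longlongrightarrow> F p) (at p within D)" using lim p by blast
    then obtain d where d: "d > 0" "\<And>z. z \<in> D \<Longrightarrow> z \<noteq> p \<Longrightarrow> dist z p < d \<Longrightarrow> dist (f z) (F p) < e/2"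
      using e unfolding Lim_within by (metis half_gt_zero zero_less_dist_iff)
    have d': "dist (f z) (F p) \<le> e/2" if "z \<in> D" "dist z p < d" for z
      using d(2)[of z] that e by (cases "z = p") (auto simp: F_def less_imp_le)
    show "\<exists>d>0. \<forall>q\<in>closure D. dist q p < d \<longrightarrow> dist (F q) (F p) < e"
    proof (intro exI[of _ d] conjI ballI impI d(1))
      fix q assume q: "q \<in> closure D" "dist q p < d"
      have "\<forall>\<^sub>F z in at q within D. z \<in> D \<and> dist z p < d"
      proof (rule eventually_conj)
        show "\<forall>\<^sub>F z in at q within D. z \<in> D" by (simp add: eventually_at_filter)
        have "((\<lambda>z. dist z p) \<longlongrightarrow> dist q p) (at q within D)" by (intro tendsto_intros)
        then show "\<forall>\<^sub>F z in at q within D. dist z p < d" using q(2) by (rule order_tendstoD)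
      qed
      then have "\<forall>\<^sub>F z in at q within D. dist (f z) (F p) \<le> e/2"
        by (rule eventually_mono) (use d' in blast)
      moreover have "((\<lambda>z. dist (f z) (F p)) \<longlongrightarrow> dist (F q) (F p)) (at q within D)"
        using lim[OF q(1)] by (intro tendsto_intros) auto
      ultimately have "dist (F q) (F p) \<le> e/2" using tendsto_upperbound bot[OF q(1)] by blast
      then show "dist (F q) (F p) < e" using e by simp
    qed
  qed
  have compD: "compact (closure D)" using D(2) by (simp add: compact_closure)
  have gclos: "g w \<in> closure D" if "w \<in> ball 0 1" for w using g(2)[OF that] closure_subset by blast
  have Fg: "F (g w) = w" if "w \<in> ball 0 1" for w using g(2)[OF that] fg[OF that] by (simp add: FD)
  have im: "F ` closure D = cball 0 1"
  proof
    show "F ` closure D \<subseteq> cball 0 1"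
    proof clarsimp
      fix z assume "z \<in> closure D"
      then show "norm (F z) \<le> 1" using lim[of z] FD[of z] f(2)[of z] by (cases "z \<in> D") auto
    qed
    have "ball 0 1 \<subseteq> F ` closure D" using Fg gclos by force
    moreover have "closed (F ` closure D)"
      using compact_continuous_image[OF cont compD] compact_imp_closed by blast
    ultimately have "closure (ball 0 1) \<subseteq> F ` closure D" by (rule closure_minimal)
    then show "cball 0 1 \<subseteq> F ` closure D" by simp
  qed
  have inj: "inj_on F (closure D)"
  proof (rule inj_onI)
    fix z1 z2 assume z: "z1 \<in> closure D" "z2 \<in> closure D" "F z1 = F z2"
    show "z1 = z2"
    proof (cases "z1 \<in> D \<or> z2 \<in> D")
      case True
      then have "norm (F z1) < 1" using f(2)[of z1] f(2)[of z2] FD[of z1] FD[of z2] z(3) by auto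
      then have "z1 \<in> D" "z2 \<in> D" using lim[OF z(1)] lim[OF z(2)] z(3) by auto
      then show ?thesis using gf[of z1] gf[of z2] FD[of z1] FD[of z2] z(3) by simp
    next
      case False
      define \<zeta> where "\<zeta> = F z1"
      have n\<zeta>: "norm \<zeta> = 1" using lim[OF z(1)] False by (simp add: \<zeta>_def)
      \<comment> \<open>Convex caps of the disc shrinking to \<open>\<zeta>\<close>. The closures of
        their images under \<open>g\<close> are nested continua, and their intersection is exactly
        the set where \<open>F\<close> equals \<open>\<zeta>\<close>.\<close>
      define B where "B n = ball 0 1 \<inter> ball \<zeta> (inverse (real (Suc n)))" for n
      define K where "K n = closure (g ` B n)" for n
      have gB: "g ` B n \<subseteq> D" for n using g(2) by (auto simp: B_def)
      have KD: "K n \<subseteq> closure D" for n unfolding K_def by (rule closure_mono[OF gB])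
      have Kc: "compact (K n)" for n
        using compact_Int_closed[OF compD, of "K n"] KD[of n] by (simp add: K_def Int_absorb1)
      have Kconn: "connected (K n)" for n unfolding K_def
      proof (intro connected_imp_connected_closure connected_continuous_image)
        show "continuous_on (B n) g"
          using g(1) by (intro holomorphic_on_imp_continuous_on holomorphic_on_subset[OF g(1)]) (auto simp: B_def)
        show "connected (B n)" unfolding B_def by (intro convex_connected convex_Int convex_ball)
      qed
      have nest: "K n \<subseteq> K m" if "m \<le> n" for m n
      proof -
        have "inverse (real (Suc n)) \<le> inverse (real (Suc m))" using that by (intro le_imp_inverse_le) auto
        then have "B n \<subseteq> B m" unfolding B_def by (intro Int_mono subset_ball order_refl)
        then show ?thesis unfolding K_def by (intro closure_mono image_mono)
      qed
      have conn: "connected (\<Inter> (range K))" by (rule connected_nest[OF Kc Kconn nest])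
      have inK: "x \<in> \<Inter> (range K)" if x: "x \<in> closure D" "F x = \<zeta>" for x
      proof clarify
        fix n
        show "x \<in> K n" unfolding K_def closure_approachable
        proof (intro allI impI)
          fix e :: real assume "e > 0"
          have l: "(f \<longlongrightarrow> \<zeta>) (at x within D)" using lim[OF x(1)] x(2) by simp
          have "\<forall>\<^sub>F z in at x within D. z \<in> D" by (simp add: eventually_at_filter)
          moreover have "\<forall>\<^sub>F z in at x within D. dist (f z) \<zeta> < inverse (real (Suc n))"
            by (rule tendstoD[OF l]) simp
          moreover have "\<forall>\<^sub>F z in at x within D. dist z x < e"
            by (rule tendstoD[OF tendsto_ident_at \<open>e > 0\<close>])
          ultimately have "\<forall>\<^sub>F z in at x within D. z \<in> D \<and> dist (f z) \<zeta> < inverse (real (Suc n)) \<and> dist z x < e"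
            by eventually_elim simp
          then obtain z where z: "z \<in> D" "dist (f z) \<zeta> < inverse (real (Suc n))" "dist z x < e"
            using eventually_happens'[OF bot[OF x(1)]] by blast
          have "f z \<in> B n" using f(2)[OF z(1)] z(2) by (simp add: B_def dist_commute)
          then have "z \<in> g ` B n" using gf[OF z(1)] by force
          then show "\<exists>y\<in>g ` B n. dist y x < e" using z(3) by blast
        qed
      qed
      have onK: "F x = \<zeta>" if x: "x \<in> \<Inter> (range K)" for x
      proof -
        have "dist \<zeta> (F x) \<le> inverse (real (Suc n))" for n
        proof -
          have "F ` K n \<subseteq> cball \<zeta> (inverse (real (Suc n)))" unfolding K_def
          proof (rule image_closure_subset)
            show "continuous_on (closure (g ` B n)) F"
              using KD[of n] cont continuous_on_subset unfolding K_def by blast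
            show "F ` g ` B n \<subseteq> cball \<zeta> (inverse (real (Suc n)))"
              using Fg by (auto simp: B_def less_imp_le)
          qed auto
          moreover have "x \<in> K n" using x by blast
          ultimately show ?thesis by auto
        qed
        then have "dist \<zeta> (F x) \<le> 0"
          by (intro LIMSEQ_le_const[OF LIMSEQ_inverse_real_of_nat]) auto
        then show ?thesis by simp
      qed
      show ?thesis
      proof (rule ccontr)
        assume "z1 \<noteq> z2"
        show False
        proof (rule un[OF _ conn _ _ _ \<open>z1 \<noteq> z2\<close> n\<zeta>])
          show "closed (\<Inter> (range K))" by (intro closed_Inter) (auto simp: K_def)
          show "z1 \<in> \<Inter> (range K)" "z2 \<in> \<Inter> (range K)" using inK z by (auto simp: \<zeta>_def)
          have cl: "x \<in> closure D" if "x \<in> \<Inter> (range K)" for x using that KD by blast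
          show "\<Inter> (range K) \<subseteq> frontier D"
          proof
            fix x assume x: "x \<in> \<Inter> (range K)"
            have "x \<notin> D"
            proof
              assume "x \<in> D"
              then show False using onK[OF x] FD f(2) n\<zeta> by force
            qed
            then show "x \<in> frontier D" using cl[OF x] fr by blast
          qed
          show "(f \<longlongrightarrow> \<zeta>) (at x within D)" if "x \<in> \<Inter> (range K)" for x
            using lim[OF cl[OF that]] onK[OF that] by simp
        qed
      qed
    qed
  qed
  show thesis
    using that[OF cont inj im FD] lim fr by blast
qed

end

section \<open>Maximum principles and boundary arcs\<close>

text \<open>If the real part reached a value \<open>e > 0\<close>, the set where it is at least
  \<open>e\<close> would be bounded and closed, hence compact in \<open>S\<close>. A maximum is
  attained there, so the real part is constant and \<open>S\<close> itself is compact and open,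
  which is impossible in the plane.\<close>

lemma max_principle:
  assumes S: "open S" "connected S" and W: "W holomorphic_on S"
    and fr: "\<And>p e. p \<in> frontier S \<Longrightarrow> e > 0 \<Longrightarrow> \<forall>\<^sub>F z in at p within S. Re (W z) < e"
    and inf: "\<And>e. e > 0 \<Longrightarrow> \<exists>R. \<forall>z\<in>S. norm z > R \<longrightarrow> Re (W z) < e"
    and z: "z \<in> S"
  shows "Re (W z) \<le> 0"
proof (rule ccontr)
  assume neg: "\<not> Re (W z) \<le> 0"
  define e where "e = Re (W z)"
  have e: "e > 0" using neg by (simp add: e_def)
  define K where "K = {x \<in> S. e \<le> Re (W x)}"
  have contW: "continuous_on S W" using W by (rule holomorphic_on_imp_continuous_on)
  have "bounded K"
  proof -
    obtain R where "\<forall>x\<in>S. norm x > R \<longrightarrow> Re (W x) < e" using inf[OF e] by blast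
    then have "\<forall>x\<in>K. norm x \<le> R" by (force simp: K_def)
    then show ?thesis unfolding bounded_iff by blast
  qed
  moreover have "closed K" unfolding closed_sequential_limits
  proof (intro allI impI, elim conjE)
    fix x p assume x: "\<forall>n. x n \<in> K" "x \<longlonglongrightarrow> p"
    have xS: "\<And>n. x n \<in> S" "\<And>n. e \<le> Re (W (x n))" using x by (auto simp: K_def)
    have "p \<in> closure S" using xS x unfolding closure_sequential by blast
    show "p \<in> K"
    proof (cases "p \<in> S")
      case True
      then have "isCont W p" using contW S by (simp add: continuous_on_eq_continuous_at)
      then have "(\<lambda>n. Re (W (x n))) \<longlonglongrightarrow> Re (W p)" using x(2) by (rule tendsto_Re[OF isCont_tendsto_compose])
      then have "e \<le> Re (W p)" by (rule LIMSEQ_le_const) (use xS in blast)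
      then show ?thesis using True by (simp add: K_def)
    next
      case False
      then have "p \<in> frontier S" using \<open>p \<in> closure S\<close> S by (simp add: frontier_def interior_open)
      then have ev: "\<forall>\<^sub>F z in at p within S. Re (W z) < e" using fr e by blast
      have "filterlim x (at p within S) sequentially"
        unfolding filterlim_at using x(2) xS(1) False by (intro conjI always_eventually) auto
      then have "\<forall>\<^sub>F n in sequentially. Re (W (x n)) < e" using ev unfolding filterlim_iff by blast
      then obtain n where "Re (W (x n)) < e" using eventually_happens'[OF sequentially_bot] by blast
      then show ?thesis using xS(2)[of n] by simp
    qed
  qed
  ultimately have cK: "compact K" by (simp add: compact_eq_bounded_closed)
  have KS: "K \<subseteq> S" by (auto simp: K_def)
  have "continuous_on K (\<lambda>x. Re (W x))" using contW KS by (intro continuous_on_Re continuous_on_subset[OF contW])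
  moreover have "K \<noteq> {}" using z by (auto simp: K_def e_def)
  ultimately obtain x0 where x0: "x0 \<in> K" "\<And>x. x \<in> K \<Longrightarrow> Re (W x) \<le> Re (W x0)"
    using continuous_attains_sup[OF cK] by blast
  have le: "Re (W x) \<le> Re (W x0)" if "x \<in> S" for x
    using x0 that by (cases "x \<in> K") (auto simp: K_def)
  have "(\<lambda>x. exp (W x)) constant_on S"
  proof (rule maximum_modulus_principle[OF _ S S(1) subset_refl])
    show "(\<lambda>x. exp (W x)) holomorphic_on S" using W by (intro holomorphic_on_exp')
    show "x0 \<in> S" using x0 KS by blast
    show "norm (exp (W x)) \<le> norm (exp (W x0))" if "x \<in> S" for x using le[OF that] by simp
  qed
  then obtain c where c: "\<And>x. x \<in> S \<Longrightarrow> exp (W x) = c" unfolding constant_on_def by blast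
  have "S = K"
  proof
    show "S \<subseteq> K"
    proof
      fix x assume x: "x \<in> S"
      then have "norm (exp (W x)) = norm (exp (W z))" using c z by simp
      then have "Re (W x) = e" by (simp add: e_def)
      then show "x \<in> K" using x by (simp add: K_def)
    qed
  qed fact
  then have "compact S" "open S" "S \<noteq> {}" using cK S z by auto
  then show False using clopen[of S] compact_imp_closed not_bounded_UNIV compact_imp_bounded by metis
qed

text \<open>The real part of \<open>Ln (1 - F / \<zeta>)\<close> is at most \<open>ln 2\<close> and
  tends to minus infinity at \<open>\<Gamma>\<close>, so it outweighs every multiple of the barrier
  \<open>B\<close> there; on the rest of the frontier the barrier is nonpositive. The maximum
  principle thus bounds \<open>N * Re (B s)\<close> independently of \<open>N\<close>, against
  \<open>Re (B s) > 0\<close>.\<close>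

lemma no_constant_boundary_arc:
  assumes S: "open S" "connected S" "bounded S" and F: "F holomorphic_on S" "\<And>z. z \<in> S \<Longrightarrow> norm (F z) < 1"
    and \<zeta>: "norm \<zeta> = 1" and \<Gamma>: "\<And>x. x \<in> \<Gamma> \<Longrightarrow> (F \<longlongrightarrow> \<zeta>) (at x within S)"
    and B: "B holomorphic_on UNIV" "\<And>z. z \<in> frontier S \<Longrightarrow> z \<notin> \<Gamma> \<Longrightarrow> Re (B z) \<le> 0"
    and s: "s \<in> S" "Re (B s) > 0"
  shows False
proof -
  have \<zeta>0: "\<zeta> \<noteq> 0" using \<zeta> by auto
  have nq: "norm (F z / \<zeta>) < 1" if "z \<in> S" for z using F(2)[OF that] \<zeta> by (simp add: norm_divide)
  have pos: "Re (1 - F z / \<zeta>) > 0" if "z \<in> S" for z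
    using nq[OF that] complex_Re_le_cmod[of "F z / \<zeta>"] by simp
  have nz: "1 - F z / \<zeta> \<noteq> 0" if "z \<in> S" for z using pos[OF that] by auto
  define G where "G z = Ln (1 - F z / \<zeta>)" for z
  have G: "G holomorphic_on S" unfolding G_def
  proof (rule holomorphic_on_Ln')
    show "(\<lambda>z. 1 - F z / \<zeta>) holomorphic_on S" using F(1) \<zeta>0 by (intro holomorphic_intros) auto
    show "1 - F z / \<zeta> \<notin> \<real>\<^sub>\<le>\<^sub>0" if "z \<in> S" for z using pos[OF that] by (auto simp: complex_nonpos_Reals_iff)
  qed
  have ReG: "Re (G z) = ln (norm (1 - F z / \<zeta>))" if "z \<in> S" for z using nz[OF that] by (simp add: G_def)
  have G2: "Re (G z) \<le> ln 2" if "z \<in> S" for z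
  proof -
    have "norm (1 - F z / \<zeta>) \<le> 2" using norm_triangle_ineq4[of 1 "F z / \<zeta>"] nq[OF that] by simp
    then show ?thesis unfolding ReG[OF that] using nz[OF that] by (intro ln_mono) auto
  qed
  have contB: "isCont B z" for z using B(1) holomorphic_on_imp_continuous_on continuous_on_eq_continuous_at by blast
  have key: "Re (G s - of_real (ln 2) + of_real N * B s) \<le> 0" if N: "N > 0" for N
  proof (rule max_principle[OF S(1,2) _ _ _ s(1)])
    show "(\<lambda>z. G z - of_real (ln 2) + of_real N * B z) holomorphic_on S"
      using G holomorphic_on_subset[OF B(1)]
      by (intro holomorphic_on_add holomorphic_on_diff holomorphic_on_mult holomorphic_on_const) auto
    show "\<exists>R. \<forall>z\<in>S. norm z > R \<longrightarrow> Re (G z - of_real (ln 2) + of_real N * B z) < e" for e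
    proof -
      obtain R where "\<And>z. z \<in> S \<Longrightarrow> norm z \<le> R" using S(3) unfolding bounded_iff by blast
      then show ?thesis by (intro exI[of _ R]) force
    qed
    fix p e :: "complex" and e' :: real assume p: "p \<in> frontier S" and e: "e' > 0"
    have Bl: "((\<lambda>z. Re (B z)) \<longlongrightarrow> Re (B p)) (at p within S)"
      by (rule tendsto_Re[OF tendsto_within_subset[OF contB[unfolded isCont_def] subset_UNIV]])
    have inS: "\<forall>\<^sub>F z in at p within S. z \<in> S" by (simp add: eventually_at_filter)
    show "\<forall>\<^sub>F z in at p within S. Re (G z - of_real (ln 2) + of_real N * B z) < e'"
    proof (cases "p \<in> \<Gamma>")
      case False
      then have "Re (B p) < e' / N" using B(2)[OF p] e N by (smt (verit) divide_pos_pos)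
      then have "\<forall>\<^sub>F z in at p within S. Re (B z) < e' / N" using Bl order_tendstoD by blast
      then show ?thesis using inS
      proof eventually_elim
        case (elim z)
        then have "N * Re (B z) < e'" using N by (simp add: field_simps)
        then show ?case using G2[of z] elim by simp
      qed
    next
      case True
      have "\<forall>\<^sub>F z in at p within S. Re (B z) < Re (B p) + 1" using Bl by (rule order_tendstoD) simp
      moreover have "((\<lambda>z. norm (1 - F z / \<zeta>)) \<longlongrightarrow> norm (1 - \<zeta> / \<zeta>)) (at p within S)"
        using \<Gamma>[OF True] \<zeta>0 by (intro tendsto_intros) auto
      then have "\<forall>\<^sub>F z in at p within S. norm (1 - F z / \<zeta>) < exp (- N * (Re (B p) + 1))"
        by (rule order_tendstoD) (use \<zeta>0 in simp)
      ultimately show ?thesis using inS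
      proof eventually_elim
        case (elim z)
        have "Re (G z) < - N * (Re (B p) + 1)"
          unfolding ReG[OF elim(3)] using nz[OF elim(3)] elim(2)
          by (smt (verit, best) ln_exp ln_less_cancel_iff exp_gt_zero zero_less_norm_iff)
        moreover have "N * Re (B z) < N * (Re (B p) + 1)" using N elim(1) by simp
        moreover have "ln 2 \<ge> (0::real)" by simp
        ultimately have "Re (G z) - ln 2 + N * Re (B z) < 0" by linarith
        then show ?case using e by simp
      qed
    qed
  qed
  \<comment> \<open>Makes \<open>N * Re (B s)\<close> exceed the bound
    \<open>ln 2 - Re (G s)\<close> by at least 1.\<close>
  define N where "N = (\<bar>ln 2 - Re (G s)\<bar> + 1) / Re (B s)"
  have "N > 0" using s by (auto simp: N_def intro!: divide_pos_pos)
  then have "Re (G s) - ln 2 + N * Re (B s) \<le> 0" using key[of N] by simp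
  moreover have "N * Re (B s) = \<bar>ln 2 - Re (G s)\<bar> + 1" using s by (simp add: N_def)
  ultimately show False by linarith
qed

section \<open>Connected regions above a graph\<close>

lemma connected_via_core:
  assumes A: "A \<subseteq> S" "connected A"
    and C: "\<And>z. z \<in> S \<Longrightarrow> \<exists>C. connected C \<and> z \<in> C \<and> C \<subseteq> S \<and> C \<inter> A \<noteq> {}"
  shows "connected S"
proof (cases "S = {}")
  case False
  obtain C where C': "\<And>z. z \<in> S \<Longrightarrow> connected (C z) \<and> z \<in> C z \<and> C z \<subseteq> S \<and> C z \<inter> A \<noteq> {}"
    using C by metis
  have "S = (\<Union>z\<in>S. C z \<union> A)" using C' A by blast
  moreover have "connected (\<Union>z\<in>S. C z \<union> A)"
  proof (rule connected_Union)
    show "connected s" if "s \<in> (\<lambda>z. C z \<union> A) ` S" for s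
      using that C' A(2) by (auto intro!: connected_Un)
    obtain z where "z \<in> S" using False by blast
    then obtain a where "a \<in> A" using C' by blast
    then show "\<Inter> ((\<lambda>z. C z \<union> A) ` S) \<noteq> {}" by blast
  qed
  ultimately show ?thesis by simp
qed auto

text \<open>Every point rises vertically into the rectangle between the heights \<open>c'\<close>
  and \<open>c\<close>. The floor \<open>G\<close> may jump, as it does at the end of the
  obstacle.\<close>

lemma connected_subgraph_strip:
  fixes G :: "real \<Rightarrow> real"
  assumes I: "is_interval I" and c: "c' < c" "\<And>x. x \<in> I \<Longrightarrow> G x \<le> c'"
  shows "connected {z. Re z \<in> I \<and> G (Re z) < Im z \<and> Im z < c}" (is "connected ?S")
proof (rule connected_via_core)
  let ?A = "{z. Re z \<in> I \<and> c' < Im z \<and> Im z < c}"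
  show "?A \<subseteq> ?S" using c by force
  have "?A = Re -` I \<inter> {z. c' < Im z} \<inter> {z. Im z < c}" by auto
  moreover have "convex (Re -` I)"
    using I by (intro convex_linear_vimage) (auto simp: is_interval_convex_1 bounded_linear.linear[OF bounded_linear_Re])
  ultimately have "convex ?A" by (auto intro!: convex_Int convex_halfspace_Im_gt convex_halfspace_Im_lt)
  then show "connected ?A" by (rule convex_connected)
  fix z assume z: "z \<in> ?S"
  let ?C = "{w. Re w = Re z} \<inter> {w. Im z \<le> Im w} \<inter> {w. Im w < c}"
  show "\<exists>C. connected C \<and> z \<in> C \<and> C \<subseteq> ?S \<and> C \<inter> ?A \<noteq> {}"
  proof (intro exI conjI)
    have "convex ?C" by (intro convex_Int convex_halfspace_Im_lt convex_halfspace_Im_ge)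
       (simp add: convex_def algebra_simps flip: distrib_right)
    then show "connected ?C" by (rule convex_connected)
    show "z \<in> ?C" "?C \<subseteq> ?S" using z by auto
    have "Complex (Re z) ((max (Im z) c' + c) / 2) \<in> ?C \<inter> ?A" using z c by (auto simp: max_def)
    then show "?C \<inter> ?A \<noteq> {}" by blast
  qed
qed

section \<open>The quarter domain\<close>

locale corner =
  fixes L :: real and h :: "real \<Rightarrow> real"
  assumes L: "L > 0" and conth: "continuous_on UNIV h" and hpos: "\<And>x. h x > 0"
begin

definition T where "T = {z. 0 < Re z \<and> 0 < Im z \<and> (L < Re z \<or> h (Re z) < Im z)}"
definition Tb where "Tb = {z. 0 \<le> Re z \<and> 0 \<le> Im z \<and> (L \<le> Re z \<or> h (Re z) \<le> Im z)}"

lemma isConth: "isCont h x" using conth by (simp add: continuous_on_eq_continuous_at)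

lemma conth': "continuous_on S (\<lambda>z. h (Re z))"
  by (rule continuous_on_compose2[OF conth]) (auto intro: continuous_on_Re continuous_on_id)

lemma open_T: "open T"
proof -
  have "T = {z. 0 < Re z} \<inter> {z. 0 < Im z} \<inter> ({z. L < Re z} \<union> {z. h (Re z) < Im z})"
    by (auto simp: T_def)
  moreover have "open {z. h (Re z) < Im z}"
    by (intro open_Collect_less conth' continuous_on_Im continuous_on_id)
  ultimately show ?thesis
    by (simp add: open_Int open_Un open_halfspace_Re_gt open_halfspace_Im_gt)
qed

lemma closed_Tb: "closed Tb"
proof -
  have "Tb = {z. 0 \<le> Re z} \<inter> {z. 0 \<le> Im z} \<inter> ({z. L \<le> Re z} \<union> {z. h (Re z) \<le> Im z})"
    by (auto simp: Tb_def)
  moreover have "closed {z. h (Re z) \<le> Im z}"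
    by (intro closed_Collect_le conth' continuous_on_Im continuous_on_id)
  ultimately show ?thesis
    by (simp add: closed_Int closed_Un closed_halfspace_Re_ge closed_halfspace_Im_ge)
qed

lemma T_subset: "T \<subseteq> Tb" by (auto simp: T_def Tb_def)

text \<open>A small shift to the right and upwards leads into \<open>T\<close>. Over the graph the
  horizontal part is chosen after the vertical one, by continuity of \<open>h\<close>.\<close>

lemma Tb_limit:
  assumes "z \<in> Tb" "e > 0"
  shows "\<exists>w\<in>T. dist w z < e"
proof (cases "L \<le> Re z")
  case True
  define w where "w = z + Complex (e/4) (e/4)"
  have "norm (w - z) \<le> \<bar>e/4\<bar> + \<bar>e/4\<bar>" using cmod_le[of "w - z"] by (simp add: w_def)
  then have "dist w z < e" using assms by (simp add: dist_norm)
  moreover have "w \<in> T" using assms True L by (auto simp: T_def Tb_def w_def)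
  ultimately show ?thesis by blast
next
  case False
  then have z: "0 \<le> Re z" "h (Re z) \<le> Im z" using assms by (auto simp: Tb_def)
  have "\<exists>d>0. \<forall>y. dist y (Re z) < d \<longrightarrow> dist (h y) (h (Re z)) < e/4"
    using isConth[of "Re z"] \<open>e > 0\<close> unfolding continuous_at_eps_delta
    by (metis divide_pos_pos zero_less_numeral)
  then obtain d where d: "d > 0" "\<And>y. dist y (Re z) < d \<Longrightarrow> dist (h y) (h (Re z)) < e/4" by blast
  define r where "r = min (d/2) (e/4)"
  have r: "r > 0" "r < d" "r \<le> e/4" using d assms by (auto simp: r_def)
  define w where "w = z + Complex r (e/4)"
  have "norm (w - z) \<le> \<bar>r\<bar> + \<bar>e/4\<bar>" using cmod_le[of "w - z"] by (simp add: w_def)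
  then have "dist w z < e" using assms r by (simp add: dist_norm)
  moreover have "\<bar>h (Re w) - h (Re z)\<bar> < e/4" using d(2)[of "Re w"] r by (simp add: w_def dist_real_def)
  moreover have "Im w = Im z + e/4" by (simp add: w_def)
  ultimately have "h (Re w) < Im w" using z by linarith
  moreover have "h (Re w) > 0" by (rule hpos)
  ultimately have "w \<in> T" using r z L by (auto simp: T_def w_def)
  then show ?thesis using \<open>dist w z < e\<close> by blast
qed

lemma bounded_h: obtains M where "M > 0" "\<And>x. 0 \<le> x \<Longrightarrow> x \<le> L \<Longrightarrow> h x < M"
proof -
  have "continuous_on {0..L} h" using conth continuous_on_subset by blast
  then have "bounded (h ` {0..L})" by (intro compact_imp_bounded compact_continuous_image) auto
  then obtain M where "\<forall>y\<in>h ` {0..L}. norm y \<le> M" unfolding bounded_iff by blast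
  then have M: "\<bar>h x\<bar> \<le> M" if "0 \<le> x" "x \<le> L" for x using that by auto
  show thesis
  proof (rule that[of "M + 1"])
    show "M + 1 > 0" using M[of 0] L by auto
    show "h x < M + 1" if "0 \<le> x" "x \<le> L" for x using M[OF that] by linarith
  qed
qed

text \<open>The part of the domain outside a large square; its image under \<open>\<tau>\<close> below is a neighbourhood
  of the boundary point \<open>0\<close>.\<close>

lemma far_connected:
  assumes R: "R \<ge> L" "\<And>x. 0 \<le> x \<Longrightarrow> x \<le> L \<Longrightarrow> h x < R"
  shows "connected {z \<in> T. R < Re z \<or> R < Im z}"
proof -
  have e: "{z \<in> T. R < Re z \<or> R < Im z} = ({z. R < Re z} \<inter> {z. 0 < Im z}) \<union> ({z. 0 < Re z} \<inter> {z. R < Im z})"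
    (is "_ = ?A \<union> ?B")
  proof (intro set_eqI iffI)
    fix z assume "z \<in> ?A \<union> ?B"
    then consider "R < Re z" "0 < Im z" | "0 < Re z" "R < Im z" by blast
    then show "z \<in> {z \<in> T. R < Re z \<or> R < Im z}"
    proof cases
      case 1 then show ?thesis using R L by (auto simp: T_def)
    next
      case 2
      then have "L < Re z \<or> h (Re z) < Im z" using R(2)[of "Re z"] by (cases "L < Re z") auto
      then show ?thesis using 2 R L by (auto simp: T_def)
    qed
  qed (auto simp: T_def)
  have "connected ?A" "connected ?B"
    by (auto intro!: convex_connected convex_Int convex_halfspace_Im_gt convex_halfspace_Re_gt)
  moreover have "Complex (R+1) (R+1) \<in> ?A \<inter> ?B" using R L by auto
  moreover have "?A \<inter> ?B \<noteq> {}" using calculation(3) by (metis empty_iff)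
  ultimately show ?thesis unfolding e by (intro connected_Un)
qed

lemma connected_T: "connected T"
proof -
  obtain M where M: "M > 0" "\<And>x. 0 \<le> x \<Longrightarrow> x \<le> L \<Longrightarrow> h x < M" using bounded_h by blast
  define R where "R = max L M"
  have R: "R \<ge> L" "\<And>x. 0 \<le> x \<Longrightarrow> x \<le> L \<Longrightarrow> h x < R" using M by (force simp: R_def)+
  show ?thesis
  proof (rule connected_via_core[OF _ far_connected[OF R]])
    fix z assume z: "z \<in> T"
    let ?C = "{w. Re w = Re z} \<inter> {w. Im z \<le> Im w}"
    show "\<exists>C. connected C \<and> z \<in> C \<and> C \<subseteq> T \<and> C \<inter> {z \<in> T. R < Re z \<or> R < Im z} \<noteq> {}"
    proof (intro exI conjI)
      have "convex ?C" by (intro convex_Int convex_halfspace_Im_ge)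
         (simp add: convex_def algebra_simps flip: distrib_right)
      then show "connected ?C" by (rule convex_connected)
      show "z \<in> ?C" "?C \<subseteq> T" using z by (auto simp: T_def)
      have "Complex (Re z) (max (Im z) R + 1) \<in> ?C \<inter> {z \<in> T. R < Re z \<or> R < Im z}" using z by (auto simp: T_def)
      then show "?C \<inter> {z \<in> T. R < Re z \<or> R < Im z} \<noteq> {}" by blast
    qed
  qed auto
qed

lemma T_nonempty: "T \<noteq> {}"
proof -
  have "Complex (L+1) 1 \<in> T" using L by (simp add: T_def)
  then show ?thesis by blast
qed

text \<open>The vertical half line below a point outside \<open>T\<close> misses \<open>T\<close>,
  so such a point lies in the unbounded component of the complement of every loop in
  \<open>T\<close> and has winding number zero.\<close>

lemma simply_connected_T: "simply_connected T"
  unfolding simply_connected_eq_winding_number_zero[OF open_T]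
proof (intro conjI allI impI connected_T)
  fix \<gamma> z assume a: "path \<gamma> \<and> path_image \<gamma> \<subseteq> T \<and> pathfinish \<gamma> = pathstart \<gamma> \<and> z \<notin> T"
  let ?R = "{w. Re w = Re z} \<inter> {w. Im w \<le> Im z}"
  have "convex ?R" by (intro convex_Int convex_halfspace_Im_le)
      (simp add: convex_def algebra_simps flip: distrib_right)
  then have "connected ?R" by (rule convex_connected)
  moreover have RT: "?R \<inter> T = {}" using a by (auto simp: T_def)
  moreover have "\<not> bounded ?R"
  proof
    assume "bounded ?R"
    then obtain B where B: "\<And>w. w \<in> ?R \<Longrightarrow> norm w \<le> B" unfolding bounded_iff by blast
    have "norm (Complex (Re z) (min (Im z) (- \<bar>B\<bar> - 1))) \<le> B" by (rule B) auto
    then show False using abs_Im_le_cmod[of "Complex (Re z) (min (Im z) (- \<bar>B\<bar> - 1))"] by auto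
  qed
  moreover have "?R \<subseteq> connected_component_set (- path_image \<gamma>) z"
    using \<open>connected ?R\<close> RT a by (intro connected_component_maximal) auto
  ultimately have "\<not> bounded (connected_component_set (- path_image \<gamma>) z)"
    using bounded_subset by blast
  then have "z \<in> outside (path_image \<gamma>)" using a by (auto simp: outside_def)
  then show "winding_number \<gamma> z = 0" using a by (intro winding_number_zero_in_outside) auto
qed

section \<open>A bounded image of the quarter domain\<close>

text \<open>An inversion with its pole at -1, off \<open>Tb\<close>. It makes the domain bounded and
  turns infinity into the boundary point 0, so that \<open>disc_map\<close> treats infinity like any
  other boundary point.\<close>

definition \<tau> :: "complex \<Rightarrow> complex" where "\<tau> z = inverse (z + 1)"
definition \<sigma> :: "complex \<Rightarrow> complex" where "\<sigma> w = inverse w - 1"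
definition D where "D = \<tau> ` T"

lemma \<sigma>\<tau>[simp]: "\<sigma> (\<tau> z) = z" by (simp add: \<sigma>_def \<tau>_def)
lemma \<tau>\<sigma>[simp]: "\<tau> (\<sigma> z) = z" by (simp add: \<sigma>_def \<tau>_def)

lemma Tb_ne: "z \<in> Tb \<Longrightarrow> z + 1 \<noteq> 0" by (auto simp: Tb_def complex_eq_iff)

lemma \<tau>_ne: "z \<in> Tb \<Longrightarrow> \<tau> z \<noteq> 0" using Tb_ne by (simp add: \<tau>_def)

lemma hol_\<tau>: "\<tau> holomorphic_on - {-1}"
  unfolding \<tau>_def by (intro holomorphic_intros) (auto simp: add_eq_0_iff2)

lemma hol_\<sigma>: "\<sigma> holomorphic_on - {0}"
  unfolding \<sigma>_def by (intro holomorphic_intros) auto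

lemma D_eq: "D = {w. w \<noteq> 0 \<and> \<sigma> w \<in> T}"
  using \<tau>_ne T_subset by (force simp: D_def image_iff intro: \<tau>\<sigma>[symmetric])

lemma open_\<sigma>_vimage: "open U \<Longrightarrow> open {w. w \<noteq> 0 \<and> \<sigma> w \<in> U}"
  using continuous_open_preimage[OF holomorphic_on_imp_continuous_on[OF hol_\<sigma>], of U]
  by (auto simp: vimage_def Int_def)

lemma open_\<tau>_vimage: "open U \<Longrightarrow> open {w. w \<noteq> -1 \<and> \<tau> w \<in> U}"
  using continuous_open_preimage[OF holomorphic_on_imp_continuous_on[OF hol_\<tau>], of U]
  by (auto simp: vimage_def Int_def)

lemma open_D: "open D" unfolding D_eq by (rule open_\<sigma>_vimage[OF open_T])

lemma norm_\<tau>_eq: "norm (\<tau> z) = 1 / norm (z + 1)"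
  by (simp add: \<tau>_def norm_inverse divide_inverse)

lemma norm_\<tau>: "z \<in> Tb \<Longrightarrow> norm (\<tau> z) \<le> 1"
proof -
  assume "z \<in> Tb"
  then have "1 \<le> Re (z + 1)" by (simp add: Tb_def)
  also have "\<dots> \<le> norm (z + 1)" by (rule complex_Re_le_cmod)
  finally show ?thesis by (simp add: \<tau>_def norm_inverse inverse_le_1_iff)
qed

lemma bounded_D: "bounded D"
  unfolding bounded_iff D_def using norm_\<tau> T_subset by blast

lemma frontier_D: "frontier D \<subseteq> insert 0 (\<tau> ` (Tb - T))"
proof
  fix p assume "p \<in> frontier D"
  then have p: "p \<in> closure D" "p \<notin> D" using open_D by (auto simp: frontier_def interior_open)
  then obtain x where x: "\<And>n. x n \<in> D" "x \<longlonglongrightarrow> p" unfolding closure_sequential by blast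
  show "p \<in> insert 0 (\<tau> ` (Tb - T))"
  proof (cases "p = 0")
    case False
    then have "isCont \<sigma> p"
      using holomorphic_on_imp_continuous_on[OF hol_\<sigma>] by (simp add: continuous_on_eq_continuous_at open_Compl)
    then have "(\<lambda>n. \<sigma> (x n)) \<longlonglongrightarrow> \<sigma> p" using x(2) by (rule isCont_tendsto_compose)
    moreover have "\<sigma> (x n) \<in> Tb" for n using x(1)[of n] T_subset by (auto simp: D_eq)
    ultimately have "\<sigma> p \<in> Tb" using closed_sequentially[OF closed_Tb, of "\<lambda>n. \<sigma> (x n)"] by blast
    moreover have "\<sigma> p \<notin> T" using p False by (simp add: D_eq)
    ultimately show ?thesis by (force intro: \<tau>\<sigma>[symmetric])
  qed simp
qed

lemma closure_D: "closure D = insert 0 (\<tau> ` Tb)"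
proof
  have "closure D = D \<union> frontier D" by (simp add: closure_Un_frontier)
  then show "closure D \<subseteq> insert 0 (\<tau> ` Tb)" using frontier_D T_subset by (auto simp: D_def)
  have 1: "\<tau> z \<in> closure D" if z: "z \<in> Tb" for z
  proof -
    have "z \<in> closure T" unfolding closure_approachable using Tb_limit[OF z] by blast
    then obtain x where x: "\<And>n. x n \<in> T" "x \<longlonglongrightarrow> z" unfolding closure_sequential by blast
    have "isCont \<tau> z"
      using holomorphic_on_imp_continuous_on[OF hol_\<tau>] Tb_ne[OF z]
      by (simp add: continuous_on_eq_continuous_at add_eq_0_iff2 open_Compl)
    then have "(\<lambda>n. \<tau> (x n)) \<longlonglongrightarrow> \<tau> z" using x(2) by (rule isCont_tendsto_compose)
    then show ?thesis unfolding closure_sequential using x(1) by (intro exI[of _ "\<lambda>n. \<tau> (x n)"]) (auto simp: D_def)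
  qed
  have "0 \<in> closure D" unfolding closure_approachable
  proof (intro allI impI)
    fix e :: real assume e: "e > 0"
    define z where "z = Complex (L + 1/e) 1"
    have z: "z \<in> T" using L e by (simp add: T_def z_def add_pos_pos)
    have "1/e < Re (z + 1)" using L by (simp add: z_def)
    also have "\<dots> \<le> norm (z + 1)" by (rule complex_Re_le_cmod)
    finally have "1/e < norm (z + 1)" .
    moreover from this have "0 < norm (z + 1)" using e by (smt (verit) divide_pos_pos)
    ultimately have "norm (\<tau> z) < e" unfolding norm_\<tau>_eq using e by (simp add: field_simps)
    then show "\<exists>y\<in>D. dist y 0 < e" using z by (auto simp: D_def)
  qed
  then show "insert 0 (\<tau> ` Tb) \<subseteq> closure D" using 1 by auto
qed

lemma lc_at_\<tau>:
  assumes q: "q \<in> Tb" "locally_connected_at T q"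
  shows "locally_connected_at D (\<tau> q)"
  unfolding locally_connected_at_def
proof (intro allI impI, elim conjE)
  fix U assume U: "open U" "\<tau> q \<in> U"
  define U' where "U' = {w. w \<noteq> -1 \<and> \<tau> w \<in> U}"
  have "open U'" "q \<in> U'" using open_\<tau>_vimage[OF U(1)] U(2) Tb_ne[OF q(1)] by (auto simp: U'_def)
  then obtain V' N' where V': "open V'" "q \<in> V'" "open N'" "connected N'" "T \<inter> V' \<subseteq> N'" "N' \<subseteq> T \<inter> U'"
    using q(2) unfolding locally_connected_at_def by meson
  define V where "V = {w. w \<noteq> 0 \<and> \<sigma> w \<in> V'}"
  define N where "N = {w. w \<noteq> 0 \<and> \<sigma> w \<in> N'}"
  have Neq: "N = \<tau> ` N'"
  proof
    show "N \<subseteq> \<tau> ` N'" by (force simp: N_def intro: \<tau>\<sigma>[symmetric])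
    show "\<tau> ` N' \<subseteq> N" using V'(6) \<tau>_ne T_subset by (auto simp: N_def)
  qed
  show "\<exists>V N. open V \<and> \<tau> q \<in> V \<and> open N \<and> connected N \<and> D \<inter> V \<subseteq> N \<and> N \<subseteq> D \<inter> U"
  proof (intro exI conjI)
    show "open V" "open N" unfolding V_def N_def using V' open_\<sigma>_vimage by auto
    show "\<tau> q \<in> V" using V' \<tau>_ne[OF q(1)] by (simp add: V_def)
    have "continuous_on N' \<tau>"
      using V'(6) by (intro holomorphic_on_imp_continuous_on holomorphic_on_subset[OF hol_\<tau>]) (auto simp: U'_def)
    then show "connected N" unfolding Neq using V'(4) by (rule connected_continuous_image)
    show "D \<inter> V \<subseteq> N" using V'(5) by (auto simp: D_eq V_def N_def)
    show "N \<subseteq> D \<inter> U" unfolding Neq using V'(6) by (auto simp: D_def U'_def)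
  qed
qed

lemma lc_at_0: "locally_connected_at D 0"
  unfolding locally_connected_at_def
proof (intro allI impI, elim conjE)
  fix U assume U: "open U" "(0::complex) \<in> U"
  then obtain r where r: "r > 0" "ball 0 r \<subseteq> U" using open_contains_ball by blast
  obtain M where M: "M > 0" "\<And>x. 0 \<le> x \<Longrightarrow> x \<le> L \<Longrightarrow> h x < M" using bounded_h by blast
  \<comment> \<open>Above \<open>1/r\<close>, so that the far part of \<open>T\<close> is mapped
    into the ball of radius \<open>r\<close>; above \<open>L\<close> and all heights, so that
    \<open>far_connected\<close> applies.\<close>
  define R where "R = L + M + 1/r"
  have R: "R \<ge> L" "R > 0" "R > 1/r" using M r L by (auto simp: R_def intro: add_pos_pos)
  have RM: "h x < R" if "0 \<le> x" "x \<le> L" for x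
    using M(2)[OF that] L r(1) by (smt (verit) R_def divide_pos_pos)
  define N' where "N' = {z \<in> T. R < Re z \<or> R < Im z}"
  have cN: "connected N'" unfolding N'_def by (rule far_connected[OF R(1) RM])
  have NT: "N' \<subseteq> T" by (auto simp: N'_def)
  have oN: "open N'"
  proof -
    have "N' = T \<inter> ({z. R < Re z} \<union> {z. R < Im z})" by (auto simp: N'_def)
    then show ?thesis using open_T by (simp add: open_Int open_Un open_halfspace_Re_gt open_halfspace_Im_gt)
  qed
  define N where "N = {w. w \<noteq> 0 \<and> \<sigma> w \<in> N'}"
  have Neq: "N = \<tau> ` N'"
  proof
    show "N \<subseteq> \<tau> ` N'" by (force simp: N_def intro: \<tau>\<sigma>[symmetric])
    show "\<tau> ` N' \<subseteq> N" using NT \<tau>_ne T_subset by (auto simp: N_def)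
  qed
  show "\<exists>V N. open V \<and> 0 \<in> V \<and> open N \<and> connected N \<and> D \<inter> V \<subseteq> N \<and> N \<subseteq> D \<inter> U"
  proof (intro exI conjI)
    \<comment> \<open>Since \<open>\<bar>z + 1\<bar> \<le> Re z + Im z + 1\<close> in the quadrant,
      a value of \<open>\<bar>z + 1\<bar>\<close> above \<open>2*R + 1\<close> forces one coordinate
      above \<open>R\<close>.\<close>
    show "open (ball (0::complex) (1/(2*R+1)))" "0 \<in> ball (0::complex) (1/(2*R+1))" using R by auto
    show "open N" unfolding N_def by (rule open_\<sigma>_vimage[OF oN])
    have "continuous_on N' \<tau>"
      using NT T_subset Tb_ne by (intro holomorphic_on_imp_continuous_on holomorphic_on_subset[OF hol_\<tau>]) force
    then show "connected N" unfolding Neq using cN by (rule connected_continuous_image)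
    have "N \<subseteq> D" unfolding Neq using NT by (auto simp: D_def)
    moreover have "N \<subseteq> U" unfolding Neq
    proof clarify
      fix z assume z: "z \<in> N'"
      then have zT: "z \<in> T" "0 \<le> Re z" "0 \<le> Im z" by (auto simp: N'_def T_def)
      have "1/r < norm (z + 1)"
        using z R(3) zT complex_Re_le_cmod[of "z+1"] abs_Im_le_cmod[of "z+1"] by (auto simp: N'_def)
      moreover from this have "0 < norm (z + 1)" using r(1) by (smt (verit) divide_pos_pos)
      ultimately have "norm (\<tau> z) < r" unfolding norm_\<tau>_eq using r(1) by (simp add: field_simps)
      then show "\<tau> z \<in> U" using r(2) by auto
    qed
    ultimately show "N \<subseteq> D \<inter> U" by blast
    show "D \<inter> ball 0 (1/(2*R+1)) \<subseteq> N" unfolding Neq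
    proof
      fix w assume w: "w \<in> D \<inter> ball 0 (1/(2*R+1))"
      then obtain z where z: "w = \<tau> z" "z \<in> T" by (auto simp: D_def)
      have pos: "norm (z + 1) > 0" using Tb_ne z T_subset by auto
      have "norm (\<tau> z) < 1/(2*R+1)" using w z by auto
      then have "2*R+1 < norm (z + 1)" using R(2) pos unfolding norm_\<tau>_eq by (simp add: field_simps)
      also have "\<dots> \<le> \<bar>Re z\<bar> + \<bar>Im z\<bar> + 1"
        using cmod_le[of z] norm_triangle_ineq[of z 1] by simp
      finally have "R < Re z \<or> R < Im z" using z by (auto simp: T_def)
      then have "z \<in> N'" using z by (simp add: N'_def)
      then show "w \<in> \<tau> ` N'" using z by blast
    qed
  qed
qed

end

section \<open>The boundary of the quarter domain: local connectedness and continua\<close>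

lemma Re_sin_barrier: "Re (\<i> * sin (Complex a (-b))) = cos a * sinh b"
proof -
  have "Im (sin (Complex x y)) = cos x * sinh y" for x y
    by (simp add: Im_sin sinh_def field_simps)
  then show ?thesis by simp
qed

context corner
begin

lemma h_near:
  assumes "e > 0"
  obtains d where "d > 0" "\<And>y. \<bar>y - x\<bar> < d \<Longrightarrow> \<bar>h y - h x\<bar> < e"
proof -
  have "\<exists>d>0. \<forall>y. dist y x < d \<longrightarrow> dist (h y) (h x) < e"
    using isConth[of x] assms unfolding continuous_at_eps_delta by blast
  then show thesis using that by (auto simp: dist_real_def)
qed

text \<open>Width and height of the test rectangles are independent, so near the graph the width can
  be chosen after the height.\<close>

lemma locally_connected_at_T_box:
  assumes "\<And>e. e > 0 \<Longrightarrow> \<exists>d e'. 0 < d \<and> d \<le> e \<and> 0 < e' \<and> e' \<le> e \<and>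
     connected (T \<inter> {z. \<bar>Re z - Re q\<bar> < d \<and> \<bar>Im z - Im q\<bar> < e'})"
  shows "locally_connected_at T q"
  unfolding locally_connected_at_def
proof (intro allI impI, elim conjE)
  fix U assume U: "open U" "q \<in> U"
  then obtain r where r: "r > 0" "ball q r \<subseteq> U" using open_contains_ball by blast
  obtain d e' where de: "0 < d" "d \<le> r/2" "0 < e'" "e' \<le> r/2"
     "connected (T \<inter> {z. \<bar>Re z - Re q\<bar> < d \<and> \<bar>Im z - Im q\<bar> < e'})"
    using assms[of "r/2"] r by auto
  let ?V = "{z. \<bar>Re z - Re q\<bar> < d \<and> \<bar>Im z - Im q\<bar> < e'}"
  have oV: "open ?V" by (intro open_Collect_conj open_Collect_less continuous_intros)
  have "?V \<subseteq> U"
  proof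
    fix z assume "z \<in> ?V"
    then have "norm (z - q) < r" using cmod_le[of "z - q"] de by auto
    then show "z \<in> U" using r(2) by (auto simp: dist_norm norm_minus_commute)
  qed
  then show "\<exists>V N. open V \<and> q \<in> V \<and> open N \<and> connected N \<and> T \<inter> V \<subseteq> N \<and> N \<subseteq> T \<inter> U"
    using de oV open_T by (intro exI[of _ ?V] exI[of _ "T \<inter> ?V"]) auto
qed

text \<open>Two shapes occur. At a point of the vertical segment below its top, a small rectangle
  meets \<open>T\<close> only to the right of \<open>Re = L\<close>. At every other boundary point
  the trace of a small rectangle is the region above a floor that stays below the upper side, so
  \<open>connected_subgraph_strip\<close> applies.\<close>

lemma locally_connected_at_T:
  assumes q: "q \<in> Tb" "q \<notin> T"
  shows "locally_connected_at T q"
proof (rule locally_connected_at_T_box)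
  fix e :: real assume e: "e > 0"
  define x0 where "x0 = Re q"
  define y0 where "y0 = Im q"
  have q0: "0 \<le> x0" "0 \<le> y0" using q by (auto simp: Tb_def x0_def y0_def)
  show "\<exists>d e'. 0 < d \<and> d \<le> e \<and> 0 < e' \<and> e' \<le> e \<and>
     connected (T \<inter> {z. \<bar>Re z - Re q\<bar> < d \<and> \<bar>Im z - Im q\<bar> < e'})"
  proof (cases "x0 = L \<and> y0 < h L")
    case True
    \<comment> \<open>At most half the distance to the corner above: even if the graph varies by
      \<open>e'\<close> near \<open>L\<close>, the rectangle stays below it.\<close>
    define e' where "e' = min e ((h L - y0)/2)"
    have "e' \<le> (h L - y0)/2" unfolding e'_def by (rule min.cobounded2)
    then have e': "0 < e'" "e' \<le> e" "y0 + e' \<le> h L - e'" using True e by (auto simp: e'_def)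
    obtain d0 where d0: "d0 > 0" "\<And>y. \<bar>y - L\<bar> < d0 \<Longrightarrow> \<bar>h y - h L\<bar> < e'" using h_near[OF e'(1), of L] by blast
    define d where "d = min e (min d0 L)"
    have d: "0 < d" "d \<le> e" "d \<le> d0" "d \<le> L" using e d0 L by (auto simp: d_def)
    have eq: "T \<inter> {z. \<bar>Re z - Re q\<bar> < d \<and> \<bar>Im z - Im q\<bar> < e'} =
        {z. Re z \<in> {L<..<L+d} \<and> (\<lambda>_. max (y0-e') 0) (Re z) < Im z \<and> Im z < y0 + e'}" (is "?l = ?r")
    proof (intro set_eqI iffI)
      fix z assume z: "z \<in> ?l"
      have "L < Re z"
      proof (rule ccontr)
        assume "\<not> L < Re z"
        then have "h (Re z) < Im z" using z by (auto simp: T_def)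
        moreover have "\<bar>h (Re z) - h L\<bar> < e'" using z d True by (intro d0) (auto simp: x0_def)
        moreover have "Im z < y0 + e'" using z by (auto simp: y0_def)
        ultimately show False using e'(3) by linarith
      qed
      moreover have "0 < Im z" using z by (auto simp: T_def)
      ultimately show "z \<in> ?r" using z True by (auto simp: x0_def y0_def)
    next
      fix z assume "z \<in> ?r"
      then show "z \<in> ?l" using True L by (auto simp: x0_def y0_def T_def)
    qed
    have "connected ?l" unfolding eq
      by (rule connected_subgraph_strip[of _ "max (y0-e') 0"]) (use e' q0 in \<open>auto simp: is_interval_oo\<close>)
    then show ?thesis using d(1,2) e'(1,2) by blast
  next
    case False
    define e' where "e' = e"
    obtain d where d: "0 < d" "d \<le> e" "\<And>x. \<bar>x - x0\<bar> < d \<Longrightarrow> x \<le> L \<Longrightarrow> h x \<le> y0 + e/2"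
    proof (cases "x0 > L")
      case True
      show thesis by (rule that[of "min e (x0 - L)"]) (use True e in auto)
    next
      case nL: False
      have hx: "h x0 \<le> y0" using nL False q by (force simp: Tb_def x0_def y0_def)
      obtain d0 where d0: "d0 > 0" "\<And>y. \<bar>y - x0\<bar> < d0 \<Longrightarrow> \<bar>h y - h x0\<bar> < e/2"
        using h_near[of "e/2" x0] e by (metis half_gt_zero)
      show thesis
      proof (rule that[of "min e d0"])
        show "h x \<le> y0 + e/2" if "\<bar>x - x0\<bar> < min e d0" for x
        proof -
          have "\<bar>h x - h x0\<bar> < e/2" using d0(2)[of x] that by simp
          then show ?thesis using hx by linarith
        qed
      qed (use e d0 in auto)
    qed
    define I where "I = {max 0 (x0-d)<..<x0+d}"
    \<comment> \<open>The floor is the graph up to \<open>L\<close> and 0 beyond; the maximum with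
      \<open>y0 - e\<close> takes the lower side of the rectangle into account.\<close>
    define G where "G x = max (y0 - e) (if x > L then 0 else h x)" for x
    have eq: "T \<inter> {z. \<bar>Re z - Re q\<bar> < d \<and> \<bar>Im z - Im q\<bar> < e} =
        {z. Re z \<in> I \<and> G (Re z) < Im z \<and> Im z < y0 + e}" (is "?l = ?r")
    proof (intro set_eqI iffI)
      fix z assume z: "z \<in> ?l"
      then show "z \<in> ?r" by (auto simp: I_def G_def T_def x0_def y0_def)
    next
      fix z assume z: "z \<in> ?r"
      have "0 < h (Re z)" by (rule hpos)
      then show "z \<in> ?l" using z by (auto simp: I_def G_def T_def x0_def y0_def split: if_splits)
    qed
    have "connected ?l" unfolding eq
    proof (rule connected_subgraph_strip[of _ "y0 + e/2"])
      show "is_interval I" by (simp add: I_def is_interval_oo)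
      show "G x \<le> y0 + e/2" if "x \<in> I" for x using d(3)[of x] that e q0 by (auto simp: I_def G_def)
    qed (use e in simp)
    then show ?thesis using d(1,2) e order_refl by blast
  qed
qed

text \<open>\<open>no_constant_boundary_arc\<close> applies to the region between the boundary piece
  and a horizontal line above it. The barrier, a cosine times a hyperbolic sine, vanishes on the two
  vertical sides and on the top. The two admissible choices of \<open>G\<close> are the graph over
  \<open>[0, L]\<close> and the real axis beyond \<open>L\<close>.\<close>

lemma no_graph_piece:
  assumes F: "F holomorphic_on T" "\<And>z. z \<in> T \<Longrightarrow> norm (F z) < 1" "norm \<zeta> = 1"
    and A: "\<And>z. z \<in> A \<Longrightarrow> (F \<longlongrightarrow> \<zeta>) (at z within T)"
    and x: "0 \<le> x1" "x1 < x2"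
    and G: "continuous_on UNIV G" "(G = h \<and> x2 \<le> L) \<or> (G = (\<lambda>_. 0) \<and> L \<le> x1)"
    and GA: "\<And>x. x1 \<le> x \<Longrightarrow> x \<le> x2 \<Longrightarrow> Complex x (G x) \<in> A"
  shows False
proof -
  have "continuous_on {x1..x2} G" using G(1) continuous_on_subset by blast
  then have "bounded (G ` {x1..x2})" by (intro compact_imp_bounded compact_continuous_image) auto
  then obtain M where "\<forall>y\<in>G ` {x1..x2}. norm y \<le> M" unfolding bounded_iff by blast
  then have M: "G x \<le> M" if "x1 \<le> x" "x \<le> x2" for x using that by force
  define c where "c = M + 1"
  define S where "S = {z. Re z \<in> {x1<..<x2} \<and> G (Re z) < Im z \<and> Im z < c}"
  have contG: "continuous_on UNIV (\<lambda>z. G (Re z))"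
    by (rule continuous_on_compose2[OF G(1)]) (auto intro: continuous_on_Re continuous_on_id)
  have S1: "S = {z. x1 < Re z} \<inter> {z. Re z < x2} \<inter> {z. G (Re z) < Im z} \<inter> {z. Im z < c}" by (auto simp: S_def)
  have oS: "open S" unfolding S1
    by (intro open_Int open_halfspace_Re_gt open_halfspace_Re_lt open_halfspace_Im_lt
         open_Collect_less contG continuous_on_Im continuous_on_id)
  have cS: "connected S" unfolding S_def
    by (rule connected_subgraph_strip[of _ M]) (use M in \<open>auto simp: is_interval_oo c_def\<close>)
  have G0: "G x \<ge> 0" for x using G(2) hpos[of x] by (auto simp: less_imp_le)
  have ST: "S \<subseteq> T"
  proof
    fix z assume z: "z \<in> S"
    then have "Im z > 0" using G0[of "Re z"] by (auto simp: S_def)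
    then show "z \<in> T" using z G(2) x by (auto simp: S_def T_def)
  qed
  have clS: "closure S \<subseteq> {z. x1 \<le> Re z \<and> Re z \<le> x2 \<and> G (Re z) \<le> Im z \<and> Im z \<le> c}" (is "_ \<subseteq> ?C")
  proof (rule closure_minimal)
    have "?C = {z. x1 \<le> Re z} \<inter> {z. Re z \<le> x2} \<inter> {z. G (Re z) \<le> Im z} \<inter> {z. Im z \<le> c}" by auto
    then show "closed ?C"
      by (simp add: closed_Int closed_halfspace_Re_ge closed_halfspace_Re_le closed_halfspace_Im_le
            closed_Collect_le contG continuous_on_Im)
  qed (auto simp: S_def)
  have bS: "bounded S"
  proof -
    have "S \<subseteq> cbox (Complex x1 0) (Complex x2 c)" using G0 by (fastforce simp: S_def in_cbox_complex_iff intro: less_imp_le order_trans)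
    then show ?thesis using bounded_cbox bounded_subset by blast
  qed
  define k where "k = pi / (x2 - x1)"
  have k: "k > 0" using x by (simp add: k_def)
  define xm where "xm = (x1 + x2)/2"
  define B where "B z = \<i> * sin (of_real k * (z - Complex xm c))" for z
  have ReB: "Re (B z) = cos (k * (Re z - xm)) * sinh (k * (c - Im z))" for z
  proof -
    have "of_real k * (z - Complex xm c) = Complex (k * (Re z - xm)) (- (k * (c - Im z)))"
      by (simp add: complex_eq_iff algebra_simps)
    then show ?thesis unfolding B_def by (simp only: Re_sin_barrier)
  qed
  have kx: "k * (x2 - xm) = pi/2" "k * (x1 - xm) = - (pi/2)" using x by (auto simp: k_def xm_def field_simps)
  define s where "s = Complex xm (M + 1/2)"
  show False
  proof (rule no_constant_boundary_arc[OF oS cS bS holomorphic_on_subset[OF F(1) ST] _ F(3), of A B s])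
    show "norm (F z) < 1" if "z \<in> S" for z using that ST F(2) by blast
    show "(F \<longlongrightarrow> \<zeta>) (at z within S)" if "z \<in> A" for z using tendsto_within_subset[OF A[OF that] ST] .
    show "B holomorphic_on UNIV" unfolding B_def
      by (intro holomorphic_on_mult holomorphic_on_sin' holomorphic_on_diff holomorphic_on_const holomorphic_on_ident)
    show "s \<in> S" using M[of xm] x by (auto simp: s_def S_def xm_def c_def)
    show "Re (B s) > 0" unfolding ReB using k by (simp add: s_def c_def)
    fix z assume z: "z \<in> frontier S" "z \<notin> A"
    then have zc: "z \<in> closure S" "z \<notin> S" using oS by (auto simp: frontier_def interior_open)
    then have zz: "x1 \<le> Re z" "Re z \<le> x2" "G (Re z) \<le> Im z" "Im z \<le> c" using clS by auto
    have "Im z \<noteq> G (Re z)" using GA[OF zz(1,2)] z(2) by (metis complex_surj)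
    then consider "Re z = x1" | "Re z = x2" | "Im z = c" using zc(2) zz by (force simp: S_def)
    then have "Re (B z) = 0" by cases (simp_all add: ReB kx)
    then show "Re (B z) \<le> 0" by simp
  qed
qed

text \<open>The argument of \<open>no_graph_piece\<close> in a rectangle to the right of the
  vertical piece. On the imaginary axis the strict inequality \<open>h 0 < y1\<close> leaves room
  for a rectangle of positive width above the graph.\<close>

lemma no_vertical_piece:
  assumes F: "F holomorphic_on T" "\<And>z. z \<in> T \<Longrightarrow> norm (F z) < 1" "norm \<zeta> = 1"
    and A: "\<And>z. z \<in> A \<Longrightarrow> (F \<longlongrightarrow> \<zeta>) (at z within T)"
    and y: "y1 < y2" "(x0 = 0 \<and> h 0 < y1) \<or> (x0 = L \<and> 0 \<le> y1)"
    and yA: "\<And>y. y1 \<le> y \<Longrightarrow> y \<le> y2 \<Longrightarrow> Complex x0 y \<in> A"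
  shows False
proof -
  obtain d where d: "d > 0" "\<And>x. x0 < x \<Longrightarrow> x < x0 + d \<Longrightarrow> 0 < x \<and> (L < x \<or> h x < y1)"
  proof (cases "x0 = L")
    case True
    show thesis by (rule that[of 1]) (use True L in auto)
  next
    case False
    then have h0: "x0 = 0" "h 0 < y1" using y(2) by auto
    obtain d where d: "d > 0" "\<And>y. \<bar>y - 0\<bar> < d \<Longrightarrow> \<bar>h y - h 0\<bar> < y1 - h 0"
      using h_near[of "y1 - h 0" 0] h0 by (metis diff_gt_0_iff_gt)
    show thesis
    proof (rule that[of d])
      fix x assume "x0 < x" "x < x0 + d"
      then have x: "0 < x" "\<bar>h x - h 0\<bar> < y1 - h 0" using d(2)[of x] h0 by auto
      then have "h x < y1" by linarith
      then show "0 < x \<and> (L < x \<or> h x < y1)" using x by blast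
    qed (use d in auto)
  qed
  have y10: "0 \<le> y1" using y(2) hpos[of 0] by auto
  define S where "S = box (Complex x0 y1) (Complex (x0+d) y2)"
  have inS: "z \<in> S \<longleftrightarrow> x0 < Re z \<and> Re z < x0 + d \<and> y1 < Im z \<and> Im z < y2" for z
    by (auto simp: S_def in_box_complex_iff)
  have S: "open S" "connected S" "bounded S" by (auto simp: S_def open_box bounded_box convex_connected convex_box)
  have ST: "S \<subseteq> T"
  proof
    fix z assume "z \<in> S"
    then show "z \<in> T" using d(2)[of "Re z"] y10 by (auto simp: inS T_def)
  qed
  have clS: "closure S \<subseteq> cbox (Complex x0 y1) (Complex (x0+d) y2)"
    unfolding S_def by (rule closure_minimal[OF box_subset_cbox closed_cbox])
  define k where "k = pi / (y2 - y1)"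
  have k: "k > 0" using y by (simp add: k_def)
  define ym where "ym = (y1 + y2)/2"
  define B where "B z = \<i> * sin (of_real k * \<i> * (z - Complex (x0+d) ym))" for z
  have ReB: "Re (B z) = cos (k * (ym - Im z)) * sinh (k * (x0 + d - Re z))" for z
  proof -
    have "of_real k * \<i> * (z - Complex (x0+d) ym) = Complex (k * (ym - Im z)) (- (k * (x0 + d - Re z)))"
      by (simp add: complex_eq_iff algebra_simps)
    then show ?thesis unfolding B_def by (simp only: Re_sin_barrier)
  qed
  have kx: "k * (ym - y1) = pi/2" "k * (ym - y2) = - (pi/2)" using y by (auto simp: k_def ym_def field_simps)
  define s where "s = Complex (x0 + d/2) ym"
  show False
  proof (rule no_constant_boundary_arc[OF S holomorphic_on_subset[OF F(1) ST] _ F(3), of A B s])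
    show "norm (F z) < 1" if "z \<in> S" for z using that ST F(2) by blast
    show "(F \<longlongrightarrow> \<zeta>) (at z within S)" if "z \<in> A" for z using tendsto_within_subset[OF A[OF that] ST] .
    show "B holomorphic_on UNIV" unfolding B_def
      by (intro holomorphic_on_mult holomorphic_on_sin' holomorphic_on_diff holomorphic_on_const holomorphic_on_ident)
    show "s \<in> S" using y d by (auto simp: s_def inS ym_def)
    show "Re (B s) > 0" unfolding ReB using k d by (simp add: s_def)
    fix z assume z: "z \<in> frontier S" "z \<notin> A"
    then have zc: "z \<in> closure S" "z \<notin> S" using S by (auto simp: frontier_def interior_open)
    then have zz: "x0 \<le> Re z" "Re z \<le> x0 + d" "y1 \<le> Im z" "Im z \<le> y2" using clS by (auto simp: in_cbox_complex_iff)
    have "Re z \<noteq> x0" using yA[OF zz(3,4)] z(2) by (metis complex_surj)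
    then consider "Im z = y1" | "Im z = y2" | "Re z = x0 + d" using zc(2) zz by (force simp: inS)
    then have "Re (B z) = 0" by cases (simp_all add: ReB kx)
    then show "Re (B z) \<le> 0" by simp
  qed
qed

lemma isCont_\<tau>: "z \<in> Tb \<Longrightarrow> isCont \<tau> z"
  using holomorphic_on_imp_continuous_on[OF hol_\<tau>] Tb_ne[of z]
  by (simp add: continuous_on_eq_continuous_at add_eq_0_iff2 open_Compl)

lemma Tb_T_cases:
  assumes "z \<in> Tb" "z \<notin> T"
  obtains "Re z = 0" "h 0 \<le> Im z" | "0 < Re z" "Re z < L" "Im z = h (Re z)"
    | "Re z = L" "0 \<le> Im z" "Im z \<le> h L" | "L < Re z" "Im z = 0"
proof -
  have *: "0 \<le> Re z" "0 \<le> Im z" "L \<le> Re z \<or> h (Re z) \<le> Im z"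
    and n: "0 < Re z \<Longrightarrow> 0 < Im z \<Longrightarrow> L < Re z \<or> h (Re z) < Im z \<Longrightarrow> False"
    using assms by (auto simp: T_def Tb_def)
  consider "Re z = 0" | "0 < Re z" "Re z < L" | "Re z = L" | "L < Re z" using *(1) by linarith
  then show thesis
  proof cases
    case 1 then show thesis using that(1) * L by auto
  next
    case 2 then show thesis using that(2) * n hpos[of "Re z"] by force
  next
    case 3 then show thesis using that(3) * n hpos[of L] L by force
  next
    case 4 then show thesis using that(4) * n L by force
  qed
qed

text \<open>A boundary continuum with two points contains an arc of one of the boundary pieces,
  where \<open>no_graph_piece\<close> or \<open>no_vertical_piece\<close> forbids constancy. If the
  continuum avoids infinity, its projection to the real axis is either a nondegenerate interval or a
  point; if it contains infinity, the circles \<open>\<bar>z + 1\<bar> = \<rho>\<close> play the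
  part of the projection.\<close>

lemma no_constant_continuum:
  assumes f: "f holomorphic_on D" "\<And>z. z \<in> D \<Longrightarrow> norm (f z) < 1" "norm \<zeta> = 1"
    and K: "K \<subseteq> frontier D" "connected K" "closed K" "p \<in> K" "q \<in> K" "p \<noteq> q"
    and lim: "\<And>x. x \<in> K \<Longrightarrow> (f \<longlongrightarrow> \<zeta>) (at x within D)"
  shows False
proof -
  define A where "A = {z \<in> Tb - T. \<tau> z \<in> K}"
  define F where "F = f \<circ> \<tau>"
  have F: "F holomorphic_on T" unfolding F_def
  proof (rule holomorphic_on_compose_gen[OF _ f(1)])
    show "\<tau> holomorphic_on T" using Tb_ne T_subset by (intro holomorphic_on_subset[OF hol_\<tau>]) force
  qed (auto simp: D_def)
  have F1: "norm (F z) < 1" if "z \<in> T" for z using that f(2) by (auto simp: F_def D_def)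
  have A: "(F \<longlongrightarrow> \<zeta>) (at z within T)" if z: "z \<in> A" for z
  proof -
    have zz: "z \<in> Tb" "z \<notin> T" "\<tau> z \<in> K" using z by (auto simp: A_def)
    have "(\<tau> \<longlongrightarrow> \<tau> z) (at z within T)"
      by (rule tendsto_within_subset[OF isCont_\<tau>[OF zz(1), unfolded isCont_def] subset_UNIV])
    moreover have "\<forall>\<^sub>F w in at z within T. \<tau> w \<in> D \<and> \<tau> w \<noteq> \<tau> z"
    proof -
      have "\<tau> w \<noteq> \<tau> z" if "w \<in> T" for w using that zz(2) \<sigma>\<tau> by metis
      then show ?thesis unfolding eventually_at_filter by (auto simp: D_def intro!: always_eventually)
    qed
    ultimately have "filterlim \<tau> (at (\<tau> z) within D) (at z within T)" by (simp add: filterlim_at)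
    then show ?thesis unfolding F_def o_def by (rule filterlim_compose[OF lim[OF zz(3)]])
  qed
  have KA: "\<sigma> x \<in> A" if "x \<in> K" "x \<noteq> 0" for x
    using that frontier_D K(1) unfolding A_def by auto
  have contG0: "continuous_on UNIV (\<lambda>x::real. 0::real)" by simp
  show False
  proof (cases "0 \<in> K")
    case False
    define K' where "K' = \<sigma> ` K"
    have K'A: "K' \<subseteq> A" using KA False by (auto simp: K'_def)
    have "continuous_on K \<sigma>"
      using False by (intro holomorphic_on_imp_continuous_on holomorphic_on_subset[OF hol_\<sigma>]) auto
    then have cK': "connected K'" unfolding K'_def using K(2) by (rule connected_continuous_image)
    have cRe: "connected (Re ` K')" "connected (Im ` K')"
      using cK' by (auto intro!: connected_continuous_image continuous_on_Re continuous_on_Im continuous_on_id)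
    define p' where "p' = \<sigma> p"
    define q' where "q' = \<sigma> q"
    have pq: "p' \<in> K'" "q' \<in> K'" "p' \<noteq> q'" using K(4-6) \<tau>\<sigma> unfolding K'_def p'_def q'_def by (auto, metis)
    show False
    proof (cases "\<exists>z1\<in>K'. \<exists>z2\<in>K'. Re z1 < Re z2")
      case True
      then obtain z1 z2 where z: "z1 \<in> K'" "z2 \<in> K'" "Re z1 < Re z2" by blast
      have at: "\<exists>z\<in>A. Re z = x" if "Re z1 \<le> x" "x \<le> Re z2" for x
      proof -
        have "x \<in> Re ` K'" using connectedD_interval[OF cRe(1), of "Re z1" "Re z2" x] z that by blast
        then show ?thesis using K'A by blast
      qed
      have z1: "0 \<le> Re z1" using z(1) K'A by (auto simp: A_def Tb_def)
      show False
      proof (cases "Re z1 < L")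
        case True
        \<comment> \<open>Thirds keep the interval strictly between \<open>Re z1\<close> and
          \<open>min L (Re z2)\<close>; over such abscissae the boundary consists of the graph
          alone.\<close>
        define x1 where "x1 = (2 * Re z1 + min L (Re z2)) / 3"
        define x2 where "x2 = (Re z1 + 2 * min L (Re z2)) / 3"
        have x: "Re z1 < x1" "x1 < x2" "x2 < L" "x2 < Re z2" using True z(3) by (auto simp: x1_def x2_def min_def)
        have "Complex x (h x) \<in> A" if "x1 \<le> x" "x \<le> x2" for x
        proof -
          have "Re z1 \<le> x" "x \<le> Re z2" using x that by linarith+
          then obtain w where w: "w \<in> A" "Re w = x" using at by blast
          then have "w \<in> Tb" "w \<notin> T" by (auto simp: A_def)
          then have "Im w = h x" by (rule Tb_T_cases) (use w x that z1 in auto)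
          then have "w = Complex x (h x)" using w by (simp add: complex_eq_iff)
          then show ?thesis using w by simp
        qed
        then show False using no_graph_piece[OF F F1 f(3) A, of A x1 x2 h] x z1 conth by auto
      next
        case False
        define x1 where "x1 = (2 * Re z1 + Re z2) / 3"
        have x: "Re z1 < x1" "x1 < Re z2" using z(3) by (auto simp: x1_def)
        have "Complex x 0 \<in> A" if "x1 \<le> x" "x \<le> Re z2" for x
        proof -
          have "Re z1 \<le> x" "x \<le> Re z2" using x that by linarith+
          then obtain w where w: "w \<in> A" "Re w = x" using at by blast
          then have "w \<in> Tb" "w \<notin> T" by (auto simp: A_def)
          then have "Im w = 0" by (rule Tb_T_cases) (use w x that z1 False L in auto)
          then have "w = Complex x 0" using w by (simp add: complex_eq_iff)
          then show ?thesis using w by simp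
        qed
        then show False using no_graph_piece[OF F F1 f(3) A, of A x1 "Re z2" "\<lambda>_. 0"] x z1 False by auto
      qed
    next
      case False
      define x0 where "x0 = Re p'"
      have x0: "Re z = x0" if "z \<in> K'" for z
        using False that pq(1) unfolding x0_def by (metis linorder_neqE_linordered_idom)
      have imne: "Im p' \<noteq> Im q'" using pq x0[of p'] x0[of q'] by (auto simp: complex_eq_iff)
      define y1 where "y1 = min (Im p') (Im q')"
      define y2 where "y2 = max (Im p') (Im q')"
      have y: "y1 < y2" using imne by (auto simp: y1_def y2_def)
      have yi: "y1 \<in> Im ` K'" "y2 \<in> Im ` K'" using pq by (auto simp: y1_def y2_def min_def max_def)
      have yA: "Complex x0 y \<in> A" if "y1 \<le> y" "y \<le> y2" for y
      proof -
        have "y \<in> Im ` K'" using connectedD_interval[OF cRe(2) yi that] .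
        then obtain w where w: "w \<in> K'" "y = Im w" by blast
        then have "w = Complex x0 y" using x0 by (auto simp: complex_eq_iff)
        then show ?thesis using w K'A by auto
      qed
      \<comment> \<open>Only the upper half of the segment is used, which gives the strict
        inequality \<open>h 0 < ym\<close> on the imaginary axis.\<close>
      define ym where "ym = (y1+y2)/2"
      have ym: "y1 < ym" "ym < y2" using y by (auto simp: ym_def)
      have a1: "Complex x0 y1 \<in> Tb - T" "Complex x0 y2 \<in> Tb - T" using yA[of y1] yA[of y2] y by (auto simp: A_def)
      have "(x0 = 0 \<and> h 0 < ym) \<or> (x0 = L \<and> 0 \<le> ym)"
      proof -
        have "Complex x0 y1 \<in> Tb" "Complex x0 y1 \<notin> T" using a1 by auto
        then show ?thesis
        proof (rule Tb_T_cases)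
          assume *: "0 < Re (Complex x0 y1)" "Re (Complex x0 y1) < L" "Im (Complex x0 y1) = h (Re (Complex x0 y1))"
          have "Complex x0 y2 \<in> Tb" "Complex x0 y2 \<notin> T" using a1 by auto
          then have False by (rule Tb_T_cases) (use * y in auto)
          then show ?thesis ..
        next
          assume *: "L < Re (Complex x0 y1)" "Im (Complex x0 y1) = 0"
          have "Complex x0 y2 \<in> Tb" "Complex x0 y2 \<notin> T" using a1 by auto
          then have False by (rule Tb_T_cases) (use * y L in auto)
          then show ?thesis ..
        qed (use ym in auto)
      qed
      then show False using no_vertical_piece[OF F F1 f(3) A, of A ym y2 x0] ym yA by auto
    qed
  next
    case True
    obtain q0 where q0: "q0 \<in> K" "q0 \<noteq> 0" using K(4-6) by metis
    obtain M where M: "M > 0" "\<And>x. 0 \<le> x \<Longrightarrow> x \<le> L \<Longrightarrow> h x < M" using bounded_h by blast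
    define R1 where "R1 = L + M + 2 + 1 / norm q0"
    define R2 where "R2 = R1 + 1"
    have nq: "0 < 1 / norm q0" using q0 by simp
    have R1: "R1 > L + M + 2" "R1 > 1 / norm q0" using nq M(1) L by (auto simp: R1_def)
    \<comment> \<open>\<open>K\<close> is connected and contains 0 and \<open>q0\<close>, so it
      meets every small circle about 0, which means \<open>\<bar>z + 1\<bar> = \<rho>\<close> for
      every large \<open>\<rho>\<close>. From \<open>R1\<close> on these circles meet the boundary
      of \<open>T\<close> on the two axes only.\<close>
    have ex: "Complex (\<rho> - 1) 0 \<in> A \<or> Complex 0 (sqrt (\<rho>\<^sup>2 - 1)) \<in> A" if \<rho>: "R1 \<le> \<rho>" for \<rho>
    proof -
      have "connected (norm ` K)" using K(2) by (intro connected_continuous_image continuous_on_norm continuous_on_id)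
      moreover have "0 \<in> norm ` K" using True by force
      moreover have "norm q0 \<in> norm ` K" using q0 by blast
      moreover have rpos: "\<rho> > 0" using \<rho> R1 L M(1) by linarith
      moreover have "1 / norm q0 \<le> \<rho>" using \<rho> R1(2) by linarith
      then have "1/\<rho> \<le> norm q0" using rpos q0(2) by (simp add: field_simps)
      ultimately have "1/\<rho> \<in> norm ` K" using connectedD_interval[of "norm ` K" 0 "norm q0" "1/\<rho>"] by auto
      then obtain x where x: "x \<in> K" "norm x = 1/\<rho>" by (metis imageE)
      then have "x \<noteq> 0" using rpos by auto
      define z where "z = \<sigma> x"
      have zA: "z \<in> A" unfolding z_def using KA x \<open>x \<noteq> 0\<close> by blast
      have "norm (\<tau> z) = 1/\<rho>" using x by (simp add: z_def)
      then have nz: "norm (z + 1) = \<rho>" unfolding norm_\<tau>_eq using rpos by (simp add: field_simps)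
      have "z \<in> Tb" "z \<notin> T" using zA by (auto simp: A_def)
      then show ?thesis
      proof (rule Tb_T_cases)
        assume z: "Re z = 0" "h 0 \<le> Im z"
        have "\<rho>\<^sup>2 = 1 + (Im z)\<^sup>2" using nz z unfolding cmod_power2[of "z+1", unfolded nz] by simp
        moreover have "Im z \<ge> 0" using z hpos[of 0] by linarith
        ultimately have "Im z = sqrt (\<rho>\<^sup>2 - 1)" by simp
        then have "z = Complex 0 (sqrt (\<rho>\<^sup>2 - 1))" using z by (simp add: complex_eq_iff)
        then show ?thesis using zA by simp
      next
        assume z: "L < Re z" "Im z = 0"
        then have "z + 1 = of_real (Re z + 1)" by (simp add: complex_eq_iff)
        then have "norm (z + 1) = \<bar>Re z + 1\<bar>" by (simp only: norm_of_real)
        then have "Re z = \<rho> - 1" using nz z L by simp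
        then have "z = Complex (\<rho> - 1) 0" using z by (simp add: complex_eq_iff)
        then show ?thesis using zA by simp
      next
        assume z: "0 < Re z" "Re z < L" "Im z = h (Re z)"
        have "\<rho> \<le> \<bar>Re z + 1\<bar> + \<bar>Im z\<bar>" using cmod_le[of "z+1"] nz by simp
        then have False using z M(2)[of "Re z"] hpos[of "Re z"] \<rho> R1(1) by auto
        then show ?thesis ..
      next
        assume z: "Re z = L" "0 \<le> Im z" "Im z \<le> h L"
        have "\<rho> \<le> \<bar>Re z + 1\<bar> + \<bar>Im z\<bar>" using cmod_le[of "z+1"] nz by simp
        then have False using z M(2)[of L] \<rho> R1(1) L by auto
        then show ?thesis ..
      qed
    qed
    show False
    proof (cases "\<forall>\<rho>\<in>{R1..R2}. Complex (\<rho> - 1) 0 \<in> A")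
      case True
      have "Complex x 0 \<in> A" if "R1 - 1 \<le> x" "x \<le> R2 - 1" for x
        using True[rule_format, of "x+1"] that by auto
      then show False
        using no_graph_piece[OF F F1 f(3) A, of A "R1 - 1" "R2 - 1" "\<lambda>_. 0"] R1 M(1) L by (auto simp: R2_def)
    next
      case False
      then obtain t where t: "t \<in> {R1..R2}" "Complex (t - 1) 0 \<notin> A" by blast
      have inTb: "Complex (\<rho> - 1) 0 \<in> Tb - T" if "R1 \<le> \<rho>" for \<rho>
        using that R1 L M(1) by (auto simp: Tb_def T_def)
      have tK: "\<tau> (Complex (t - 1) 0) \<notin> K" using t inTb[of t] by (auto simp: A_def)
      have "isCont (\<lambda>\<rho>. \<tau> (Complex (\<rho> - 1) 0)) t"
      proof (rule isCont_o2[where g = \<tau>])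
        have "(\<lambda>\<rho>::real. Complex (\<rho> - 1) 0) = (\<lambda>\<rho>. of_real \<rho> - 1)"
          by (simp add: fun_eq_iff complex_eq_iff)
        then show "isCont (\<lambda>\<rho>. Complex (\<rho> - 1) 0) t"
          by (simp add: continuous_intros)
        show "isCont \<tau> (Complex (t - 1) 0)" using inTb[of t] t by (intro isCont_\<tau>) auto
      qed
      then have "\<forall>\<^sub>F \<rho> in at t. \<tau> (Complex (\<rho> - 1) 0) \<in> - K"
        using tK K(3) unfolding isCont_def by (intro topological_tendstoD) auto
      then obtain d where d0: "d > 0" "\<And>\<rho>. \<rho> \<noteq> t \<Longrightarrow> dist \<rho> t < d \<Longrightarrow> \<tau> (Complex (\<rho> - 1) 0) \<notin> K"
        unfolding eventually_at by auto
      then have d: "d > 0" "\<And>\<rho>. dist \<rho> t < d \<Longrightarrow> \<tau> (Complex (\<rho> - 1) 0) \<notin> K"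
        using tK by metis+
      \<comment> \<open>As \<open>K\<close> is closed, a missing point of the real axis means a
        whole interval of radii for which the real axis contributes nothing; there the imaginary
        axis must supply the point.\<close>
      obtain u v where uv: "R1 \<le> u" "u < v" "\<And>\<rho>. u \<le> \<rho> \<Longrightarrow> \<rho> \<le> v \<Longrightarrow> dist \<rho> t < d"
        by (rule that[of t "t + d/2"]) (use t d in \<open>auto simp: dist_real_def\<close>)
      have vA: "Complex 0 (sqrt (\<rho>\<^sup>2 - 1)) \<in> A" if "u \<le> \<rho>" "\<rho> \<le> v" for \<rho>
        using ex[of \<rho>] d(2)[OF uv(3)[OF that]] that uv by (auto simp: A_def)
      have u1: "u > M + 1" "u > 1" using uv R1 M(1) L by auto
      have yA: "Complex 0 y \<in> A" if y: "sqrt (u\<^sup>2 - 1) \<le> y" "y \<le> sqrt (v\<^sup>2 - 1)" for y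
      proof -
        have "1 \<le> u\<^sup>2" using u1 by (simp add: one_le_power)
        then have "0 \<le> sqrt (u\<^sup>2 - 1)" by simp
        then have y0: "0 \<le> y" using y(1) by linarith
        define \<rho> where "\<rho> = sqrt (y\<^sup>2 + 1)"
        have \<rho>2: "\<rho>\<^sup>2 = y\<^sup>2 + 1" "\<rho> \<ge> 0" by (simp_all add: \<rho>_def add_nonneg_nonneg)
        have "u\<^sup>2 - 1 \<le> y\<^sup>2" using y(1) by (rule sqrt_le_D)
        then have "u\<^sup>2 \<le> \<rho>\<^sup>2" using \<rho>2 by simp
        then have "u \<le> \<rho>" using \<rho>2(2) by (rule power2_le_imp_le)
        have "y\<^sup>2 \<le> v\<^sup>2 - 1"
        proof -
          have "y\<^sup>2 \<le> (sqrt (v\<^sup>2 - 1))\<^sup>2" using y(2) y0 by (intro power_mono) auto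
          moreover have "1 \<le> v\<^sup>2" using u1 uv by (simp add: one_le_power)
          ultimately show ?thesis by simp
        qed
        then have "\<rho>\<^sup>2 \<le> v\<^sup>2" using \<rho>2 by simp
        moreover have "0 \<le> v" using u1 uv by linarith
        ultimately have "\<rho> \<le> v" by (rule power2_le_imp_le)
        with \<open>u \<le> \<rho>\<close> have "Complex 0 (sqrt (\<rho>\<^sup>2 - 1)) \<in> A" by (rule vA)
        then show ?thesis using \<rho>2 y0 by simp
      qed
      have "M < sqrt (u\<^sup>2 - 1)"
      proof (rule real_less_rsqrt)
        have "M\<^sup>2 + 1 < (M+1)\<^sup>2" using M(1) by (simp add: power2_sum)
        also have "\<dots> < u\<^sup>2" using u1 M(1) by (intro power_strict_mono) auto
        finally show "M\<^sup>2 < u\<^sup>2 - 1" by simp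
      qed
      then have "h 0 < sqrt (u\<^sup>2 - 1)" using M(2)[of 0] L by simp
      moreover have "sqrt (u\<^sup>2 - 1) < sqrt (v\<^sup>2 - 1)" using uv u1 by (simp add: power_strict_mono)
      ultimately show False
        using no_vertical_piece[OF F F1 f(3) A, of A "sqrt (u\<^sup>2 - 1)" "sqrt (v\<^sup>2 - 1)" 0] yA by auto
    qed
  qed
qed

lemma disc_homeomorphism:
  obtains F where "continuous_on (closure D) F" "inj_on F (closure D)" "F ` closure D = cball 0 1"
    "F holomorphic_on D" "F ` D = ball 0 1"
proof -
  have "simply_connected T" "open T" by (fact simply_connected_T open_T)+
  moreover have "T \<noteq> UNIV"
  proof -
    have "(0::complex) \<notin> T" by (simp add: T_def)
    then show ?thesis by blast
  qed
  ultimately obtain f0 g0 where fg: "f0 holomorphic_on T" "g0 holomorphic_on ball 0 1"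
      "\<And>z. z \<in> T \<Longrightarrow> f0 z \<in> ball 0 1 \<and> g0 (f0 z) = z"
      "\<And>z. z \<in> ball 0 1 \<Longrightarrow> g0 z \<in> T \<and> f0 (g0 z) = z"
    using T_nonempty Riemann_mapping_theorem[of T] by metis
  interpret disc_map D "f0 \<circ> \<sigma>" "\<tau> \<circ> g0"
  proof
    show "open D" "bounded D" by (fact open_D bounded_D)+
    have "0 \<notin> D" by (simp add: D_eq)
    then show "(f0 \<circ> \<sigma>) holomorphic_on D"
      by (intro holomorphic_on_compose_gen[OF holomorphic_on_subset[OF hol_\<sigma>] fg(1)]) (auto simp: D_eq)
    show "(f0 \<circ> \<sigma>) z \<in> ball 0 1" if "z \<in> D" for z using fg(3) that by (auto simp: D_eq)
    have "-1 \<notin> T" by (simp add: T_def)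
    then show "(\<tau> \<circ> g0) holomorphic_on ball 0 1"
      using fg(4) by (intro holomorphic_on_compose_gen[OF fg(2) hol_\<tau>]) auto
    show "(\<tau> \<circ> g0) w \<in> D" if "w \<in> ball 0 1" for w using fg(4)[OF that] by (auto simp: D_def)
    show "(\<tau> \<circ> g0) ((f0 \<circ> \<sigma>) z) = z" if "z \<in> D" for z using fg(3)[of "\<sigma> z"] that by (auto simp: D_eq)
    show "(f0 \<circ> \<sigma>) ((\<tau> \<circ> g0) w) = w" if "w \<in> ball 0 1" for w using fg(4)[OF that] by simp
  qed
  obtain F where F: "continuous_on (closure D) F" "inj_on F (closure D)" "F ` closure D = cball 0 1"
    "\<And>z. z \<in> D \<Longrightarrow> F z = (f0 \<circ> \<sigma>) z"
  proof (rule boundary_homeomorphism)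
    fix p assume "p \<in> frontier D"
    then have "p = 0 \<or> (\<exists>q\<in>Tb-T. p = \<tau> q)" using frontier_D by auto
    then show "locally_connected_at D p" using lc_at_0 lc_at_\<tau> locally_connected_at_T by auto
  next
    fix K \<zeta> p q
    assume "K \<subseteq> frontier D" "connected K" "closed K" "p \<in> K" "q \<in> K" "p \<noteq> q" "norm \<zeta> = 1"
      "\<And>x. x \<in> K \<Longrightarrow> ((f0 \<circ> \<sigma>) \<longlongrightarrow> \<zeta>) (at x within D)"
    then show False using no_constant_continuum[of "f0 \<circ> \<sigma>" \<zeta> K p q] f by auto
  qed blast
  have "F ` D = ball 0 1"
  proof
    show "F ` D \<subseteq> ball 0 1" using F(4) f(2) by auto
    show "ball 0 1 \<subseteq> F ` D" using F(4) g(2) fg by (metis image_eqI subsetI)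
  qed
  moreover have "F holomorphic_on D" using holomorphic_cong[of D D F] F(4) f(1) by blast
  ultimately show thesis using that[OF F(1-3)] by blast
qed

end

section \<open>The half-plane map\<close>

text \<open>Preservation of orientation at the boundary. Schwarz reflection makes \<open>u\<close>
  analytic across the interval. The real part of its derivative is nonpositive there because
  \<open>Re u\<close> decreases along the interval, and nonnegative because \<open>Im u\<close> is 0
  on the interval and positive above it; so \<open>Re u\<close> would be constant.\<close>

lemma halfplane_boundary_increasing:
  fixes u :: "complex \<Rightarrow> complex"
  assumes x: "x1 < x2" and c: "\<And>z. x1 < Re z \<Longrightarrow> Re z < x2 \<Longrightarrow> 0 \<le> Im z \<Longrightarrow> z \<in> C"
    and o: "\<And>z. x1 < Re z \<Longrightarrow> Re z < x2 \<Longrightarrow> 0 < Im z \<Longrightarrow> z \<in> W"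
    and u: "continuous_on C u" "u holomorphic_on W" "\<And>z. z \<in> W \<Longrightarrow> Im (u z) > 0"
    and real: "\<And>x. x1 < x \<Longrightarrow> x < x2 \<Longrightarrow> Im (u (of_real x)) = 0"
    and dec: "\<And>x y. x1 < x \<Longrightarrow> x < y \<Longrightarrow> y < x2 \<Longrightarrow> Re (u (of_real y)) < Re (u (of_real x))"
  shows False
proof -
  define p where "p = (x1+x2)/2"
  define r where "r = (x2-x1)/2"
  have r: "r > 0" using x by (simp add: r_def)
  define S where "S = ball (complex_of_real p) r"
  have SR: "x1 < Re z \<and> Re z < x2" if "z \<in> S" for z
  proof -
    have "\<bar>Re (z - of_real p)\<bar> < r" using that abs_Re_le_cmod[of "z - of_real p"] by (simp add: S_def dist_norm norm_minus_commute)
    then show ?thesis by (auto simp: p_def r_def abs_less_iff field_simps)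
  qed
  define g where "g z = (if 0 \<le> Im z then u z else cnj (u (cnj z)))" for z
  have g: "g holomorphic_on S" unfolding g_def
  proof (rule Schwarz_reflection)
    show "open S" by (simp add: S_def)
    show "cnj ` S \<subseteq> S"
    proof clarify
      fix z assume "z \<in> S"
      moreover have "cmod (of_real p - cnj z) = cmod (of_real p - z)"
        by (metis complex_cnj_complex_of_real complex_cnj_diff complex_mod_cnj)
      ultimately show "cnj z \<in> S" by (simp add: S_def dist_norm)
    qed
    show "u holomorphic_on S \<inter> {z. 0 < Im z}" using SR o by (intro holomorphic_on_subset[OF u(2)]) auto
    show "continuous_on (S \<inter> {z. 0 \<le> Im z}) u" using SR c by (intro continuous_on_subset[OF u(1)]) auto
    fix z assume z: "z \<in> S" "z \<in> \<real>"
    then obtain t where t: "z = of_real t" by (auto elim: Reals_cases)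
    have "Im (u z) = 0" unfolding t using real[of t] SR[OF z(1)] t by auto
    then show "u z \<in> \<real>" by (simp add: complex_is_Real_iff)
  qed
  have inS: "of_real t \<in> S" if "x1 < t" "t < x2" for t
    unfolding S_def mem_ball dist_of_real using that by (auto simp: p_def r_def dist_real_def abs_less_iff field_simps)
  have d0: "((\<lambda>t. Re (u (of_real t))) has_real_derivative 0) (at t)" if t: "x1 < t" "t < x2" for t
  proof -
    have gd: "(g has_field_derivative deriv g (of_real t)) (at (of_real t))"
      using g inS[OF t] by (simp add: holomorphic_derivI S_def)
    have 1: "((\<lambda>s. Re (u (of_real s))) has_real_derivative Re (deriv g (of_real t))) (at t)"
    proof -
      have "((\<lambda>s. g (of_real s)) has_vector_derivative deriv g (of_real t)) (at t)"
        using field_vector_diff_chain_at[OF has_vector_derivative_of_real[OF DERIV_ident] gd]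
        by (simp add: o_def)
      then have "((\<lambda>s. Re (g (of_real s))) has_vector_derivative Re (deriv g (of_real t))) (at t)"
        by (rule bounded_linear.has_vector_derivative[OF bounded_linear_Re])
      then show ?thesis by (simp add: g_def has_real_derivative_iff_has_vector_derivative)
    qed
    have 2: "((\<lambda>s. Im (g (of_real t + \<i> * of_real s))) has_real_derivative Re (deriv g (of_real t))) (at 0)"
    proof -
      have "((\<lambda>s. of_real t + \<i> * of_real s) has_vector_derivative \<i>) (at (0::real))"
        by (auto intro!: derivative_eq_intros has_vector_derivative_of_real)
      then have "((\<lambda>s. g (of_real t + \<i> * of_real s)) has_vector_derivative \<i> * deriv g (of_real t)) (at 0)"
        using field_vector_diff_chain_at[of "\<lambda>s. of_real t + \<i> * of_real s" \<i> 0 g "deriv g (of_real t)"] gd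
        by (simp add: o_def)
      then have "((\<lambda>s. Im (g (of_real t + \<i> * of_real s))) has_vector_derivative Im (\<i> * deriv g (of_real t))) (at 0)"
        by (rule bounded_linear.has_vector_derivative[OF bounded_linear_Im])
      then show ?thesis by (simp add: has_real_derivative_iff_has_vector_derivative)
    qed
    have "Re (deriv g (of_real t)) \<le> 0"
    proof (rule ccontr)
      assume "\<not> ?thesis"
      then obtain d where d: "d > 0" "\<And>s. 0 < s \<Longrightarrow> s < d \<Longrightarrow> Re (u (of_real t)) < Re (u (of_real (t + s)))"
        using DERIV_pos_inc_right[OF 1] by auto
      define s where "s = min (d/2) ((x2 - t)/2)"
      have s: "0 < s" "s < d" "t + s < x2" using d t by (auto simp: s_def min_def field_simps)
      then show False using d(2)[of s] dec[of t "t+s"] t by simp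
    qed
    moreover have "Re (deriv g (of_real t)) \<ge> 0"
    proof (rule ccontr)
      assume "\<not> ?thesis"
      then obtain d where d: "d > 0" "\<And>s. 0 < s \<Longrightarrow> s < d \<Longrightarrow> Im (g (of_real t + \<i> * of_real s)) < Im (g (of_real t))"
        using DERIV_neg_dec_right[OF 2] by auto
      have "Im (g (of_real t + \<i> * of_real (d/2))) > 0" using d(1) t by (simp add: g_def) (intro u(3) o, auto)
      moreover have "Im (g (of_real t)) = 0" using real[OF t] by (simp add: g_def)
      ultimately show False using d(2)[of "d/2"] d(1) by simp
    qed
    ultimately show ?thesis using 1 by simp
  qed
  define a where "a = (2*x1+x2)/3"
  define b where "b = (x1+2*x2)/3"
  have ab: "x1 < a" "a < b" "b < x2" using x by (auto simp: a_def b_def)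
  have "Re (u (of_real b)) = Re (u (of_real a))"
  proof (rule DERIV_isconst_end[OF ab(2)])
    show "continuous_on {a..b} (\<lambda>t. Re (u (of_real t)))"
    proof (rule DERIV_continuous_on)
      show "((\<lambda>t. Re (u (of_real t))) has_real_derivative 0) (at t within {a..b})" if "t \<in> {a..b}" for t
        by (rule has_field_derivative_at_within, rule d0) (use ab that in auto)
    qed
    show "((\<lambda>t. Re (u (of_real t))) has_real_derivative 0) (at t)" if "a < t" "t < b" for t
      using d0 ab that by auto
  qed
  then show False using dec[of a b] ab by simp
qed

text \<open>Continuity and injectivity give monotonicity on every triple of points; one increasing
  pair then decides the direction on the whole ray.\<close>

lemma continuous_inj_ray_cases:
  fixes r :: "real \<Rightarrow> real"
  assumes c: "continuous_on {a..} r" and i: "inj_on r {a..}" and x: "a \<le> x" "x < y" "r x < r y"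
    and z: "a \<le> z" "z < w"
  shows "r z < r w"
proof -
  define M where "M = max y w + 1"
  have mono: "(r p < r q \<and> r q < r s) \<or> (r s < r q \<and> r q < r p)" if "a \<le> p" "p < q" "q < s" for p q s
    by (rule continuous_inj_imp_mono[OF that(2,3)])
       (use that in \<open>auto intro: continuous_on_subset[OF c] inj_on_subset[OF i]\<close>)
  have lt: "y < M" "w < M" by (auto simp: M_def)
  have yM: "r x < r M" using mono[of x y M] x lt by auto
  have "r z < r M"
  proof (cases "z = x")
    case False
    then consider "z < x" | "x < z" by linarith
    then show ?thesis
    proof cases
      case 1 then show ?thesis using mono[of z x M] yM x z lt by auto
    next
      case 2 then show ?thesis using mono[of x z M] yM x z lt by auto
    qed
  qed (use yM in simp)
  then show ?thesis using mono[of z w M] z lt by auto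
qed

section \<open>The normalised map onto the half plane\<close>

context corner
begin

text \<open>The Cayley transform \<open>N\<close>, with inverse \<open>J\<close>, has its pole at
  \<open>F 0\<close>, the boundary value belonging to infinity. This turns continuity of
  \<open>F\<close> at 0 into the growth statement for \<open>u\<close>.\<close>

lemma halfplane_map_raw:
  obtains u where "continuous_on Tb u" "inj_on u Tb" "u ` Tb = {w. 0 \<le> Im w}" "u holomorphic_on T"
    "u ` T = {w. 0 < Im w}" "\<And>R. \<exists>R'. \<forall>z\<in>Tb. R' < norm z \<longrightarrow> R < norm (u z)"
proof -
  obtain F where F: "continuous_on (closure D) F" "inj_on F (closure D)" "F ` closure D = cball 0 1"
    "F holomorphic_on D" "F ` D = ball 0 1" using disc_homeomorphism by blast
  have D0: "0 \<notin> D" by (simp add: D_eq)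
  have c0: "0 \<in> closure D" and ct: "\<And>z. z \<in> Tb \<Longrightarrow> \<tau> z \<in> closure D" by (auto simp: closure_D)
  have bd: "norm (F x) = 1" if "x \<in> closure D" "x \<notin> D" for x
  proof -
    have "F x \<notin> ball 0 1"
    proof
      assume "F x \<in> ball 0 1"
      then obtain y where "y \<in> D" "F y = F x" using F(5) by (metis imageE)
      then show False using that F(2) closure_subset by (metis inj_onD subsetD)
    qed
    moreover have "F x \<in> cball 0 1" using F(3) that by blast
    ultimately show ?thesis by simp
  qed
  define a where "a z = F (\<tau> z)" for z
  define \<zeta> where "\<zeta> = F 0"
  have \<zeta>: "norm \<zeta> = 1" unfolding \<zeta>_def by (rule bd[OF c0 D0])
  have \<zeta>0: "\<zeta> \<noteq> 0" using \<zeta> by auto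
  define N where "N d = \<i> * (\<zeta> + d) / (\<zeta> - d)" for d
  define J where "J w = \<zeta> * ((w - \<i>) / (w + \<i>))" for w
  have ImN: "Im (N d) = (1 - (norm d)\<^sup>2) / (norm (\<zeta> - d))\<^sup>2" for d
  proof -
    have "N d = \<i> * (\<zeta> + d) * cnj (\<zeta> - d) / of_real ((norm (\<zeta> - d))\<^sup>2)"
      unfolding N_def by (subst complex_div_cnj) simp
    then have "Im (N d) = Im (\<i> * (\<zeta> + d) * cnj (\<zeta> - d)) / (norm (\<zeta> - d))\<^sup>2" by (simp only: Im_divide_of_real)
    also have "Im (\<i> * (\<zeta> + d) * cnj (\<zeta> - d)) = (Re \<zeta>)\<^sup>2 + (Im \<zeta>)\<^sup>2 - ((Re d)\<^sup>2 + (Im d)\<^sup>2)"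
      by (simp add: algebra_simps power2_eq_square)
    finally show ?thesis using \<zeta> by (simp add: cmod_power2[symmetric])
  qed
  have JN: "J (N d) = d" if "d \<noteq> \<zeta>" for d
  proof -
    have "N d - \<i> = 2 * \<i> * d / (\<zeta> - d)" "N d + \<i> = 2 * \<i> * \<zeta> / (\<zeta> - d)"
      using that by (simp_all add: N_def field_simps)
    then show ?thesis using that \<zeta>0 by (simp add: J_def)
  qed
  have NJ: "N (J w) = w \<and> J w \<noteq> \<zeta>" if "w + \<i> \<noteq> 0" for w
  proof -
    have 1: "\<zeta> + J w = 2 * \<zeta> * w / (w + \<i>)" "\<zeta> - J w = 2 * \<zeta> * \<i> / (w + \<i>)"
      using that by (simp_all add: J_def field_simps)
    have "\<zeta> - J w \<noteq> 0" unfolding 1 using that \<zeta>0 by simp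
    moreover have "N (J w) = w"
    proof -
      have "N (J w) = (\<i> * (2 * \<zeta> * w)) / (2 * \<zeta> * \<i>)"
        unfolding N_def 1 using that by (simp only: times_divide_eq_right divide_divide_eq_left divide_divide_eq_right) simp
      then show ?thesis using \<zeta>0 by simp
    qed
    ultimately show ?thesis by auto
  qed
  have a: "a z \<noteq> \<zeta>" if "z \<in> Tb" for z
    using F(2) c0 ct[OF that] \<tau>_ne[OF that] unfolding a_def \<zeta>_def by (metis inj_onD)
  define u where "u z = N (a z)" for z
  have conta: "continuous_on Tb a" unfolding a_def
  proof (rule continuous_on_compose2[OF F(1)])
    show "continuous_on Tb \<tau>" using Tb_ne by (intro holomorphic_on_imp_continuous_on holomorphic_on_subset[OF hol_\<tau>]) force
  qed (use ct in auto)
  have contu: "continuous_on Tb u" unfolding u_def N_def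
    using a by (intro continuous_intros conta) auto
  have inju: "inj_on u Tb"
  proof (rule inj_onI)
    fix x y assume xy: "x \<in> Tb" "y \<in> Tb" "u x = u y"
    then have "a x = a y" using JN a unfolding u_def by metis
    then have "\<tau> x = \<tau> y" using F(2) ct xy unfolding a_def by (meson inj_onD)
    then show "x = y" using \<sigma>\<tau> by metis
  qed
  have aT: "norm (a z) < 1" if "z \<in> T" for z
  proof -
    have "\<tau> z \<in> D" using that by (simp add: D_def)
    then have "F (\<tau> z) \<in> ball 0 1" using F(5) by blast
    then show ?thesis by (simp add: a_def)
  qed
  have aTb: "norm (a z) \<le> 1" if "z \<in> Tb" for z
  proof -
    have "F (\<tau> z) \<in> cball 0 1" using F(3) ct[OF that] by blast
    then show ?thesis by (simp add: a_def)
  qed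
  have imT: "Im (u z) > 0" if "z \<in> T" for z
  proof -
    have "(norm (a z))\<^sup>2 < 1" using aT[OF that] by (simp add: power_less_one_iff abs_square_less_1)
    then show ?thesis unfolding u_def ImN using a[of z] that T_subset by (intro divide_pos_pos) auto
  qed
  have imTb: "Im (u z) \<ge> 0" if "z \<in> Tb" for z
  proof -
    have "(norm (a z))\<^sup>2 \<le> 1" using aTb[OF that] by (simp add: power_le_one)
    then show ?thesis unfolding u_def ImN by simp
  qed
  have surj: "\<exists>z\<in>Tb. u z = w \<and> (0 < Im w \<longrightarrow> z \<in> T)" if w: "0 \<le> Im w" for w
  proof -
    have wi: "w + \<i> \<noteq> 0" using w by (auto simp: complex_eq_iff)
    have J: "N (J w) = w" "J w \<noteq> \<zeta>" using NJ[OF wi] by auto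
    have Im: "Im w = (1 - (norm (J w))\<^sup>2) / (norm (\<zeta> - J w))\<^sup>2" using ImN[of "J w"] J by simp
    have pos: "(norm (\<zeta> - J w))\<^sup>2 > 0" using J by simp
    have "(norm (J w))\<^sup>2 \<le> 1" using Im pos w by (simp add: zero_le_divide_iff)
    then have "norm (J w) \<le> 1" by (simp add: abs_square_le_1)
    then obtain x where x: "x \<in> closure D" "F x = J w" "0 < Im w \<longrightarrow> x \<in> D"
    proof (cases "0 < Im w")
      case True
      then have "(norm (J w))\<^sup>2 < 1" using Im pos by (simp add: zero_less_divide_iff)
      then have "norm (J w) < 1" by (simp add: abs_square_less_1)
      then obtain x where "x \<in> D" "F x = J w" using F(5) by (metis imageE mem_ball_0)
      then show thesis using that closure_subset by blast
    next
      case False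
      obtain x where "x \<in> closure D" "F x = J w" using F(3) \<open>norm (J w) \<le> 1\<close> by (metis imageE mem_cball_0)
      then show thesis using that False by blast
    qed
    have "x \<noteq> 0" using x J \<zeta>_def by auto
    then obtain z where z: "z \<in> Tb" "x = \<tau> z" using x(1) unfolding closure_D by auto
    have "u z = w" using x z J by (simp add: u_def a_def)
    moreover have "0 < Im w \<longrightarrow> z \<in> T" using x(3) z \<sigma>\<tau> by (auto simp: D_eq)
    ultimately show ?thesis using z by blast
  qed
  have inf: "\<exists>R'. \<forall>z\<in>Tb. R' < norm z \<longrightarrow> R < norm (u z)" for R
  proof -
    \<comment> \<open>\<open>\<bar>u\<bar> = \<bar>\<zeta> + a\<bar> / \<bar>\<zeta> -
      a\<bar>\<close>, and the numerator is at least 1 as soon as the denominator is at most 1; so a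
      denominator below \<open>d\<close> makes the quotient larger than
      \<open>\<bar>R\<bar>\<close>.\<close>
    define d where "d = 1 / (\<bar>R\<bar> + 1)"
    have d: "d > 0" "d \<le> 1" by (auto simp: d_def)
    obtain e where e: "e > 0" "\<And>x. x \<in> closure D \<Longrightarrow> dist x 0 < e \<Longrightarrow> dist (F x) (F 0) < d"
      using F(1) c0 d(1) unfolding continuous_on_iff by metis
    show ?thesis
    proof (intro exI[of _ "1/e + 1"] ballI impI)
      fix z assume z: "z \<in> Tb" "1/e + 1 < norm z"
      have "norm z \<le> norm (z + 1) + 1" using norm_triangle_ineq4[of "z+1" 1] by simp
      then have n1: "1/e < norm (z + 1)" using z by simp
      moreover from this have "0 < norm (z + 1)" using e by (smt (verit) divide_pos_pos)
      ultimately have "norm (\<tau> z) < e" unfolding norm_\<tau>_eq using e by (simp add: field_simps)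
      then have "norm (\<zeta> - a z) < d" using e(2)[OF ct[OF z(1)]]
        by (simp add: a_def \<zeta>_def dist_norm norm_minus_commute)
      moreover have "norm (\<zeta> + a z) \<ge> 2 - norm (\<zeta> - a z)"
        using norm_triangle_ineq4[of "2*\<zeta>" "\<zeta> - a z"] norm_triangle_ineq2[of "2*\<zeta>" "\<zeta> - a z"] \<zeta> by (simp add: norm_mult)
      ultimately have n: "1 \<le> norm (\<zeta> + a z)" "norm (\<zeta> - a z) < d" "0 < norm (\<zeta> - a z)" using d a[OF z(1)] by auto
      have "\<bar>R\<bar> + 1 = 1/d" by (simp add: d_def)
      also have "\<dots> \<le> 1 / norm (\<zeta> - a z)" using n d by (intro divide_left_mono) auto
      also have "\<dots> \<le> norm (\<zeta> + a z) / norm (\<zeta> - a z)" using n by (intro divide_right_mono) auto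
      also have "\<dots> = norm (u z)" by (simp add: u_def N_def norm_mult norm_divide)
      finally show "R < norm (u z)" by linarith
    qed
  qed
  have holu: "u holomorphic_on T"
  proof -
    have "a holomorphic_on T" unfolding a_def
      using holomorphic_on_compose_gen[OF holomorphic_on_subset[OF hol_\<tau>] F(4), of T] Tb_ne T_subset
      by (force simp: o_def D_def)
    then show ?thesis unfolding u_def N_def using a T_subset
      by (intro holomorphic_on_divide holomorphic_on_mult holomorphic_on_add holomorphic_on_diff holomorphic_on_const) auto
  qed
  show thesis
  proof (rule that[OF contu inju _ holu _ inf])
    show "u ` Tb = {w. 0 \<le> Im w}" using imTb surj by blast
    show "u ` T = {w. 0 < Im w}"
    proof
      show "{w. 0 < Im w} \<subseteq> u ` T" using surj by (metis (mono_tags, lifting) image_eqI less_imp_le mem_Collect_eq subsetI)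
    qed (use imT in auto)
  qed
qed

lemma boundary_value_real:
  assumes "inj_on u Tb" "u ` Tb = {w. 0 \<le> Im w}" "u ` T = {w. 0 < Im w}" "z \<in> Tb" "z \<notin> T"
  shows "Im (u z) = 0"
proof -
  have "u z \<notin> u ` T" using assms T_subset by (metis inj_on_image_mem_iff)
  moreover have "0 \<le> Im (u z)" using assms(2,4) by blast
  ultimately show ?thesis using assms(3) by auto
qed

text \<open>A real affine change sends \<open>\<i> * h 0\<close> to 0 and \<open>L\<close> to 1 or
  -1. Orientation decides for 1: the ray beyond \<open>L\<close> is mapped increasingly and without
  bound, so from -1 it would pass through 0, which is already taken. The two unbounded rays then
  cover \<open>[1, \<infinity>)\<close> and \<open>(-\<infinity>, 0]\<close>, and the remaining
  arcs, mapped monotonically, lie between.\<close>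

lemma halfplane_map:
  obtains u \<mu> where "continuous_on Tb u" "inj_on u Tb" "u ` Tb = {w. 0 \<le> Im w}" "u holomorphic_on T"
    "u ` T = {w. 0 < Im w}" "\<And>R. \<exists>R'. \<forall>z\<in>Tb. R' < norm z \<longrightarrow> R < norm (u z)"
    "0 < \<mu>" "\<mu> < 1" "u (Complex 0 (h 0)) = 0" "u (Complex L (h L)) = of_real \<mu>" "u (Complex L 0) = 1"
    "\<And>z. z \<in> Tb \<Longrightarrow> z \<notin> T \<Longrightarrow> Im (u z) = 0"
    "\<And>y. h 0 < y \<Longrightarrow> Re (u (Complex 0 y)) < 0"
    "\<And>x. 0 < x \<Longrightarrow> x < L \<Longrightarrow> 0 < Re (u (Complex x (h x))) \<and> Re (u (Complex x (h x))) < \<mu>"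
    "\<And>y. 0 < y \<Longrightarrow> y < h L \<Longrightarrow> \<mu> < Re (u (Complex L y)) \<and> Re (u (Complex L y)) < 1"
    "\<And>x. L < x \<Longrightarrow> 1 < Re (u (Complex x 0))"
proof -
  obtain v where v: "continuous_on Tb v" "inj_on v Tb" "v ` Tb = {w. 0 \<le> Im w}" "v holomorphic_on T"
    "v ` T = {w. 0 < Im w}" "\<And>R. \<exists>R'. \<forall>z\<in>Tb. R' < norm z \<longrightarrow> R < norm (v z)" using halfplane_map_raw by blast
  define p0 where "p0 = Complex 0 (h 0)"
  define pL where "pL = Complex L 0"
  have h0: "0 < h x" "0 \<le> h x" for x using hpos[of x] by auto
  have inI: "Complex 0 y \<in> Tb" "Complex 0 y \<notin> T" if "h 0 \<le> y" for y
    using that h0[of 0] by (auto simp: Tb_def T_def)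
  have inR: "Complex x 0 \<in> Tb" "Complex x 0 \<notin> T" if "L \<le> x" for x using that L by (auto simp: Tb_def T_def)
  have inG: "Complex x (h x) \<in> Tb" "Complex x (h x) \<notin> T" if "0 \<le> x" "x \<le> L" for x
    using that h0[of x] by (auto simp: Tb_def T_def)
  have inS: "Complex L y \<in> Tb" "Complex L y \<notin> T" if "0 \<le> y" "y \<le> h L" for y
    using that L by (auto simp: Tb_def T_def)
  have vr: "Im (v z) = 0" if "z \<in> Tb" "z \<notin> T" for z using boundary_value_real[OF v(2,3,5) that] .
  have p: "p0 \<in> Tb" "pL \<in> Tb" "p0 \<noteq> pL" using inI[of "h 0"] inR[of L] L by (auto simp: p0_def pL_def complex_eq_iff)
  have vp: "Im (v p0) = 0" "Im (v pL) = 0" using vr inI[of "h 0"] inR[of L] by (auto simp: p0_def pL_def)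
  \<comment> \<open>The absolute value keeps the upper half plane invariant under the division; the
    sign of \<open>Re (u pL)\<close> stays open until \<open>rL\<close>.\<close>
  define k where "k = \<bar>Re (v pL) - Re (v p0)\<bar>"
  have k: "k > 0"
  proof -
    have "v pL \<noteq> v p0" using v(2) p by (metis inj_onD)
    then show ?thesis using vp by (auto simp: k_def complex_eq_iff)
  qed
  define b where "b = Re (v p0)"
  define u where "u z = (v z - of_real b) / of_real k" for z
  have Reu: "Re (u z) = (Re (v z) - b) / k" and Imu: "Im (u z) = Im (v z) / k" for z
    by (simp_all add: u_def Re_divide_of_real Im_divide_of_real)
  have contu: "continuous_on Tb u" unfolding u_def using k by (intro continuous_intros v(1)) auto
  have inju: "inj_on u Tb" using v(2) k unfolding inj_on_def u_def by auto
  have holu: "u holomorphic_on T" unfolding u_def using k v(4)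
    by (intro holomorphic_on_divide holomorphic_on_diff holomorphic_on_const) auto
  have preim: "\<exists>z\<in>X. u z = w" if "v ` X = {w. Q (Im w)}" "Q (k * Im w)" for X w Q
  proof -
    have "of_real k * w + of_real b \<in> v ` X" unfolding that(1) using that(2) by simp
    then obtain z where "z \<in> X" "v z = of_real k * w + of_real b" by (metis imageE)
    then show ?thesis using k by (intro bexI[of _ z]) (simp_all add: u_def)
  qed
  have imTb: "u ` Tb = {w. 0 \<le> Im w}"
  proof
    have "0 \<le> Im (v z)" if "z \<in> Tb" for z using v(3) that by blast
    then show "u ` Tb \<subseteq> {w. 0 \<le> Im w}" using k by (auto simp: Imu)
    show "{w. 0 \<le> Im w} \<subseteq> u ` Tb"
    proof clarify
      fix w assume "0 \<le> Im w"
      then have "0 \<le> k * Im w" using k by simp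
      from preim[of Tb "\<lambda>x. 0 \<le> x", OF v(3) this] show "w \<in> u ` Tb" by blast
    qed
  qed
  have imT: "u ` T = {w. 0 < Im w}"
  proof
    have "0 < Im (v z)" if "z \<in> T" for z using v(5) that by blast
    then show "u ` T \<subseteq> {w. 0 < Im w}" using k by (auto simp: Imu)
    show "{w. 0 < Im w} \<subseteq> u ` T"
    proof clarify
      fix w assume "0 < Im w"
      then have "0 < k * Im w" using k by simp
      from preim[of T "\<lambda>x. 0 < x", OF v(5) this] show "w \<in> u ` T" by blast
    qed
  qed
  have inf: "\<exists>R'. \<forall>z\<in>Tb. R' < norm z \<longrightarrow> R < norm (u z)" for R
  proof -
    obtain R' where R': "\<forall>z\<in>Tb. R' < norm z \<longrightarrow> k * \<bar>R\<bar> + \<bar>b\<bar> < norm (v z)" using v(6) by blast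
    show ?thesis
    proof (intro exI[of _ R'] ballI impI)
      fix z assume "z \<in> Tb" "R' < norm z"
      then have "k * \<bar>R\<bar> + \<bar>b\<bar> < norm (v z)" using R' by blast
      moreover have "norm (v z) \<le> norm (v z - of_real b) + \<bar>b\<bar>"
        using norm_triangle_ineq[of "v z - of_real b" "of_real b"] by simp
      ultimately have "k * \<bar>R\<bar> < norm (v z - of_real b)" by linarith
      also have "\<dots> = k * norm (u z)" using k by (simp add: u_def norm_divide)
      finally show "R < norm (u z)" using k by simp
    qed
  qed
  have ur: "Im (u z) = 0" if "z \<in> Tb" "z \<notin> T" for z using vr[OF that] by (simp add: Imu)
  have u0: "u p0 = 0" using vp by (simp add: complex_eq_iff Reu Imu b_def)
  have inj: "z = w" if "z \<in> Tb" "w \<in> Tb" "z \<notin> T" "w \<notin> T" "Re (u z) = Re (u w)" for z w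
  proof -
    have "u z = u w" using that ur by (simp add: complex_eq_iff)
    then show ?thesis using inju that by (meson inj_onD)
  qed
  have cont: "continuous_on X (\<lambda>t. Re (u (Complex (\<alpha> t) (\<beta> t))))"
    if "continuous_on X \<alpha>" "continuous_on X \<beta>" "\<And>t. t \<in> X \<Longrightarrow> Complex (\<alpha> t) (\<beta> t) \<in> Tb" for X :: "real set" and \<alpha> \<beta>
  proof -
    have "continuous_on X (\<lambda>t. Complex (\<alpha> t) (\<beta> t))"
      unfolding Complex_eq by (intro continuous_on_add continuous_on_mult continuous_on_of_real continuous_on_const that)
    then have "continuous_on X (\<lambda>t. u (Complex (\<alpha> t) (\<beta> t)))"
      by (rule continuous_on_compose2[OF contu]) (use that in blast)
    then show ?thesis by (rule continuous_on_Re)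
  qed
  define r where "r x = Re (u (Complex x 0))" for x
  have contr: "continuous_on {L..} r" unfolding r_def by (rule cont) (use inR in auto)
  have injr: "inj_on r {L..}" unfolding r_def using inj inR by (intro inj_onI) (metis atLeast_iff complex.inject)
  have "\<exists>x y. L < x \<and> x < y \<and> r x < r y"
  proof (rule ccontr)
    assume neg: "\<not> ?thesis"
    have dec: "r y < r x" if "L < x" "x < y" for x y
    proof -
      have "r x \<noteq> r y" using injr that by (auto dest: inj_onD)
      then show ?thesis using neg that by force
    qed
    show False
    proof (rule halfplane_boundary_increasing[of L "L+1" Tb T u])
      show "z \<in> Tb" if "L < Re z" "Re z < L + 1" "0 \<le> Im z" for z using that L by (auto simp: Tb_def)
      show "z \<in> T" if "L < Re z" "Re z < L + 1" "0 < Im z" for z using that L by (auto simp: T_def)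
      show "Im (u z) > 0" if "z \<in> T" for z using imT that by blast
      have e: "of_real x = Complex x 0" for x by (simp add: complex_eq_iff)
      show "Im (u (of_real x)) = 0" if "L < x" "x < L + 1" for x unfolding e using inR[of x] that by (intro ur) auto
      show "Re (u (of_real y)) < Re (u (of_real x))" if "L < x" "x < y" "y < L+1" for x y
        using dec[OF that(1,2)] by (simp add: e r_def)
    qed (use contu holu in auto)
  qed
  then obtain x1 y1 where xy: "L \<le> x1" "x1 < y1" "r x1 < r y1" by (meson less_imp_le)
  have rinc: "r x < r y" if "L \<le> x" "x < y" for x y
    by (rule continuous_inj_ray_cases[OF contr injr xy that])
  have rbig: "\<exists>x>L. r x > R" for R
  proof -
    obtain R' where R': "\<forall>z\<in>Tb. R' < norm z \<longrightarrow> \<bar>R\<bar> + \<bar>r L\<bar> < norm (u z)" using inf by blast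
    define x where "x = max L R' + 1"
    have x: "L < x" "R' < x" by (auto simp: x_def)
    have nx: "norm (Complex x 0) = \<bar>x\<bar>" by (simp add: complex_norm)
    have "Im (u (Complex x 0)) = 0" using inR[of x] x by (intro ur) auto
    then have "norm (u (Complex x 0)) = \<bar>r x\<bar>" by (simp add: r_def cmod_eq_Re)
    moreover have "\<bar>R\<bar> + \<bar>r L\<bar> < norm (u (Complex x 0))" using R' inR[of x] x nx L by auto
    moreover have "r L < r x" using rinc[of L x] x by simp
    ultimately show ?thesis using x by (intro exI[of _ x]) auto
  qed
  have rsurj: "\<exists>x\<ge>L. r x = t" if "t \<ge> r L" for t
  proof -
    obtain x where x: "x > L" "r x > t" using rbig by blast
    then show ?thesis using IVT'[of r L t x] that continuous_on_subset[OF contr, of "{L..x}"] by auto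
  qed
  have rL: "r L = 1"
  proof -
    have "Re (u pL) = 1 \<or> Re (u pL) = -1" using k unfolding Reu k_def b_def by (auto simp: abs_if field_simps split: if_splits)
    then have "r L = 1 \<or> r L = -1" by (simp add: r_def pL_def)
    moreover have "r L \<noteq> -1"
    proof
      assume "r L = -1"
      then obtain x where x: "x \<ge> L" "r x = 0" using rsurj[of 0] by auto
      then have "Complex x 0 = p0" using inR[of x] inI[of "h 0"] u0 by (intro inj) (auto simp: p0_def r_def)
      then show False using h0[of 0] by (simp add: p0_def)
    qed
    ultimately show ?thesis by blast
  qed
  have notr: "Re (u z) < 1" if "z \<in> Tb" "z \<notin> T" "\<And>x. L \<le> x \<Longrightarrow> z \<noteq> Complex x 0" for z
  proof (rule ccontr)
    assume "\<not> ?thesis"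
    then obtain x where "x \<ge> L" "r x = Re (u z)" using rsurj[of "Re (u z)"] rL by auto
    then have "z = Complex x 0" using that inR[of x] by (intro inj) (auto simp: r_def)
    then show False using that \<open>x \<ge> L\<close> by blast
  qed
  define s where "s y = Re (u (Complex 0 y))" for y
  have conts: "continuous_on {h 0..} s" unfolding s_def by (rule cont) (use inI in auto)
  have s0: "s (h 0) = 0" using u0 by (simp add: s_def p0_def)
  have s1: "s y < 1" if "y \<ge> h 0" for y unfolding s_def by (rule notr) (use inI[OF that] h0[of 0] that in auto)
  have snz: "s y \<noteq> 0" if "y > h 0" for y
  proof
    assume "s y = 0"
    then have "Complex 0 y = p0" using inI[of y] inI[of "h 0"] that u0 by (intro inj) (auto simp: s_def p0_def)
    then show False using that by (simp add: p0_def)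
  qed
  have sbig: "\<exists>y>h 0. y > Y \<and> \<bar>s y\<bar> > R" for R Y
  proof -
    obtain R' where R': "\<forall>z\<in>Tb. R' < norm z \<longrightarrow> R < norm (u z)" using inf by blast
    define y where "y = max (max (h 0) R') Y + 1"
    have y: "h 0 < y" "R' < y" "Y < y" by (auto simp: y_def)
    have ny: "norm (Complex 0 y) = \<bar>y\<bar>" by (simp add: complex_norm)
    have "Im (u (Complex 0 y)) = 0" using inI[of y] y by (intro ur) auto
    then have "norm (u (Complex 0 y)) = \<bar>s y\<bar>" by (simp add: s_def cmod_eq_Re)
    moreover have "R < norm (u (Complex 0 y))" using R' inI[of y] y ny h0[of 0] by auto
    ultimately show ?thesis using y by (intro exI[of _ y]) auto
  qed
  \<comment> \<open>Far up the axis there are values of large modulus, and all values are below 1,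
    so these are negative; a positive value anywhere would force a zero in between.\<close>
  have sneg: "s y < 0" if y: "y > h 0" for y
  proof (rule ccontr)
    assume "\<not> s y < 0"
    then have "s y > 0" using snz[OF y] by simp
    obtain y' where y': "y' > h 0" "y' > y" "\<bar>s y'\<bar> > 1" using sbig by blast
    then have "s y' < 0" using s1[of y'] by auto
    then have "\<exists>t\<ge>y. t \<le> y' \<and> s t = 0"
      using y y' \<open>s y > 0\<close> by (intro IVT2' continuous_on_subset[OF conts]) auto
    then show False using snz y by force
  qed
  have ssurj: "\<exists>y\<ge>h 0. s y = t" if "t \<le> 0" for t
  proof -
    obtain y where y: "y > h 0" "\<bar>s y\<bar> > \<bar>t\<bar>" using sbig by blast
    then have "s y < t" using sneg[of y] that by auto
    then show ?thesis using IVT2'[of s y t "h 0"] that y s0 continuous_on_subset[OF conts, of "{h 0..y}"] by auto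
  qed
  have nots: "Re (u z) > 0" if "z \<in> Tb" "z \<notin> T" "\<And>y. h 0 \<le> y \<Longrightarrow> z \<noteq> Complex 0 y" for z
  proof (rule ccontr)
    assume "\<not> ?thesis"
    then obtain y where "y \<ge> h 0" "s y = Re (u z)" using ssurj[of "Re (u z)"] by auto
    then have "z = Complex 0 y" using that inI[of y] by (intro inj) (auto simp: s_def)
    then show False using that \<open>y \<ge> h 0\<close> by blast
  qed
  define \<mu> where "\<mu> = Re (u (Complex L (h L)))"
  have \<mu>: "0 < \<mu>" "\<mu> < 1" unfolding \<mu>_def
    using notr[of "Complex L (h L)"] nots[of "Complex L (h L)"] inS[of "h L"] h0[of L] L by auto
  have graph: "0 < Re (u (Complex x (h x))) \<and> Re (u (Complex x (h x))) < \<mu>" if x: "0 < x" "x < L" for x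
  proof -
    define q where "q x = Re (u (Complex x (h x)))" for x
    have "continuous_on {0..L} h" by (rule continuous_on_subset[OF conth]) simp
    then have "continuous_on {0..L} q" unfolding q_def by (rule cont[OF continuous_on_id]) (use inG in auto)
    moreover have "inj_on q {0..L}" unfolding q_def using inj inG by (intro inj_onI) (metis atLeastAtMost_iff complex.inject)
    ultimately have "(q 0 < q x \<and> q x < q L) \<or> (q L < q x \<and> q x < q 0)" by (rule continuous_inj_imp_mono[OF x])
    moreover have "q 0 = 0" "q L = \<mu>" using u0 by (auto simp: q_def \<mu>_def p0_def)
    ultimately show ?thesis using \<mu> by (auto simp: q_def)
  qed
  have seg: "\<mu> < Re (u (Complex L y)) \<and> Re (u (Complex L y)) < 1" if y: "0 < y" "y < h L" for y
  proof -
    define q where "q y = Re (u (Complex L y))" for y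
    have "continuous_on {0..h L} q" unfolding q_def by (rule cont[OF continuous_on_const continuous_on_id]) (use inS in auto)
    moreover have "inj_on q {0..h L}" unfolding q_def using inj inS by (intro inj_onI) (metis atLeastAtMost_iff complex.inject)
    ultimately have "(q 0 < q y \<and> q y < q (h L)) \<or> (q (h L) < q y \<and> q y < q 0)" by (rule continuous_inj_imp_mono[OF y])
    moreover have "q 0 = 1" "q (h L) = \<mu>" using rL by (auto simp: q_def \<mu>_def r_def)
    ultimately show ?thesis using \<mu> by (auto simp: q_def)
  qed
  have 1: "u (Complex L (h L)) = of_real \<mu>" using ur inS[of "h L"] h0[of L] by (auto simp: complex_eq_iff \<mu>_def)
  have 2: "u (Complex L 0) = 1" using ur inR[of L] rL by (auto simp: complex_eq_iff r_def)
  have 3: "1 < Re (u (Complex x 0))" if "L < x" for x using rinc[of L x] that rL by (simp add: r_def)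
  show thesis
    by (rule that[OF contu inju imTb holu imT inf \<mu> u0[unfolded p0_def] 1 2 ur sneg[unfolded s_def] graph seg 3])
qed

end

section \<open>The Schwarz--Christoffel map of a quadrant onto a rectangle\<close>

lemma csqrt_uminus_upper:
  assumes "Im X > 0" shows "csqrt (- X) = - \<i> * csqrt X"
proof (rule csqrt_unique)
  show "(- \<i> * csqrt X)\<^sup>2 = - X" by (simp add: power_mult_distrib)
  have "Im (csqrt X) > 0" using assms by (simp add: csqrt.simps cmod_def real_less_rsqrt abs_le_square_iff)
  then show "0 < Re (- \<i> * csqrt X) \<or> Re (- \<i> * csqrt X) = 0 \<and> 0 \<le> Im (- \<i> * csqrt X)" by simp
qed

locale schwarz_christoffel =
  fixes l :: real assumes l: "0 < l" "l < 1"
begin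

definition H where "H = {w::complex. 0 < Im w}"
definition Hb where "Hb = {w::complex. 0 \<le> Im w}"
text \<open>The integrand of the elliptic integral of the first kind, with branch points at
  \<open>l\<close>, 1 and their negatives. On the open upper half plane neither radicand meets the
  nonpositive real axis, so the principal roots form one holomorphic branch.\<close>

definition k :: "complex \<Rightarrow> complex" where "k w = 1 / (csqrt (1 - w\<^sup>2) * csqrt ((of_real l)\<^sup>2 - w\<^sup>2))"

lemma H: "open H" "convex H" by (auto simp: H_def open_halfspace_Im_gt convex_halfspace_Im_gt)

lemma sq_diff_nonneg:
  assumes "(of_real p)\<^sup>2 - w\<^sup>2 \<in> \<real>\<^sub>\<le>\<^sub>0"
  shows "Im w * Re w = 0" "p\<^sup>2 \<le> (Re w)\<^sup>2 - (Im w)\<^sup>2"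
proof -
  have "Im ((of_real p)\<^sup>2 - w\<^sup>2) = 0" "Re ((of_real p)\<^sup>2 - w\<^sup>2) \<le> 0"
    using assms by (auto simp: complex_nonpos_Reals_iff)
  then show "Im w * Re w = 0" "p\<^sup>2 \<le> (Re w)\<^sup>2 - (Im w)\<^sup>2" by (auto simp: power2_eq_square algebra_simps)
qed

lemma upper_slit: "(of_real p)\<^sup>2 - w\<^sup>2 \<notin> \<real>\<^sub>\<le>\<^sub>0" if "w \<in> H"
proof
  assume a: "(of_real p)\<^sup>2 - w\<^sup>2 \<in> \<real>\<^sub>\<le>\<^sub>0"
  have "Re w = 0" using sq_diff_nonneg(1)[OF a] that by (auto simp: H_def)
  then have "p\<^sup>2 \<le> - (Im w)\<^sup>2" using sq_diff_nonneg(2)[OF a] by simp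
  moreover have "(Im w)\<^sup>2 > 0" using that by (auto simp: H_def)
  ultimately show False using zero_le_power2[of p] by linarith
qed

lemma hol_csqrt_diff:
  assumes "\<And>w. w \<in> X \<Longrightarrow> (of_real p)\<^sup>2 - w\<^sup>2 \<notin> \<real>\<^sub>\<le>\<^sub>0"
  shows "(\<lambda>w. csqrt ((of_real p)\<^sup>2 - w\<^sup>2)) holomorphic_on X"
  by (rule holomorphic_on_csqrt')
     (use assms in \<open>auto intro!: holomorphic_on_diff holomorphic_on_power holomorphic_on_const holomorphic_on_ident\<close>)

lemma hol_k:
  assumes "\<And>w. w \<in> X \<Longrightarrow> 1 - w\<^sup>2 \<notin> \<real>\<^sub>\<le>\<^sub>0" "\<And>w. w \<in> X \<Longrightarrow> (of_real l)\<^sup>2 - w\<^sup>2 \<notin> \<real>\<^sub>\<le>\<^sub>0"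
  shows "k holomorphic_on X"
proof -
  have 1: "(\<lambda>w. csqrt (1 - w\<^sup>2)) holomorphic_on X" using hol_csqrt_diff[of X 1] assms(1) by simp
  have 2: "(\<lambda>w. csqrt ((of_real l)\<^sup>2 - w\<^sup>2)) holomorphic_on X" by (rule hol_csqrt_diff[OF assms(2)])
  have n1: "csqrt (1 - w\<^sup>2) \<noteq> 0" if "w \<in> X" for w using assms(1)[OF that] by auto
  have n2: "csqrt ((of_real l)\<^sup>2 - w\<^sup>2) \<noteq> 0" if "w \<in> X" for w using assms(2)[OF that] by auto
  show ?thesis unfolding k_def
    by (rule holomorphic_on_divide[OF holomorphic_on_const holomorphic_on_mult[OF 1 2]]) (use n1 n2 in simp)
qed

lemma hol_kH: "k holomorphic_on H"
  by (rule hol_k) (use upper_slit[of _ 1] upper_slit[of _ l] in auto)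

definition C where "C = sqrt (2 / (l * (1 - l\<^sup>2)))"

lemma l2: "l\<^sup>2 < 1" using l by (simp add: power_less_one_iff abs_square_less_1)

lemma norm_k: "norm (k w) = 1 / sqrt (norm (1 - w\<^sup>2) * norm ((of_real l)\<^sup>2 - w\<^sup>2))"
proof -
  have "norm (csqrt z) = sqrt (norm z)" for z
    using arg_cong[OF power2_csqrt[of z], of norm] by (simp add: norm_power real_sqrt_unique)
  then show ?thesis by (simp add: k_def norm_divide norm_mult real_sqrt_mult)
qed

text \<open>Of the factors \<open>\<bar>p - w\<bar>\<close> and \<open>\<bar>p + w\<bar>\<close>
  both are at least \<open>Im w\<close>, and one is at least \<open>p\<close>, depending on the sign
  of \<open>Re w\<close>.\<close>

lemma sq_diff_lower:
  assumes "w \<in> H" "0 < p" shows "p * Im w \<le> norm ((of_real p)\<^sup>2 - w\<^sup>2)"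
proof -
  have f: "norm ((of_real p)\<^sup>2 - w\<^sup>2) = norm (of_real p - w) * norm (of_real p + w)"
    by (simp add: power2_eq_square algebra_simps flip: norm_mult)
  have i: "Im w \<le> norm (of_real p - w)" "Im w \<le> norm (of_real p + w)"
    using abs_Im_le_cmod[of "of_real p - w"] abs_Im_le_cmod[of "of_real p + w"] assms by (auto simp: H_def)
  have Imp: "0 < Im w" using assms by (simp add: H_def)
  show ?thesis
  proof (cases "Re w \<ge> 0")
    case True
    have "p \<le> norm (of_real p + w)" using complex_Re_le_cmod[of "of_real p + w"] True by simp
    then show ?thesis unfolding f using i(1) Imp assms(2) mult_mono[of "Im w" "norm (of_real p - w)" p "norm (of_real p + w)"]
      by (simp add: mult.commute)
  next
    case False
    have "p \<le> norm (of_real p - w)" using complex_Re_le_cmod[of "of_real p - w"] False by simp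
    then show ?thesis unfolding f using i(2) Imp assms(2) mult_mono[of p "norm (of_real p - w)" "Im w" "norm (of_real p + w)"]
      by simp
  qed
qed

text \<open>The two radicands differ by \<open>1 - l\<^sup>2\<close>, so they cannot both be small:
  one is at least half that difference while the other is at least \<open>l * Im w\<close>. The
  resulting inverse square root is integrable in the vertical direction.\<close>

lemma k_bound:
  assumes "w \<in> H" shows "norm (k w) \<le> C / sqrt (Im w)"
proof -
  let ?A = "norm (1 - w\<^sup>2)" and ?B = "norm ((of_real l)\<^sup>2 - w\<^sup>2)"
  have y: "Im w > 0" using assms by (simp add: H_def)
  have A: "l * Im w \<le> ?A" 
  proof -
    have "l * Im w \<le> 1 * Im w" using y l by (intro mult_right_mono) auto
    also have "\<dots> \<le> ?A" using sq_diff_lower[OF assms, of 1] by simp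
    finally show ?thesis .
  qed
  have B: "l * Im w \<le> ?B" using sq_diff_lower[OF assms l(1)] .
  have "(1 - w\<^sup>2) - ((of_real l)\<^sup>2 - w\<^sup>2) = of_real (1 - l\<^sup>2)" by simp
  then have e: "norm ((1 - w\<^sup>2) - ((of_real l)\<^sup>2 - w\<^sup>2)) = 1 - l\<^sup>2"
    using l2 by (simp only: norm_of_real)
  have AB: "1 - l\<^sup>2 \<le> ?A + ?B" by (rule ord_eq_le_trans[OF e[symmetric] norm_triangle_ineq4])
  have ly: "0 < l * Im w" using l y by simp
  have prod: "l * Im w * ((1 - l\<^sup>2)/2) \<le> ?A * ?B"
  proof (cases "?A \<ge> (1 - l\<^sup>2)/2")
    case True
    have "((1 - l\<^sup>2)/2) * (l * Im w) \<le> ?A * ?B" using True B ly l2 by (intro mult_mono) auto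
    then show ?thesis by (simp add: mult.commute)
  next
    case False
    then have "(1 - l\<^sup>2)/2 \<le> ?B" using AB by (simp add: field_simps)
    then show ?thesis using A ly l2 by (intro mult_mono) auto
  qed
  have pos: "0 < l * Im w * ((1 - l\<^sup>2)/2)" using ly l2 by simp
  have "norm (k w) \<le> 1 / sqrt (l * Im w * ((1 - l\<^sup>2)/2))"
    unfolding norm_k using pos prod by (intro divide_left_mono mult_pos_pos) auto
  also have "\<dots> = sqrt (1 / (l * Im w * ((1 - l\<^sup>2)/2)))" by (simp only: real_sqrt_divide real_sqrt_one)
  also have "1 / (l * Im w * ((1 - l\<^sup>2)/2)) = 2 / (l * (1 - l\<^sup>2)) / Im w"
  proof -
    have "l \<noteq> 0" "1 - l\<^sup>2 \<noteq> 0" "Im w \<noteq> 0" using l l2 y by auto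
    then show ?thesis by (simp only: divide_divide_eq_left divide_divide_eq_right times_divide_eq_right) (simp add: mult_ac)
  qed
  also have "sqrt \<dots> = C / sqrt (Im w)" unfolding C_def by (rule real_sqrt_divide)
  finally show ?thesis .
qed

lemma k_decay:
  assumes "norm w \<ge> 2" shows "norm (k w) \<le> 2 / (norm w)\<^sup>2"
proof -
  have w2: "(norm w)\<^sup>2 \<ge> 4" using power_mono[OF assms, of 2] by simp
  have b: "(norm w)\<^sup>2 / 2 \<le> norm ((of_real p)\<^sup>2 - w\<^sup>2)" if "0 \<le> p" "p \<le> 1" for p
  proof -
    have "p\<^sup>2 \<le> 1" using that by (simp add: power_le_one)
    moreover have "(norm w)\<^sup>2 - p\<^sup>2 \<le> norm ((of_real p)\<^sup>2 - w\<^sup>2)"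
      using norm_triangle_ineq2[of "w\<^sup>2" "(of_real p)\<^sup>2"] by (simp add: norm_power norm_minus_commute)
    ultimately show ?thesis using w2 by simp
  qed
  have "w \<noteq> 0" using assms by auto
  define q where "q = (norm w)\<^sup>2 / 2"
  have q: "q > 0" using \<open>w \<noteq> 0\<close> by (simp add: q_def)
  have "q * q \<le> norm (1 - w\<^sup>2) * norm ((of_real l)\<^sup>2 - w\<^sup>2)"
    using b[of 1] b[of l] l q by (intro mult_mono) (auto simp: q_def)
  then have "1 / sqrt (norm (1 - w\<^sup>2) * norm ((of_real l)\<^sup>2 - w\<^sup>2)) \<le> 1 / sqrt (q * q)"
    using q by (intro frac_le real_sqrt_le_mono) auto
  then have "norm (k w) \<le> 1 / q" unfolding norm_k using q by simp
  also have "\<dots> = 2 / (norm w)\<^sup>2" using \<open>w \<noteq> 0\<close> by (simp add: q_def)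
  finally show ?thesis .
qed

definition S0 where "S0 = (SOME g. \<forall>w\<in>H. (g has_field_derivative k w) (at w))"

lemma S0: "w \<in> H \<Longrightarrow> (S0 has_field_derivative k w) (at w)"
proof -
  have "\<exists>g. \<forall>w\<in>H. (g has_field_derivative k w) (at w)"
  proof -
    obtain g where g: "\<And>x. x \<in> H \<Longrightarrow> (g has_field_derivative k x) (at x within H)"
    proof (rule holomorphic_convex_primitive[of H "{}" k])
      show "k field_differentiable at x" if "x \<in> interior H - {}" for x
        using that hol_kH H by (simp add: interior_open holomorphic_on_imp_differentiable_at)
    qed (use H hol_kH holomorphic_on_imp_continuous_on in auto)
    have "(g has_field_derivative k w) (at w)" if "w \<in> H" for w
      using g[OF that] at_within_open[OF that H(1)] by simp
    then show ?thesis by blast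
  qed
  then show "w \<in> H \<Longrightarrow> (S0 has_field_derivative k w) (at w)"
    unfolding S0_def by (rule someI2_ex) blast
qed

lemma S0_vertical:
  assumes "0 \<le> Im w" "0 < s" "s < t"
  shows "norm (S0 (w + \<i> * of_real t) - S0 (w + \<i> * of_real s)) \<le> 2 * C * (sqrt t - sqrt s)"
proof -
  have inH: "w + \<i> * of_real x \<in> H" if "s \<le> x" for x using assms that by (simp add: H_def)
  have d: "((\<lambda>x. S0 (w + \<i> * of_real x)) has_vector_derivative \<i> * k (w + \<i> * of_real x)) (at x)" if "s \<le> x" for x
  proof -
    have "((\<lambda>x. w + \<i> * of_real x) has_vector_derivative \<i>) (at x)"
      by (auto intro!: derivative_eq_intros has_vector_derivative_of_real)
    from field_vector_diff_chain_at[OF this S0[OF inH[OF that]]] show ?thesis by (simp add: o_def)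
  qed
  have "norm (S0 (w + \<i> * of_real t) - S0 (w + \<i> * of_real s)) \<le> 2 * C * sqrt t - 2 * C * sqrt s"
  proof (rule differentiable_bound_general[where f = "\<lambda>x. S0 (w + \<i> * of_real x)" and \<phi> = "\<lambda>x. 2 * C * sqrt x"
       and f' = "\<lambda>x. \<i> * k (w + \<i> * of_real x)" and \<phi>' = "\<lambda>x. C / sqrt x"])
    show "continuous_on {s..t} (\<lambda>x. S0 (w + \<i> * of_real x))"
    proof (rule continuous_at_imp_continuous_on, rule ballI)
      fix x assume "x \<in> {s..t}"
      then show "isCont (\<lambda>x. S0 (w + \<i> * of_real x)) x" using has_vector_derivative_continuous[OF d] by auto
    qed
    show "((\<lambda>x. 2 * C * sqrt x) has_vector_derivative C / sqrt x) (at x)" if "s < x" for x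
      using that assms by (auto intro!: derivative_eq_intros simp: field_simps simp flip: has_real_derivative_iff_has_vector_derivative)
    show "norm (\<i> * k (w + \<i> * of_real x)) \<le> C / sqrt x" if x: "s < x" for x
    proof -
      have "norm (k (w + \<i> * of_real x)) \<le> C / sqrt (Im (w + \<i> * of_real x))" by (rule k_bound[OF inH]) (use x in simp)
      also have "\<dots> \<le> C / sqrt x"
        using assms x l l2 by (intro divide_left_mono mult_pos_pos) (auto simp: C_def)
      finally show ?thesis by (simp add: norm_mult)
    qed
  qed (use assms d in \<open>auto intro!: continuous_intros\<close>)
  then show ?thesis by (simp add: algebra_simps)
qed

text \<open>Since \<open>k = O(Im w powr (-1/2))\<close>, the primitive has a uniform limit on vertical approach to the real line.\<close>

lemma boundary_primitive: "\<exists>S. continuous_on Hb S \<and> (\<forall>w\<in>H. S w = S0 w)"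
proof -
  define Sn where "Sn n w = S0 (w + \<i> * of_real (1 / real (Suc n)))" for n w
  have inH: "w + \<i> * of_real (1 / real (Suc n)) \<in> H" if "w \<in> Hb" for n w
    using that by (simp add: H_def Hb_def add_nonneg_pos)
  have Cp: "C > 0" using l l2 by (simp add: C_def)
  have dist: "dist (Sn n w) (Sn m w) \<le> 2 * C * sqrt (1 / real (Suc n))" if "w \<in> Hb" "n \<le> m" for n m w
  proof (cases "n = m")
    case False
    have "norm (Sn n w - Sn m w) \<le> 2 * C * (sqrt (1 / real (Suc n)) - sqrt (1 / real (Suc m)))"
      unfolding Sn_def
      by (rule S0_vertical) (use that False in \<open>auto simp: Hb_def intro!: divide_strict_left_mono\<close>)
    also have "\<dots> \<le> 2 * C * sqrt (1 / real (Suc n))" using Cp by (intro mult_left_mono) auto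
    finally show ?thesis by (simp add: dist_norm)
  qed (use Cp in simp)
  have lim0: "(\<lambda>n. 2 * C * sqrt (1 / real (Suc n))) \<longlonglongrightarrow> 0"
  proof -
    have "(\<lambda>n. 2 * C * sqrt (1 / real (Suc n))) \<longlonglongrightarrow> 2 * C * sqrt 0"
      using LIMSEQ_inverse_real_of_nat by (intro tendsto_mult tendsto_const tendsto_real_sqrt) (simp add: inverse_eq_divide)
    then show ?thesis by simp
  qed
  have "uniformly_Cauchy_on Hb Sn"
    unfolding uniformly_Cauchy_on_def
  proof (intro allI impI)
    fix e :: real assume "e > 0"
    then obtain M where M: "\<And>n. n \<ge> M \<Longrightarrow> 2 * C * sqrt (1 / real (Suc n)) < e"
      using order_tendstoD(2)[OF lim0] unfolding eventually_sequentially by blast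
    show "\<exists>M. \<forall>w\<in>Hb. \<forall>m\<ge>M. \<forall>n\<ge>M. dist (Sn m w) (Sn n w) < e"
    proof (intro exI[of _ M] ballI allI impI)
      fix w m n assume w: "w \<in> Hb" "M \<le> m" "M \<le> n"
      show "dist (Sn m w) (Sn n w) < e"
      proof (cases "m \<le> n")
        case True then show ?thesis using dist[OF w(1) True] M[OF w(2)] by linarith
      next
        case False
        then have "n \<le> m" by simp
        then show ?thesis using dist[OF w(1) \<open>n \<le> m\<close>] M[OF w(3)] by (simp add: dist_commute)
      qed
    qed
  qed
  then have "uniformly_convergent_on Hb Sn" by (rule Cauchy_uniformly_convergent)
  then obtain S where S: "uniform_limit Hb Sn S sequentially" unfolding uniformly_convergent_on_def by blast
  have contS0: "continuous_on H S0"
  proof (rule continuous_at_imp_continuous_on, rule ballI)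
    fix x assume "x \<in> H" then show "isCont S0 x" using S0 DERIV_isCont by blast
  qed
  have "continuous_on Hb S"
  proof (rule uniform_limit_theorem[OF _ S])
    have "continuous_on Hb (Sn n)" for n unfolding Sn_def
      by (rule continuous_on_compose2[OF contS0]) (use inH in \<open>auto intro!: continuous_on_add continuous_on_id continuous_on_const\<close>)
    then show "\<forall>\<^sub>F n in sequentially. continuous_on Hb (Sn n)" by simp
  qed simp
  moreover have "S w = S0 w" if w: "w \<in> H" for w
  proof -
    have "(\<lambda>n. Sn n w) \<longlonglongrightarrow> S w" using tendsto_uniform_limitI[OF S, of w] w by (auto simp: H_def Hb_def)
    moreover have "(\<lambda>n. Sn n w) \<longlonglongrightarrow> S0 w"
      unfolding Sn_def
    proof (rule isCont_tendsto_compose[where g = S0])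
      show "isCont S0 w" using S0[OF w] DERIV_isCont by blast
      have "(\<lambda>n. w + \<i> * of_real (1 / real (Suc n))) \<longlonglongrightarrow> w + \<i> * of_real 0"
        using LIMSEQ_inverse_real_of_nat by (intro tendsto_add tendsto_mult tendsto_const tendsto_of_real) (simp add: inverse_eq_divide)
      then show "(\<lambda>n. w + \<i> * of_real (1 / real (Suc n))) \<longlonglongrightarrow> w" by simp
    qed
    ultimately show ?thesis by (rule LIMSEQ_unique)
  qed
  ultimately show ?thesis by blast
qed

definition S where "S = (let P = (SOME P. continuous_on Hb P \<and> (\<forall>w\<in>H. P w = S0 w)) in (\<lambda>w. P w - P 0))"

lemma S_props: "continuous_on Hb S" "w \<in> H \<Longrightarrow> (S has_field_derivative k w) (at w)" "S 0 = 0"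
proof -
  define P where "P = (SOME P. continuous_on Hb P \<and> (\<forall>w\<in>H. P w = S0 w))"
  have P: "continuous_on Hb P" "\<And>w. w \<in> H \<Longrightarrow> P w = S0 w"
    using someI_ex[OF boundary_primitive] unfolding P_def by blast+
  have S: "S = (\<lambda>w. P w - P 0)" by (simp add: S_def P_def Let_def)
  show "continuous_on Hb S" unfolding S by (intro continuous_on_diff P(1) continuous_on_const)
  show "S 0 = 0" by (simp add: S)
  assume w: "w \<in> H"
  have "(P has_field_derivative k w) (at w)"
    by (rule DERIV_cong_ev[THEN iffD1, OF refl _ refl S0[OF w]])
       (rule eventually_mono[OF eventually_nhds_in_open[OF H(1) w]], simp add: P(2))
  then show "(S has_field_derivative k w) (at w)"
    unfolding S by (auto intro!: derivative_eq_intros)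
qed

lemma holS: "S holomorphic_on H"
  unfolding holomorphic_on_def field_differentiable_def using S_props(2) has_field_derivative_at_within by blast

lemma H_Hb: "H \<subseteq> Hb" by (auto simp: H_def Hb_def)

section \<open>Derivatives of the map along the axes\<close>

text \<open>\<open>j\<close> continues \<open>k\<close> analytically across an interval of the real
  axis. A primitive of \<open>j\<close> in the vertical strip differs from \<open>S\<close> by a
  constant above the axis and, by continuity, on it; so along the axis \<open>S\<close> has the
  derivative \<open>j\<close>.\<close>

lemma boundary_derivative:
  assumes j: "j holomorphic_on {w. p < Re w \<and> Re w < q}" "\<And>w. w \<in> H \<Longrightarrow> p < Re w \<Longrightarrow> Re w < q \<Longrightarrow> j w = k w"
    and t: "p < t" "t < q"
  shows "((\<lambda>x. S (of_real x)) has_vector_derivative j (of_real t)) (at t)"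
proof -
  define B where "B = {w::complex. p < Re w \<and> Re w < q}"
  have Beq: "B = {w. p < Re w} \<inter> {w. Re w < q}" by (auto simp: B_def)
  have B: "convex B" "open B" unfolding Beq
    by (auto intro!: convex_Int open_Int convex_halfspace_Re_gt convex_halfspace_Re_lt open_halfspace_Re_gt open_halfspace_Re_lt)
  have jB: "j holomorphic_on B" using j(1) by (simp add: B_def)
  obtain P where P: "\<And>x. x \<in> B \<Longrightarrow> (P has_field_derivative j x) (at x within B)"
  proof (rule holomorphic_convex_primitive[of B "{}" j])
    show "j field_differentiable at x" if "x \<in> interior B - {}" for x
      using that jB B by (simp add: interior_open holomorphic_on_imp_differentiable_at)
  qed (use B jB holomorphic_on_imp_continuous_on in auto)
  have P: "(P has_field_derivative j x) (at x)" if "x \<in> B" for x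
    using P[OF that] at_within_open[OF that B(2)] by simp
  have "\<exists>c. \<forall>x\<in>B \<inter> H. S x - P x = c"
  proof (rule has_field_derivative_zero_constant)
    show "convex (B \<inter> H)" using B H by (simp add: convex_Int)
    fix x assume x: "x \<in> B \<inter> H"
    have "j x = k x" using j(2)[of x] x by (auto simp: B_def)
    then have "((\<lambda>x. S x - P x) has_field_derivative 0) (at x)"
      using S_props(2)[of x] P[of x] x by (auto intro!: derivative_eq_intros)
    then show "((\<lambda>x. S x - P x) has_field_derivative 0) (at x within B \<inter> H)" by (rule has_field_derivative_at_within)
  qed
  then obtain c where c: "\<And>x. x \<in> B \<Longrightarrow> x \<in> H \<Longrightarrow> S x - P x = c" by blast
  have cr: "S (of_real x) = P (of_real x) + c" if x: "p < x" "x < q" for x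
  proof -
    have xB: "of_real x \<in> B" using x by (simp add: B_def)
    have lim: "(\<lambda>n. of_real x + \<i> * of_real (1 / real (Suc n))) \<longlonglongrightarrow> of_real x + \<i> * of_real 0"
      using LIMSEQ_inverse_real_of_nat by (intro tendsto_add tendsto_mult tendsto_const tendsto_of_real) (simp add: inverse_eq_divide)
    have inH: "of_real x + \<i> * of_real (1 / real (Suc n)) \<in> H" "of_real x + \<i> * of_real (1 / real (Suc n)) \<in> B" for n
      using x by (auto simp: H_def B_def)
    have "(\<lambda>n. S (of_real x + \<i> * of_real (1 / real (Suc n)))) \<longlonglongrightarrow> S (of_real x + \<i> * of_real 0)"
      by (rule continuous_on_tendsto_compose[OF S_props(1) lim]) (use inH H_Hb in \<open>auto simp: Hb_def\<close>)
    moreover have "(\<lambda>n. P (of_real x + \<i> * of_real (1 / real (Suc n)))) \<longlonglongrightarrow> P (of_real x + \<i> * of_real 0)"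
      by (rule isCont_tendsto_compose[OF _ lim]) (use P[OF xB] DERIV_isCont in auto)
    ultimately have "(\<lambda>n. S (of_real x + \<i> * of_real (1 / real (Suc n))) - P (of_real x + \<i> * of_real (1 / real (Suc n))))
      \<longlonglongrightarrow> S (of_real x + \<i> * of_real 0) - P (of_real x + \<i> * of_real 0)" by (rule tendsto_diff)
    then have "(\<lambda>n::nat. c) \<longlonglongrightarrow> S (of_real x) - P (of_real x)" using c inH by simp
    then show ?thesis by (simp add: LIMSEQ_const_iff algebra_simps)
  qed
  have "((\<lambda>x. P (of_real x) + c) has_vector_derivative j (of_real t)) (at t)"
    using field_vector_diff_chain_at[OF has_vector_derivative_of_real[OF DERIV_ident] P[of "of_real t"]] t
    by (auto intro!: derivative_eq_intros simp: o_def B_def)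
  then show ?thesis
  proof (rule has_vector_derivative_transform_within_open[of _ _ _ "{p<..<q}"])
    show "P (of_real x) + c = S (of_real x)" if "x \<in> {p<..<q}" for x using cr[of x] that by simp
  qed (use t in auto)
qed

lemma right_slit1: "(of_real p)\<^sup>2 - w\<^sup>2 \<notin> \<real>\<^sub>\<le>\<^sub>0" if "0 < Re w" "Re w < p"
proof
  assume a: "(of_real p)\<^sup>2 - w\<^sup>2 \<in> \<real>\<^sub>\<le>\<^sub>0"
  then have "Im w = 0" "p\<^sup>2 \<le> (Re w)\<^sup>2" using sq_diff_nonneg[OF a] that by auto
  moreover have "(Re w)\<^sup>2 < p\<^sup>2" using that by (intro power_strict_mono) auto
  ultimately show False by simp
qed

lemma right_slit2: "w\<^sup>2 - (of_real p)\<^sup>2 \<notin> \<real>\<^sub>\<le>\<^sub>0" if "0 < p" "p < Re w"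
proof
  assume "w\<^sup>2 - (of_real p)\<^sup>2 \<in> \<real>\<^sub>\<le>\<^sub>0"
  then have "Re w * Im w = 0" "(Re w)\<^sup>2 - (Im w)\<^sup>2 \<le> p\<^sup>2" by (auto simp: complex_nonpos_Reals_iff power2_eq_square)
  moreover have "p\<^sup>2 < (Re w)\<^sup>2" using that by (intro power_strict_mono) auto
  ultimately show False using that by auto
qed

lemma csqrt_flip: "csqrt ((of_real p)\<^sup>2 - w\<^sup>2) = - \<i> * csqrt (w\<^sup>2 - (of_real p)\<^sup>2)" if "w \<in> H" "0 < Re w"
proof -
  have "Im (w\<^sup>2 - (of_real p)\<^sup>2) > 0" using that by (simp add: power2_eq_square H_def)
  from csqrt_uminus_upper[OF this] show ?thesis by simp
qed

lemma hol_csqrt_diff2: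
  assumes "\<And>w. w \<in> X \<Longrightarrow> w\<^sup>2 - (of_real p)\<^sup>2 \<notin> \<real>\<^sub>\<le>\<^sub>0"
  shows "(\<lambda>w. csqrt (w\<^sup>2 - (of_real p)\<^sup>2)) holomorphic_on X"
  by (rule holomorphic_on_csqrt')
     (use assms in \<open>auto intro!: holomorphic_on_diff holomorphic_on_power holomorphic_on_const holomorphic_on_ident\<close>)

lemma csq: "x \<le> y \<Longrightarrow> csqrt ((of_real y)\<^sup>2 - (of_real x)\<^sup>2) = of_real (sqrt (y\<^sup>2 - x\<^sup>2))" if "0 \<le> x" for x y :: real
proof -
  assume "x \<le> y"
  then have "x\<^sup>2 \<le> y\<^sup>2" using that by (intro power_mono)
  then show ?thesis by (simp add: csqrt_of_real flip: of_real_power of_real_diff)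
qed

lemma csq1: "0 \<le> x \<Longrightarrow> x \<le> 1 \<Longrightarrow> csqrt (1 - (of_real x)\<^sup>2) = of_real (sqrt (1 - x\<^sup>2))"
  using csq[of x 1] by simp
lemma csq2: "1 \<le> x \<Longrightarrow> csqrt ((of_real x)\<^sup>2 - 1) = of_real (sqrt (x\<^sup>2 - 1))"
  using csq[of 1 x] by simp

lemma csqrt_nz: "z \<notin> \<real>\<^sub>\<le>\<^sub>0 \<Longrightarrow> csqrt z \<noteq> 0" by auto

lemma deriv_0l:
  assumes "0 < t" "t < l"
  shows "((\<lambda>x. S (of_real x)) has_vector_derivative of_real (1 / (sqrt (1 - t\<^sup>2) * sqrt (l\<^sup>2 - t\<^sup>2)))) (at t)"
proof -
  have "k holomorphic_on {w. 0 < Re w \<and> Re w < l}"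
    by (rule hol_k) (use right_slit1[of _ 1] right_slit1[of _ l] l in auto)
  then have "((\<lambda>x. S (of_real x)) has_vector_derivative k (of_real t)) (at t)"
    by (rule boundary_derivative[of k 0 l]) (use assms in auto)
  moreover have "k (of_real t) = of_real (1 / (sqrt (1 - t\<^sup>2) * sqrt (l\<^sup>2 - t\<^sup>2)))"
    using assms l csq1[of t] csq[of t l] by (simp add: k_def)
  ultimately show ?thesis by simp
qed

text \<open>Past \<open>l\<close> the radicand \<open>l\<^sup>2 - w\<^sup>2\<close> changes sign. In
  the first quadrant its principal root is \<open>- \<i>\<close> times the root of the negative, and
  the reciprocal contributes the factor \<open>\<i>\<close>: the image curve turns left by a right
  angle.\<close>

lemma deriv_l1:
  assumes "l < t" "t < 1"
  shows "((\<lambda>x. S (of_real x)) has_vector_derivative \<i> * of_real (1 / (sqrt (1 - t\<^sup>2) * sqrt (t\<^sup>2 - l\<^sup>2)))) (at t)"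
proof -
  define j where "j w = \<i> / (csqrt ((of_real 1)\<^sup>2 - w\<^sup>2) * csqrt (w\<^sup>2 - (of_real l)\<^sup>2))" for w
  have "j holomorphic_on {w. l < Re w \<and> Re w < 1}"
    unfolding j_def
  proof (intro holomorphic_on_divide holomorphic_on_const holomorphic_on_mult hol_csqrt_diff hol_csqrt_diff2)
    fix w assume "w \<in> {w. l < Re w \<and> Re w < 1}"
    then show s: "(of_real 1)\<^sup>2 - w\<^sup>2 \<notin> \<real>\<^sub>\<le>\<^sub>0" "w\<^sup>2 - (of_real l)\<^sup>2 \<notin> \<real>\<^sub>\<le>\<^sub>0"
      using right_slit1[of w 1] right_slit2[of l w] l by auto
    show "csqrt ((of_real 1)\<^sup>2 - w\<^sup>2) * csqrt (w\<^sup>2 - (of_real l)\<^sup>2) \<noteq> 0"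
      using csqrt_nz[OF s(1)] csqrt_nz[OF s(2)] by (simp only: mult_eq_0_iff) blast
  qed
  moreover have "j w = k w" if "w \<in> H" "l < Re w" "Re w < 1" for w
  proof -
    have "csqrt ((of_real l)\<^sup>2 - w\<^sup>2) = - \<i> * csqrt (w\<^sup>2 - (of_real l)\<^sup>2)" using csqrt_flip[of w l] that l by simp
    moreover have "1 / (A * (- \<i> * B)) = \<i> / (A * B)" for A B :: complex
      by (cases "A = 0 \<or> B = 0") (auto simp: divide_simps)
    ultimately show ?thesis unfolding j_def k_def by (simp only: of_real_1 one_power2)
  qed
  ultimately have "((\<lambda>x. S (of_real x)) has_vector_derivative j (of_real t)) (at t)"
    by (rule boundary_derivative[of j l 1]) (use assms in auto)
  moreover have "j (of_real t) = \<i> * of_real (1 / (sqrt (1 - t\<^sup>2) * sqrt (t\<^sup>2 - l\<^sup>2)))"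
    using assms l csq1[of t] csq[of l t] by (simp add: j_def)
  ultimately show ?thesis by simp
qed

text \<open>Both radicands have changed sign, and \<open>\<i> * \<i> = - 1\<close> sends the image
  curve back to the left.\<close>

lemma deriv_1:
  assumes "1 < t"
  shows "((\<lambda>x. S (of_real x)) has_vector_derivative of_real (- 1 / (sqrt (t\<^sup>2 - 1) * sqrt (t\<^sup>2 - l\<^sup>2)))) (at t)"
proof -
  define j where "j w = - 1 / (csqrt (w\<^sup>2 - (of_real 1)\<^sup>2) * csqrt (w\<^sup>2 - (of_real l)\<^sup>2))" for w
  have "j holomorphic_on {w. 1 < Re w \<and> Re w < t + 1}"
    unfolding j_def
  proof (intro holomorphic_on_divide holomorphic_on_const holomorphic_on_mult hol_csqrt_diff2)
    fix w assume "w \<in> {w. 1 < Re w \<and> Re w < t + 1}"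
    then show s: "w\<^sup>2 - (of_real 1)\<^sup>2 \<notin> \<real>\<^sub>\<le>\<^sub>0" "w\<^sup>2 - (of_real l)\<^sup>2 \<notin> \<real>\<^sub>\<le>\<^sub>0"
      using right_slit2[of 1 w] right_slit2[of l w] l by auto
    show "csqrt (w\<^sup>2 - (of_real 1)\<^sup>2) * csqrt (w\<^sup>2 - (of_real l)\<^sup>2) \<noteq> 0"
      using csqrt_nz[OF s(1)] csqrt_nz[OF s(2)] by (simp only: mult_eq_0_iff) blast
  qed
  moreover have "j w = k w" if "w \<in> H" "1 < Re w" "Re w < t + 1" for w
  proof -
    have "csqrt ((of_real l)\<^sup>2 - w\<^sup>2) = - \<i> * csqrt (w\<^sup>2 - (of_real l)\<^sup>2)"
      "csqrt (1 - w\<^sup>2) = - \<i> * csqrt (w\<^sup>2 - 1)" using csqrt_flip[of w l] csqrt_flip[of w 1] that l by auto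
    then show ?thesis by (simp add: j_def k_def field_simps)
  qed
  ultimately have "((\<lambda>x. S (of_real x)) has_vector_derivative j (of_real t)) (at t)"
    by (rule boundary_derivative[of j 1 "t+1"]) (use assms in auto)
  moreover have "j (of_real t) = of_real (- 1 / (sqrt (t\<^sup>2 - 1) * sqrt (t\<^sup>2 - l\<^sup>2)))"
    using assms l csq2[of t] csq[of l t] by (simp add: j_def)
  ultimately show ?thesis by simp
qed

lemma deriv_i:
  assumes "0 < y"
  shows "((\<lambda>y. S (\<i> * of_real y)) has_vector_derivative \<i> * of_real (1 / (sqrt (1 + y\<^sup>2) * sqrt (l\<^sup>2 + y\<^sup>2)))) (at y)"
proof -
  have "((\<lambda>x. \<i> * of_real x) has_vector_derivative \<i>) (at y)"
    by (auto intro!: derivative_eq_intros has_vector_derivative_of_real)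
  moreover have "\<i> * of_real y \<in> H" using assms by (simp add: H_def)
  ultimately have "((\<lambda>x. S (\<i> * of_real x)) has_vector_derivative \<i> * k (\<i> * of_real y)) (at y)"
    using field_vector_diff_chain_at[of "\<lambda>x. \<i> * of_real x" \<i> y S] S_props(2) by (simp add: o_def)
  moreover have "k (\<i> * of_real y) = of_real (1 / (sqrt (1 + y\<^sup>2) * sqrt (l\<^sup>2 + y\<^sup>2)))"
  proof -
    have "csqrt ((of_real p)\<^sup>2 - (\<i> * of_real y)\<^sup>2) = of_real (sqrt (p\<^sup>2 + y\<^sup>2))" for p
      by (simp add: power_mult_distrib csqrt_of_real flip: of_real_power of_real_add)
    from this[of 1] this[of l] show ?thesis by (simp add: k_def)
  qed
  ultimately show ?thesis by simp
qed

end

lemma vector_derivative_Re_Im: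
  assumes "(f has_vector_derivative c) (at t)"
  shows "((\<lambda>x. Re (f x)) has_real_derivative Re c) (at t)" "((\<lambda>x. Im (f x)) has_real_derivative Im c) (at t)"
  using bounded_linear.has_vector_derivative[OF bounded_linear_Re assms]
    bounded_linear.has_vector_derivative[OF bounded_linear_Im assms]
  by (simp_all add: has_real_derivative_iff_has_vector_derivative)

lemma csqrt_lower: "Im X < 0 \<Longrightarrow> Re (csqrt X) > 0 \<and> Im (csqrt X) < 0"
proof -
  assume a: "Im X < 0"
  have n: "\<bar>Re X\<bar> < norm X" using a by (simp add: cmod_def real_less_rsqrt)
  then have "0 < (norm X + Re X)/2" "0 < (norm X - Re X)/2" by auto
  then show ?thesis using a by (simp add: csqrt.simps)
qed

section \<open>Boundary correspondence and behaviour at infinity\<close>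

context schwarz_christoffel
begin

definition Q where "Q = {w::complex. 0 < Re w \<and> 0 < Im w}"
definition Qb where "Qb = {w::complex. 0 \<le> Re w \<and> 0 \<le> Im w}"
text \<open>By the derivatives along the real axis, \<open>a\<close> is the complete elliptic
  integral of the first kind with modulus \<open>l\<close>, and \<open>b\<close> the one with the
  complementary modulus.\<close>

definition a where "a = Re (S (of_real l))"
definition b where "b = Im (S 1)"

lemma Qb_Hb: "Qb \<subseteq> Hb" by (auto simp: Qb_def Hb_def)
lemma Q_H: "Q \<subseteq> H" by (auto simp: Q_def H_def)

lemma contr: "continuous_on X (\<lambda>t::real. S (of_real t))"
  by (rule continuous_on_compose2[OF S_props(1)]) (auto simp: Hb_def intro!: continuous_intros)

lemma conti: "X \<subseteq> {0..} \<Longrightarrow> continuous_on X (\<lambda>t::real. S (\<i> * of_real t))"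
  by (rule continuous_on_compose2[OF S_props(1)]) (auto simp: Hb_def intro!: continuous_intros)

lemma sqrt_pos: "0 \<le> s \<Longrightarrow> s < t \<Longrightarrow> 0 < sqrt (t\<^sup>2 - s\<^sup>2)" by (simp add: power_strict_mono)

lemma sq1: "0 \<le> t \<Longrightarrow> t < 1 \<Longrightarrow> 0 < sqrt (1 - t\<^sup>2)" "1 < t \<Longrightarrow> 0 < sqrt (t\<^sup>2 - 1)"
  using sqrt_pos[of t 1] sqrt_pos[of 1 t] by auto

lemma d1pos: "0 < t \<Longrightarrow> t < l \<Longrightarrow> 0 < 1 / (sqrt (1 - t\<^sup>2) * sqrt (l\<^sup>2 - t\<^sup>2))"
  using sq1(1)[of t] sqrt_pos[of t l] l by (intro divide_pos_pos mult_pos_pos) auto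
lemma d2pos: "l < t \<Longrightarrow> t < 1 \<Longrightarrow> 0 < 1 / (sqrt (1 - t\<^sup>2) * sqrt (t\<^sup>2 - l\<^sup>2))"
  using sq1(1)[of t] sqrt_pos[of l t] l by (intro divide_pos_pos mult_pos_pos) auto
lemma d3pos: "1 < t \<Longrightarrow> 0 < 1 / (sqrt (t\<^sup>2 - 1) * sqrt (t\<^sup>2 - l\<^sup>2))"
  using sq1(2)[of t] sqrt_pos[of l t] l by (intro divide_pos_pos mult_pos_pos) auto
lemma d4pos: "0 < 1 / (sqrt (1 + y\<^sup>2) * sqrt (l\<^sup>2 + y\<^sup>2))"
  using l by (intro divide_pos_pos mult_pos_pos) (auto intro: add_pos_nonneg)

text \<open>The lemmas \<open>bd_...\<close> trace the boundary of the rectangle with corners 0,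
  \<open>a\<close>, \<open>a + \<i> * b\<close> and \<open>\<i> * b\<close>: the bottom over
  \<open>[0, l]\<close>, the right side over \<open>[l, 1]\<close>, the top from right to left over
  \<open>[1, \<infinity>)\<close>, and the left side upwards along the imaginary axis. The corner
  \<open>\<i> * b\<close> is the value at infinity.\<close>

lemma bd_0l_Im: "0 \<le> t \<Longrightarrow> t \<le> l \<Longrightarrow> Im (S (of_real t)) = 0"
proof (cases "t = 0")
  case False
  assume t: "0 \<le> t" "t \<le> l"
  have "Im (S (of_real t)) = Im (S (of_real 0))"
  proof (rule DERIV_isconst_end[where f = "\<lambda>t. Im (S (of_real t))"])
    show "((\<lambda>t. Im (S (of_real t))) has_real_derivative 0) (at x)" if "0 < x" "x < t" for x
      using vector_derivative_Re_Im(2)[OF deriv_0l[of x]] that t by simp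
  qed (use t False in \<open>auto intro!: continuous_on_Im contr\<close>)
  then show ?thesis by (simp add: S_props)
qed (simp add: S_props)

lemma bd_0l_Re: "0 \<le> s \<Longrightarrow> s < t \<Longrightarrow> t \<le> l \<Longrightarrow> Re (S (of_real s)) < Re (S (of_real t))"
proof (rule DERIV_pos_imp_increasing_open[where f = "\<lambda>t. Re (S (of_real t))"])
  assume t: "0 \<le> s" "s < t" "t \<le> l"
  show "\<exists>y. ((\<lambda>t. Re (S (of_real t))) has_real_derivative y) (at x) \<and> 0 < y" if "s < x" "x < t" for x
    using vector_derivative_Re_Im(1)[OF deriv_0l[of x]] d1pos[of x] that t by force
qed (auto intro!: continuous_on_Re contr)

lemma bd_l1_Re: "l \<le> t \<Longrightarrow> t \<le> 1 \<Longrightarrow> Re (S (of_real t)) = a"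
proof (cases "t = l")
  case False
  assume t: "l \<le> t" "t \<le> 1"
  have "Re (S (of_real t)) = Re (S (of_real l))"
  proof (rule DERIV_isconst_end[where f = "\<lambda>t. Re (S (of_real t))"])
    show "((\<lambda>t. Re (S (of_real t))) has_real_derivative 0) (at x)" if "l < x" "x < t" for x
      using vector_derivative_Re_Im(1)[OF deriv_l1[of x]] that t by simp
  qed (use t False in \<open>auto intro!: continuous_on_Re contr\<close>)
  then show ?thesis by (simp add: a_def)
qed (simp add: a_def)

lemma bd_l1_Im: "l \<le> s \<Longrightarrow> s < t \<Longrightarrow> t \<le> 1 \<Longrightarrow> Im (S (of_real s)) < Im (S (of_real t))"
proof (rule DERIV_pos_imp_increasing_open[where f = "\<lambda>t. Im (S (of_real t))"])
  assume t: "l \<le> s" "s < t" "t \<le> 1"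
  show "\<exists>y. ((\<lambda>t. Im (S (of_real t))) has_real_derivative y) (at x) \<and> 0 < y" if "s < x" "x < t" for x
    using vector_derivative_Re_Im(2)[OF deriv_l1[of x]] d2pos[of x] that t by force
qed (auto intro!: continuous_on_Im contr)

lemma bd_1_Im: "1 \<le> t \<Longrightarrow> Im (S (of_real t)) = b"
proof (cases "t = 1")
  case False
  assume t: "1 \<le> t"
  have "Im (S (of_real t)) = Im (S (of_real 1))"
  proof (rule DERIV_isconst_end[where f = "\<lambda>t. Im (S (of_real t))"])
    show "((\<lambda>t. Im (S (of_real t))) has_real_derivative 0) (at x)" if "1 < x" "x < t" for x
      using vector_derivative_Re_Im(2)[OF deriv_1[of x]] that t by simp
  qed (use t False in \<open>auto intro!: continuous_on_Im contr\<close>)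
  then show ?thesis by (simp add: b_def)
qed (simp add: b_def)

lemma bd_1_Re: "1 \<le> s \<Longrightarrow> s < t \<Longrightarrow> Re (S (of_real t)) < Re (S (of_real s))"
proof (rule DERIV_neg_imp_decreasing_open[where f = "\<lambda>t. Re (S (of_real t))"])
  assume t: "1 \<le> s" "s < t"
  show "\<exists>y. ((\<lambda>t. Re (S (of_real t))) has_real_derivative y) (at x) \<and> y < 0" if "s < x" "x < t" for x
    using vector_derivative_Re_Im(1)[OF deriv_1[of x]] d3pos[of x] that t by force
qed (auto intro!: continuous_on_Re contr)

lemma bd_i_Re: "0 \<le> t \<Longrightarrow> Re (S (\<i> * of_real t)) = 0"
proof (cases "t = 0")
  case False
  assume t: "0 \<le> t"
  have "Re (S (\<i> * of_real t)) = Re (S (\<i> * of_real 0))"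
  proof (rule DERIV_isconst_end[where f = "\<lambda>t. Re (S (\<i> * of_real t))"])
    show "((\<lambda>t. Re (S (\<i> * of_real t))) has_real_derivative 0) (at x)" if "0 < x" "x < t" for x
      using vector_derivative_Re_Im(1)[OF deriv_i[of x]] that t by simp
  qed (use t False in \<open>auto intro!: continuous_on_Re conti\<close>)
  then show ?thesis by (simp add: S_props)
qed (simp add: S_props)

lemma bd_i_Im: "0 \<le> s \<Longrightarrow> s < t \<Longrightarrow> Im (S (\<i> * of_real s)) < Im (S (\<i> * of_real t))"
proof (rule DERIV_pos_imp_increasing_open[where f = "\<lambda>t. Im (S (\<i> * of_real t))"])
  assume t: "0 \<le> s" "s < t"
  show "\<exists>y. ((\<lambda>t. Im (S (\<i> * of_real t))) has_real_derivative y) (at x) \<and> 0 < y" if "s < x" "x < t" for x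
    using vector_derivative_Re_Im(2)[OF deriv_i[of x]] d4pos[of x] that t by force
  show "continuous_on {s..t} (\<lambda>t. Im (S (\<i> * of_real t)))" using t by (intro continuous_on_Im conti) auto
qed

lemma ab_pos: "a > 0" "b > 0"
proof -
  show "a > 0" using bd_0l_Re[of 0 l] l by (simp add: a_def S_props)
  show "b > 0" using bd_l1_Im[of l 1] bd_0l_Im[of l] l by (simp add: b_def)
qed

lemma S_l: "S (of_real l) = of_real a" using bd_0l_Im[of l] l by (simp add: a_def complex_eq_iff)

text \<open>The decay of \<open>k\<close> is integrated upwards, using that
  \<open>\<bar>w + \<i> * x\<bar>\<close> is at least \<open>(\<bar>w\<bar> + x) / sqrt 2\<close> in
  the closed half plane.\<close>

lemma S_vertical:
  assumes "w \<in> Hb" "norm w \<ge> 2" "0 \<le> t"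
  shows "norm (S (w + \<i> * of_real t) - S w) \<le> 4 / norm w"
proof (cases "t = 0")
  case False
  have y: "0 \<le> Im w" using assms by (simp add: Hb_def)
  have inH: "w + \<i> * of_real x \<in> H" if "0 < x" for x using y that by (simp add: H_def)
  have d: "((\<lambda>x. S (w + \<i> * of_real x)) has_vector_derivative \<i> * k (w + \<i> * of_real x)) (at x)" if "0 < x" for x
  proof -
    have "((\<lambda>x. w + \<i> * of_real x) has_vector_derivative \<i>) (at x)"
      by (auto intro!: derivative_eq_intros has_vector_derivative_of_real)
    from field_vector_diff_chain_at[OF this S_props(2)[OF inH[OF that]]] show ?thesis by (simp add: o_def)
  qed
  have bnd: "norm (\<i> * k (w + \<i> * of_real x)) \<le> 4 / (norm w + x)\<^sup>2" if x: "0 < x" for x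
  proof -
    have "(norm w)\<^sup>2 + x\<^sup>2 \<le> (norm (w + \<i> * of_real x))\<^sup>2"
      using y x by (simp add: cmod_power2 power2_sum)
    moreover have "(norm w + x)\<^sup>2 \<le> 2 * ((norm w)\<^sup>2 + x\<^sup>2)"
      using sum_squares_bound[of "norm w" x] by (simp add: power2_sum)
    ultimately have 1: "(norm w + x)\<^sup>2 / 2 \<le> (norm (w + \<i> * of_real x))\<^sup>2" by simp
    have pos: "0 < (norm w + x)\<^sup>2" using assms x by (intro zero_less_power) auto
    have "(norm w)\<^sup>2 \<le> (norm (w + \<i> * of_real x))\<^sup>2"
      using \<open>(norm w)\<^sup>2 + x\<^sup>2 \<le> _\<close> zero_le_power2[of x] by linarith
    then have "norm w \<le> norm (w + \<i> * of_real x)" by (rule power2_le_imp_le) simp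
    then have "norm (k (w + \<i> * of_real x)) \<le> 2 / (norm (w + \<i> * of_real x))\<^sup>2" using assms by (intro k_decay) simp
    also have "\<dots> \<le> 2 / ((norm w + x)\<^sup>2 / 2)" using 1 pos by (intro divide_left_mono mult_pos_pos) auto
    finally show ?thesis by (simp add: norm_mult)
  qed
  have "norm (S (w + \<i> * of_real t) - S (w + \<i> * of_real 0)) \<le> (- 4 / (norm w + t)) - (- 4 / (norm w + 0))"
  proof (rule differentiable_bound_general[where f = "\<lambda>x. S (w + \<i> * of_real x)" and \<phi> = "\<lambda>x. - 4 / (norm w + x)"
       and f' = "\<lambda>x. \<i> * k (w + \<i> * of_real x)" and \<phi>' = "\<lambda>x. 4 / (norm w + x)\<^sup>2"])
    show "continuous_on {0..t} (\<lambda>x. S (w + \<i> * of_real x))"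
      by (rule continuous_on_compose2[OF S_props(1)]) (use y in \<open>auto simp: Hb_def intro!: continuous_intros\<close>)
    show "continuous_on {0..t} (\<lambda>x. - 4 / (norm w + x))"
      using assms by (intro continuous_intros) auto
    show "((\<lambda>x. - 4 / (norm w + x)) has_vector_derivative 4 / (norm w + x)\<^sup>2) (at x)" if "0 < x" for x
    proof -
      have "norm w + x \<noteq> 0" using that assms by auto
      then show ?thesis
        by (auto intro!: derivative_eq_intros simp: power2_eq_square simp flip: has_real_derivative_iff_has_vector_derivative)
    qed
  qed (use False assms d bnd in auto)
  moreover have "4 / (norm w + t) \<ge> 0" using assms by (intro divide_nonneg_nonneg add_nonneg_nonneg) auto
  moreover have "(- 4 / (norm w + t)) - (- 4 / (norm w + 0)) = 4 / norm w - 4 / (norm w + t)" by simp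
  moreover have "w + \<i> * of_real 0 = w" by simp
  ultimately show ?thesis by (simp only:)
qed simp

lemma S_horizontal:
  assumes "0 \<le> x" "2 \<le> Y"
  shows "norm (S (Complex x Y) - S (Complex 0 Y)) \<le> 2 * x / Y\<^sup>2"
proof (cases "x = 0")
  case False
  have e: "Complex t Y = of_real t + \<i> * of_real Y" for t by (simp add: complex_eq_iff)
  have inH: "Complex t Y \<in> H" for t using assms by (simp add: H_def)
  have d: "((\<lambda>x. S (Complex x Y)) has_vector_derivative k (Complex t Y)) (at t)" for t
  proof -
    have "((\<lambda>x. of_real x + \<i> * of_real Y) has_vector_derivative 1) (at t)"
      by (auto intro!: derivative_eq_intros has_vector_derivative_of_real[OF DERIV_ident, simplified])
    from field_vector_diff_chain_at[OF this] S_props(2)[OF inH[of t]] show ?thesis unfolding e by (simp add: o_def)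
  qed
  have "norm (S (Complex x Y) - S (Complex 0 Y)) \<le> 2 / Y\<^sup>2 * x - 2 / Y\<^sup>2 * 0"
  proof (rule differentiable_bound_general[where f = "\<lambda>x. S (Complex x Y)" and \<phi> = "\<lambda>x. 2 / Y\<^sup>2 * x"
       and f' = "\<lambda>x. k (Complex x Y)" and \<phi>' = "\<lambda>x. 2 / Y\<^sup>2"])
    show "continuous_on {0..x} (\<lambda>x. S (Complex x Y))"
      using d by (intro continuous_at_imp_continuous_on) (auto intro: has_vector_derivative_continuous)
    show "norm (k (Complex t Y)) \<le> 2 / Y\<^sup>2" for t
    proof -
      have Y: "Y \<le> norm (Complex t Y)" using abs_Im_le_cmod[of "Complex t Y"] assms by simp
      then have "norm (k (Complex t Y)) \<le> 2 / (norm (Complex t Y))\<^sup>2" using assms by (intro k_decay) simp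
      also have "\<dots> \<le> 2 / Y\<^sup>2" using Y assms by (intro divide_left_mono power_mono mult_pos_pos zero_less_power) auto
      finally show ?thesis .
    qed
    show "((\<lambda>x. 2 / Y\<^sup>2 * x) has_vector_derivative 2 / Y\<^sup>2) (at t)" for t
      unfolding has_real_derivative_iff_has_vector_derivative[symmetric] by (rule DERIV_cmult_Id)
  qed (use False assms d in \<open>auto intro!: continuous_intros\<close>)
  then show ?thesis by simp
qed simp

text \<open>Both points are moved up to a common height \<open>Y\<close> and joined through the
  imaginary axis. The vertical moves cost \<open>4 / norm w1\<close> and \<open>4 / norm w2\<close>;
  the horizontal ones cost \<open>O(1 / Y\<^sup>2)\<close> and vanish as \<open>Y\<close>
  grows.\<close>

lemma S_far2:
  assumes "w1 \<in> Qb" "w2 \<in> Qb" "norm w1 \<ge> 2" "norm w2 \<ge> 2"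
  shows "norm (S w1 - S w2) \<le> 4 / norm w1 + 4 / norm w2"
proof -
  have far1: "norm (S w - S (Complex 0 Y)) \<le> 4 / norm w + 2 * Re w / Y\<^sup>2"
    if "w \<in> Qb" "norm w \<ge> 2" "Y \<ge> Im w" "Y \<ge> 2" for w Y
  proof -
    have e: "w + \<i> * of_real (Y - Im w) = Complex (Re w) Y" by (simp add: complex_eq_iff)
    have "norm (S (Complex (Re w) Y) - S w) \<le> 4 / norm w"
      using S_vertical[of w "Y - Im w"] that Qb_Hb unfolding e by auto
    moreover have "norm (S (Complex (Re w) Y) - S (Complex 0 Y)) \<le> 2 * Re w / Y\<^sup>2"
      using that by (intro S_horizontal) (auto simp: Qb_def)
    ultimately show ?thesis
      using norm_triangle_ineq4[of "S (Complex (Re w) Y) - S (Complex 0 Y)" "S (Complex (Re w) Y) - S w"] by simp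
  qed
  have "(\<lambda>n. 4 / norm w1 + 2 * Re w1 / (real n)\<^sup>2 + (4 / norm w2 + 2 * Re w2 / (real n)\<^sup>2)) \<longlonglongrightarrow>
     4 / norm w1 + 0 + (4 / norm w2 + 0)"
    by (intro tendsto_intros tendsto_divide_0[OF tendsto_const] filterlim_at_top_imp_at_infinity
        filterlim_pow_at_top filterlim_real_sequentially) auto
  moreover have "\<forall>\<^sub>F n in sequentially. norm (S w1 - S w2) \<le> 4 / norm w1 + 2 * Re w1 / (real n)\<^sup>2 + (4 / norm w2 + 2 * Re w2 / (real n)\<^sup>2)"
    using eventually_ge_at_top[of "nat \<lceil>max 2 (max (Im w1) (Im w2))\<rceil>"]
  proof eventually_elim
    case (elim n)
    then have "real n \<ge> max 2 (max (Im w1) (Im w2))" by linarith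
    then have n: "real n \<ge> 2" "real n \<ge> Im w1" "real n \<ge> Im w2" by auto
    show ?case using far1[OF assms(1,3) n(2,1)] far1[OF assms(2,4) n(3,1)]
        norm_triangle_ineq4[of "S w1 - S (Complex 0 (real n))" "S w2 - S (Complex 0 (real n))"] by simp
  qed
  ultimately have "norm (S w1 - S w2) \<le> 4 / norm w1 + 0 + (4 / norm w2 + 0)"
    by (rule tendsto_lowerbound[OF _ _ sequentially_bot])
  then show ?thesis by simp
qed

text \<open>The limit at infinity is identified from two directions: on the imaginary axis the real
  part is 0, on \<open>[1, \<infinity>)\<close> the imaginary part is \<open>b\<close>, and
  \<open>S_far2\<close> makes the two directions share their limit.\<close>

lemma S_far:
  assumes "w \<in> Qb" "norm w \<ge> 2"
  shows "norm (S w - Complex 0 b) \<le> 4 / norm w"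
proof -
  have lim: "(\<lambda>n. A + c / real n) \<longlonglongrightarrow> A" for A c :: real
    using tendsto_add[OF tendsto_const[of A] lim_const_over_n[of c]] by simp
  have Re0: "\<bar>Re (S (of_real t))\<bar> \<le> 4 / t" if t: "t \<ge> 2" for t
  proof (rule tendsto_lowerbound[OF lim[of "4/t" 4] _ sequentially_bot])
    show "\<forall>\<^sub>F n in sequentially. \<bar>Re (S (of_real t))\<bar> \<le> 4 / t + 4 / real n"
      using eventually_ge_at_top[of 2]
    proof eventually_elim
      case (elim n)
      have "norm (S (of_real t) - S (\<i> * of_real (real n))) \<le> 4 / t + 4 / real n"
        using S_far2[of "of_real t" "\<i> * of_real (real n)"] t elim by (auto simp: Qb_def norm_mult)
      then show ?case using abs_Re_le_cmod[of "S (of_real t) - S (\<i> * of_real (real n))"] bd_i_Re[of "real n"] by simp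
    qed
  qed
  show ?thesis
  proof (rule tendsto_lowerbound[OF lim[of "4 / norm w" 8] _ sequentially_bot])
    show "\<forall>\<^sub>F n in sequentially. norm (S w - Complex 0 b) \<le> 4 / norm w + 8 / real n"
      using eventually_ge_at_top[of 2]
    proof eventually_elim
      case (elim n)
      have "norm (S w - S (of_real (real n))) \<le> 4 / norm w + 4 / real n"
        using S_far2[of w "of_real (real n)"] assms elim by (auto simp: Qb_def)
      moreover have "S (of_real (real n)) - Complex 0 b = of_real (Re (S (of_real (real n))))"
        using bd_1_Im[of "real n"] elim by (simp add: complex_eq_iff)
      then have "norm (S (of_real (real n)) - Complex 0 b) \<le> 4 / real n" using Re0[of "real n"] elim by (simp only: norm_of_real)
      moreover have "norm (S w - Complex 0 b) \<le> norm (S w - S (of_real (real n))) + norm (S (of_real (real n)) - Complex 0 b)"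
        using norm_triangle_ineq[of "S w - S (of_real (real n))" "S (of_real (real n)) - Complex 0 b"] by simp
      ultimately show ?case by simp
    qed
  qed
qed

lemma bd_i_lt: "0 \<le> y \<Longrightarrow> Im (S (\<i> * of_real y)) < b"
proof -
  assume y: "0 \<le> y"
  have lim: "(\<lambda>n. b + 4 / real n) \<longlonglongrightarrow> b"
    using tendsto_add[OF tendsto_const[of b] lim_const_over_n[of 4]] by simp
  have "Im (S (\<i> * of_real (y + 1))) \<le> b"
  proof (rule tendsto_lowerbound[OF lim _ sequentially_bot])
    show "\<forall>\<^sub>F n in sequentially. Im (S (\<i> * of_real (y + 1))) \<le> b + 4 / real n"
      using eventually_ge_at_top[of "nat \<lceil>y + 2\<rceil>"]
    proof eventually_elim
      case (elim n)
      then have n: "real n \<ge> y + 2" by linarith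
      have "norm (S (\<i> * of_real (real n)) - Complex 0 b) \<le> 4 / real n"
        using S_far[of "\<i> * of_real (real n)"] n y by (auto simp: Qb_def norm_mult)
      then have "Im (S (\<i> * of_real (real n))) \<le> b + 4 / real n"
        using abs_Im_le_cmod[of "S (\<i> * of_real (real n)) - Complex 0 b"] by simp
      moreover have "Im (S (\<i> * of_real (y + 1))) < Im (S (\<i> * of_real (real n)))" using n y by (intro bd_i_Im) auto
      ultimately show ?case by simp
    qed
  qed
  then show ?thesis using bd_i_Im[of y "y+1"] y by simp
qed

lemma bd_1_pos: "1 \<le> t \<Longrightarrow> 0 < Re (S (of_real t))"
proof -
  assume t: "1 \<le> t"
  have lim: "(\<lambda>n. - 4 / real n) \<longlonglongrightarrow> 0" by (rule lim_const_over_n)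
  have "0 \<le> Re (S (of_real (t + 1)))"
  proof (rule tendsto_upperbound[OF lim _ sequentially_bot])
    show "\<forall>\<^sub>F n in sequentially. - 4 / real n \<le> Re (S (of_real (t + 1)))"
      using eventually_ge_at_top[of "nat \<lceil>t + 2\<rceil>"]
    proof eventually_elim
      case (elim n)
      then have n: "real n \<ge> t + 2" by linarith
      have "norm (S (of_real (real n)) - Complex 0 b) \<le> 4 / real n"
        using S_far[of "of_real (real n)"] n t by (auto simp: Qb_def)
      then have "- 4 / real n \<le> Re (S (of_real (real n)))"
        using abs_Re_le_cmod[of "S (of_real (real n)) - Complex 0 b"] by simp
      moreover have "Re (S (of_real (real n))) < Re (S (of_real (t + 1)))" using n t by (intro bd_1_Re) auto
      ultimately show ?case by simp
    qed
  qed
  then show ?thesis using bd_1_Re[of t "t+1"] t by simp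
qed

section \<open>Univalence and image of the map\<close>

text \<open>In the open quadrant both radicands lie in the lower half plane, so both roots lie in
  the fourth quadrant and their product has negative imaginary part.\<close>

lemma Im_k_pos: "w \<in> Q \<Longrightarrow> Im (k w) > 0"
proof -
  assume w: "w \<in> Q"
  have neg: "Im ((of_real p)\<^sup>2 - w\<^sup>2) < 0" for p
  proof -
    have "0 < Re w * Im w" using w by (intro mult_pos_pos) (auto simp: Q_def)
    moreover have "Im ((of_real p)\<^sup>2 - w\<^sup>2) = - 2 * (Re w * Im w)" by (simp add: power2_eq_square)
    ultimately show ?thesis by simp
  qed
  define A where "A = csqrt (1 - w\<^sup>2)"
  define B where "B = csqrt ((of_real l)\<^sup>2 - w\<^sup>2)"
  have A: "Re A > 0" "Im A < 0" using csqrt_lower[OF neg[of 1]] by (auto simp: A_def)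
  have B: "Re B > 0" "Im B < 0" using csqrt_lower[OF neg[of l]] by (auto simp: B_def)
  have "Re A * Im B < 0" "Im A * Re B < 0" using A B by (auto intro: mult_pos_neg mult_neg_pos)
  then have neg: "Im (A * B) < 0" by simp
  then have nz: "A * B \<noteq> 0" by (metis less_irrefl zero_complex.sel(2))
  have "Im (1 / (A * B)) = - Im (A * B) / (norm (A * B))\<^sup>2" unfolding cmod_power2 by (simp add: Im_divide)
  also have "\<dots> > 0" by (rule divide_pos_pos) (use neg nz in \<open>auto simp del: mult_eq_0_iff norm_mult times_complex.sel\<close>)
  finally have "Im (1 / (A * B)) > 0" .
  then show ?thesis by (simp add: k_def A_def B_def)
qed

text \<open>The argument of Noshiro and Warschawski: a derivative with positive imaginary part makes
  \<open>Im (S / d)\<close> strictly increasing along a segment of direction \<open>d\<close>. For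
  two points on a common axis the segment would run along the boundary; that case is left to the
  monotonicity of the boundary values.\<close>

lemma S_inj_aux:
  assumes w: "w1 \<in> Qb" "w2 \<in> Qb" "\<not> (Re w1 = 0 \<and> Re w2 = 0)" "\<not> (Im w1 = 0 \<and> Im w2 = 0)" "w1 \<noteq> w2"
  shows "S w1 \<noteq> S w2"
proof
  assume eq: "S w1 = S w2"
  define d where "d = w2 - w1"
  have d0: "d \<noteq> 0" using w by (simp add: d_def)
  define \<gamma> where "\<gamma> t = w1 + of_real t * d" for t :: real
  have conv: "Re (\<gamma> t) = (1 - t) * Re w1 + t * Re w2" "Im (\<gamma> t) = (1 - t) * Im w1 + t * Im w2" for t
    by (simp_all add: \<gamma>_def d_def algebra_simps)
  have pos: "0 < (1 - t) * x + t * y" if "0 \<le> x" "0 \<le> y" "\<not> (x = 0 \<and> y = 0)" "0 < t" "t < 1" for x y t :: real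
  proof -
    have "0 \<le> (1 - t) * x" "0 \<le> t * y" using that by auto
    moreover have "0 < (1 - t) * x \<or> 0 < t * y" using that by auto
    ultimately show ?thesis by linarith
  qed
  have nonneg: "0 \<le> (1 - t) * x + t * y" if "0 \<le> x" "0 \<le> y" "0 \<le> t" "t \<le> 1" for x y t :: real
    using that by simp
  have inQ: "\<gamma> t \<in> Q" if "0 < t" "t < 1" for t
    unfolding Q_def mem_Collect_eq conv using w that by (intro conjI pos) (auto simp: Qb_def)
  have inQb: "\<gamma> t \<in> Qb" if "0 \<le> t" "t \<le> 1" for t
    unfolding Qb_def mem_Collect_eq conv using w that by (intro conjI nonneg) (auto simp: Qb_def)
  have der: "((\<lambda>t. S (\<gamma> t) / d) has_vector_derivative k (\<gamma> t)) (at t)" if "0 < t" "t < 1" for t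
  proof -
    have g: "(\<gamma> has_vector_derivative d) (at t)"
    proof -
      have "((\<lambda>t. w1 + of_real t * d) has_vector_derivative 0 + of_real 1 * d) (at t)"
        by (intro has_vector_derivative_add has_vector_derivative_const has_vector_derivative_mult_left
             has_vector_derivative_of_real DERIV_ident)
      then show ?thesis by (simp add: \<gamma>_def[abs_def])
    qed
    have "\<gamma> t \<in> H" using inQ[OF that] Q_H by blast
    from has_vector_derivative_divide[OF field_vector_diff_chain_at[OF g S_props(2)[OF this]], of d]
    show ?thesis using d0 by (simp add: o_def)
  qed
  have "Im (S (\<gamma> 0) / d) < Im (S (\<gamma> 1) / d)"
  proof (rule DERIV_pos_imp_increasing_open[where f = "\<lambda>t. Im (S (\<gamma> t) / d)"])
    show "\<exists>y. ((\<lambda>t. Im (S (\<gamma> t) / d)) has_real_derivative y) (at x) \<and> 0 < y" if "0 < x" "x < 1" for x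
      using vector_derivative_Re_Im(2)[OF der[OF that]] Im_k_pos[OF inQ[OF that]] by blast
    have "continuous_on {0..1} (\<lambda>t. S (\<gamma> t))"
    proof (rule continuous_on_compose2[OF S_props(1)])
      show "continuous_on {0..1} \<gamma>" unfolding \<gamma>_def by (intro continuous_intros)
    qed (use inQb Qb_Hb in auto)
    then show "continuous_on {0..1} (\<lambda>t. Im (S (\<gamma> t) / d))" using d0 by (intro continuous_on_Im continuous_on_divide continuous_on_const) auto
  qed simp
  moreover have "\<gamma> 0 = w1" "\<gamma> 1 = w2" by (simp_all add: \<gamma>_def d_def)
  ultimately show False using eq by simp
qed

lemma real_inj: "0 \<le> s \<Longrightarrow> s < t \<Longrightarrow> S (of_real s) \<noteq> S (of_real t)"
proof -
  assume st: "0 \<le> s" "s < t"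
  have im: "Im (S (of_real t)) > 0" if "l < t" for t
  proof (cases "t \<le> 1")
    case True then show ?thesis using bd_l1_Im[of l t] bd_0l_Im[of l] that l by simp
  qed (use bd_1_Im[of t] ab_pos in simp)
  consider "t \<le> l" | "s \<le> l" "l < t" | "l < s" "t \<le> 1" | "l < s" "s < 1" "1 < t" | "1 \<le> s" using st by linarith
  then show ?thesis
  proof cases
    case 1 then show ?thesis using bd_0l_Re[of s t] st by auto
  next
    case 2 then show ?thesis using bd_0l_Im[of s] im[of t] st by auto
  next
    case 3 then show ?thesis using bd_l1_Im[of s t] st by auto
  next
    case 4 then show ?thesis using bd_l1_Im[of s 1] bd_1_Im[of t] bd_1_Im[of 1] by auto
  next
    case 5 then show ?thesis using bd_1_Re[of s t] st by auto
  qed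
qed

lemma S_inj: "inj_on S Qb"
proof (rule inj_onI, rule ccontr)
  fix w1 w2 assume w: "w1 \<in> Qb" "w2 \<in> Qb" "S w1 = S w2" "w1 \<noteq> w2"
  then consider "Re w1 = 0" "Re w2 = 0" | "Im w1 = 0" "Im w2 = 0" using S_inj_aux by blast
  then show False
  proof cases
    case 1
    then have e: "w1 = \<i> * of_real (Im w1)" "w2 = \<i> * of_real (Im w2)" "Im w1 \<noteq> Im w2" using w by (auto simp: complex_eq_iff)
    have "Im (S (\<i> * of_real (Im w1))) = Im (S (\<i> * of_real (Im w2)))" using w(3) e(1,2) by simp
    then show False using bd_i_Im[of "Im w1" "Im w2"] bd_i_Im[of "Im w2" "Im w1"] w e(3)
      by (cases "Im w1 < Im w2") (auto simp: Qb_def)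
  next
    case 2
    then have e: "w1 = of_real (Re w1)" "w2 = of_real (Re w2)" "Re w1 \<noteq> Re w2" using w by (auto simp: complex_eq_iff)
    have "S (of_real (Re w1)) = S (of_real (Re w2))" using w(3) e(1,2) by simp
    then show False using real_inj[of "Re w1" "Re w2"] real_inj[of "Re w2" "Re w1"] w(1,2) e(3)
      by (cases "Re w1 < Re w2") (auto simp: Qb_def)
  qed
qed

lemma bd_values:
  assumes "w \<in> Qb" "w \<notin> Q"
  shows "S w \<in> cbox 0 (Complex a b) - box 0 (Complex a b) - {Complex 0 b}"
    "Re (S w) = 0 \<longleftrightarrow> Re w = 0" "Im (S w) = b \<longleftrightarrow> Im w = 0 \<and> 1 \<le> Re w"
proof -
  have "S w \<in> cbox 0 (Complex a b) - box 0 (Complex a b) - {Complex 0 b} \<and>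
    (Re (S w) = 0 \<longleftrightarrow> Re w = 0) \<and> (Im (S w) = b \<longleftrightarrow> Im w = 0 \<and> 1 \<le> Re w)"
  proof (cases "Re w = 0")
    case True
    define y where "y = Im w"
    have w: "w = \<i> * of_real y" using True by (simp add: y_def complex_eq_iff)
    have y: "0 \<le> y" using assms by (simp add: y_def Qb_def)
    have i: "0 \<le> Im (S w)" using bd_i_Im[of 0 y] y S_props(3) unfolding w by (cases "y = 0") auto
    show ?thesis using i bd_i_Re[OF y] bd_i_lt[OF y] ab_pos y True unfolding w
      by (auto simp: in_cbox_complex_iff in_box_complex_iff complex_eq_iff)
  next
    case False
    define t where "t = Re w"
    have t: "0 < t" using False assms by (simp add: t_def Qb_def)
    have "Im w = 0" using False assms by (auto simp: Qb_def Q_def)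
    then have w: "w = of_real t" by (simp add: t_def complex_eq_iff)
    consider "t \<le> l" | "l < t" "t < 1" | "1 \<le> t" by linarith
    then show ?thesis
    proof cases
      case 1
      have "0 < Re (S w)" using bd_0l_Re[of 0 t] t 1 S_props(3) by (simp add: w)
      moreover have "Re (S w) \<le> a" using bd_0l_Re[of t l] t 1 unfolding w a_def by (cases "t = l") auto
      moreover have "Im (S w) = 0" using bd_0l_Im[of t] t 1 by (simp add: w)
      ultimately show ?thesis using ab_pos t 1 l unfolding w by (auto simp: in_cbox_complex_iff in_box_complex_iff)
    next
      case 2
      have "Re (S w) = a" using bd_l1_Re[of t] 2 by (simp add: w)
      moreover have "0 < Im (S w)" using bd_l1_Im[of l t] bd_0l_Im[of l] 2 l by (simp add: w)
      moreover have "Im (S w) < b" using bd_l1_Im[of t 1] 2 by (simp add: w b_def)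
      ultimately show ?thesis using ab_pos t 2 l unfolding w by (auto simp: in_cbox_complex_iff in_box_complex_iff)
    next
      case 3
      have "Re (S w) \<le> a" using bd_1_Re[of 1 t] bd_l1_Re[of 1] 3 l unfolding w by (cases "t = 1") auto
      moreover have "0 < Re (S w)" using bd_1_pos[of t] 3 by (simp add: w)
      moreover have "Im (S w) = b" using bd_1_Im[of t] 3 by (simp add: w)
      ultimately show ?thesis using ab_pos t 3 l unfolding w by (auto simp: in_cbox_complex_iff in_box_complex_iff)
    qed
  qed
  then show "S w \<in> cbox 0 (Complex a b) - box 0 (Complex a b) - {Complex 0 b}"
    "Re (S w) = 0 \<longleftrightarrow> Re w = 0" "Im (S w) = b \<longleftrightarrow> Im w = 0 \<and> 1 \<le> Re w" by blast+
qed

lemma openQ: "open Q" "connected Q" "Q \<noteq> {}"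
proof -
  have e: "Q = {w. 0 < Re w} \<inter> {w. 0 < Im w}" by (auto simp: Q_def)
  show "open Q" "connected Q" unfolding e
    by (auto intro!: open_Int convex_connected convex_Int open_halfspace_Re_gt open_halfspace_Im_gt convex_halfspace_Re_gt convex_halfspace_Im_gt)
  have "Complex 1 1 \<in> Q" by (simp add: Q_def)
  then show "Q \<noteq> {}" by blast
qed

lemma closedQb: "closed Qb"
proof -
  have e: "Qb = {w. 0 \<le> Re w} \<inter> {w. 0 \<le> Im w}" by (auto simp: Qb_def)
  show ?thesis unfolding e by (auto intro!: closed_Int closed_halfspace_Re_ge closed_halfspace_Im_ge)
qed

lemma contS_Qb: "continuous_on Qb S" using S_props(1) Qb_Hb continuous_on_subset by blast

lemma holS_Q: "S holomorphic_on Q" using holS Q_H holomorphic_on_subset by blast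

text \<open>If the images of a sequence converge to a point other than \<open>\<i> * b\<close>, the
  sequence is eventually bounded by \<open>S_far\<close>, and compactness gives a preimage in the
  closed quadrant.\<close>

lemma S_closure: "closure (S ` Q) \<subseteq> insert (Complex 0 b) (S ` Qb)"
proof
  fix v assume v: "v \<in> closure (S ` Q)"
  then obtain x where x: "\<And>n. x n \<in> S ` Q" "x \<longlonglongrightarrow> v" unfolding closure_sequential by blast
  then have "\<forall>n. \<exists>w. w \<in> Q \<and> x n = S w" by blast
  then obtain w where w: "\<And>n. w n \<in> Q" "\<And>n. x n = S (w n)" by metis
  have wb: "w n \<in> Qb" for n using w(1)[of n] by (auto simp: Q_def Qb_def)
  show "v \<in> insert (Complex 0 b) (S ` Qb)"
  proof (cases "v = Complex 0 b")
    case False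
    define e where "e = dist v (Complex 0 b) / 2"
    have e: "e > 0" using False by (simp add: e_def)
    have "\<forall>\<^sub>F n in sequentially. dist (x n) v < e" using tendstoD[OF x(2) e] .
    then obtain N where N: "\<And>n. n \<ge> N \<Longrightarrow> dist (x n) v < e" unfolding eventually_sequentially by blast
    define R where "R = max 2 (4 / e)"
    have bnd: "norm (w n) \<le> R" if "n \<ge> N" for n
    proof (rule ccontr)
      assume "\<not> ?thesis"
      then have big: "norm (w n) > 2" "norm (w n) > 4 / e" by (auto simp: R_def)
      have "dist (x n) (Complex 0 b) \<le> 4 / norm (w n)" using S_far[OF wb[of n]] big by (simp add: dist_norm w(2))
      also have "\<dots> < e"
      proof -
        have "0 < norm (w n)" using big by linarith
        then show ?thesis using big(2) e by (simp add: field_simps)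
      qed
      finally have "dist v (Complex 0 b) < 2 * e" using N[OF that] dist_triangle[of v "Complex 0 b" "x n"] by (simp add: dist_commute)
      then show False by (simp add: e_def)
    qed
    have comp: "compact (Qb \<inter> cball 0 R)" using closedQb by (simp add: closed_Int_compact)
    have "compact (S ` (Qb \<inter> cball 0 R))"
      by (rule compact_continuous_image[OF continuous_on_subset[OF contS_Qb] comp]) simp
    then have "closed (S ` (Qb \<inter> cball 0 R))" by (rule compact_imp_closed)
    moreover have "x (n + N) \<in> S ` (Qb \<inter> cball 0 R)" for n using w(2)[of "n+N"] wb[of "n+N"] bnd[of "n+N"] by auto
    moreover have "(\<lambda>n. x (n + N)) \<longlonglongrightarrow> v" using x(2) by (rule LIMSEQ_ignore_initial_segment)
    ultimately have "v \<in> S ` (Qb \<inter> cball 0 R)" by (rule closed_sequentially)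
    then show ?thesis by blast
  qed simp
qed

text \<open>The image is open, bounded, and has its frontier on the boundary of the rectangle. The
  complement of the closed rectangle is connected and unbounded, so the image cannot meet it without
  containing it; the open rectangle is connected and met by the image, so it is filled.\<close>

lemma S_image_open: "S ` Q = box 0 (Complex a b)"
proof -
  define V where "V = S ` Q"
  define R where "R = box 0 (Complex a b)"
  define Rb where "Rb = cbox 0 (Complex a b)"
  have V: "open V" "connected V" "V \<noteq> {}"
  proof -
    have "inj_on S Q" using S_inj by (rule inj_on_subset) (auto simp: Q_def Qb_def)
    then show "open V" unfolding V_def by (rule open_mapping_thm3[OF holS_Q openQ(1)])
    show "connected V" unfolding V_def
      by (rule connected_continuous_image[OF holomorphic_on_imp_continuous_on[OF holS_Q] openQ(2)])
  qed (use openQ in \<open>auto simp: V_def\<close>)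
  have corner: "Complex 0 b \<in> Rb - R" using ab_pos by (auto simp: R_def Rb_def in_cbox_complex_iff in_box_complex_iff)
  have fr: "frontier V \<subseteq> Rb - R"
  proof
    fix v assume "v \<in> frontier V"
    then have v: "v \<in> closure V" "v \<notin> V" using V(1) by (auto simp: frontier_def interior_open)
    then consider "v = Complex 0 b" | w where "w \<in> Qb" "v = S w" using S_closure unfolding V_def by blast
    then show "v \<in> Rb - R"
    proof cases
      case 1 then show ?thesis using corner by simp
    next
      case 2
      then have "w \<notin> Q" using v(2) by (auto simp: V_def)
      then show ?thesis using bd_values(1)[of w] 2 by (simp add: R_def Rb_def)
    qed
  qed
  have bV: "bounded V"
  proof -
    have "bounded (S ` (Qb \<inter> cball 0 2))"
      by (intro compact_imp_bounded compact_continuous_image continuous_on_subset[OF contS_Qb])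
         (auto intro: closed_Int_compact closedQb)
    moreover have far: "S w \<in> cball (Complex 0 b) 2" if "w \<in> Qb" "norm w > 2" for w
    proof -
      have "norm (S w - Complex 0 b) \<le> 4 / norm w" using S_far that by auto
      also have "\<dots> \<le> 4 / 2" using that by (intro divide_left_mono) auto
      finally show ?thesis by (simp add: dist_norm norm_minus_commute)
    qed
    have "V \<subseteq> S ` (Qb \<inter> cball 0 2) \<union> cball (Complex 0 b) 2"
    proof
      fix v assume "v \<in> V"
      then obtain w where w0: "w \<in> Q" "v = S w" unfolding V_def by blast
      then have w: "w \<in> Qb" "v = S w" by (auto simp: Q_def Qb_def)
      then show "v \<in> S ` (Qb \<inter> cball 0 2) \<union> cball (Complex 0 b) 2"
        using far[of w] by (cases "norm w > 2") auto
    qed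
    ultimately show ?thesis
      by (intro bounded_subset[OF _ \<open>V \<subseteq> S ` (Qb \<inter> cball 0 2) \<union> cball (Complex 0 b) 2\<close>]) (simp add: bounded_Un)
  qed
  have "V \<subseteq> Rb"
  proof (rule ccontr)
    assume "\<not> V \<subseteq> Rb"
    then have 1: "(- Rb) \<inter> V \<noteq> {}" by blast
    have "connected (- Rb)" unfolding Rb_def
      by (rule connected_complement_bounded_convex[OF bounded_cbox convex_box(1)]) simp
    moreover have "(- Rb) \<inter> frontier V = {}" using fr by blast
    ultimately have "(- Rb) - V = {}" using connected_Int_frontier[of "- Rb" V] 1 by blast
    then have "- Rb \<subseteq> V" by blast
    then have "bounded (- Rb)" using bV bounded_subset by blast
    moreover have "bounded Rb" by (simp add: Rb_def)
    ultimately have "bounded (Rb \<union> - Rb)" unfolding bounded_Un by blast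
    then show False unfolding Compl_partition using not_bounded_UNIV by blast
  qed
  then have VR: "V \<subseteq> R" using interior_maximal[of V Rb] V(1) by (simp add: R_def Rb_def interior_cbox)
  have "connected R" by (simp add: R_def convex_connected convex_box)
  moreover have "R \<inter> V \<noteq> {}" using VR V(3) by blast
  moreover have "R \<inter> frontier V = {}" using fr by blast
  ultimately have "R - V = {}" using connected_Int_frontier[of R V] by blast
  then show ?thesis using VR unfolding V_def R_def by blast
qed

lemma S_image_closed: "S ` Qb = cbox 0 (Complex a b) - {Complex 0 b}"
proof
  have notc: "Complex 0 b \<notin> box 0 (Complex a b)" by (simp add: in_box_complex_iff)
  show "S ` Qb \<subseteq> cbox 0 (Complex a b) - {Complex 0 b}"
  proof
    fix v assume "v \<in> S ` Qb"
    then obtain w where w: "w \<in> Qb" "v = S w" by blast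
    show "v \<in> cbox 0 (Complex a b) - {Complex 0 b}"
    proof (cases "w \<in> Q")
      case True
      then have "v \<in> box 0 (Complex a b)" using S_image_open w by blast
      then show ?thesis using notc box_subset_cbox by blast
    next
      case False
      then show ?thesis using bd_values(1)[OF w(1) False] unfolding w(2) by auto
    qed
  qed
  have "box 0 (Complex a b) \<noteq> {}"
  proof -
    have "Complex (a/2) (b/2) \<in> box 0 (Complex a b)" using ab_pos by (simp add: in_box_complex_iff)
    then show ?thesis by blast
  qed
  then have "closure (S ` Q) = cbox 0 (Complex a b)" unfolding S_image_open by (rule closure_box)
  then show "cbox 0 (Complex a b) - {Complex 0 b} \<subseteq> S ` Qb" using S_closure by blast
qed

lemma S_sides:
  assumes "w \<in> Qb"
  shows "Re (S w) = 0 \<longleftrightarrow> Re w = 0" "Im (S w) = b \<longleftrightarrow> Im w = 0 \<and> 1 \<le> Re w"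
proof -
  have "(Re (S w) = 0 \<longleftrightarrow> Re w = 0) \<and> (Im (S w) = b \<longleftrightarrow> Im w = 0 \<and> 1 \<le> Re w)"
  proof (cases "w \<in> Q")
    case True
    then have "S w \<in> box 0 (Complex a b)" using S_image_open by blast
    then show ?thesis using True by (auto simp: in_box_complex_iff Q_def)
  next
    case False then show ?thesis using bd_values(2,3)[OF assms] by blast
  qed
  then show "Re (S w) = 0 \<longleftrightarrow> Re w = 0" "Im (S w) = b \<longleftrightarrow> Im w = 0 \<and> 1 \<le> Re w" by blast+
qed

section \<open>Estimates of the two elliptic integrals\<close>

lemma sqrt_diff_squares: "0 \<le> s \<Longrightarrow> s \<le> t \<Longrightarrow> sqrt (t\<^sup>2 - s\<^sup>2) = sqrt (t - s) * sqrt (t + s)"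
  by (simp add: power2_eq_square algebra_simps flip: real_sqrt_mult)

lemma sqrt_prod_le: "0 \<le> x \<Longrightarrow> x \<le> 2 \<Longrightarrow> 0 \<le> y \<Longrightarrow> y \<le> 2 \<Longrightarrow> sqrt x * sqrt y \<le> 2"
proof -
  assume a: "0 \<le> x" "x \<le> 2" "0 \<le> y" "y \<le> 2"
  have "x * y \<le> 2 * 2" using a by (intro mult_mono) auto
  then have "sqrt (x * y) \<le> sqrt (2 * 2)" by (rule real_sqrt_le_mono)
  then show ?thesis by (simp add: real_sqrt_mult)
qed

lemma sqrt_prod_ge: "0 \<le> c \<Longrightarrow> c \<le> x \<Longrightarrow> c \<le> y \<Longrightarrow> c \<le> sqrt x * sqrt y"
proof -
  assume a: "0 \<le> c" "c \<le> x" "c \<le> y"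
  have "c * c \<le> x * y" using a by (intro mult_mono) auto
  then have "sqrt (c * c) \<le> sqrt (x * y)" by (rule real_sqrt_le_mono)
  then show ?thesis using a by (simp add: real_sqrt_mult)
qed

text \<open>A primitive of \<open>1 / (sqrt (1 - t) * sqrt (t - l))\<close>, increasing by
  \<open>pi\<close> from \<open>l\<close> to 1.\<close>

definition B where "B t = arcsin ((2*t - 1 - l) / (1 - l))"

lemma B_cont: "continuous_on {l..1} B"
  unfolding B_def using l by (intro continuous_intros) (auto simp: field_simps)

lemma B_ends: "B l = - (pi/2)" "B 1 = pi/2"
proof -
  have "(2*l - 1 - l) / (1 - l) = -1" "(2*1 - 1 - l) / (1 - l) = 1" using l by (auto simp: field_simps)
  then show "B l = - (pi/2)" "B 1 = pi/2" by (simp_all only: B_def arcsin_minus_1 arcsin_1)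
qed

lemma B_deriv:
  assumes "l < t" "t < 1"
  shows "(B has_real_derivative 1 / (sqrt (1 - t) * sqrt (t - l))) (at t)"
proof -
  define u where "u = (2*t - 1 - l) / (1 - l)"
  have u: "-1 < u" "u < 1" using assms l by (auto simp: u_def field_simps)
  have e: "1 - u\<^sup>2 = (1 - t) * (t - l) * (2 / (1 - l))\<^sup>2"
    using l by (simp add: u_def power_divide divide_simps) (simp add: power2_eq_square algebra_simps)
  have nz: "2 / (1 - l) \<noteq> 0" using l by simp
  have "sqrt (1 - u\<^sup>2) = sqrt (1 - t) * sqrt (t - l) * (2 / (1 - l))"
    unfolding e using l by (simp add: real_sqrt_mult)
  then have "(2 / (1 - l)) / sqrt (1 - u\<^sup>2) = 1 / (sqrt (1 - t) * sqrt (t - l))"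
    by (simp only: nonzero_divide_mult_cancel_right[OF nz])
  moreover have "((\<lambda>t. arcsin ((2*t - 1 - l) / (1 - l))) has_real_derivative (2 / (1 - l)) / sqrt (1 - u\<^sup>2)) (at t)"
    using u l unfolding u_def by (auto intro!: derivative_eq_intros simp: divide_simps)
  ultimately show ?thesis unfolding B_def[abs_def] by (simp only:)
qed

text \<open>Splitting the radicands into linear factors leaves the arcsine density
  \<open>1 / (sqrt (1 - t) * sqrt (t - l))\<close> of total mass \<open>pi\<close>, multiplied by
  \<open>1 / (sqrt (1 + t) * sqrt (t + l))\<close>, which lies between 1/2 and
  \<open>1 / (2*l)\<close>.\<close>

lemma b_bounds: "pi/2 \<le> b" "b \<le> pi / (2*l)"
proof -
  have imd: "((\<lambda>t. Im (S (of_real t))) has_vector_derivative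
       1 / (sqrt (1 - t) * sqrt (t - l)) * (1 / (sqrt (1 + t) * sqrt (t + l)))) (at t)" if "l < t" "t < 1" for t
    using vector_derivative_Re_Im(2)[OF deriv_l1[OF that]] sqrt_diff_squares[of t 1] sqrt_diff_squares[of l t] that l
    by (simp add: has_real_derivative_iff_has_vector_derivative mult_ac)
  have Bd: "(B has_vector_derivative 1 / (sqrt (1 - t) * sqrt (t - l))) (at t)" if "l < t" "t < 1" for t
    using B_deriv[OF that] by (simp add: has_real_derivative_iff_has_vector_derivative)
  have Dp: "0 < 1 / (sqrt (1 - t) * sqrt (t - l))" if "l < t" "t < 1" for t
    using that by (intro divide_pos_pos mult_pos_pos) auto
  have w1: "1/2 \<le> 1 / (sqrt (1 + t) * sqrt (t + l))" "1 / (sqrt (1 + t) * sqrt (t + l)) \<le> 1 / (2*l)" if "l < t" "t < 1" for t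
  proof -
    have "sqrt (1 + t) * sqrt (t + l) \<le> 2" "2 * l \<le> sqrt (1 + t) * sqrt (t + l)"
      using that l by (auto intro!: sqrt_prod_le sqrt_prod_ge)
    then show "1/2 \<le> 1 / (sqrt (1 + t) * sqrt (t + l))" "1 / (sqrt (1 + t) * sqrt (t + l)) \<le> 1 / (2*l)"
      using that l by (auto intro!: divide_left_mono mult_pos_pos)
  qed
  have "norm (B 1 * (1/2) - B l * (1/2)) \<le> Im (S (of_real 1)) - Im (S (of_real l))"
  proof (rule differentiable_bound_general[where f = "\<lambda>t. B t * (1/2)" and \<phi> = "\<lambda>t. Im (S (of_real t))"])
    show "((\<lambda>t. B t * (1/2)) has_vector_derivative 1 / (sqrt (1 - t) * sqrt (t - l)) * (1/2)) (at t)" if "l < t" "t < 1" for t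
      by (rule has_vector_derivative_mult_left[OF Bd[OF that]])
    show "norm (1 / (sqrt (1 - t) * sqrt (t - l)) * (1/2)) \<le> 1 / (sqrt (1 - t) * sqrt (t - l)) * (1 / (sqrt (1 + t) * sqrt (t + l)))"
      if "l < t" "t < 1" for t
    proof -
      have "norm (1 / (sqrt (1 - t) * sqrt (t - l)) * (1/2)) = 1 / (sqrt (1 - t) * sqrt (t - l)) * (1/2)"
        using Dp[OF that] by (simp only: real_norm_def abs_of_pos mult_pos_pos)
      also have "\<dots> \<le> 1 / (sqrt (1 - t) * sqrt (t - l)) * (1 / (sqrt (1 + t) * sqrt (t + l)))"
        using Dp[OF that] w1[OF that] by (intro mult_left_mono) auto
      finally show ?thesis .
    qed
  qed (use l imd in \<open>auto intro!: continuous_intros B_cont contr\<close>)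
  then show "pi/2 \<le> b" using bd_0l_Im[of l] l by (simp add: B_ends b_def)
  have "norm (Im (S (of_real 1)) - Im (S (of_real l))) \<le> B 1 * (1/(2*l)) - B l * (1/(2*l))"
  proof (rule differentiable_bound_general[where \<phi> = "\<lambda>t. B t * (1/(2*l))" and f = "\<lambda>t. Im (S (of_real t))", OF _ _ _ imd])
    show "((\<lambda>t. B t * (1/(2*l))) has_vector_derivative 1 / (sqrt (1 - t) * sqrt (t - l)) * (1/(2*l))) (at t)" if "l < t" "t < 1" for t
      by (rule has_vector_derivative_mult_left[OF Bd[OF that]])
    show "norm (1 / (sqrt (1 - t) * sqrt (t - l)) * (1 / (sqrt (1 + t) * sqrt (t + l)))) \<le> 1 / (sqrt (1 - t) * sqrt (t - l)) * (1/(2*l))"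
      if "l < t" "t < 1" for t
    proof -
      have "0 < 1 / (sqrt (1 + t) * sqrt (t + l))" using w1(1)[OF that] by linarith
      then have "norm (1 / (sqrt (1 - t) * sqrt (t - l)) * (1 / (sqrt (1 + t) * sqrt (t + l)))) = 1 / (sqrt (1 - t) * sqrt (t - l)) * (1 / (sqrt (1 + t) * sqrt (t + l)))"
        using Dp[OF that] by (simp only: real_norm_def abs_of_pos mult_pos_pos)
      also have "\<dots> \<le> 1 / (sqrt (1 - t) * sqrt (t - l)) * (1/(2*l))"
        using Dp[OF that] w1[OF that] by (intro mult_left_mono) auto
      finally show ?thesis .
    qed
  qed (use l in \<open>auto intro!: continuous_intros B_cont contr\<close>)
  then show "b \<le> pi / (2*l)" using bd_0l_Im[of l] l by (simp add: B_ends b_def abs_le_iff)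
qed

text \<open>A primitive of \<open>1 / (sqrt (1 - t) * sqrt (l - t))\<close>; its increase over
  \<open>[0, l]\<close> carries the logarithm \<open>- ln (1 - l)\<close>.\<close>

definition A where "A t = - 2 * ln (sqrt (1 - t) + sqrt (l - t))"

lemma A_arg: "t \<le> l \<Longrightarrow> sqrt (1 - t) + sqrt (l - t) > 0"
  using l by (intro add_pos_nonneg) auto

lemma A_cont: "continuous_on {0..l} A"
proof -
  have "sqrt (1 - t) + sqrt (l - t) \<noteq> 0" if "t \<in> {0..l}" for t using A_arg[of t] that by auto
  then show ?thesis unfolding A_def by (intro continuous_intros) auto
qed

lemma A_deriv:
  assumes "0 < t" "t < l"
  shows "(A has_vector_derivative 1 / (sqrt (1 - t) * sqrt (l - t))) (at t)"
proof -
  define p where "p = sqrt (1 - t)"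
  define q where "q = sqrt (l - t)"
  have pq: "p > 0" "q > 0" using assms l by (auto simp: p_def q_def)
  have 1: "((\<lambda>t. sqrt (1 - t) + sqrt (l - t)) has_real_derivative - (inverse p / 2) - (inverse q / 2)) (at t)"
    using assms l unfolding p_def q_def by (auto intro!: derivative_eq_intros)
  have "((\<lambda>t. - 2 * ln (sqrt (1 - t) + sqrt (l - t))) has_real_derivative
      - 2 * (inverse (p + q) * (- (inverse p / 2) - (inverse q / 2)))) (at t)"
    by (rule DERIV_cmult[OF DERIV_chain2[OF DERIV_ln 1, folded p_def q_def]]) (use pq in simp)
  moreover have "- 2 * (inverse (p + q) * (- (inverse p / 2) - (inverse q / 2))) = 1 / (p * q)"
  proof -
    have "p + q \<noteq> 0" using pq by simp
    moreover have "inverse p + inverse q = (p + q) / (p * q)" using pq by (simp add: field_simps)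
    moreover have "- 2 * (inverse (p + q) * (- (inverse p / 2) - (inverse q / 2))) = inverse (p + q) * (inverse p + inverse q)"
      by (simp add: algebra_simps)
    ultimately show ?thesis by simp
  qed
  ultimately show ?thesis
    unfolding A_def[abs_def] p_def q_def by (simp add: has_real_derivative_iff_has_vector_derivative)
qed

lemma A_ends: "A l - A 0 = - ln (1 - l) + 2 * ln (1 + sqrt l)"
proof -
  have "A l = - ln (1 - l)" using l by (simp add: A_def ln_sqrt)
  then show ?thesis by (simp add: A_def)
qed

text \<open>The weight \<open>1 / (sqrt (1 + t) * sqrt (l + t))\<close> is at least 1/2, which gives
  the lower bound. In the upper bound the logarithm must keep a coefficient tending to 1/2, so the
  weight is compared with \<open>1 / (2*l)\<close>, about its size at the singular end. The error
  \<open>(l - t) / (2*l\<^sup>2)\<close> cancels the singularity there and contributes at most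
  \<open>1 / (2*l)\<close>.\<close>

lemma a_bounds: "- ln (1 - l) / 2 \<le> a" "a \<le> (- ln (1 - l) + 2 * ln 2 + 1) / (2*l)"
proof -
  have red: "((\<lambda>t. Re (S (of_real t))) has_vector_derivative
       1 / (sqrt (1 - t) * sqrt (l - t)) * (1 / (sqrt (1 + t) * sqrt (l + t)))) (at t)" if "0 < t" "t < l" for t
    using vector_derivative_Re_Im(1)[OF deriv_0l[OF that]] sqrt_diff_squares[of t 1] sqrt_diff_squares[of t l] that l
    by (simp add: has_real_derivative_iff_has_vector_derivative mult_ac)
  have Dp: "0 < 1 / (sqrt (1 - t) * sqrt (l - t))" if "0 < t" "t < l" for t
    using that l by (intro divide_pos_pos mult_pos_pos) auto
  have w1: "1/2 \<le> 1 / (sqrt (1 + t) * sqrt (l + t))" if "0 < t" "t < l" for t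
  proof -
    have "sqrt (1 + t) * sqrt (l + t) \<le> 2" using that l by (intro sqrt_prod_le) auto
    then show ?thesis using that l by (auto intro!: divide_left_mono mult_pos_pos)
  qed
  have w2: "1 / (sqrt (1 + t) * sqrt (l + t)) \<le> 1 / (2*l) + (l - t) / (2*l\<^sup>2)" if "0 < t" "t < l" for t
  proof -
    have "l + t \<le> sqrt (1 + t) * sqrt (l + t)" using that l by (intro sqrt_prod_ge) auto
    then have "1 / (sqrt (1 + t) * sqrt (l + t)) \<le> 1 / (l + t)" using that l by (intro divide_left_mono mult_pos_pos) auto
    also have "\<dots> = 1 / (2*l) + (l - t) / (2*l*(l + t))"
    proof -
      have "l + t \<noteq> 0" "l \<noteq> 0" using that by auto
      then show ?thesis by (simp add: divide_simps)
    qed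
    also have "(l - t) / (2*l*(l + t)) \<le> (l - t) / (2*l\<^sup>2)"
      using that l by (intro divide_left_mono mult_pos_pos) (auto simp: power2_eq_square)
    finally show ?thesis by simp
  qed
  have w3: "1 / (sqrt (1 - t) * sqrt (l - t)) * (l - t) \<le> 1" if "0 < t" "t < l" for t
  proof -
    have "l - t = sqrt (l - t) * sqrt (l - t)" using that by simp
    then have "1 / (sqrt (1 - t) * sqrt (l - t)) * (l - t) = sqrt (l - t) / sqrt (1 - t)" using that l
      by (metis divide_self_if mult.commute nonzero_mult_divide_mult_cancel_right real_sqrt_eq_zero_cancel_iff right_minus_eq order_less_irrefl times_divide_eq_left mult.left_neutral)
    also have "\<dots> \<le> 1" using that l by simp
    finally show ?thesis .
  qed
  have "norm (A l * (1/2) - A 0 * (1/2)) \<le> Re (S (of_real l)) - Re (S (of_real 0))"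
  proof (rule differentiable_bound_general[where f = "\<lambda>t. A t * (1/2)" and \<phi> = "\<lambda>t. Re (S (of_real t))"])
    show "((\<lambda>t. A t * (1/2)) has_vector_derivative 1 / (sqrt (1 - t) * sqrt (l - t)) * (1/2)) (at t)" if "0 < t" "t < l" for t
      by (rule has_vector_derivative_mult_left[OF A_deriv[OF that]])
    show "norm (1 / (sqrt (1 - t) * sqrt (l - t)) * (1/2)) \<le> 1 / (sqrt (1 - t) * sqrt (l - t)) * (1 / (sqrt (1 + t) * sqrt (l + t)))"
      if "0 < t" "t < l" for t
    proof -
      have "norm (1 / (sqrt (1 - t) * sqrt (l - t)) * (1/2)) = 1 / (sqrt (1 - t) * sqrt (l - t)) * (1/2)"
        using Dp[OF that] by (simp only: real_norm_def abs_of_pos mult_pos_pos)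
      also have "\<dots> \<le> 1 / (sqrt (1 - t) * sqrt (l - t)) * (1 / (sqrt (1 + t) * sqrt (l + t)))"
        using Dp[OF that] w1[OF that] by (intro mult_left_mono) auto
      finally show ?thesis .
    qed
  qed (use l red in \<open>auto intro!: continuous_intros A_cont contr\<close>)
  then have "(A l - A 0) / 2 \<le> a" by (simp add: S_props a_def)
  moreover have "0 \<le> ln (1 + sqrt l)" using l by simp
  moreover have "(A l - A 0) / 2 = - ln (1 - l) / 2 + ln (1 + sqrt l)"
    unfolding A_ends by (simp add: add_divide_distrib diff_divide_distrib)
  ultimately show "- ln (1 - l) / 2 \<le> a" by simp
  define G where "G t = A t * (1/(2*l)) + t * (1/(2*l\<^sup>2))" for t
  have "norm (Re (S (of_real l)) - Re (S (of_real 0))) \<le> G l - G 0"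
  proof (rule differentiable_bound_general[where \<phi> = G and f = "\<lambda>t. Re (S (of_real t))", OF _ _ _ red])
    show "(G has_vector_derivative 1 / (sqrt (1 - t) * sqrt (l - t)) * (1/(2*l)) + 1 * (1/(2*l\<^sup>2))) (at t)" if "0 < t" "t < l" for t
      unfolding G_def[abs_def]
      by (intro has_vector_derivative_add has_vector_derivative_mult_left A_deriv that has_vector_derivative_id)
    show "continuous_on {0..l} G" unfolding G_def[abs_def] by (intro continuous_intros A_cont) (use l in auto)
    show "norm (1 / (sqrt (1 - t) * sqrt (l - t)) * (1 / (sqrt (1 + t) * sqrt (l + t)))) \<le> 1 / (sqrt (1 - t) * sqrt (l - t)) * (1/(2*l)) + 1 * (1/(2*l\<^sup>2))"
      if "0 < t" "t < l" for t
    proof -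
      have "0 < 1 / (sqrt (1 + t) * sqrt (l + t))" using w1(1)[OF that] by linarith
      then have "norm (1 / (sqrt (1 - t) * sqrt (l - t)) * (1 / (sqrt (1 + t) * sqrt (l + t)))) = 1 / (sqrt (1 - t) * sqrt (l - t)) * (1 / (sqrt (1 + t) * sqrt (l + t)))"
        using Dp[OF that] by (simp only: real_norm_def abs_of_pos mult_pos_pos)
      also have "\<dots> \<le> 1 / (sqrt (1 - t) * sqrt (l - t)) * (1 / (2*l) + (l - t) / (2*l\<^sup>2))"
        using Dp[OF that] w2[OF that] by (intro mult_left_mono) auto
      also have "\<dots> = 1 / (sqrt (1 - t) * sqrt (l - t)) * (1 / (2*l)) + 1 / (sqrt (1 - t) * sqrt (l - t)) * (l - t) * (1 / (2*l\<^sup>2))"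
        by (simp only: distrib_left times_divide_eq_right mult_1_right mult.assoc)
      also have "\<dots> \<le> 1 / (sqrt (1 - t) * sqrt (l - t)) * (1/(2*l)) + 1 * (1/(2*l\<^sup>2))"
        using w3[OF that] l by (intro add_left_mono mult_right_mono) auto
      finally show ?thesis .
    qed
  qed (use l in \<open>auto intro!: continuous_intros contr\<close>)
  then have "a \<le> G l - G 0" by (simp add: S_props a_def abs_le_iff)
  also have "\<dots> = (A l - A 0) / (2*l) + 1 / (2*l)" using l by (simp add: G_def diff_divide_distrib power2_eq_square)
  also have "\<dots> \<le> (- ln (1 - l) + 2 * ln 2) / (2*l) + 1 / (2*l)"
  proof -
    have "ln (1 + sqrt l) \<le> ln 2" using l by (intro ln_mono) (auto intro: add_pos_nonneg)
    then show ?thesis unfolding A_ends using l by (intro add_right_mono divide_right_mono) auto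
  qed
  also have "\<dots> = (- ln (1 - l) + 2 * ln 2 + 1) / (2*l)" by (simp add: add_divide_distrib)
  finally show "a \<le> (- ln (1 - l) + 2 * ln 2 + 1) / (2*l)" .
qed

end

section \<open>Conformal invariance of the modulus of a rectangle\<close>

text \<open>Constancy of \<open>Re F\<close> on the diameter is a Neumann condition for
  \<open>Im F\<close>. After a rotation of the half disc, Schwarz reflection extends
  \<open>\<i> * (F - c)\<close> to the full disc; its real part attains its minimum at the centre
  and is constant by the maximum modulus principle. The sign \<open>d\<close> tells the right half
  disc from the left one.\<close>

lemma half_ball_max:
  fixes F :: "complex \<Rightarrow> complex" and d :: real
  assumes d: "d = 1 \<or> d = -1" and r: "r > 0"
    and cont: "continuous_on {z \<in> ball z0 r. 0 \<le> d * (Re z - Re z0)} F"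
    and hol: "F holomorphic_on {z \<in> ball z0 r. 0 < d * (Re z - Re z0)}"
    and c: "\<And>z. z \<in> ball z0 r \<Longrightarrow> Re z = Re z0 \<Longrightarrow> Re (F z) = c"
    and max: "\<And>z. z \<in> ball z0 r \<Longrightarrow> 0 \<le> d * (Re z - Re z0) \<Longrightarrow> Im (F z) \<le> Im (F z0)"
    and z: "z \<in> ball z0 r" "0 \<le> d * (Re z - Re z0)"
  shows "Im (F z) = Im (F z0)"
proof -
  define S where "S = ball (0::complex) r"
  define q where "q w = z0 - \<i> * of_real d * w" for w
  have qb: "q w \<in> ball z0 r" if "w \<in> S" for w
    using that d by (auto simp: q_def S_def dist_norm norm_mult)
  have qR: "d * (Re (q w) - Re z0) = Im w" for w using d by (auto simp: q_def)
  define f where "f w = \<i> * (F (q w) - of_real c)" for w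
  have Ref: "Re (f w) = - Im (F (q w))" for w by (simp add: f_def)
  have contq: "continuous_on X q" for X unfolding q_def by (intro continuous_intros)
  have holq: "q holomorphic_on X" for X unfolding q_def by (intro holomorphic_intros)
  define g where "g = (\<lambda>w. if 0 \<le> Im w then f w else cnj (f (cnj w)))"
  have hg: "g holomorphic_on S" unfolding g_def
  proof (rule Schwarz_reflection)
    show "open S" "cnj ` S \<subseteq> S" by (auto simp: S_def)
    have "F \<circ> q holomorphic_on S \<inter> {w. 0 < Im w}"
      by (rule holomorphic_on_compose_gen[OF holq hol]) (use qb qR in auto)
    then show "f holomorphic_on S \<inter> {w. 0 < Im w}"
      unfolding f_def o_def by (intro holomorphic_on_mult holomorphic_on_diff holomorphic_on_const)
    have "continuous_on (S \<inter> {w. 0 \<le> Im w}) (\<lambda>w. F (q w))"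
      by (rule continuous_on_compose2[OF cont contq]) (use qb qR in auto)
    then show "continuous_on (S \<inter> {w. 0 \<le> Im w}) f"
      unfolding f_def by (intro continuous_on_mult continuous_on_diff continuous_on_const)
    fix w assume w: "w \<in> S" "w \<in> \<real>"
    then have "Im w = 0" by (simp add: complex_is_Real_iff)
    then have "Re (q w) = Re z0" using qR[of w] d by auto
    then have "Re (F (q w)) = c" using c qb w by blast
    then have "Im (f w) = 0" by (simp add: f_def)
    then show "f w \<in> \<real>" by (simp add: complex_is_Real_iff)
  qed
  have q0: "q 0 = z0" by (simp add: q_def)
  have ge: "Re (g w) \<ge> Re (g 0)" if w: "w \<in> S" for w
  proof -
    define w' where "w' = (if 0 \<le> Im w then w else cnj w)"
    have w': "w' \<in> S" "0 \<le> Im w'" "Re (g w) = Re (f w')" using w by (auto simp: w'_def S_def g_def)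
    have "Im (F (q w')) \<le> Im (F z0)" using max[OF qb[OF w'(1)]] qR[of w'] w' by simp
    then show ?thesis using w' by (simp add: Ref g_def q0)
  qed
  have "(\<lambda>w. exp (- g w)) constant_on S"
  proof (rule maximum_modulus_principle[of _ S S 0])
    show "(\<lambda>w. exp (- g w)) holomorphic_on S" using hg by (intro holomorphic_on_exp' holomorphic_on_minus)
    show "norm (exp (- g w)) \<le> norm (exp (- g 0))" if "w \<in> S" for w using ge[OF that] by simp
  qed (use r in \<open>auto simp: S_def\<close>)
  then obtain e where e: "\<And>w. w \<in> S \<Longrightarrow> exp (- g w) = e" unfolding constant_on_def by blast
  define w where "w = \<i> * of_real d * (z - z0)"
  have dd: "d * d = 1" "\<bar>d\<bar> = 1" using d by auto
  have qw: "q w = z" 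
  proof -
    have "\<i> * of_real d * w = - (of_real (d * d) * (z - z0))" by (simp add: w_def algebra_simps)
    then show ?thesis by (simp add: q_def dd)
  qed
  have wS: "w \<in> S" using z(1) dd by (simp add: w_def S_def norm_mult dist_norm norm_minus_commute)
  have "Im w \<ge> 0" using qR[of w] z(2) unfolding qw by simp
  have "0 \<in> S" using r by (simp add: S_def)
  have "norm (exp (- g w)) = norm (exp (- g 0))" using e[OF wS] e[OF \<open>0 \<in> S\<close>] by simp
  then have "Re (g w) = Re (g 0)" by simp
  then show ?thesis using \<open>Im w \<ge> 0\<close> by (simp add: g_def Ref qw q0)
qed

text \<open>\<open>Im F\<close> has a Dirichlet bound on the horizontal sides and Neumann conditions
  on the vertical ones. A positive maximum on a vertical side would by \<open>half_ball_max\<close>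
  be attained in the interior as well, and an interior maximum makes \<open>Im F\<close> constant,
  against the horizontal sides.\<close>

lemma mixed_boundary_max:
  fixes F :: "complex \<Rightarrow> complex"
  defines "R m \<equiv> cbox 0 (Complex 1 m)"
  assumes m: "m > 0" and cont: "continuous_on (R m) F" and hol: "F holomorphic_on box 0 (Complex 1 m)"
    and hor: "\<And>z. z \<in> R m \<Longrightarrow> Im z = 0 \<or> Im z = m \<Longrightarrow> Im (F z) \<le> 0"
    and left: "\<And>z. z \<in> R m \<Longrightarrow> Re z = 0 \<Longrightarrow> Re (F z) = c0"
    and right: "\<And>z. z \<in> R m \<Longrightarrow> Re z = 1 \<Longrightarrow> Re (F z) = c1"
    and z: "z \<in> R m"
  shows "Im (F z) \<le> 0"
proof (rule ccontr)
  assume neg: "\<not> Im (F z) \<le> 0"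
  have inR: "w \<in> R m \<longleftrightarrow> 0 \<le> Re w \<and> Re w \<le> 1 \<and> 0 \<le> Im w \<and> Im w \<le> m" for w
    by (auto simp: R_def in_cbox_complex_iff)
  have inB: "w \<in> box 0 (Complex 1 m) \<longleftrightarrow> 0 < Re w \<and> Re w < 1 \<and> 0 < Im w \<and> Im w < m" for w
    by (auto simp: in_box_complex_iff)
  have "compact (R m)" by (simp add: R_def)
  moreover have "continuous_on (R m) (\<lambda>z. Im (F z))" using cont by (rule continuous_on_Im)
  ultimately obtain z0 where z0: "z0 \<in> R m" "\<And>w. w \<in> R m \<Longrightarrow> Im (F w) \<le> Im (F z0)"
    using continuous_attains_sup[of "R m" "\<lambda>z. Im (F z)"] z by blast
  have M: "Im (F z0) > 0" using z0(2)[OF z] neg by linarith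
  have interior: False if w: "w \<in> box 0 (Complex 1 m)" "Im (F w) = Im (F z0)" for w
  proof -
    let ?B = "box 0 (Complex 1 m)"
    have BR: "?B \<subseteq> R m" by (auto simp: inB inR)
    have "(\<lambda>u. exp (- \<i> * F u)) constant_on ?B"
    proof (rule maximum_modulus_principle[of _ ?B ?B w])
      show "(\<lambda>u. exp (- \<i> * F u)) holomorphic_on ?B" using hol by (intro holomorphic_on_exp' holomorphic_on_mult holomorphic_on_const)
      show "norm (exp (- \<i> * F u)) \<le> norm (exp (- \<i> * F w))" if "u \<in> ?B" for u using z0(2)[of u] that BR w by auto
      show "connected ?B" by (simp add: convex_connected convex_box)
    qed (use w in \<open>auto simp: open_box\<close>)
    then obtain e where e: "\<And>u. u \<in> ?B \<Longrightarrow> exp (- \<i> * F u) = e" unfolding constant_on_def by blast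
    have eq: "Im (F u) = Im (F z0)" if "u \<in> ?B" for u
    proof -
      have "norm (exp (- \<i> * F u)) = norm (exp (- \<i> * F w))" using e[OF that] e[OF w(1)] by simp
      then show ?thesis using w by simp
    qed
    have clB: "closure ?B = R m" unfolding R_def by (rule closure_box) (use w in auto)
    have "(\<lambda>u. Im (F u)) ` closure ?B \<subseteq> {Im (F z0)}"
    proof (rule image_closure_subset)
      show "continuous_on (closure ?B) (\<lambda>u. Im (F u))" unfolding clB using cont by (rule continuous_on_Im)
    qed (use eq in auto)
    moreover have "0 \<in> closure ?B" unfolding clB using m by (simp add: inR)
    ultimately have "Im (F 0) = Im (F z0)" by blast
    then show False using hor[of 0] m M by (simp add: inR)
  qed
  have side: False if d: "(d = 1 \<and> Re z0 = 0) \<or> (d = -1 \<and> Re z0 = 1)" and im: "0 < Im z0" "Im z0 < m" for d :: real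
  proof -
    define r where "r = min 1 (min (Im z0) (m - Im z0)) / 2"
    have r: "r > 0" "r < 1" "r < Im z0" "r < m - Im z0" using im by (auto simp: r_def)
    have near: "\<bar>Re w - Re z0\<bar> < 1 \<and> 0 < Im w \<and> Im w < m" if "w \<in> ball z0 r" for w
    proof -
      have "norm (w - z0) < r" using that by (simp add: dist_norm norm_minus_commute)
      then have "\<bar>Re w - Re z0\<bar> < r" "\<bar>Im w - Im z0\<bar> < r"
        using abs_Re_le_cmod[of "w - z0"] abs_Im_le_cmod[of "w - z0"] by auto
      then show ?thesis using r by linarith
    qed
    have hR: "w \<in> R m" if "w \<in> ball z0 r" "0 \<le> d * (Re w - Re z0)" for w
      using near[OF that(1)] that(2) d by (auto simp: inR)
    have hB: "w \<in> box 0 (Complex 1 m)" if "w \<in> ball z0 r" "0 < d * (Re w - Re z0)" for w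
      using near[OF that(1)] that(2) d by (auto simp: inB)
    define w where "w = z0 + of_real (d * r / 2)"
    have w: "w \<in> ball z0 r" "0 < d * (Re w - Re z0)" using r d by (auto simp: w_def dist_norm)
    define c where "c = (if d = 1 then c0 else c1)"
    have "Im (F w) = Im (F z0)"
    proof (rule half_ball_max[of d r z0 F c])
      show "d = 1 \<or> d = -1" using d by blast
      show "continuous_on {z \<in> ball z0 r. 0 \<le> d * (Re z - Re z0)} F"
        by (rule continuous_on_subset[OF cont]) (use hR in auto)
      show "F holomorphic_on {z \<in> ball z0 r. 0 < d * (Re z - Re z0)}"
        by (rule holomorphic_on_subset[OF hol]) (use hB in auto)
      show "Re (F u) = c" if "u \<in> ball z0 r" "Re u = Re z0" for u
        using left[of u] right[of u] hR[of u] that d by (auto simp: c_def)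
      show "Im (F u) \<le> Im (F z0)" if "u \<in> ball z0 r" "0 \<le> d * (Re u - Re z0)" for u
        using z0(2) hR[OF that] by blast
    qed (use r w in auto)
    then show False using interior[OF hB[OF w]] by blast
  qed
  have "Im z0 \<noteq> 0" "Im z0 \<noteq> m" using hor[OF z0(1)] M by auto
  then have im: "0 < Im z0" "Im z0 < m" using z0(1) by (auto simp: inR)
  consider "Re z0 = 0" | "Re z0 = 1" | "z0 \<in> box 0 (Complex 1 m)" using z0(1) im by (force simp: inR inB)
  then show False
    using side[of 1] side[of "-1"] interior[of z0] im by cases auto
qed

text \<open>The boundary of the rectangle is a closed curve: removing a point of a side together
  with a corner off that side separates the two ends of the side. So a connected part of the
  boundary that contains both ends and misses such a corner contains the whole side.\<close>

lemma rect_boundary_sides: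
  fixes T :: "complex set"
  assumes T: "connected T" "\<And>z. z \<in> T \<Longrightarrow> 0 \<le> Re z \<and> Re z \<le> 1 \<and> 0 \<le> Im z \<and> Im z \<le> m \<and> (Re z = 0 \<or> Re z = 1 \<or> Im z = 0 \<or> Im z = m)"
    and m: "m > 0"
  shows "\<lbrakk>0 \<in> T; 1 \<in> T; Complex 0 m \<notin> T; 0 \<le> x; x \<le> 1\<rbrakk> \<Longrightarrow> Complex x 0 \<in> T"
    and "\<lbrakk>Complex 0 m \<in> T; Complex 1 m \<in> T; 0 \<notin> T; 0 \<le> x; x \<le> 1\<rbrakk> \<Longrightarrow> Complex x m \<in> T"
    and "\<lbrakk>0 \<in> T; Complex 0 m \<in> T; 1 \<notin> T; 0 \<le> y; y \<le> m\<rbrakk> \<Longrightarrow> Complex 0 y \<in> T"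
    and "\<lbrakk>1 \<in> T; Complex 1 m \<in> T; 0 \<notin> T; 0 \<le> y; y \<le> m\<rbrakk> \<Longrightarrow> Complex 1 y \<in> T"
proof -
  have cl: "closed {z. Re z = t}" "closed {z. Im z = t}" "closed {z. Re z \<le> t}" "closed {z. Re z \<ge> t}" "closed {z. Im z \<le> t}" "closed {z. Im z \<ge> t}" for t
    by (auto simp: closed_halfspace_Re_le closed_halfspace_Re_ge closed_halfspace_Im_le closed_halfspace_Im_ge
        intro!: closed_Collect_eq continuous_intros)
  have e: "z = 0 \<longleftrightarrow> Re z = 0 \<and> Im z = 0" "z = 1 \<longleftrightarrow> Re z = 1 \<and> Im z = 0" "z = Complex s t \<longleftrightarrow> Re z = s \<and> Im z = t" for z s t
    by (auto simp: complex_eq_iff)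
  have no: False if "closed A" "closed B" "T \<subseteq> A \<union> B" "A \<inter> B \<inter> T = {}" "p \<in> A \<inter> T" "q \<in> B \<inter> T" for A B p q
    using T(1) that unfolding connected_closed by blast
  show "Complex x 0 \<in> T" if a: "0 \<in> T" "1 \<in> T" "Complex 0 m \<notin> T" "0 \<le> x" "x \<le> 1"
  proof (rule ccontr)
    assume n: "Complex x 0 \<notin> T"
    then have x: "x \<noteq> 0" "x \<noteq> 1" using a by (metis complex_eq_iff complex.sel zero_complex.sel one_complex.sel)+
    show False
    proof (rule no[of "{z. Re z = 0} \<union> ({z. Re z \<le> x} \<inter> {z. Im z = 0})" "{z. Im z = m} \<union> {z. Re z = 1} \<union> ({z. Re z \<ge> x} \<inter> {z. Im z = 0})" 0 1])
      show "({z. Re z = 0} \<union> ({z. Re z \<le> x} \<inter> {z. Im z = 0})) \<inter> ({z. Im z = m} \<union> {z. Re z = 1} \<union> ({z. Re z \<ge> x} \<inter> {z. Im z = 0})) \<inter> T = {}"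
      proof (rule ccontr)
        assume "\<not> ?thesis"
        then obtain z where z: "z \<in> T" "Re z = 0 \<or> Re z \<le> x \<and> Im z = 0" "Im z = m \<or> Re z = 1 \<or> Re z \<ge> x \<and> Im z = 0" by auto
        then have "z = Complex 0 m \<or> z = Complex x 0" using x a m unfolding e by auto
        then show False using z(1) n a by auto
      qed
    qed (use a T(2) in \<open>auto intro!: closed_Un closed_Int cl\<close>)
  qed
  show "Complex x m \<in> T" if a: "Complex 0 m \<in> T" "Complex 1 m \<in> T" "0 \<notin> T" "0 \<le> x" "x \<le> 1"
  proof (rule ccontr)
    assume n: "Complex x m \<notin> T"
    then have x: "x \<noteq> 0" "x \<noteq> 1" using a by auto
    show False
    proof (rule no[of "{z. Re z = 0} \<union> ({z. Re z \<le> x} \<inter> {z. Im z = m})" "{z. Im z = 0} \<union> {z. Re z = 1} \<union> ({z. Re z \<ge> x} \<inter> {z. Im z = m})" "Complex 0 m" "Complex 1 m"])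
      show "({z. Re z = 0} \<union> ({z. Re z \<le> x} \<inter> {z. Im z = m})) \<inter> ({z. Im z = 0} \<union> {z. Re z = 1} \<union> ({z. Re z \<ge> x} \<inter> {z. Im z = m})) \<inter> T = {}"
      proof (rule ccontr)
        assume "\<not> ?thesis"
        then obtain z where z: "z \<in> T" "Re z = 0 \<or> Re z \<le> x \<and> Im z = m" "Im z = 0 \<or> Re z = 1 \<or> Re z \<ge> x \<and> Im z = m" by auto
        then have "z = 0 \<or> z = Complex x m" using x a m unfolding e by auto
        then show False using z(1) n a by auto
      qed
    qed (use a T(2) in \<open>auto intro!: closed_Un closed_Int cl\<close>)
  qed
  show "Complex 0 y \<in> T" if a: "0 \<in> T" "Complex 0 m \<in> T" "1 \<notin> T" "0 \<le> y" "y \<le> m"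
  proof (rule ccontr)
    assume n: "Complex 0 y \<notin> T"
    then have y: "y \<noteq> 0" "y \<noteq> m" using a by (metis complex_eq_iff complex.sel zero_complex.sel)+
    show False
    proof (rule no[of "{z. Im z = 0} \<union> ({z. Im z \<le> y} \<inter> {z. Re z = 0})" "{z. Re z = 1} \<union> {z. Im z = m} \<union> ({z. Im z \<ge> y} \<inter> {z. Re z = 0})" 0 "Complex 0 m"])
      show "({z. Im z = 0} \<union> ({z. Im z \<le> y} \<inter> {z. Re z = 0})) \<inter> ({z. Re z = 1} \<union> {z. Im z = m} \<union> ({z. Im z \<ge> y} \<inter> {z. Re z = 0})) \<inter> T = {}"
      proof (rule ccontr)
        assume "\<not> ?thesis"
        then obtain z where z: "z \<in> T" "Im z = 0 \<or> Im z \<le> y \<and> Re z = 0" "Re z = 1 \<or> Im z = m \<or> Im z \<ge> y \<and> Re z = 0" by auto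
        then have "z = 1 \<or> z = Complex 0 y" using y a m unfolding e by auto
        then show False using z(1) n a by auto
      qed
    qed (use a T(2) in \<open>auto intro!: closed_Un closed_Int cl\<close>)
  qed
  show "Complex 1 y \<in> T" if a: "1 \<in> T" "Complex 1 m \<in> T" "0 \<notin> T" "0 \<le> y" "y \<le> m"
  proof (rule ccontr)
    assume n: "Complex 1 y \<notin> T"
    then have y: "y \<noteq> 0" "y \<noteq> m" using a by (metis complex_eq_iff complex.sel one_complex.sel)+
    show False
    proof (rule no[of "{z. Im z = 0} \<union> ({z. Im z \<le> y} \<inter> {z. Re z = 1})" "{z. Re z = 0} \<union> {z. Im z = m} \<union> ({z. Im z \<ge> y} \<inter> {z. Re z = 1})" 1 "Complex 1 m"])
      show "({z. Im z = 0} \<union> ({z. Im z \<le> y} \<inter> {z. Re z = 1})) \<inter> ({z. Re z = 0} \<union> {z. Im z = m} \<union> ({z. Im z \<ge> y} \<inter> {z. Re z = 1})) \<inter> T = {}"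
      proof (rule ccontr)
        assume "\<not> ?thesis"
        then obtain z where z: "z \<in> T" "Im z = 0 \<or> Im z \<le> y \<and> Re z = 1" "Re z = 0 \<or> Im z = m \<or> Im z \<ge> y \<and> Re z = 1" by auto
        then have "z = 0 \<or> z = Complex 1 y" using y a m unfolding e by auto
        then show False using z(1) n a by auto
      qed
    qed (use a T(2) in \<open>auto intro!: closed_Un closed_Int cl\<close>)
  qed
qed

text \<open>The transition map \<open>\<psi>\<close> between the rectangles carries corners to
  corners, hence sides to sides. The difference \<open>\<psi> z - \<kappa> * z\<close> with
  \<open>\<kappa> = m2 / m1\<close> has imaginary part 0 on the horizontal sides and constant real
  part on each vertical one; by \<open>mixed_boundary_max\<close> its imaginary part vanishes, so it
  is constant, and its values at 0 and 1 give \<open>\<kappa> = 1\<close>.\<close>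

lemma rect_modulus_unique:
  fixes P1 P2 :: "complex \<Rightarrow> complex"
  assumes m: "m1 > 0" "m2 > 0" and X: "compact X"
    and P1: "continuous_on X P1" "inj_on P1 X" "P1 ` X = cbox 0 (Complex 1 m1)" "P1 holomorphic_on interior X"
    and P2: "continuous_on X P2" "inj_on P2 X" "P2 ` X = cbox 0 (Complex 1 m2)" "P2 holomorphic_on interior X"
    and v: "p \<in> X" "q \<in> X" "r \<in> X" "s \<in> X"
    and v1: "P1 p = 0" "P1 q = 1" "P1 r = Complex 1 m1" "P1 s = Complex 0 m1"
    and v2: "P2 p = 0" "P2 q = 1" "P2 r = Complex 1 m2" "P2 s = Complex 0 m2"
  shows "m1 = m2"
proof -
  define R1 where "R1 = cbox 0 (Complex 1 m1)"
  define R2 where "R2 = cbox 0 (Complex 1 m2)"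
  define B1 where "B1 = box 0 (Complex 1 m1)"
  define B2 where "B2 = box 0 (Complex 1 m2)"
  have inR1: "w \<in> R1 \<longleftrightarrow> 0 \<le> Re w \<and> Re w \<le> 1 \<and> 0 \<le> Im w \<and> Im w \<le> m1" for w
    by (auto simp: R1_def in_cbox_complex_iff)
  have inR2: "w \<in> R2 \<longleftrightarrow> 0 \<le> Re w \<and> Re w \<le> 1 \<and> 0 \<le> Im w \<and> Im w \<le> m2" for w
    by (auto simp: R2_def in_cbox_complex_iff)
  have inB1: "w \<in> B1 \<longleftrightarrow> 0 < Re w \<and> Re w < 1 \<and> 0 < Im w \<and> Im w < m1" for w
    by (auto simp: B1_def in_box_complex_iff)
  have inB2: "w \<in> B2 \<longleftrightarrow> 0 < Re w \<and> Re w < 1 \<and> 0 < Im w \<and> Im w < m2" for w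
    by (auto simp: B2_def in_box_complex_iff)
  have BR: "B1 \<subseteq> R1" "B2 \<subseteq> R2" "open B1" "open B2" "interior R1 = B1" "interior R2 = B2"
    unfolding R1_def R2_def B1_def B2_def by (auto simp: box_subset_cbox open_box interior_cbox)
  obtain g1 where g1: "homeomorphism X R1 P1 g1" using homeomorphism_compact[OF X P1(1) P1(3) P1(2)] R1_def by blast
  obtain g2 where g2: "homeomorphism X R2 P2 g2" using homeomorphism_compact[OF X P2(1) P2(3) P2(2)] R2_def by blast
  have \<psi>h: "homeomorphism R1 R2 (P2 \<circ> g1) (P1 \<circ> g2)"
    by (rule homeomorphism_compose[OF homeomorphism_symD[OF g1] g2])
  define \<psi> where "\<psi> = P2 \<circ> g1"
  define \<xi> where "\<xi> = P1 \<circ> g2"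
  have hom: "homeomorphism R1 R2 \<psi> \<xi>" using \<psi>h by (simp add: \<psi>_def \<xi>_def)
  have cont: "continuous_on R1 \<psi>" and im: "\<psi> ` R1 = R2" and cont2: "continuous_on R2 \<xi>" and im2: "\<xi> ` R2 = R1"
    and inv: "\<And>z. z \<in> R1 \<Longrightarrow> \<xi> (\<psi> z) = z" and inv2: "\<And>z. z \<in> R2 \<Longrightarrow> \<psi> (\<xi> z) = z"
    using hom by (auto simp: homeomorphism_def)
  have inj: "inj_on \<psi> R1" "inj_on \<xi> R2" using inv inv2 by (metis inj_onI)+
  have op1: "\<psi> ` B1 \<subseteq> B2"
  proof -
    have "open (\<psi> ` B1)"
      by (rule invariance_of_domain[OF continuous_on_subset[OF cont BR(1)] BR(3) inj_on_subset[OF inj(1) BR(1)]])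
    moreover have "\<psi> ` B1 \<subseteq> R2" using im BR by blast
    ultimately show ?thesis using interior_maximal BR(6) by metis
  qed
  have op2: "\<xi> ` B2 \<subseteq> B1"
  proof -
    have "open (\<xi> ` B2)"
      by (rule invariance_of_domain[OF continuous_on_subset[OF cont2 BR(2)] BR(4) inj_on_subset[OF inj(2) BR(2)]])
    moreover have "\<xi> ` B2 \<subseteq> R1" using im2 BR by blast
    ultimately show ?thesis using interior_maximal BR(5) by metis
  qed
  have bd: "\<psi> z \<in> R2 - B2" if "z \<in> R1 - B1" for z
    using that im op2 inv by (metis DiffD1 DiffD2 DiffI image_eqI image_subset_iff)
  have g1X: "g1 w \<in> X" "P1 (g1 w) = w" if "w \<in> R1" for w using g1 that by (auto simp: homeomorphism_def)
  have gP: "g1 (P1 x) = x" if "x \<in> X" for x using g1 that by (auto simp: homeomorphism_def)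
  have hol: "\<psi> holomorphic_on B1"
  proof -
    \<comment> \<open>\<open>P1\<close> is known to be holomorphic on \<open>interior X\<close>;
      invariance of domain makes the preimage of the open rectangle open, so it lies there.\<close>
    define U where "U = g1 ` B1"
    have cg: "continuous_on R1 g1" using g1 by (simp add: homeomorphism_def)
    have ig: "inj_on g1 R1" using g1X by (metis inj_onI)
    have oU: "open U" unfolding U_def
      by (rule invariance_of_domain[OF continuous_on_subset[OF cg BR(1)] BR(3) inj_on_subset[OF ig BR(1)]])
    have UX: "U \<subseteq> X" using g1X BR(1) by (auto simp: U_def)
    then have Uint: "U \<subseteq> interior X" using oU interior_maximal by blast
    obtain g where g: "g holomorphic_on (P1 ` U)" "\<And>z. z \<in> U \<Longrightarrow> deriv P1 z * deriv g (P1 z) = 1"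
        "\<And>z. z \<in> U \<Longrightarrow> g (P1 z) = z"
    proof (rule holomorphic_has_inverse[OF holomorphic_on_subset[OF P1(4) Uint] oU inj_on_subset[OF P1(2) UX]])
      fix g assume "g holomorphic_on (P1 ` U)" "\<And>z. z \<in> U \<Longrightarrow> deriv P1 z * deriv g (P1 z) = 1"
        "\<And>z. z \<in> U \<Longrightarrow> g (P1 z) = z"
      then show thesis by (rule that)
    qed
    have PU: "P1 ` U = B1"
    proof
      have e: "P1 (g1 w) = w" if "w \<in> B1" for w using g1X(2)[of w] that BR(1) by blast
      show "P1 ` U \<subseteq> B1" unfolding U_def using e by auto
      show "B1 \<subseteq> P1 ` U" unfolding U_def using e by (metis image_eqI subsetI)
    qed
    have ge: "g w = g1 w" if "w \<in> B1" for w
    proof -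
      have "w \<in> R1" using that BR by blast
      then have "g (P1 (g1 w)) = g1 w" using that by (intro g(3)) (simp add: U_def)
      then show ?thesis using g1X(2)[OF \<open>w \<in> R1\<close>] by simp
    qed
    have "g1 holomorphic_on B1" by (rule holomorphic_transform[OF g(1)[unfolded PU] ge])
    then show ?thesis unfolding \<psi>_def
      by (rule holomorphic_on_compose_gen[OF _ P2(4)]) (use Uint in \<open>auto simp: U_def\<close>)
  qed
  have corners: "\<psi> 0 = 0" "\<psi> 1 = 1" "\<psi> (Complex 1 m1) = Complex 1 m2" "\<psi> (Complex 0 m1) = Complex 0 m2"
    using gP[OF v(1)] gP[OF v(2)] gP[OF v(3)] gP[OF v(4)] v1 v2 by (simp_all add: \<psi>_def)
  have cR1: "0 \<in> R1" "1 \<in> R1" "Complex 1 m1 \<in> R1" "Complex 0 m1 \<in> R1" using m by (auto simp: inR1)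
  have \<psi>bd: "0 \<le> Re (\<psi> z) \<and> Re (\<psi> z) \<le> 1 \<and> 0 \<le> Im (\<psi> z) \<and> Im (\<psi> z) \<le> m2 \<and> (Re (\<psi> z) = 0 \<or> Re (\<psi> z) = 1 \<or> Im (\<psi> z) = 0 \<or> Im (\<psi> z) = m2)"
    if "z \<in> R1" "Re z = 0 \<or> Re z = 1 \<or> Im z = 0 \<or> Im z = m1" for z
  proof -
    have "z \<in> R1 - B1" using that by (auto simp: inB1)
    then have "\<psi> z \<in> R2 - B2" by (rule bd)
    then show ?thesis by (force simp: inR2 inB2)
  qed
  define Eb where "Eb = {z \<in> R1. Im z = 0}"
  define Et where "Et = {z \<in> R1. Im z = m1}"
  define El where "El = {z \<in> R1. Re z = 0}"
  define Er where "Er = {z \<in> R1. Re z = 1}"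
  have cvx: "convex Eb" "convex Et" "convex El" "convex Er"
  proof -
    have c: "convex {z. Im z = t}" "convex {z. Re z = t}" for t
      by (auto simp: convex_def simp flip: distrib_right)
    have "Eb = R1 \<inter> {z. Im z = 0}" "Et = R1 \<inter> {z. Im z = m1}" "El = R1 \<inter> {z. Re z = 0}" "Er = R1 \<inter> {z. Re z = 1}"
      by (auto simp: Eb_def Et_def El_def Er_def)
    then show "convex Eb" "convex Et" "convex El" "convex Er" using c by (auto simp: R1_def intro!: convex_Int convex_box)
  qed
  have conn: "connected (\<psi> ` E)" if "convex E" "E \<subseteq> R1" for E
    using that by (intro connected_continuous_image continuous_on_subset[OF cont] convex_connected)
  have notin: "\<psi> c \<notin> \<psi> ` E" if "c \<in> R1" "c \<notin> E" "E \<subseteq> R1" for c E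
    using inj(1) that by (metis inj_on_image_mem_iff)
  have sub: "Eb \<subseteq> R1" "Et \<subseteq> R1" "El \<subseteq> R1" "Er \<subseteq> R1" by (auto simp: Eb_def Et_def El_def Er_def)
  have bdE: "0 \<le> Re w \<and> Re w \<le> 1 \<and> 0 \<le> Im w \<and> Im w \<le> m2 \<and> (Re w = 0 \<or> Re w = 1 \<or> Im w = 0 \<or> Im w = m2)"
    if wE: "w \<in> \<psi> ` Eb \<or> w \<in> \<psi> ` Et \<or> w \<in> \<psi> ` El \<or> w \<in> \<psi> ` Er" for w
  proof -
    obtain z where z: "z \<in> R1" "Re z = 0 \<or> Re z = 1 \<or> Im z = 0 \<or> Im z = m1" "w = \<psi> z"
      using wE unfolding Eb_def Et_def El_def Er_def by blast
    show ?thesis unfolding z(3) by (rule \<psi>bd[OF z(1,2)])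
  qed
  have b: "Complex x 0 \<in> \<psi> ` Eb" if "0 \<le> x" "x \<le> 1" for x
  proof (rule rect_boundary_sides(1)[of _ m2])
    show "0 \<in> \<psi> ` Eb" "1 \<in> \<psi> ` Eb" using cR1 corners by (force simp: Eb_def)+
    show "Complex 0 m2 \<notin> \<psi> ` Eb" using notin[OF cR1(4), of Eb] sub m corners by (auto simp: Eb_def)
  qed (use conn cvx sub bdE m that in auto)
  have t: "Complex x m2 \<in> \<psi> ` Et" if "0 \<le> x" "x \<le> 1" for x
  proof (rule rect_boundary_sides(2)[of _ m2])
    show "Complex 0 m2 \<in> \<psi> ` Et" "Complex 1 m2 \<in> \<psi> ` Et" using cR1 corners by (force simp: Et_def)+
    show "0 \<notin> \<psi> ` Et" using notin[OF cR1(1), of Et] sub m corners by (auto simp: Et_def)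
  qed (use conn cvx sub bdE m that in auto)
  have le: "Complex 0 y \<in> \<psi> ` El" if "0 \<le> y" "y \<le> m2" for y
  proof (rule rect_boundary_sides(3)[of _ m2])
    show "0 \<in> \<psi> ` El" "Complex 0 m2 \<in> \<psi> ` El" using cR1 corners by (force simp: El_def)+
    show "1 \<notin> \<psi> ` El" using notin[OF cR1(2), of El] sub m corners by (auto simp: El_def)
  qed (use conn cvx sub bdE m that in auto)
  have ri: "Complex 1 y \<in> \<psi> ` Er" if "0 \<le> y" "y \<le> m2" for y
  proof (rule rect_boundary_sides(4)[of _ m2])
    show "1 \<in> \<psi> ` Er" "Complex 1 m2 \<in> \<psi> ` Er" using cR1 corners by (force simp: Er_def)+
    show "0 \<notin> \<psi> ` Er" using notin[OF cR1(1), of Er] sub m corners by (auto simp: Er_def)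
  qed (use conn cvx sub bdE m that in auto)
  have pull: "z \<in> E" if "\<psi> z \<in> \<psi> ` E" "z \<in> R1" "E \<subseteq> R1" for z E
    using inj(1) that by (metis inj_on_image_mem_iff)
  \<comment> \<open>The images of the sides of \<open>R1\<close> cover the sides of
    \<open>R2\<close>, so injectivity pulls every side back into its counterpart. A point of one
    side whose image lies on another side can then only be a corner, and the values at corners are
    known.\<close>
  have which: "(Im (\<psi> z) = 0 \<longrightarrow> z \<in> Eb) \<and> (Im (\<psi> z) = m2 \<longrightarrow> z \<in> Et) \<and> (Re (\<psi> z) = 0 \<longrightarrow> z \<in> El) \<and> (Re (\<psi> z) = 1 \<longrightarrow> z \<in> Er)"
    if z: "z \<in> R1" for z
  proof -
    have p: "\<psi> z \<in> R2" using im z by blast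
    have e: "\<psi> z = Complex (Re (\<psi> z)) (Im (\<psi> z))" by simp
    have 1: "z \<in> Eb" if "Im (\<psi> z) = 0" using pull[OF _ z sub(1)] b[of "Re (\<psi> z)"] that p e by (simp add: inR2)
    have 2: "z \<in> Et" if "Im (\<psi> z) = m2" using pull[OF _ z sub(2)] t[of "Re (\<psi> z)"] that p e by (simp add: inR2)
    have 3: "z \<in> El" if "Re (\<psi> z) = 0" using pull[OF _ z sub(3)] le[of "Im (\<psi> z)"] that p e by (simp add: inR2)
    have 4: "z \<in> Er" if "Re (\<psi> z) = 1" using pull[OF _ z sub(4)] ri[of "Im (\<psi> z)"] that p e by (simp add: inR2)
    show ?thesis using 1 2 3 4 by blast
  qed
  have sb: "Im (\<psi> z) = 0" if z: "z \<in> R1" "Im z = 0" for z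
  proof -
    have bz: "Re z = 0 \<or> Re z = 1 \<or> Im z = 0 \<or> Im z = m1" using z(2) by blast
    have w: "(Im (\<psi> z) = 0 \<longrightarrow> Im z = 0) \<and> (Im (\<psi> z) = m2 \<longrightarrow> Im z = m1) \<and> (Re (\<psi> z) = 0 \<longrightarrow> Re z = 0) \<and> (Re (\<psi> z) = 1 \<longrightarrow> Re z = 1)"
      using which[OF z(1)] by (simp add: Eb_def Et_def El_def Er_def)
    from \<psi>bd[OF z(1) bz] consider "Re (\<psi> z) = 0" | "Re (\<psi> z) = 1" | "Im (\<psi> z) = 0" | "Im (\<psi> z) = m2" by blast
    then show ?thesis
    proof cases
      case 1
      then have "z = 0" using w z(2) by (simp add: complex_eq_iff)
      then show ?thesis using corners by simp
    next
      case 2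
      then have "z = 1" using w z(2) by (simp add: complex_eq_iff)
      then show ?thesis using corners by simp
    next
      case 3
      then show ?thesis by simp
    next
      case 4
      then show ?thesis using w z(2) m by simp
    qed
  qed
  have st: "Im (\<psi> z) = m2" if z: "z \<in> R1" "Im z = m1" for z
  proof -
    have bz: "Re z = 0 \<or> Re z = 1 \<or> Im z = 0 \<or> Im z = m1" using z(2) by blast
    have w: "(Im (\<psi> z) = 0 \<longrightarrow> Im z = 0) \<and> (Im (\<psi> z) = m2 \<longrightarrow> Im z = m1) \<and> (Re (\<psi> z) = 0 \<longrightarrow> Re z = 0) \<and> (Re (\<psi> z) = 1 \<longrightarrow> Re z = 1)"
      using which[OF z(1)] by (simp add: Eb_def Et_def El_def Er_def)
    from \<psi>bd[OF z(1) bz] consider "Re (\<psi> z) = 0" | "Re (\<psi> z) = 1" | "Im (\<psi> z) = 0" | "Im (\<psi> z) = m2" by blast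
    then show ?thesis
    proof cases
      case 1
      then have "z = Complex 0 m1" using w z(2) by (simp add: complex_eq_iff)
      then show ?thesis using corners by simp
    next
      case 2
      then have "z = Complex 1 m1" using w z(2) by (simp add: complex_eq_iff)
      then show ?thesis using corners by simp
    next
      case 3
      then show ?thesis using w z(2) m by simp
    next
      case 4
      then show ?thesis by simp
    qed
  qed
  have sl: "Re (\<psi> z) = 0" if z: "z \<in> R1" "Re z = 0" for z
  proof -
    have bz: "Re z = 0 \<or> Re z = 1 \<or> Im z = 0 \<or> Im z = m1" using z(2) by blast
    have w: "(Im (\<psi> z) = 0 \<longrightarrow> Im z = 0) \<and> (Im (\<psi> z) = m2 \<longrightarrow> Im z = m1) \<and> (Re (\<psi> z) = 0 \<longrightarrow> Re z = 0) \<and> (Re (\<psi> z) = 1 \<longrightarrow> Re z = 1)"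
      using which[OF z(1)] by (simp add: Eb_def Et_def El_def Er_def)
    from \<psi>bd[OF z(1) bz] consider "Re (\<psi> z) = 0" | "Re (\<psi> z) = 1" | "Im (\<psi> z) = 0" | "Im (\<psi> z) = m2" by blast
    then show ?thesis
    proof cases
      case 1
      then show ?thesis by simp
    next
      case 2
      then show ?thesis using w z(2) m by simp
    next
      case 3
      then have "z = 0" using w z(2) by (simp add: complex_eq_iff)
      then show ?thesis using corners by simp
    next
      case 4
      then have "z = Complex 0 m1" using w z(2) by (simp add: complex_eq_iff)
      then show ?thesis using corners by simp
    qed
  qed
  have sr: "Re (\<psi> z) = 1" if z: "z \<in> R1" "Re z = 1" for z
  proof -
    have bz: "Re z = 0 \<or> Re z = 1 \<or> Im z = 0 \<or> Im z = m1" using z(2) by blast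
    have w: "(Im (\<psi> z) = 0 \<longrightarrow> Im z = 0) \<and> (Im (\<psi> z) = m2 \<longrightarrow> Im z = m1) \<and> (Re (\<psi> z) = 0 \<longrightarrow> Re z = 0) \<and> (Re (\<psi> z) = 1 \<longrightarrow> Re z = 1)"
      using which[OF z(1)] by (simp add: Eb_def Et_def El_def Er_def)
    from \<psi>bd[OF z(1) bz] consider "Re (\<psi> z) = 0" | "Re (\<psi> z) = 1" | "Im (\<psi> z) = 0" | "Im (\<psi> z) = m2" by blast
    then show ?thesis
    proof cases
      case 1
      then show ?thesis using w z(2) m by simp
    next
      case 2
      then show ?thesis by simp
    next
      case 3
      then have "z = 1" using w z(2) by (simp add: complex_eq_iff)
      then show ?thesis using corners by simp
    next
      case 4
      then have "z = Complex 1 m1" using w z(2) by (simp add: complex_eq_iff)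
      then show ?thesis using corners by simp
    qed
  qed
  define \<kappa> where "\<kappa> = m2 / m1"
  have \<kappa>: "\<kappa> * m1 = m2" using m by (simp add: \<kappa>_def)
  \<comment> \<open>The maximum principle bounds from above only; taking both signs \<open>e\<close>
    makes the imaginary part vanish.\<close>
  have le0: "Im (e * (\<psi> z - of_real \<kappa> * z)) \<le> 0" if e: "e = 1 \<or> e = -1" and z: "z \<in> R1" for e z :: complex
  proof -
    have es: "Re (e * u) = Re e * Re u" "Im (e * u) = Re e * Im u" for u using e by auto
    show ?thesis
    proof (rule mixed_boundary_max[OF m(1), of "\<lambda>z. e * (\<psi> z - of_real \<kappa> * z)" 0 "Re e * (1 - \<kappa>)"])
      show "continuous_on (cbox 0 (Complex 1 m1)) (\<lambda>z. e * (\<psi> z - of_real \<kappa> * z))"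
        using cont unfolding R1_def by (intro continuous_intros)
      show "(\<lambda>z. e * (\<psi> z - of_real \<kappa> * z)) holomorphic_on box 0 (Complex 1 m1)"
        using hol unfolding B1_def by (intro holomorphic_on_mult holomorphic_on_diff holomorphic_on_const holomorphic_on_ident)
      show "z \<in> cbox 0 (Complex 1 m1)" using z by (simp add: R1_def)
      fix u assume "u \<in> cbox 0 (Complex 1 m1)"
      then have u: "u \<in> R1" by (simp add: R1_def)
      show "Im (e * (\<psi> u - of_real \<kappa> * u)) \<le> 0" if "Im u = 0 \<or> Im u = m1"
        using sb[OF u] st[OF u] that \<kappa> unfolding es by auto
      show "Re (e * (\<psi> u - of_real \<kappa> * u)) = 0" if "Re u = 0" using sl[OF u] that unfolding es by simp
      show "Re (e * (\<psi> u - of_real \<kappa> * u)) = Re e * (1 - \<kappa>)" if "Re u = 1" using sr[OF u] that unfolding es by simp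
    qed
  qed
  have im0: "Im (\<psi> z - of_real \<kappa> * z) = 0" if "z \<in> R1" for z
    using le0[of 1 z] le0[of "-1" z] that by simp
  have ne: "B1 \<noteq> {}"
  proof -
    have "Complex (1/2) (m1/2) \<in> B1" using m by (simp add: inB1)
    then show ?thesis by blast
  qed
  have "(\<lambda>z. \<psi> z - of_real \<kappa> * z) constant_on B1"
  proof (rule ccontr)
    assume nc: "\<not> ?thesis"
    have "open ((\<lambda>z. \<psi> z - of_real \<kappa> * z) ` B1)"
    proof (rule open_mapping_thm[OF _ BR(3) _ BR(3) subset_refl nc])
      show "(\<lambda>z. \<psi> z - of_real \<kappa> * z) holomorphic_on B1"
        using hol by (intro holomorphic_on_diff holomorphic_on_mult holomorphic_on_const holomorphic_on_ident)
      show "connected B1" by (simp add: B1_def convex_connected convex_box)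
    qed
    moreover have "(\<lambda>z. \<psi> z - of_real \<kappa> * z) ` B1 \<subseteq> {z. Im z = 0}" using im0 BR(1) by auto
    ultimately have "(\<lambda>z. \<psi> z - of_real \<kappa> * z) ` B1 \<subseteq> interior {z. Im z = 0}" by (rule interior_maximal[rotated])
    moreover have "interior {z. Im z = 0} = {}"
    proof -
      have "interior {z::complex. \<i> \<bullet> z = 0} = {}" by (rule interior_hyperplane) simp
      moreover have "{z::complex. \<i> \<bullet> z = 0} = {z. Im z = 0}" by (auto simp: inner_complex_def)
      ultimately show ?thesis by simp
    qed
    ultimately show False using ne by blast
  qed
  then obtain c where c: "\<And>z. z \<in> B1 \<Longrightarrow> \<psi> z - of_real \<kappa> * z = c" unfolding constant_on_def by blast
  have clB: "closure B1 = R1" using ne unfolding B1_def R1_def by (rule closure_box)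
  have "(\<lambda>z. \<psi> z - of_real \<kappa> * z) ` closure B1 \<subseteq> {c}"
  proof (rule image_closure_subset)
    show "continuous_on (closure B1) (\<lambda>z. \<psi> z - of_real \<kappa> * z)" unfolding clB using cont by (intro continuous_intros)
  qed (use c in auto)
  then have "\<psi> 0 - of_real \<kappa> * 0 = c" "\<psi> 1 - of_real \<kappa> * 1 = c" using cR1 unfolding clB by auto
  then have "of_real \<kappa> = (1::complex)" using corners by simp
  then have "\<kappa> = 1" by (simp only: of_real_eq_1_iff)
  then show ?thesis using \<kappa> by simp
qed

section \<open>Harmonic measure estimates\<close>

text \<open>\<open>view_angle s t\<close> is the angle under which the interval \<open>[s, t]\<close> is seen, i.e. \<open>\<pi>\<close> times its harmonic
  measure in the upper half plane; it is the real part of \<open>view_angle_fun s t\<close>.\<close>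

definition view_angle_fun :: "real \<Rightarrow> real \<Rightarrow> complex \<Rightarrow> complex" where
  "view_angle_fun s t \<zeta> = - \<i> * (Ln (\<zeta> - of_real t) - Ln (\<zeta> - of_real s))"

definition view_angle :: "real \<Rightarrow> real \<Rightarrow> complex \<Rightarrow> real" where "view_angle s t \<zeta> = Re (view_angle_fun s t \<zeta>)"

lemma view_angle_eq: "view_angle s t \<zeta> = Im (Ln (\<zeta> - of_real t)) - Im (Ln (\<zeta> - of_real s))"
  by (simp add: view_angle_def view_angle_fun_def)

lemma view_angle_fun_holomorphic: "view_angle_fun s t holomorphic_on {\<zeta>. 0 < Im \<zeta>}"
  unfolding view_angle_fun_def
  by (intro holomorphic_on_mult holomorphic_on_diff holomorphic_on_const holomorphic_on_Ln' holomorphic_on_ident)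
     (auto simp: complex_nonpos_Reals_iff)

text \<open>The derivative of \<open>Im (Ln (\<zeta> - r))\<close> in \<open>r\<close> is the
  Poisson kernel. The mean value theorem turns the angle into the length of the interval times the
  kernel at an intermediate point, and the quantitative bounds on angles rest on this form.\<close>

lemma view_angle_mean:
  assumes "0 < Im \<zeta>" "s < t"
  obtains \<xi> where "s < \<xi>" "\<xi> < t" "view_angle s t \<zeta> = (t - s) * (Im \<zeta> / (norm (\<zeta> - of_real \<xi>))\<^sup>2)"
proof -
  have d: "((\<lambda>r. Im (Ln (\<zeta> - of_real r))) has_real_derivative Im \<zeta> / (norm (\<zeta> - of_real r))\<^sup>2) (at r)" for r
  proof -
    have nz: "\<zeta> - of_real r \<notin> \<real>\<^sub>\<le>\<^sub>0" using assms by (simp add: complex_nonpos_Reals_iff)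
    have "((\<lambda>r. \<zeta> - of_real r) has_vector_derivative 0 - of_real 1) (at r)"
      by (intro has_vector_derivative_diff has_vector_derivative_const has_vector_derivative_of_real DERIV_ident)
    from field_vector_diff_chain_at[OF this has_field_derivative_Ln[OF nz]]
    have "((\<lambda>r. Ln (\<zeta> - of_real r)) has_vector_derivative - inverse (\<zeta> - of_real r)) (at r)" by (simp add: o_def)
    then have "((\<lambda>r. Im (Ln (\<zeta> - of_real r))) has_vector_derivative Im (- inverse (\<zeta> - of_real r))) (at r)"
      by (rule bounded_linear.has_vector_derivative[OF bounded_linear_Im])
    then show ?thesis by (simp add: has_real_derivative_iff_has_vector_derivative cmod_power2)
  qed
  obtain \<xi> where "s < \<xi>" "\<xi> < t" "Im (Ln (\<zeta> - of_real t)) - Im (Ln (\<zeta> - of_real s)) = (t - s) * (Im \<zeta> / (norm (\<zeta> - of_real \<xi>))\<^sup>2)"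
    using MVT2[OF assms(2), of "\<lambda>r. Im (Ln (\<zeta> - of_real r))" "\<lambda>r. Im \<zeta> / (norm (\<zeta> - of_real r))\<^sup>2"] d by auto
  then show thesis using that by (simp add: view_angle_eq)
qed

lemma view_angle_nonneg: "0 < Im \<zeta> \<Longrightarrow> s < t \<Longrightarrow> 0 \<le> view_angle s t \<zeta>"
proof -
  assume a: "0 < Im \<zeta>" "s < t"
  obtain \<xi> where "view_angle s t \<zeta> = (t - s) * (Im \<zeta> / (norm (\<zeta> - of_real \<xi>))\<^sup>2)" using view_angle_mean[OF a] by blast
  moreover have "0 \<le> (t - s) * (Im \<zeta> / (norm (\<zeta> - of_real \<xi>))\<^sup>2)"
    using a by (intro mult_nonneg_nonneg divide_nonneg_nonneg) auto
  ultimately show ?thesis by simp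
qed

lemma view_angle_le_pi: "0 < Im \<zeta> \<Longrightarrow> view_angle s t \<zeta> \<le> pi"
proof -
  assume a: "0 < Im \<zeta>"
  have "\<zeta> - of_real t \<noteq> 0" "\<zeta> - of_real s \<noteq> 0" using a by (auto simp: complex_eq_iff)
  then have "Im (Ln (\<zeta> - of_real t)) \<le> pi" "0 < Im (Ln (\<zeta> - of_real s))"
    using Im_Ln_le_pi Im_Ln_pos_lt[of "\<zeta> - of_real s"] a by auto
  then show ?thesis by (simp add: view_angle_eq)
qed

lemma view_angle_far:
  assumes "0 < Im \<zeta>" "s < t" "\<bar>s\<bar> \<le> c" "\<bar>t\<bar> \<le> c" "2 * c \<le> norm \<zeta>"
  shows "view_angle s t \<zeta> \<le> 4 * (t - s) / norm \<zeta>"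
proof -
  obtain \<xi> where x: "s < \<xi>" "\<xi> < t" "view_angle s t \<zeta> = (t - s) * (Im \<zeta> / (norm (\<zeta> - of_real \<xi>))\<^sup>2)" using view_angle_mean assms by blast
  have nz: "norm \<zeta> > 0" using assms(1) by auto
  have "norm \<zeta> / 2 \<le> norm (\<zeta> - of_real \<xi>)" using norm_triangle_ineq2[of \<zeta> "of_real \<xi>"] x assms by auto
  then have "(norm \<zeta> / 2)\<^sup>2 \<le> (norm (\<zeta> - of_real \<xi>))\<^sup>2" by (intro power_mono) auto
  then have "Im \<zeta> / (norm (\<zeta> - of_real \<xi>))\<^sup>2 \<le> norm \<zeta> / (norm \<zeta> / 2)\<^sup>2"
    using assms(1) nz abs_Im_le_cmod[of \<zeta>] by (intro frac_le) auto
  also have "\<dots> = 4 / norm \<zeta>" using nz by (simp add: power2_eq_square)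
  finally have "(t - s) * (Im \<zeta> / (norm (\<zeta> - of_real \<xi>))\<^sup>2) \<le> (t - s) * (4 / norm \<zeta>)"
    using assms by (intro mult_left_mono) auto
  then show ?thesis using x(3) by (simp add: mult.commute)
qed

lemma view_angle_tendsto_0:
  assumes q: "(q \<longlongrightarrow> w0) F" "Im w0 = 0" "\<forall>\<^sub>F z in F. 0 < Im (q z)" and st: "s < t" "Re w0 < s \<or> t < Re w0"
  shows "((\<lambda>z. view_angle s t (q z)) \<longlongrightarrow> 0) F"
proof -
  define d where "d = (if Re w0 < s then s - Re w0 else Re w0 - t) / 2"
  have d: "d > 0" using st by (auto simp: d_def)
  have "\<forall>\<^sub>F z in F. \<bar>Re (q z) - Re w0\<bar> < d"
    using tendstoD[OF tendsto_Re[OF q(1)] d] by (simp add: dist_real_def)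
  then have up: "\<forall>\<^sub>F z in F. view_angle s t (q z) \<le> (t - s) / d\<^sup>2 * Im (q z)" using q(3)
  proof eventually_elim
    case (elim z)
    obtain \<xi> where x: "s < \<xi>" "\<xi> < t" "view_angle s t (q z) = (t - s) * (Im (q z) / (norm (q z - of_real \<xi>))\<^sup>2)" using view_angle_mean elim st by blast
    have "d \<le> \<bar>Re (q z) - \<xi>\<bar>" using elim(1) x st by (auto simp: d_def abs_if split: if_splits)
    also have "\<dots> \<le> norm (q z - of_real \<xi>)" using abs_Re_le_cmod[of "q z - of_real \<xi>"] by simp
    finally have "d\<^sup>2 \<le> (norm (q z - of_real \<xi>))\<^sup>2" using d by (intro power_mono) auto
    then have "Im (q z) / (norm (q z - of_real \<xi>))\<^sup>2 \<le> Im (q z) / d\<^sup>2" using elim d by (intro frac_le) auto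
    then have "(t - s) * (Im (q z) / (norm (q z - of_real \<xi>))\<^sup>2) \<le> (t - s) * (Im (q z) / d\<^sup>2)" using st by (intro mult_left_mono) auto
    then show ?case using x by simp
  qed
  have lo: "\<forall>\<^sub>F z in F. 0 \<le> view_angle s t (q z)" using q(3) by eventually_elim (rule view_angle_nonneg[OF _ st(1)])
  have "((\<lambda>z. (t - s) / d\<^sup>2 * Im (q z)) \<longlongrightarrow> (t - s) / d\<^sup>2 * Im w0) F" by (intro tendsto_mult tendsto_const tendsto_Im q(1))
  then have "((\<lambda>z. (t - s) / d\<^sup>2 * Im (q z)) \<longlongrightarrow> 0) F" using q(2) by simp
  then show ?thesis by (rule tendsto_sandwich[OF lo up tendsto_const])
qed

lemma view_angle_tendsto_pi:
  assumes q: "(q \<longlongrightarrow> w0) F" "Im w0 = 0" "\<forall>\<^sub>F z in F. 0 < Im (q z)" and st: "s < Re w0" "Re w0 < t"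
  shows "((\<lambda>z. view_angle s t (q z)) \<longlongrightarrow> pi) F"
proof -
  have w0: "w0 = of_real (Re w0)" using q(2) by (simp add: complex_eq_iff)
  have pos: "Im (Ln (of_real r)) = 0" "isCont Ln (of_real r)" if "r > 0" for r
    using that by (auto intro!: continuous_at_Ln simp: complex_nonpos_Reals_iff)
  have e1: "w0 - of_real s = of_real (Re w0 - s)" "of_real t - w0 = of_real (t - Re w0)" using w0 by (simp_all add: complex_eq_iff q(2))
  have 1: "((\<lambda>z. Im (Ln (q z - of_real s))) \<longlongrightarrow> Im (Ln (w0 - of_real s))) F"
    by (intro tendsto_Im isCont_tendsto_compose[of _ Ln] tendsto_diff q tendsto_const) (unfold e1, rule pos, use st in simp)
  have 2: "((\<lambda>z. Im (Ln (of_real t - q z))) \<longlongrightarrow> Im (Ln (of_real t - w0))) F"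
    by (intro tendsto_Im isCont_tendsto_compose[of _ Ln] tendsto_diff q tendsto_const) (unfold e1, rule pos, use st in simp)
  have "((\<lambda>z. pi + Im (Ln (of_real t - q z)) - Im (Ln (q z - of_real s))) \<longlongrightarrow> pi + Im (Ln (of_real t - w0)) - Im (Ln (w0 - of_real s))) F"
    by (intro tendsto_diff tendsto_add tendsto_const 1 2)
  then have "((\<lambda>z. pi + Im (Ln (of_real t - q z)) - Im (Ln (q z - of_real s))) \<longlongrightarrow> pi) F"
    unfolding e1 using pos(1)[of "t - Re w0"] pos(1)[of "Re w0 - s"] st by simp
  \<comment> \<open>\<open>Ln (q z - t)\<close> would be evaluated near its branch cut; rewritten as
    \<open>Ln (t - q z) + \<i> * pi\<close> its limit is a matter of continuity.\<close>
  moreover have "\<forall>\<^sub>F z in F. pi + Im (Ln (of_real t - q z)) - Im (Ln (q z - of_real s)) = view_angle s t (q z)"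
    using q(3)
  proof eventually_elim
    case (elim z)
    have "Im (of_real t - q z) < 0" using elim by simp
    moreover from this have "of_real t - q z \<noteq> 0" by (metis less_irrefl zero_complex.sel(2))
    ultimately have "Ln (- (of_real t - q z)) = Ln (of_real t - q z) + \<i> * pi"
      by (subst Ln_minus) auto
    then show ?case by (simp add: view_angle_eq)
  qed
  ultimately show ?thesis by (rule Lim_transform_eventually)
qed

lemma Re_ii_over: "Re (\<i> / \<zeta>) = Im \<zeta> / (norm \<zeta>)\<^sup>2"
  by (simp add: Re_divide cmod_power2)

lemma Re_comparison_principle:
  assumes S: "open S" "connected S" and f: "f1 holomorphic_on S" "f2 holomorphic_on S"
    and fr: "\<And>p e. p \<in> frontier S \<Longrightarrow> e > 0 \<Longrightarrow> \<forall>\<^sub>F z in at p within S. Re (f1 z) < Re (f2 z) + e"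
    and inf: "\<And>e. e > 0 \<Longrightarrow> \<exists>R. \<forall>z\<in>S. norm z > R \<longrightarrow> Re (f1 z) < Re (f2 z) + e"
    and z: "z \<in> S"
  shows "Re (f1 z) \<le> Re (f2 z)"
proof -
  have "Re (f1 z - f2 z) \<le> 0"
  proof (rule max_principle[OF S _ _ _ z])
    show "(\<lambda>z. f1 z - f2 z) holomorphic_on S" using f by (rule holomorphic_on_diff)
    show "\<forall>\<^sub>F z in at p within S. Re (f1 z - f2 z) < e" if "p \<in> frontier S" "e > 0" for p e
      using fr[OF that] by eventually_elim simp
    show "\<exists>R. \<forall>z\<in>S. R < norm z \<longrightarrow> Re (f1 z - f2 z) < e" if "e > 0" for e
      using inf[OF that] by (auto simp: diff_less_eq add.commute)
  qed
  then show ?thesis by simp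
qed

lemma eventually_lt_of_limits:
  fixes f1 f2 :: "'a \<Rightarrow> real"
  assumes "(f1 \<longlongrightarrow> a) F" "\<forall>\<^sub>F z in F. 0 \<le> f2 z" "a \<le> 0" "e > 0"
  shows "\<forall>\<^sub>F z in F. f1 z < f2 z + e"
  using order_tendstoD(2)[OF assms(1), of e] assms(2-4) by (auto elim: eventually_elim2)

lemma eventually_lt_of_limits2:
  fixes f1 f2 :: "'a \<Rightarrow> real"
  assumes "(f2 \<longlongrightarrow> a) F" "\<forall>\<^sub>F z in F. f1 z \<le> c" "c \<le> a" "e > 0"
  shows "\<forall>\<^sub>F z in F. f1 z < f2 z + e"
proof -
  have "\<forall>\<^sub>F z in F. a - e < f2 z" using order_tendstoD(1)[OF assms(1), of "a - e"] assms(4) by simp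
  then show ?thesis using assms(2) by eventually_elim (use assms in linarith)
qed

section \<open>Angles pulled back to the quarter domain\<close>

locale corner_map = corner +
  fixes u :: "complex \<Rightarrow> complex" and \<mu> :: real
  assumes contu: "continuous_on Tb u" and inju: "inj_on u Tb" and imTb: "u ` Tb = {w. 0 \<le> Im w}"
    and holu: "u holomorphic_on T" and imT: "u ` T = {w. 0 < Im w}"
    and uinf: "\<And>R. \<exists>R'. \<forall>z\<in>Tb. R' < norm z \<longrightarrow> R < norm (u z)"
    and \<mu>: "0 < \<mu>" "\<mu> < 1"
    and u0: "u (Complex 0 (h 0)) = 0" and u\<mu>: "u (Complex L (h L)) = of_real \<mu>" and u1: "u (Complex L 0) = 1"
    and ureal: "\<And>z. z \<in> Tb \<Longrightarrow> z \<notin> T \<Longrightarrow> Im (u z) = 0"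
    and u_im: "\<And>y. h 0 < y \<Longrightarrow> Re (u (Complex 0 y)) < 0"
    and u_gr: "\<And>x. 0 < x \<Longrightarrow> x < L \<Longrightarrow> 0 < Re (u (Complex x (h x))) \<and> Re (u (Complex x (h x))) < \<mu>"
    and u_seg: "\<And>y. 0 < y \<Longrightarrow> y < h L \<Longrightarrow> \<mu> < Re (u (Complex L y)) \<and> Re (u (Complex L y)) < 1"
    and u_re: "\<And>x. L < x \<Longrightarrow> 1 < Re (u (Complex x 0))"
begin

lemma Imu: "z \<in> T \<Longrightarrow> 0 < Im (u z)" using imT by blast

lemma eventually_in_within: "\<forall>\<^sub>F z in at p within S. z \<in> S" by (simp add: eventually_at_filter)

lemma u_lim: "p \<in> Tb \<Longrightarrow> S \<subseteq> T \<Longrightarrow> (u \<longlongrightarrow> u p) (at p within S)"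
  using contu T_subset unfolding continuous_on_def by (meson subset_trans tendsto_within_subset)

lemma frontier_T: "frontier T \<subseteq> Tb - T"
  using closure_minimal[OF T_subset closed_Tb] open_T by (auto simp: frontier_def interior_open)

lemma angu_holomorphic: "S \<subseteq> T \<Longrightarrow> (\<lambda>z. view_angle_fun s t (u z)) holomorphic_on S"
  using holomorphic_on_compose_gen[OF holomorphic_on_subset[OF holu] view_angle_fun_holomorphic, of S s t] Imu
  by (force simp: o_def)

lemma angu_lim0:
  assumes "p \<in> Tb" "p \<notin> T" "S \<subseteq> T" "s < t" "Re (u p) < s \<or> t < Re (u p)"
  shows "((\<lambda>z. view_angle s t (u z)) \<longlongrightarrow> 0) (at p within S)"
  by (rule view_angle_tendsto_0[OF u_lim[OF assms(1,3)] ureal[OF assms(1,2)] _ assms(4,5)])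
     (rule eventually_mono[OF eventually_in_within], use Imu assms(3) in blast)

lemma angu_lim_pi:
  assumes "p \<in> Tb" "p \<notin> T" "S \<subseteq> T" "s < Re (u p)" "Re (u p) < t"
  shows "((\<lambda>z. view_angle s t (u z)) \<longlongrightarrow> pi) (at p within S)"
  by (rule view_angle_tendsto_pi[OF u_lim[OF assms(1,3)] ureal[OF assms(1,2)] _ assms(4,5)])
     (rule eventually_mono[OF eventually_in_within], use Imu assms(3) in blast)

lemma angu_inf:
  assumes "0 \<le> s" "s < t" "t \<le> 1" "e > 0"
  shows "\<exists>R. \<forall>z\<in>T. R < norm z \<longrightarrow> view_angle s t (u z) < e"
proof -
  obtain R where R: "\<forall>z\<in>Tb. R < norm z \<longrightarrow> 2 + 8 / e < norm (u z)" using uinf by blast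
  show ?thesis
  proof (intro exI[of _ R] ballI impI)
    fix z assume z: "z \<in> T" "R < norm z"
    then have n: "2 + 8 / e < norm (u z)" using R T_subset by blast
    have e8: "0 < 8 / e" using assms by simp
    have n2: "2 \<le> norm (u z)" using n e8 by linarith
    have "view_angle s t (u z) \<le> 4 * (t - s) / norm (u z)"
      by (rule view_angle_far[of _ _ _ 1]) (use Imu[OF z(1)] assms n2 in auto)
    also have "\<dots> \<le> 4 / norm (u z)" using assms n e8 by (intro divide_right_mono) auto
    also have "\<dots> < e"
    proof -
      have "8 / e < norm (u z)" "0 < norm (u z)" using n e8 by linarith+
      then show ?thesis using assms(4) by (simp add: field_simps)
    qed
    finally show "view_angle s t (u z) < e" .
  qed
qed

lemma u_cases:
  assumes "p \<in> Tb" "p \<notin> T"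
  obtains (im) "Re p = 0" "h 0 < Im p" "Re (u p) < 0"
    | (zero) "Re p = 0" "Im p = h 0" "Re (u p) = 0"
    | (graph) "0 < Re p" "Re p < L" "Im p = h (Re p)" "0 < Re (u p)" "Re (u p) < \<mu>"
    | (top) "Re p = L" "Im p = h L" "Re (u p) = \<mu>"
    | (seg) "Re p = L" "0 < Im p" "Im p < h L" "\<mu> < Re (u p)" "Re (u p) < 1"
    | (one) "Re p = L" "Im p = 0" "Re (u p) = 1"
    | (real) "L < Re p" "Im p = 0" "1 < Re (u p)"
proof -
  have p: "p = Complex (Re p) (Im p)" by simp
  from assms show thesis
  proof (rule Tb_T_cases)
    assume a: "Re p = 0" "h 0 \<le> Im p"
    then show thesis using p u0 u_im[of "Im p"] im zero
      by (metis less_eq_real_def zero_complex.sel(1))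
  next
    assume a: "0 < Re p" "Re p < L" "Im p = h (Re p)"
    then show thesis using p u_gr[of "Re p"] graph by metis
  next
    assume a: "Re p = L" "0 \<le> Im p" "Im p \<le> h L"
    then consider "Im p = 0" | "0 < Im p" "Im p < h L" | "Im p = h L" by linarith
    then show thesis
    proof cases
      case 1 then show thesis using one a p u1 by (metis one_complex.sel(1))
    next
      case 2 then show thesis using seg a p u_seg[of "Im p"] by metis
    next
      case 3 then show thesis using top a p u\<mu> by (metis Re_complex_of_real)
    qed
  next
    assume "L < Re p" "Im p = 0"
    then show thesis using real p u_re[of "Re p"] by metis
  qed
qed

end

section \<open>Comparison functions on quadrants\<close>

lemma sq_in_upper: "0 < Re w \<Longrightarrow> 0 < Im w \<Longrightarrow> 0 < Im (w\<^sup>2)"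
  by (simp add: power2_eq_square)

text \<open>\<open>(z - c)\<^sup>2\<close> maps the quadrant with corner \<open>c\<close> onto the
  upper half plane, its horizontal side to the positive and its vertical side to the negative real
  axis. For an interval on one of these half axes, \<open>view_angle\<close> of the square is
  therefore \<open>pi\<close> times the harmonic measure of a piece of one side.\<close>

lemma ang_sq_holomorphic:
  assumes "\<And>z. z \<in> S \<Longrightarrow> 0 < Re (z - c) \<and> 0 < Im (z - c)"
  shows "(\<lambda>z. view_angle_fun s t ((z - c)\<^sup>2)) holomorphic_on S"
proof -
  have "(\<lambda>z. (z - c)\<^sup>2) holomorphic_on S"
    by (intro holomorphic_on_power holomorphic_on_diff holomorphic_on_ident holomorphic_on_const)
  moreover have "(\<lambda>z. (z - c)\<^sup>2) ` S \<subseteq> {\<zeta>. 0 < Im \<zeta>}"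
  proof
    fix w assume "w \<in> (\<lambda>z. (z - c)\<^sup>2) ` S"
    then obtain z where "z \<in> S" "w = (z - c)\<^sup>2" by blast
    then show "w \<in> {\<zeta>. 0 < Im \<zeta>}" using sq_in_upper[of "z - c"] assms by blast
  qed
  ultimately show ?thesis
    using holomorphic_on_compose_gen[OF _ view_angle_fun_holomorphic[of s t], of "\<lambda>z. (z - c)\<^sup>2" S] unfolding o_def by blast
qed

lemma ang_sq_lim0:
  assumes S: "\<And>z. z \<in> S \<Longrightarrow> 0 < Re (z - c) \<and> 0 < Im (z - c)"
    and p: "Re (p - c) = 0 \<or> Im (p - c) = 0" "s < t" "(Re (p - c))\<^sup>2 - (Im (p - c))\<^sup>2 < s \<or> t < (Re (p - c))\<^sup>2 - (Im (p - c))\<^sup>2"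
  shows "((\<lambda>z. view_angle s t ((z - c)\<^sup>2)) \<longlongrightarrow> 0) (at p within S)"
proof (rule view_angle_tendsto_0)
  show "((\<lambda>z. (z - c)\<^sup>2) \<longlongrightarrow> (p - c)\<^sup>2) (at p within S)" by (intro tendsto_intros)
  show "Im ((p - c)\<^sup>2) = 0" using p(1) by (auto simp: power2_eq_square)
  have "\<forall>\<^sub>F z in at p within S. z \<in> S" by (simp add: eventually_at_filter)
  then show "\<forall>\<^sub>F z in at p within S. 0 < Im ((z - c)\<^sup>2)"
    by eventually_elim (use S sq_in_upper in blast)
  show "Re ((p - c)\<^sup>2) < s \<or> t < Re ((p - c)\<^sup>2)" using p(3) by (simp add: power2_eq_square)
qed fact

lemma ang_sq_inf:
  assumes S: "\<And>z. z \<in> S \<Longrightarrow> 0 < Re (z - c) \<and> 0 < Im (z - c)" and st: "s < t" and e: "e > 0"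
  shows "\<exists>R. \<forall>z\<in>S. R < norm z \<longrightarrow> view_angle s t ((z - c)\<^sup>2) < e"
proof -
  define K where "K = 2 * (\<bar>s\<bar> + \<bar>t\<bar>) + 4 * (t - s) / e + 1"
  have K: "K \<ge> 1" "2 * (\<bar>s\<bar> + \<bar>t\<bar>) \<le> K" "4 * (t - s) / e < K" using st e by (auto simp: K_def intro: add_nonneg_nonneg add_nonneg_pos)
  show ?thesis
  proof (intro exI[of _ "K + norm c"] ballI impI)
    fix z assume z: "z \<in> S" "K + norm c < norm z"
    then have n1: "K < norm (z - c)" using norm_triangle_ineq2[of z c] by linarith
    then have "norm (z - c) * 1 \<le> norm (z - c) * norm (z - c)" using K(1) by (intro mult_left_mono) auto
    moreover have "norm ((z - c)\<^sup>2) = norm (z - c) * norm (z - c)" by (simp only: power2_eq_square norm_mult)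
    ultimately have n: "K < norm ((z - c)\<^sup>2)" using n1 by linarith
    have up: "0 < Im ((z - c)\<^sup>2)" by (rule sq_in_upper) (use S[OF z(1)] in auto)
    have "view_angle s t ((z - c)\<^sup>2) \<le> 4 * (t - s) / norm ((z - c)\<^sup>2)"
      by (rule view_angle_far[OF up st, of "\<bar>s\<bar> + \<bar>t\<bar>"]) (use K n in linarith)+
    also have "\<dots> < e"
    proof -
      have "4 * (t - s) / e < norm ((z - c)\<^sup>2)" "0 < norm ((z - c)\<^sup>2)" using n K by linarith+
      then show ?thesis using e by (simp add: field_simps)
    qed
    finally show "view_angle s t ((z - c)\<^sup>2) < e" .
  qed
qed

context corner_map
begin

lemma T_in_quadrant: "z \<in> T \<Longrightarrow> 0 < Re z \<and> 0 < Im z" by (simp add: T_def)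

lemma Im_sq: "Im (z\<^sup>2) = 2 * Re z * Im z" by (simp add: power2_eq_square)

lemma lim_within_isCont: "isCont f p \<Longrightarrow> (f \<longlongrightarrow> f p) (at p within S)"
  unfolding isCont_def by (rule tendsto_within_subset[OF _ subset_UNIV])

text \<open>The kernel \<open>Im (-1 / (z\<^sup>2 - c + i e))\<close>, whose pole lies outside the quadrant.\<close>

definition corner_kernel :: "real \<Rightarrow> real \<Rightarrow> complex \<Rightarrow> complex" where
  "corner_kernel c e z = \<i> / (z\<^sup>2 - of_real c + \<i> * of_real e)"

lemma corner_kernel_denominator_nz: "0 < e \<Longrightarrow> 0 \<le> Re z \<Longrightarrow> 0 \<le> Im z \<Longrightarrow> z\<^sup>2 - of_real c + \<i> * of_real e \<noteq> 0"
proof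
  assume a: "0 < e" "0 \<le> Re z" "0 \<le> Im z" and eq: "z\<^sup>2 - of_real c + \<i> * of_real e = 0"
  have "Im (z\<^sup>2 - of_real c + \<i> * of_real e) = 2 * Re z * Im z + e" by (simp add: Im_sq)
  moreover have "0 \<le> 2 * Re z * Im z" using a by simp
  ultimately show False using a eq by simp
qed

lemma Re_corner_kernel: "Re (corner_kernel c e z) = (2 * Re z * Im z + e) / (norm (z\<^sup>2 - of_real c + \<i> * of_real e))\<^sup>2"
  unfolding corner_kernel_def Re_ii_over by (simp add: Im_sq)

lemma Re_corner_kernel_nonneg: "0 < e \<Longrightarrow> 0 \<le> Re z \<Longrightarrow> 0 \<le> Im z \<Longrightarrow> 0 \<le> Re (corner_kernel c e z)"
  unfolding Re_corner_kernel by (intro divide_nonneg_nonneg add_nonneg_nonneg mult_nonneg_nonneg) auto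

lemma corner_kernel_holomorphic: "0 < e \<Longrightarrow> corner_kernel c e holomorphic_on T"
  unfolding corner_kernel_def
  by (intro holomorphic_on_divide holomorphic_on_const holomorphic_on_add holomorphic_on_diff holomorphic_on_power holomorphic_on_ident corner_kernel_denominator_nz)
     (auto dest: T_in_quadrant)

lemma corner_kernel_isCont: "0 < e \<Longrightarrow> 0 \<le> Re z \<Longrightarrow> 0 \<le> Im z \<Longrightarrow> isCont (corner_kernel c e) z"
  unfolding corner_kernel_def[abs_def] by (intro isCont_divide isCont_add isCont_diff isCont_power continuous_ident continuous_const corner_kernel_denominator_nz)

text \<open>The kernel serves as a positive harmonic majorant. The pulled-back angle never exceeds
  \<open>pi\<close>, and it tends to 0 at boundary points whose value under \<open>u\<close> lies
  off \<open>[s, t]\<close>; the assumption \<open>hump\<close> makes the majorant at least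
  \<open>pi\<close> on the arc that corresponds to \<open>[s, t]\<close>.\<close>

lemma view_angle_le_corner_kernel:
  assumes st: "0 \<le> s" "s < t" "t \<le> 1" and e: "0 < e" and A: "A > 0"
    and hump: "\<And>p. p \<in> Tb \<Longrightarrow> p \<notin> T \<Longrightarrow> s \<le> Re (u p) \<Longrightarrow> Re (u p) \<le> t \<Longrightarrow> pi \<le> A * Re (corner_kernel c e p)"
    and z: "z \<in> T"
  shows "view_angle s t (u z) \<le> A * Re (corner_kernel c e z)"
proof -
  have pos: "0 \<le> A * Re (corner_kernel c e z)" if "z \<in> T" for z using Re_corner_kernel_nonneg[OF e, of z] T_in_quadrant[OF that] A by simp
  have ee: "\<forall>\<^sub>F z in at p within T. 0 \<le> A * Re (corner_kernel c e z)" for p using eventually_mono[OF eventually_in_within pos] .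
  have "Re (view_angle_fun s t (u z)) \<le> Re (of_real A * corner_kernel c e z)"
  proof (rule Re_comparison_principle[OF open_T connected_T _ _ _ _ z])
    show "(\<lambda>z. view_angle_fun s t (u z)) holomorphic_on T" by (rule angu_holomorphic) simp
    show "(\<lambda>z. of_real A * corner_kernel c e z) holomorphic_on T" by (intro holomorphic_on_mult holomorphic_on_const corner_kernel_holomorphic e)
    show "\<exists>R. \<forall>z\<in>T. R < norm z \<longrightarrow> Re (view_angle_fun s t (u z)) < Re (of_real A * corner_kernel c e z) + d" if dp: "d > 0" for d
    proof -
      obtain R where R: "\<forall>z\<in>T. R < norm z \<longrightarrow> view_angle s t (u z) < d" using angu_inf[OF st dp] by blast
      show ?thesis
      proof (intro exI[of _ R] ballI impI)
        fix z assume z: "z \<in> T" "R < norm z"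
        then have "view_angle s t (u z) < d" using R by blast
        then show "Re (view_angle_fun s t (u z)) < Re (of_real A * corner_kernel c e z) + d" using pos[OF z(1)] by (simp add: view_angle_def)
      qed
    qed
    fix p and d :: real assume p: "p \<in> frontier T" and d: "d > 0"
    then have pT: "p \<in> Tb" "p \<notin> T" using frontier_T by auto
    have q: "0 \<le> Re p" "0 \<le> Im p" using pT by (auto simp: Tb_def)
    have "\<forall>\<^sub>F z in at p within T. view_angle s t (u z) < A * Re (corner_kernel c e z) + d"
    proof (cases "s \<le> Re (u p) \<and> Re (u p) \<le> t")
      case True
      show ?thesis
      proof (rule eventually_lt_of_limits2[OF _ _ _ d])
        show "((\<lambda>z. A * Re (corner_kernel c e z)) \<longlongrightarrow> A * Re (corner_kernel c e p)) (at p within T)"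
          by (intro tendsto_mult tendsto_const tendsto_Re lim_within_isCont corner_kernel_isCont e q)
        show "\<forall>\<^sub>F z in at p within T. view_angle s t (u z) \<le> pi"
          by (rule eventually_mono[OF eventually_in_within]) (use view_angle_le_pi Imu in blast)
        show "pi \<le> A * Re (corner_kernel c e p)" using hump pT True by blast
      qed
    next
      case False
      show ?thesis
        by (rule eventually_lt_of_limits[OF angu_lim0[OF pT subset_refl st(2)] ee _ d]) (use False in auto)
    qed
    then show "\<forall>\<^sub>F z in at p within T. Re (view_angle_fun s t (u z)) < Re (of_real A * corner_kernel c e z) + d" by (simp add: view_angle_def)
  qed
  then show ?thesis by (simp add: view_angle_def)
qed

lemma norm_sq_ker_denominator: "(norm (z\<^sup>2 - of_real c + \<i> * of_real e))\<^sup>2 = ((Re z)\<^sup>2 - (Im z)\<^sup>2 - c)\<^sup>2 + (2 * Re z * Im z + e)\<^sup>2"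
proof -
  have "Re (z\<^sup>2 - of_real c + \<i> * of_real e) = (Re z)\<^sup>2 - (Im z)\<^sup>2 - c"
    "Im (z\<^sup>2 - of_real c + \<i> * of_real e) = 2 * Re z * Im z + e" by (simp_all add: Im_sq Re_power2)
  then show ?thesis unfolding cmod_power2 by (simp only:)
qed

text \<open>On the segment \<open>z = L + \<i> * y\<close> one has
  \<open>z\<^sup>2 - L\<^sup>2 = - y\<^sup>2 + 2 * \<i> * L * y\<close>. With the shift
  \<open>L * h L\<close>, the denominator of the kernel has squared norm at most
  \<open>(1 + 9) * (L * h L)\<^sup>2\<close>, and the numerator is at least \<open>L * h L\<close>;
  this is the origin of the 10.\<close>

lemma segment_angle_upper:
  assumes k: "h L \<le> L" and z: "z \<in> T"
  shows "view_angle \<mu> 1 (u z) \<le> 10 * pi * (L * h L) * Re (corner_kernel (L\<^sup>2) (L * h L) z)"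
proof (rule view_angle_le_corner_kernel[OF _ \<mu>(2) order_refl _ _ _ z])
  define k where "k = h L"
  have kp: "0 < k" "k \<le> L" using hpos k by (auto simp: k_def)
  show "0 < L * h L" "0 < 10 * pi * (L * h L)" using L hpos by auto
  show "0 \<le> \<mu>" using \<mu> by simp
  fix p assume p: "p \<in> Tb" "p \<notin> T" "\<mu> \<le> Re (u p)" "Re (u p) \<le> 1"
  have "Re p = L \<and> 0 \<le> Im p \<and> Im p \<le> k" using p(1,2) by (rule u_cases) (use p \<mu> hpos[of L] in \<open>auto simp: k_def\<close>)
  then have y: "Re p = L" "0 \<le> Im p" "Im p \<le> k" by auto
  have N: "(norm (p\<^sup>2 - of_real (L\<^sup>2) + \<i> * of_real (L * k)))\<^sup>2 \<le> 10 * (L * k)\<^sup>2"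
  proof -
    have "(Im p)\<^sup>2 \<le> L * k" using y kp mult_mono[of "Im p" L "Im p" k] by (simp add: power2_eq_square)
    then have "((Im p)\<^sup>2)\<^sup>2 \<le> (L * k)\<^sup>2" by (intro power_mono) auto
    then have 1: "((Re p)\<^sup>2 - (Im p)\<^sup>2 - L\<^sup>2)\<^sup>2 \<le> (L * k)\<^sup>2" using y by simp
    have "L * Im p \<le> L * k" using y L by (intro mult_left_mono) auto
    then have "2 * Re p * Im p + L * k \<le> 3 * (L * k)" using y by simp
    then have "(2 * Re p * Im p + L * k)\<^sup>2 \<le> (3 * (L * k))\<^sup>2" using y L kp by (intro power_mono) auto
    then show ?thesis unfolding norm_sq_ker_denominator using 1 by (simp add: power_mult_distrib)
  qed
  have Np: "0 < (norm (p\<^sup>2 - of_real (L\<^sup>2) + \<i> * of_real (L * k)))\<^sup>2"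
    using corner_kernel_denominator_nz[of "L * k" p "L\<^sup>2"] y L kp by simp
  have "(L * k) / (10 * (L * k)\<^sup>2) \<le> Re (corner_kernel (L\<^sup>2) (L * k) p)"
    unfolding Re_corner_kernel using N Np y L kp by (intro frac_le) auto
  moreover have "pi = 10 * pi * (L * k) * ((L * k) / (10 * (L * k)\<^sup>2))" using L kp by (simp add: power2_eq_square)
  moreover have "0 \<le> 10 * pi * (L * k)" using L kp by simp
  ultimately have "pi \<le> 10 * pi * (L * k) * Re (corner_kernel (L\<^sup>2) (L * k) p)" by (metis mult_left_mono)
  then show "pi \<le> 10 * pi * (L * h L) * Re (corner_kernel (L\<^sup>2) (L * h L) p)" by (simp add: k_def)
qed

text \<open>The same computation with centre 0 and shift \<open>L\<^sup>2\<close>: graph and segment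
  together lie in the square of side \<open>L\<close>.\<close>

lemma graph_angle_upper:
  assumes M: "\<And>x. 0 \<le> x \<Longrightarrow> x \<le> L \<Longrightarrow> h x \<le> L" and z: "z \<in> T"
  shows "view_angle 0 1 (u z) \<le> 10 * pi * L\<^sup>2 * Re (corner_kernel 0 (L\<^sup>2) z)"
proof -
  have L2: "0 < L\<^sup>2" using L by simp
  have C: "0 < 10 * pi * L\<^sup>2" using L2 by auto
  have hump: "pi \<le> 10 * pi * L\<^sup>2 * Re (corner_kernel 0 (L\<^sup>2) p)" if p: "p \<in> Tb" "p \<notin> T" "0 \<le> Re (u p)" "Re (u p) \<le> 1" for p
  proof -
  have y: "0 \<le> Re p" "Re p \<le> L" "0 \<le> Im p" "Im p \<le> L"
  proof -
    have "0 \<le> Re p \<and> Re p \<le> L \<and> 0 \<le> Im p \<and> Im p \<le> L"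
      using p(1,2) by (rule u_cases) (use p \<mu> hpos M[of 0] M[of "Re p"] M[of L] L in \<open>auto simp: less_imp_le intro: order_trans\<close>)
    then show "0 \<le> Re p" "Re p \<le> L" "0 \<le> Im p" "Im p \<le> L" by auto
  qed
  have N: "(norm (p\<^sup>2 - of_real 0 + \<i> * of_real (L\<^sup>2)))\<^sup>2 \<le> 10 * (L\<^sup>2)\<^sup>2"
  proof -
    have sq: "0 \<le> (Re p)\<^sup>2" "(Re p)\<^sup>2 \<le> L\<^sup>2" "0 \<le> (Im p)\<^sup>2" "(Im p)\<^sup>2 \<le> L\<^sup>2" using y by (auto intro: power_mono)
    then have "\<bar>(Re p)\<^sup>2 - (Im p)\<^sup>2 - 0\<bar> \<le> L\<^sup>2" by linarith
    then have "((Re p)\<^sup>2 - (Im p)\<^sup>2 - 0)\<^sup>2 \<le> (L\<^sup>2)\<^sup>2" by (rule power2_le_iff_abs_le[THEN iffD2, OF less_imp_le[OF L2]])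
    moreover have "Re p * Im p \<le> L * L" using y by (intro mult_mono) auto
    then have "2 * Re p * Im p + L\<^sup>2 \<le> 3 * L\<^sup>2" by (simp add: power2_eq_square)
    then have "(2 * Re p * Im p + L\<^sup>2)\<^sup>2 \<le> (3 * L\<^sup>2)\<^sup>2" using y by (intro power_mono) auto
    ultimately show ?thesis unfolding norm_sq_ker_denominator by (simp add: power_mult_distrib)
  qed
  have Np: "0 < (norm (p\<^sup>2 - of_real 0 + \<i> * of_real (L\<^sup>2)))\<^sup>2"
    using corner_kernel_denominator_nz[of "L\<^sup>2" p 0] y L2 by simp
  have "L\<^sup>2 / (10 * (L\<^sup>2)\<^sup>2) \<le> Re (corner_kernel 0 (L\<^sup>2) p)"
    unfolding Re_corner_kernel using N Np y L2 by (intro frac_le) auto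
  moreover have "pi = 10 * pi * L\<^sup>2 * (L\<^sup>2 / (10 * (L\<^sup>2)\<^sup>2))" using less_imp_neq[OF L] by (simp add: power2_eq_square)
  moreover have "0 \<le> 10 * pi * L\<^sup>2" using L2 by simp
  ultimately have "pi \<le> 10 * pi * L\<^sup>2 * Re (corner_kernel 0 (L\<^sup>2) p)" by (metis mult_left_mono)
  then show ?thesis .
  qed
  from view_angle_le_corner_kernel[OF order_refl zero_less_one order_refl L2 C hump z] show ?thesis .
qed

lemma disj_cases3: "A \<and> B \<or> C1 \<and> C2 \<and> C3 \<and> C4 \<and> C5 \<or> D1 \<and> D2 \<Longrightarrow> (A \<Longrightarrow> B \<Longrightarrow> P) \<Longrightarrow>
   (C1 \<Longrightarrow> C2 \<Longrightarrow> C3 \<Longrightarrow> C4 \<Longrightarrow> C5 \<Longrightarrow> P) \<Longrightarrow> (D1 \<Longrightarrow> D2 \<Longrightarrow> P) \<Longrightarrow> P"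
  by blast

text \<open>Comparison from below on a part \<open>S\<close> of \<open>T\<close> contained in a
  quadrant. At each frontier point one of three things happens: the angle of the quadrant tends to
  0, the angle of \<open>u\<close> tends to \<open>pi\<close>, or the point lies in \<open>T\<close>
  and a lower bound is already known there. The factor \<open>d\<close> carries such a bound into
  the new comparison.\<close>

lemma quadrant_angle_le_view_angle:
  assumes S: "open S" "connected S" "S \<subseteq> T" and c: "\<And>z. z \<in> S \<Longrightarrow> 0 < Re (z - c) \<and> 0 < Im (z - c)"
    and st: "s < t" "0 \<le> s'" "s' < t'" "t' \<le> 1" and d: "0 \<le> d"
    and fr: "\<And>p. p \<in> frontier S \<Longrightarrow>
        (Re (p - c) = 0 \<or> Im (p - c) = 0) \<and> ((Re (p - c))\<^sup>2 - (Im (p - c))\<^sup>2 < s \<or> t < (Re (p - c))\<^sup>2 - (Im (p - c))\<^sup>2)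
        \<or> p \<in> Tb \<and> p \<notin> T \<and> s' < Re (u p) \<and> Re (u p) < t' \<and> d \<le> 1 \<or> p \<in> T \<and> d * pi \<le> view_angle s' t' (u p)"
    and z: "z \<in> S"
  shows "d * view_angle s t ((z - c)\<^sup>2) \<le> view_angle s' t' (u z)"
proof -
  have inS: "\<forall>\<^sub>F z in at p within S. z \<in> S" for p by (rule eventually_in_within)
  have pos: "0 \<le> view_angle s' t' (u z)" if "z \<in> S" for z using view_angle_nonneg[OF Imu st(3)] that S(3) by blast
  have le: "view_angle s t ((z - c)\<^sup>2) \<le> pi" if "z \<in> S" for z using view_angle_le_pi sq_in_upper c that by blast
  have "Re (of_real d * view_angle_fun s t ((z - c)\<^sup>2)) \<le> Re (view_angle_fun s' t' (u z))"
  proof (rule Re_comparison_principle[OF S(1,2) _ _ _ _ z])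
    show "(\<lambda>z. of_real d * view_angle_fun s t ((z - c)\<^sup>2)) holomorphic_on S"
      by (intro holomorphic_on_mult holomorphic_on_const ang_sq_holomorphic c)
    show "(\<lambda>z. view_angle_fun s' t' (u z)) holomorphic_on S" by (rule angu_holomorphic[OF S(3)])
    show "\<exists>R. \<forall>z\<in>S. R < norm z \<longrightarrow> Re (of_real d * view_angle_fun s t ((z - c)\<^sup>2)) < Re (view_angle_fun s' t' (u z)) + e" if e: "e > 0" for e
    proof -
      have e': "e / (d + 1) > 0" using e d by simp
      obtain R where R: "\<forall>z\<in>S. R < norm z \<longrightarrow> view_angle s t ((z - c)\<^sup>2) < e / (d + 1)" using ang_sq_inf[OF c st(1) e'] by blast
      show ?thesis
      proof (intro exI[of _ R] ballI impI)
        fix z assume z: "z \<in> S" "R < norm z"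
        have "0 \<le> view_angle s t ((z - c)\<^sup>2)" using view_angle_nonneg[OF sq_in_upper st(1)] c z by blast
        moreover have "view_angle s t ((z - c)\<^sup>2) * (d + 1) < e" using R z d by (simp add: pos_less_divide_eq)
        ultimately have "d * view_angle s t ((z - c)\<^sup>2) < e" by (simp add: algebra_simps)
        then show "Re (of_real d * view_angle_fun s t ((z - c)\<^sup>2)) < Re (view_angle_fun s' t' (u z)) + e" using pos[OF z(1)] by (simp add: view_angle_def)
      qed
    qed
    fix p and e :: real assume p: "p \<in> frontier S" and e: "e > 0"
    have bound: "\<forall>\<^sub>F z in at p within S. d * view_angle s t ((z - c)\<^sup>2) \<le> d * pi"
      by (rule eventually_mono[OF inS]) (use le d in \<open>auto intro: mult_left_mono\<close>)
    have "\<forall>\<^sub>F z in at p within S. d * view_angle s t ((z - c)\<^sup>2) < view_angle s' t' (u z) + e"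
    proof (rule disj_cases3[OF fr[OF p]])
      assume a: "Re (p - c) = 0 \<or> Im (p - c) = 0" "(Re (p - c))\<^sup>2 - (Im (p - c))\<^sup>2 < s \<or> t < (Re (p - c))\<^sup>2 - (Im (p - c))\<^sup>2"
      have "((\<lambda>z. d * view_angle s t ((z - c)\<^sup>2)) \<longlongrightarrow> d * 0) (at p within S)"
        by (intro tendsto_mult tendsto_const ang_sq_lim0 c a st)
      then show ?thesis
        by (rule eventually_lt_of_limits[OF _ eventually_mono[OF inS pos] _ e]) auto
    next
      assume a: "p \<in> Tb" "p \<notin> T" "s' < Re (u p)" "Re (u p) < t'" "d \<le> 1"
      show ?thesis
        by (rule eventually_lt_of_limits2[OF angu_lim_pi[OF a(1,2) S(3) a(3,4)] bound _ e])
           (use a(5) mult_right_mono[of d 1 pi] in simp)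
    next
      assume a: "p \<in> T" "d * pi \<le> view_angle s' t' (u p)"
      have "((\<lambda>z. view_angle s' t' (u z)) \<longlongrightarrow> view_angle s' t' (u p)) (at p within S)"
      proof -
        have "isCont (\<lambda>z. view_angle_fun s' t' (u z)) p"
          using holomorphic_on_imp_continuous_on[OF angu_holomorphic[OF subset_refl]] open_T a(1)
          by (simp add: continuous_on_eq_continuous_at)
        from tendsto_Re[OF lim_within_isCont[OF this]] show ?thesis by (simp add: view_angle_def)
      qed
      then show ?thesis by (rule eventually_lt_of_limits2[OF _ bound a(2) e])
    qed
    then show "\<forall>\<^sub>F z in at p within S. Re (of_real d * view_angle_fun s t ((z - c)\<^sup>2)) < Re (view_angle_fun s' t' (u z)) + e" by (simp add: view_angle_def)
  qed
  then show ?thesis by (simp add: view_angle_def)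
qed

text \<open>Monotonicity of harmonic measure: the middle third of \<open>[0, L]\<close>, a piece of
  the boundary of the full quadrant, is hidden from \<open>T\<close> by the graph and the segment,
  where the pulled-back angle is \<open>pi\<close>. Its squared end points are
  \<open>L\<^sup>2/9\<close> and \<open>4*L\<^sup>2/9\<close>.\<close>

lemma graph_angle_lower:
  assumes z: "z \<in> T"
  shows "view_angle (L\<^sup>2/9) (4*L\<^sup>2/9) (z\<^sup>2) \<le> view_angle 0 1 (u z)"
proof -
  have "1 * view_angle (L\<^sup>2/9) (4*L\<^sup>2/9) ((z - 0)\<^sup>2) \<le> view_angle 0 1 (u z)"
  proof (rule quadrant_angle_le_view_angle[OF open_T connected_T subset_refl _ _ _ _ _ _ _ z])
    show "0 < Re (z - 0) \<and> 0 < Im (z - 0)" if "z \<in> T" for z using T_in_quadrant[OF that] by simp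
    have L2: "0 < L\<^sup>2" using L by simp
    then show "L\<^sup>2/9 < 4*L\<^sup>2/9" by simp
    fix p assume "p \<in> frontier T"
    then have p: "p \<in> Tb" "p \<notin> T" using frontier_T by auto
    have big: "L\<^sup>2 \<le> (Re p)\<^sup>2" if "L \<le> Re p" using that L by (intro power_mono) auto
    have neg: "- (Im p)\<^sup>2 < L\<^sup>2/9" using L2 zero_le_power2[of "Im p"] by linarith
    from p show "(Re (p - 0) = 0 \<or> Im (p - 0) = 0) \<and> ((Re (p - 0))\<^sup>2 - (Im (p - 0))\<^sup>2 < L\<^sup>2/9 \<or> 4*L\<^sup>2/9 < (Re (p - 0))\<^sup>2 - (Im (p - 0))\<^sup>2)
        \<or> p \<in> Tb \<and> p \<notin> T \<and> 0 < Re (u p) \<and> Re (u p) < 1 \<and> (1::real) \<le> 1 \<or> p \<in> T \<and> 1 * pi \<le> view_angle 0 1 (u p)"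
    proof (cases rule: u_cases)
      case im then show ?thesis using neg by simp
    next
      case zero then show ?thesis using neg by simp
    next
      case graph then show ?thesis using p \<mu> by simp
    next
      case top then show ?thesis using p \<mu> by simp
    next
      case seg then show ?thesis using p \<mu> by simp
    next
      case one then show ?thesis using big L2 by simp
    next
      case real
      then have "4*L\<^sup>2/9 < (Re p)\<^sup>2" using big L2 by linarith
      then show ?thesis using real by simp
    qed
  qed auto
  then show ?thesis by simp
qed

text \<open>The open quadrant with corner \<open>L\<close> lies in \<open>T\<close>, and its
  vertical side contains the segment. The squared heights \<open>(h L)\<^sup>2/4\<close> and
  \<open>3 * (h L)\<^sup>2/4\<close> cut out a part strictly inside the segment; they appear negated
  because the vertical side is squared to the negative axis.\<close>

lemma segment_angle_lower_near:
  assumes z: "L < Re z" "0 < Im z"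
  shows "view_angle (- (3 * (h L)\<^sup>2 / 4)) (- ((h L)\<^sup>2 / 4)) ((z - of_real L)\<^sup>2) \<le> view_angle \<mu> 1 (u z)"
proof -
  define S where "S = {z. L < Re z} \<inter> {z. 0 < Im z}"
  have S: "open S" "connected S" "S \<subseteq> T"
    unfolding S_def using L
    by (auto intro!: open_Int convex_connected convex_Int open_halfspace_Re_gt open_halfspace_Im_gt
        convex_halfspace_Re_gt convex_halfspace_Im_gt simp: T_def)
  have clS: "closure S \<subseteq> {z. L \<le> Re z} \<inter> {z. 0 \<le> Im z}"
    unfolding S_def by (rule closure_minimal) (auto intro!: closed_Int closed_halfspace_Re_ge closed_halfspace_Im_ge)
  have k: "0 < (h L)\<^sup>2" using hpos[of L] by simp
  have "1 * view_angle (- (3 * (h L)\<^sup>2 / 4)) (- ((h L)\<^sup>2 / 4)) ((z - of_real L)\<^sup>2) \<le> view_angle \<mu> 1 (u z)"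
  proof (rule quadrant_angle_le_view_angle[OF S])
    show "z \<in> S" using z by (simp add: S_def)
    show "- (3 * (h L)\<^sup>2 / 4) < - ((h L)\<^sup>2 / 4)" using k by simp
    fix p assume "p \<in> frontier S"
    then have "p \<in> closure S" "p \<notin> S" using S by (auto simp: frontier_def interior_open)
    then have p: "L \<le> Re p" "0 \<le> Im p" "Re p = L \<or> Im p = 0" using clS by (auto simp: S_def)
    show "(Re (p - of_real L) = 0 \<or> Im (p - of_real L) = 0) \<and>
          ((Re (p - of_real L))\<^sup>2 - (Im (p - of_real L))\<^sup>2 < - (3 * (h L)\<^sup>2 / 4) \<or> - ((h L)\<^sup>2 / 4) < (Re (p - of_real L))\<^sup>2 - (Im (p - of_real L))\<^sup>2)
        \<or> p \<in> Tb \<and> p \<notin> T \<and> \<mu> < Re (u p) \<and> Re (u p) < 1 \<and> (1::real) \<le> 1 \<or> p \<in> T \<and> 1 * pi \<le> view_angle \<mu> 1 (u p)"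
    proof (cases "Im p = 0")
      case True
      have "- ((h L)\<^sup>2 / 4) < (Re p - L)\<^sup>2" using k zero_le_power2[of "Re p - L"] by linarith
      then show ?thesis using True by simp
    next
      case False
      then have R: "Re p = L" using p by blast
      show ?thesis
      proof (cases "(h L)\<^sup>2 / 4 \<le> (Im p)\<^sup>2 \<and> (Im p)\<^sup>2 \<le> 3 * (h L)\<^sup>2 / 4")
        case True
        have "(Im p)\<^sup>2 < (h L)\<^sup>2" using True k by linarith
        then have "Im p < h L" using hpos[of L] by (simp add: power2_less_imp_less)
        moreover have "0 < Im p" using False p by simp
        moreover have "p = Complex L (Im p)" using R by (simp add: complex_eq_iff)
        ultimately have "\<mu> < Re (u p) \<and> Re (u p) < 1" using u_seg[of "Im p"] by simp
        moreover have "p \<in> Tb" "p \<notin> T" using R \<open>Im p < h L\<close> p L by (auto simp: Tb_def T_def)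
        ultimately show ?thesis by simp
      next
        case False
        then show ?thesis using R by auto
      qed
    qed
  qed (use \<mu> in \<open>auto simp: S_def\<close>)
  then show ?thesis by simp
qed

text \<open>Half of \<open>(h L)\<^sup>2\<close>, the length of the interval in
  \<open>segment_angle_lower_near\<close>, times the lower bound
  \<open>2 * M / (4 + 2 * M\<^sup>2)\<^sup>2\<close> of the Poisson kernel. Apart from
  \<open>M\<close> it involves only \<open>h L\<close> and not the length \<open>L\<close> itself,
  which makes the bound uniform in the stretching.\<close>

definition segment_const where "segment_const M = (h L)\<^sup>2 * M / (4 + 2 * M\<^sup>2)\<^sup>2"

text \<open>The points considered stay at bounded distance from the corner \<open>L\<close>, so in
  the shifted quadrant all quantities in the mean value form are bounded in terms of
  \<open>M\<close> and \<open>h L\<close>.\<close>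

lemma segment_angle_lower_mid:
  assumes M: "0 < M" "h L \<le> M" and x: "1 \<le> x" "x \<le> 2"
  shows "segment_const M \<le> view_angle \<mu> 1 (u (Complex (L + x) M))"
proof -
  define Z where "Z = (Complex x M)\<^sup>2"
  have k: "0 < (h L)\<^sup>2" using hpos[of L] by simp
  have kM: "(h L)\<^sup>2 \<le> M\<^sup>2" using M hpos[of L] by (intro power_mono) auto
  have ImZ: "Im Z = 2 * x * M" by (simp add: Z_def power2_eq_square)
  have ImZ0: "0 < Im Z" using ImZ x M by simp
  obtain \<xi> where xi: "- (3 * (h L)\<^sup>2 / 4) < \<xi>" "\<xi> < - ((h L)\<^sup>2 / 4)"
     "view_angle (- (3 * (h L)\<^sup>2 / 4)) (- ((h L)\<^sup>2 / 4)) Z = (- ((h L)\<^sup>2 / 4) - - (3 * (h L)\<^sup>2 / 4)) * (Im Z / (norm (Z - of_real \<xi>))\<^sup>2)"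
    using view_angle_mean[OF ImZ0, of "- (3 * (h L)\<^sup>2 / 4)" "- ((h L)\<^sup>2 / 4)"] k by auto
  have "norm Z = x\<^sup>2 + M\<^sup>2" by (simp add: Z_def norm_power cmod_power2)
  moreover have "x\<^sup>2 \<le> 2\<^sup>2" using x by (intro power_mono) auto
  moreover have "norm (Z - of_real \<xi>) \<le> norm Z + \<bar>\<xi>\<bar>" using norm_triangle_ineq4[of Z "of_real \<xi>"] by simp
  moreover have "\<bar>\<xi>\<bar> \<le> M\<^sup>2" using xi(1,2) k kM by linarith
  ultimately have "norm (Z - of_real \<xi>) \<le> 4 + 2 * M\<^sup>2" by simp
  then have n2: "(norm (Z - of_real \<xi>))\<^sup>2 \<le> (4 + 2 * M\<^sup>2)\<^sup>2" by (intro power_mono) auto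
  have "0 < norm (Z - of_real \<xi>)" using ImZ0 by (auto simp: complex_eq_iff)
  then have "2 * M / (4 + 2 * M\<^sup>2)\<^sup>2 \<le> Im Z / (norm (Z - of_real \<xi>))\<^sup>2"
    using n2 ImZ x M by (intro frac_le) auto
  then have "(h L)\<^sup>2 / 2 * (2 * M / (4 + 2 * M\<^sup>2)\<^sup>2) \<le> (h L)\<^sup>2 / 2 * (Im Z / (norm (Z - of_real \<xi>))\<^sup>2)"
    using k by (intro mult_left_mono) auto
  moreover have "(h L)\<^sup>2 / 2 * (2 * M / (4 + 2 * M\<^sup>2)\<^sup>2) = segment_const M" by (simp add: segment_const_def)
  moreover have "(- ((h L)\<^sup>2 / 4) - - (3 * (h L)\<^sup>2 / 4)) = (h L)\<^sup>2 / 2" by simp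
  ultimately have "segment_const M \<le> view_angle (- (3 * (h L)\<^sup>2 / 4)) (- ((h L)\<^sup>2 / 4)) Z" unfolding xi(3) by simp
  moreover have "Complex (L + x) M - of_real L = Complex x M" by (simp add: complex_eq_iff)
  ultimately show ?thesis using segment_angle_lower_near[of "Complex (L + x) M"] x M unfolding Z_def by simp
qed

text \<open>A second comparison, in the quadrant with corner \<open>\<i> * M\<close>, which lies in
  \<open>T\<close>. Its horizontal side contains the interval from \<open>L + 1\<close> to
  \<open>L + 2\<close> at height \<open>M\<close>, where the angle of the segment is already at
  least \<open>segment_const M\<close>. The squares of these abscissae differ by
  \<open>2 * L + 3\<close>, which supplies the order \<open>L\<close>.\<close>

lemma segment_angle_lower:
  assumes M: "0 < M" "\<And>x. 0 \<le> x \<Longrightarrow> x \<le> L \<Longrightarrow> h x \<le> M" and z: "0 < Re z" "M < Im z"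
  shows "segment_const M / pi * view_angle ((L+1)\<^sup>2) ((L+2)\<^sup>2) ((z - \<i> * of_real M)\<^sup>2) \<le> view_angle \<mu> 1 (u z)"
proof -
  define S where "S = {z. 0 < Re z} \<inter> {z. M < Im z}"
  have S: "open S" "connected S" "S \<subseteq> T"
  proof -
    show "open S" "connected S" unfolding S_def
      by (auto intro!: open_Int convex_connected convex_Int open_halfspace_Re_gt open_halfspace_Im_gt
        convex_halfspace_Re_gt convex_halfspace_Im_gt)
    show "S \<subseteq> T"
    proof
      fix w assume "w \<in> S"
      then show "w \<in> T" using M(1) M(2)[of "Re w"] by (cases "L < Re w") (auto simp: S_def T_def)
    qed
  qed
  have clS: "closure S \<subseteq> {z. 0 \<le> Re z} \<inter> {z. M \<le> Im z}"
    unfolding S_def by (rule closure_minimal) (auto intro!: closed_Int closed_halfspace_Re_ge closed_halfspace_Im_ge)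
  show ?thesis
  proof (rule quadrant_angle_le_view_angle[OF S])
    show "z \<in> S" using z by (simp add: S_def)
    show "(L+1)\<^sup>2 < (L+2)\<^sup>2" using L by (intro power_strict_mono) auto
    show "0 \<le> segment_const M / pi" using M by (simp add: segment_const_def)
    fix p assume "p \<in> frontier S"
    then have "p \<in> closure S" "p \<notin> S" using S by (auto simp: frontier_def interior_open)
    then have p: "0 \<le> Re p" "M \<le> Im p" "Re p = 0 \<or> Im p = M" using clS by (auto simp: S_def)
    show "(Re (p - \<i> * of_real M) = 0 \<or> Im (p - \<i> * of_real M) = 0) \<and>
          ((Re (p - \<i> * of_real M))\<^sup>2 - (Im (p - \<i> * of_real M))\<^sup>2 < (L+1)\<^sup>2 \<or> (L+2)\<^sup>2 < (Re (p - \<i> * of_real M))\<^sup>2 - (Im (p - \<i> * of_real M))\<^sup>2)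
        \<or> p \<in> Tb \<and> p \<notin> T \<and> \<mu> < Re (u p) \<and> Re (u p) < 1 \<and> segment_const M / pi \<le> 1 \<or> p \<in> T \<and> segment_const M / pi * pi \<le> view_angle \<mu> 1 (u p)"
    proof (cases "Re p = 0")
      case True
      have "0 < (L+1)\<^sup>2" using L by simp
      then have "- (Im p - M)\<^sup>2 < (L+1)\<^sup>2" using zero_le_power2[of "Im p - M"] by linarith
      then show ?thesis using True by simp
    next
      case False
      then have I: "Im p = M" "0 < Re p" using p by auto
      consider "Re p < L + 1" | "L + 2 < Re p" | "L + 1 \<le> Re p" "Re p \<le> L + 2" by linarith
      then show ?thesis
      proof cases
        case 1
        then have "(Re p)\<^sup>2 < (L+1)\<^sup>2" using I by (intro power_strict_mono) auto
        then show ?thesis using I by simp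
      next
        case 2
        then have "(L+2)\<^sup>2 < (Re p)\<^sup>2" using L by (intro power_strict_mono) auto
        then show ?thesis using I by simp
      next
        case 3
        have "p = Complex (L + (Re p - L)) M" using I by (simp add: complex_eq_iff)
        then have "segment_const M \<le> view_angle \<mu> 1 (u p)" using segment_angle_lower_mid[OF M(1) M(2)[of L], of "Re p - L"] 3 L by simp
        moreover have "p \<in> T" using 3 I M(1) L by (simp add: T_def)
        ultimately show ?thesis by simp
      qed
    qed
  qed (use \<mu> in \<open>auto simp: S_def\<close>)
qed

lemma corner_kernel_far_le: "0 < e \<Longrightarrow> 0 < Re z \<Longrightarrow> 0 < Im z \<Longrightarrow> Re (corner_kernel c e z) \<le> 1 / (2 * Re z * Im z)"
proof -
  assume a: "0 < e" "0 < Re z" "0 < Im z"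
  define J where "J = 2 * Re z * Im z + e"
  have J: "0 < 2 * Re z * Im z" "2 * Re z * Im z \<le> J" using a by (auto simp: J_def)
  have J2: "J\<^sup>2 \<le> (norm (z\<^sup>2 - of_real c + \<i> * of_real e))\<^sup>2" unfolding norm_sq_ker_denominator J_def by (rule le_add_same_cancel2[THEN iffD2, OF zero_le_power2])
  have J0: "0 < J\<^sup>2" using zero_less_power[of J 2] J by linarith
  have "Re (corner_kernel c e z) \<le> J / J\<^sup>2" unfolding Re_corner_kernel J_def[symmetric]
    by (rule divide_left_mono[OF J2]) (use J mult_pos_pos[OF less_le_trans[OF J0 J2] J0] in linarith)+
  also have "\<dots> = 1 / J" using J by (simp add: power2_eq_square)
  also have "\<dots> \<le> 1 / (2 * Re z * Im z)" by (rule divide_left_mono[OF J(2) zero_le_one mult_pos_pos[OF less_le_trans[OF J] J(1)]])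
  finally show ?thesis .
qed

text \<open>From distance 3 on, the distances of \<open>q\<close> to two points of
  \<open>(0, 1)\<close> differ by at most a factor 2 and the Poisson kernels by at most a factor 4;
  so the angles compare like the lengths \<open>1 - \<mu>\<close> and 1.\<close>

lemma view_angle_ratio:
  assumes q: "0 < Im q" "3 \<le> norm q"
  shows "view_angle \<mu> 1 q \<le> 4 * (1 - \<mu>) * view_angle 0 1 q" "(1 - \<mu>) * view_angle 0 1 q \<le> 4 * view_angle \<mu> 1 q"
proof -
  obtain x where x: "\<mu> < x" "x < 1" "view_angle \<mu> 1 q = (1 - \<mu>) * (Im q / (norm (q - of_real x))\<^sup>2)" using view_angle_mean[OF q(1) \<mu>(2)] by blast
  obtain y where y: "0 < y" "y < 1" "view_angle 0 1 q = (1 - 0) * (Im q / (norm (q - of_real y))\<^sup>2)" using view_angle_mean[OF q(1) zero_less_one] by blast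
  have key: "Im q / (norm (q - of_real s))\<^sup>2 \<le> 4 * (Im q / (norm (q - of_real t))\<^sup>2)" if "0 < s" "s < 1" "0 < t" "t < 1" for s t :: real
  proof -
    have "norm q - 1 \<le> norm (q - of_real s)" using norm_triangle_ineq2[of q "of_real s"] that by simp
    moreover have "norm (q - of_real t) \<le> norm q + 1" using norm_triangle_ineq4[of q "of_real t"] that by simp
    ultimately have "norm (q - of_real t) \<le> 2 * norm (q - of_real s)" using q(2) by linarith
    then have "(norm (q - of_real t))\<^sup>2 \<le> (2 * norm (q - of_real s))\<^sup>2" by (intro power_mono) auto
    then have a: "(norm (q - of_real t))\<^sup>2 / 4 \<le> (norm (q - of_real s))\<^sup>2" by (simp add: power_mult_distrib)
    have "0 < norm (q - of_real t)" using q by (auto simp: complex_eq_iff)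
    then have "Im q / (norm (q - of_real s))\<^sup>2 \<le> Im q / ((norm (q - of_real t))\<^sup>2 / 4)"
      using a q(1) by (intro frac_le) auto
    then show ?thesis by (simp add: mult.commute)
  qed
  have m: "0 \<le> 1 - \<mu>" using \<mu> by simp
  have "(1 - \<mu>) * (Im q / (norm (q - of_real x))\<^sup>2) \<le> (1 - \<mu>) * (4 * (Im q / (norm (q - of_real y))\<^sup>2))"
    using key[of x y] x y \<mu> m by (intro mult_left_mono) auto
  then show "view_angle \<mu> 1 q \<le> 4 * (1 - \<mu>) * view_angle 0 1 q" unfolding x(3) y(3) by (simp add: mult_ac)
  have "(1 - \<mu>) * (Im q / (norm (q - of_real y))\<^sup>2) \<le> (1 - \<mu>) * (4 * (Im q / (norm (q - of_real x))\<^sup>2))"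
    using key[of y x] x y \<mu> m by (intro mult_left_mono) auto
  then show "(1 - \<mu>) * view_angle 0 1 q \<le> 4 * view_angle \<mu> 1 q" unfolding x(3) y(3) by (simp add: mult_ac)
qed

text \<open>Seen from far away, the intervals \<open>[\<mu>, 1]\<close> and \<open>[0, 1]\<close> subtend angles whose ratio is about
  \<open>1 - \<mu>\<close>; in the quarter domain these angles are of order \<open>L\<close> and \<open>L\<^sup>2\<close>, up to a common factor.\<close>

lemma one_minus_mu_bounds:
  assumes M: "0 < M" "M \<le> L" "\<And>x. 0 \<le> x \<Longrightarrow> x \<le> L \<Longrightarrow> h x \<le> M"
  shows "segment_const M / (25 * pi\<^sup>2) / L \<le> 1 - \<mu>" "1 - \<mu> \<le> 240 * pi * h L / L"
proof -
  obtain R where R: "\<forall>z\<in>Tb. R < norm z \<longrightarrow> 3 < norm (u z)" using uinf by blast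
  \<comment> \<open>Large enough for \<open>norm (u z) > 3\<close>, as
    \<open>view_angle_ratio\<close> demands, and for \<open>M\<close> and \<open>L + 2\<close> to be
    at most a quarter of \<open>N\<close>.\<close>
  define N where "N = max (4 * (M + L + 2)) (R + 1)"
  have N: "4 * (M + L + 2) \<le> N" "R < N" by (auto simp: N_def)
  have N0: "0 < N" "M \<le> N / 4" "L + 2 \<le> N / 4" using N M L by auto
  \<comment> \<open>On the diagonal of the quadrant with corner \<open>\<i> * M\<close>, so that the
    square relative to this corner is \<open>2 * \<i> * N\<^sup>2\<close>. Every estimate below
    carries the factor \<open>1 / N\<^sup>2\<close>, which cancels in the quotients.\<close>
  define z where "z = Complex N (M + N)"
  have zT: "z \<in> T" using N M L by (simp add: z_def T_def)
  have "R < norm z" using N(2) abs_Re_le_cmod[of z] by (simp add: z_def)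
  then have q: "0 < Im (u z)" "3 \<le> norm (u z)" using R zT T_subset Imu by force+
  define W where "W = view_angle \<mu> 1 (u z)"
  define A where "A = view_angle 0 1 (u z)"
  have N2: "0 < N\<^sup>2" using N0 by simp
  have kerN: "Re (corner_kernel c e z) \<le> 1 / (2 * N\<^sup>2)" if "0 < e" for c e
  proof -
    have "Re (corner_kernel c e z) \<le> 1 / (2 * N * (M + N))" using corner_kernel_far_le[OF that, of z c] T_in_quadrant[OF zT] by (simp add: z_def)
    also have "\<dots> \<le> 1 / (2 * N\<^sup>2)"
      using N0 M(1) by (intro divide_left_mono mult_pos_pos) (auto simp: power2_eq_square)
    finally show ?thesis .
  qed
  have k: "0 < h L" "h L \<le> L" using hpos[of L] M(3)[of L] M(2) L by auto
  have W_up: "W \<le> 5 * pi * (L * h L) / N\<^sup>2"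
  proof -
    have "W \<le> 10 * pi * (L * h L) * Re (corner_kernel (L\<^sup>2) (L * h L) z)" unfolding W_def by (rule segment_angle_upper[OF k(2) zT])
    also have "\<dots> \<le> 10 * pi * (L * h L) * (1 / (2 * N\<^sup>2))" using kerN[of "L * h L" "L\<^sup>2"] L k by (intro mult_left_mono) auto
    finally show ?thesis by (simp add: mult_ac)
  qed
  have A_up: "A \<le> 5 * pi * L\<^sup>2 / N\<^sup>2"
  proof -
    have "A \<le> 10 * pi * L\<^sup>2 * Re (corner_kernel 0 (L\<^sup>2) z)" unfolding A_def
      using graph_angle_upper[OF _ zT] M(2,3) by (meson order_trans)
    also have "\<dots> \<le> 10 * pi * L\<^sup>2 * (1 / (2 * N\<^sup>2))" using kerN[of "L\<^sup>2" 0] L by (intro mult_left_mono) auto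
    finally show ?thesis by simp
  qed
  have A_lo: "L\<^sup>2 / (12 * N\<^sup>2) \<le> A"
  proof -
    define Z where "Z = z\<^sup>2"
    have Z: "Re Z = - (M\<^sup>2 + 2 * M * N)" "Im Z = 2 * N * (M + N)"
      by (simp_all add: Z_def z_def power2_eq_square algebra_simps)
    have ImZ: "2 * N\<^sup>2 \<le> Im Z" unfolding Z using N0 M(1) by (simp add: power2_eq_square)
    have L2: "0 < L\<^sup>2" using L by simp
    obtain \<xi> where xi: "L\<^sup>2/9 < \<xi>" "\<xi> < 4*L\<^sup>2/9" "view_angle (L\<^sup>2/9) (4*L\<^sup>2/9) Z = (4*L\<^sup>2/9 - L\<^sup>2/9) * (Im Z / (norm (Z - of_real \<xi>))\<^sup>2)"
      using view_angle_mean[of Z "L\<^sup>2/9" "4*L\<^sup>2/9"] ImZ N2 L2 by auto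
    have "4 * M * (4 * M) \<le> N * N" "4 * M * N \<le> N * N" "4 * L * (4 * L) \<le> N * N" using N0 M(1) L by (intro mult_mono; simp)+
    then have q: "16 * M\<^sup>2 \<le> N\<^sup>2" "4 * (M * N) \<le> N\<^sup>2" "16 * L\<^sup>2 \<le> N\<^sup>2" by (simp_all add: power2_eq_square)
    have "0 \<le> M\<^sup>2" "0 \<le> M * N" using N0 M(1) by simp_all
    then have b: "M\<^sup>2 + 2 * M * N + \<xi> \<le> N\<^sup>2" "0 \<le> M\<^sup>2 + 2 * M * N + \<xi>"
      using q xi(1,2) L2 unfolding mult.assoc by linarith+
    then have "(M\<^sup>2 + 2 * M * N + \<xi>)\<^sup>2 \<le> (N\<^sup>2)\<^sup>2" by (intro power_mono) auto
    moreover have "(2 * N * (M + N))\<^sup>2 \<le> (5/2 * N\<^sup>2)\<^sup>2"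
    proof (rule power_mono)
      have "N * (M + N) \<le> N * (5/4 * N)" using N0 by (intro mult_left_mono) auto
      then show "2 * N * (M + N) \<le> 5/2 * N\<^sup>2" by (simp add: power2_eq_square)
      show "0 \<le> 2 * N * (M + N)" using N0 M(1) by simp
    qed
    moreover have "(norm (Z - of_real \<xi>))\<^sup>2 = (M\<^sup>2 + 2 * M * N + \<xi>)\<^sup>2 + (2 * N * (M + N))\<^sup>2"
    proof -
      have "Re (Z - of_real \<xi>) = - (M\<^sup>2 + 2 * M * N + \<xi>)" "Im (Z - of_real \<xi>) = 2 * N * (M + N)" using Z by auto
      then show ?thesis unfolding cmod_power2 by (simp only: power2_minus)
    qed
    moreover have "(5/2 * N\<^sup>2)\<^sup>2 = 25/4 * (N\<^sup>2)\<^sup>2" by (simp only: power_mult_distrib) (simp add: power_divide)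
    ultimately have n: "(norm (Z - of_real \<xi>))\<^sup>2 \<le> 8 * (N\<^sup>2)\<^sup>2" using zero_le_power2[of "N\<^sup>2"] by linarith
    have ImZ_pos: "0 < Im Z" using ImZ N2 by linarith
    then have "0 < norm (Z - of_real \<xi>)" by (auto simp: complex_eq_iff)
    then have "2 * N\<^sup>2 / (8 * (N\<^sup>2)\<^sup>2) \<le> Im Z / (norm (Z - of_real \<xi>))\<^sup>2"
      using n ImZ ImZ_pos by (intro frac_le) auto
    moreover have "2 * N\<^sup>2 / (8 * (N\<^sup>2)\<^sup>2) = 1 / (4 * N\<^sup>2)" using N2 by (simp add: power2_eq_square)
    ultimately have "L\<^sup>2/3 * (1 / (4 * N\<^sup>2)) \<le> L\<^sup>2/3 * (Im Z / (norm (Z - of_real \<xi>))\<^sup>2)"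
      using L2 by (intro mult_left_mono) auto
    moreover have "4*L\<^sup>2/9 - L\<^sup>2/9 = L\<^sup>2/3" by simp
    ultimately have "L\<^sup>2 / (12 * N\<^sup>2) \<le> view_angle (L\<^sup>2/9) (4*L\<^sup>2/9) Z" unfolding xi(3) by simp
    then show ?thesis using graph_angle_lower[OF zT] unfolding A_def Z_def by linarith
  qed
  have W_lo: "segment_const M / pi * (4 * L / (5 * N\<^sup>2)) \<le> W"
  proof -
    define Z where "Z = (z - \<i> * of_real M)\<^sup>2"
    have Z: "Re Z = 0" "Im Z = 2 * N\<^sup>2" by (simp_all add: Z_def z_def power2_eq_square)
    have lt: "(L+1)\<^sup>2 < (L+2)\<^sup>2" using L by (intro power_strict_mono) auto
    obtain \<xi> where xi: "(L+1)\<^sup>2 < \<xi>" "\<xi> < (L+2)\<^sup>2" "view_angle ((L+1)\<^sup>2) ((L+2)\<^sup>2) Z = ((L+2)\<^sup>2 - (L+1)\<^sup>2) * (Im Z / (norm (Z - of_real \<xi>))\<^sup>2)"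
      using view_angle_mean[of Z "(L+1)\<^sup>2" "(L+2)\<^sup>2"] Z N2 lt by auto
    have "(L+2)\<^sup>2 \<le> N\<^sup>2" using N0 L by (intro power_mono) auto
    moreover have "0 \<le> \<xi>" using xi(1) zero_le_power2[of "L+1"] by linarith
    ultimately have "\<xi>\<^sup>2 \<le> (N\<^sup>2)\<^sup>2" using xi(2) by (intro power_mono) auto
    moreover have "(norm (Z - of_real \<xi>))\<^sup>2 = \<xi>\<^sup>2 + (2 * N\<^sup>2)\<^sup>2" unfolding cmod_power2 using Z by simp
    ultimately have n: "(norm (Z - of_real \<xi>))\<^sup>2 \<le> 5 * (N\<^sup>2)\<^sup>2" by (simp add: power_mult_distrib)
    have "0 < norm (Z - of_real \<xi>)" using Z N2 by (auto simp: complex_eq_iff)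
    then have "2 * N\<^sup>2 / (5 * (N\<^sup>2)\<^sup>2) \<le> Im Z / (norm (Z - of_real \<xi>))\<^sup>2" unfolding Z using n N2 by (intro frac_le) auto
    moreover have "2 * N\<^sup>2 / (5 * (N\<^sup>2)\<^sup>2) = 2 / (5 * N\<^sup>2)" using N2 by (simp add: power2_eq_square)
    moreover have "2 * L \<le> (L+2)\<^sup>2 - (L+1)\<^sup>2" by (simp add: power2_eq_square algebra_simps)
    ultimately have "2 * L * (2 / (5 * N\<^sup>2)) \<le> view_angle ((L+1)\<^sup>2) ((L+2)\<^sup>2) Z" unfolding xi(3)
      using L lt N2 by (intro mult_mono) auto
    then have "segment_const M / pi * (4 * L / (5 * N\<^sup>2)) \<le> segment_const M / pi * view_angle ((L+1)\<^sup>2) ((L+2)\<^sup>2) Z"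
      using M(1) by (intro mult_left_mono) (auto simp: segment_const_def)
    also have "\<dots> \<le> W" unfolding Z_def W_def using segment_angle_lower[OF M(1,3), of z] N0 by (simp add: z_def)
    finally show ?thesis .
  qed
  have m: "0 < 1 - \<mu>" using \<mu> by simp
  \<comment> \<open>\<open>W\<close> is at least of order \<open>L / N\<^sup>2\<close> and
    \<open>A\<close> at most of order \<open>L\<^sup>2 / N\<^sup>2\<close>; the constant arises as
    \<open>25 * pi\<^sup>2 = (20 * pi) * (5 * pi / 4)\<close>.\<close>
  have "segment_const M / pi * (4 * L / (5 * N\<^sup>2)) \<le> 4 * (1 - \<mu>) * (5 * pi * L\<^sup>2 / N\<^sup>2)"
  proof -
    have "W \<le> 4 * (1 - \<mu>) * A" unfolding W_def A_def by (rule view_angle_ratio(1)[OF q])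
    also have "\<dots> \<le> 4 * (1 - \<mu>) * (5 * pi * L\<^sup>2 / N\<^sup>2)" using A_up m by (intro mult_left_mono) auto
    finally show ?thesis using W_lo by linarith
  qed
  moreover have "segment_const M / pi * (4 * L / (5 * N\<^sup>2)) = (segment_const M / (25 * pi\<^sup>2) / L) * (20 * pi * L\<^sup>2 / N\<^sup>2)"
    using L N0 by (simp add: power2_eq_square mult_ac)
  moreover have "4 * (1 - \<mu>) * (5 * pi * L\<^sup>2 / N\<^sup>2) = (1 - \<mu>) * (20 * pi * L\<^sup>2 / N\<^sup>2)" by simp
  moreover have "0 < 20 * pi * L\<^sup>2 / N\<^sup>2" using L N0 by simp
  ultimately show "segment_const M / (25 * pi\<^sup>2) / L \<le> 1 - \<mu>" by (metis mult_le_cancel_right_pos)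
  \<comment> \<open>Conversely \<open>A\<close> is at least
    \<open>L\<^sup>2 / (12 * N\<^sup>2)\<close> and \<open>4 * W\<close> at most
    \<open>20 * pi * (L * h L) / N\<^sup>2\<close>, whence \<open>240 = 12 * 20\<close>.\<close>
  have "(1 - \<mu>) * (L\<^sup>2 / (12 * N\<^sup>2)) \<le> 4 * (5 * pi * (L * h L) / N\<^sup>2)"
  proof -
    have "(1 - \<mu>) * (L\<^sup>2 / (12 * N\<^sup>2)) \<le> (1 - \<mu>) * A" using A_lo m by (intro mult_left_mono) auto
    also have "\<dots> \<le> 4 * W" unfolding W_def A_def by (rule view_angle_ratio(2)[OF q])
    finally show ?thesis using W_up by linarith
  qed
  moreover have "4 * (5 * pi * (L * h L) / N\<^sup>2) = (240 * pi * h L / L) * (L\<^sup>2 / (12 * N\<^sup>2))"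
    using L N0 by (simp add: power2_eq_square)
  moreover have "0 < L\<^sup>2 / (12 * N\<^sup>2)" using L N0 by simp
  ultimately show "1 - \<mu> \<le> 240 * pi * h L / L" by (metis mult_le_cancel_right_pos)
qed

end

section \<open>Reflection of the quarter map\<close>

text \<open>A map onto a quarter of the target rectangle: the vertex goes to the corner 0, the real
  axis to the midline \<open>Re = 1/2\<close>, the imaginary axis to the midline
  \<open>Im = m/2\<close>, and infinity to their crossing point. Horizontal and vertical are
  exchanged because the right vertical side of the quadrilateral goes to the bottom of the
  rectangle.\<close>

locale quarter_map = corner +
  fixes P :: "complex \<Rightarrow> complex" and m :: real
  assumes m: "0 < m"
    and contP: "continuous_on Tb P" and injP: "inj_on P Tb"
    and imP: "P ` Tb = cbox 0 (Complex (1/2) (m/2)) - {Complex (1/2) (m/2)}"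
    and holP: "P holomorphic_on T"
    and P_real: "\<And>z. z \<in> Tb \<Longrightarrow> Re (P z) = 1/2 \<longleftrightarrow> Im z = 0"
    and P_imag: "\<And>z. z \<in> Tb \<Longrightarrow> Im (P z) = m/2 \<longleftrightarrow> Re z = 0"
    and P_corner: "P (Complex L (h L)) = 0"
    and P_far: "\<And>e. e > 0 \<Longrightarrow> \<exists>R. \<forall>z\<in>Tb. R < norm z \<longrightarrow> norm (P z - Complex (1/2) (m/2)) < e"
begin

definition quadrant_fold where "quadrant_fold z = Complex \<bar>Re z\<bar> \<bar>Im z\<bar>"
definition Dom where "Dom = {z. \<bar>Re z\<bar> < L \<and> \<bar>Im z\<bar> < h \<bar>Re z\<bar>}"
text \<open>Reflection in the midlines, one coordinate at a time. On an axis both alternatives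
  agree, since \<open>P\<close> has real part 1/2 or imaginary part \<open>m/2\<close>
  there.\<close>

definition Phi where "Phi z = Complex (if Im z \<le> 0 then 1 - Re (P (quadrant_fold z)) else Re (P (quadrant_fold z)))
    (if Re z \<le> 0 then m - Im (P (quadrant_fold z)) else Im (P (quadrant_fold z)))"

lemma quadrant_fold_simps [simp]: "Re (quadrant_fold z) = \<bar>Re z\<bar>" "Im (quadrant_fold z) = \<bar>Im z\<bar>" "norm (quadrant_fold z) = norm z"
  by (simp_all add: quadrant_fold_def cmod_def)

lemma notDom_iff: "z \<notin> Dom \<longleftrightarrow> quadrant_fold z \<in> Tb"
  by (auto simp: Dom_def Tb_def)

lemma open_Dom: "open Dom"
proof -
  have "Dom = {z. \<bar>Re z\<bar> < L} \<inter> {z. \<bar>Im z\<bar> < h \<bar>Re z\<bar>}" by (auto simp: Dom_def)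
  moreover have "continuous_on UNIV (\<lambda>z. h \<bar>Re z\<bar>)"
    by (rule continuous_on_compose2[OF conth]) (auto intro!: continuous_intros)
  then have "open {z. \<bar>Im z\<bar> < h \<bar>Re z\<bar>}" by (intro open_Collect_less continuous_intros)
  moreover have "open {z. \<bar>Re z\<bar> < L}" by (intro open_Collect_less continuous_intros)
  ultimately show ?thesis by auto
qed

lemma bounded_Dom: "bounded Dom"
proof -
  obtain M where M: "\<And>x. 0 \<le> x \<Longrightarrow> x \<le> L \<Longrightarrow> h x < M" using bounded_h by blast
  have "norm z \<le> L + M" if "z \<in> Dom" for z
    using that cmod_le[of z] M[of "\<bar>Re z\<bar>"] by (simp add: Dom_def)
  then show ?thesis by (auto simp: bounded_iff)
qed

text \<open>A point with \<open>\<bar>Re z\<bar> \<le> L\<close> and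
  \<open>\<bar>Im z\<bar> \<le> h \<bar>Re z\<bar>\<close> is a limit of points of
  \<open>Dom\<close>: the abscissa is shrunk by a factor \<open>t < 1\<close>, and the height
  becomes \<open>t\<close> times the same proportion of the graph over the new abscissa.\<close>

lemma off_closure:
  assumes z: "z \<notin> closure Dom" "Re z \<noteq> 0" "Im z \<noteq> 0"
  shows "quadrant_fold z \<in> T"
proof (rule ccontr)
  assume "quadrant_fold z \<notin> T"
  then have le: "\<bar>Re z\<bar> \<le> L" "\<bar>Im z\<bar> \<le> h \<bar>Re z\<bar>" using z by (auto simp: T_def)
  define y where "y t = Complex (t * Re z) (t * Im z * h (t * \<bar>Re z\<bar>) / h \<bar>Re z\<bar>)" for t
  have h0: "0 < h x" for x by (rule hpos)
  have "y t \<in> Dom" if t: "0 < t" "t < 1" for t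
  proof -
    have "t * \<bar>Re z\<bar> < 1 * \<bar>Re z\<bar>" using t z by (intro mult_strict_right_mono) auto
    then have 1: "\<bar>t * Re z\<bar> < L" using t le by (simp add: abs_mult)
    have "\<bar>Im z\<bar> / h \<bar>Re z\<bar> \<le> 1" using le h0[of "\<bar>Re z\<bar>"] by simp
    then have "t * (\<bar>Im z\<bar> / h \<bar>Re z\<bar>) \<le> t * 1" using t by (intro mult_left_mono) auto
    then have "t * (\<bar>Im z\<bar> / h \<bar>Re z\<bar>) < 1" using t by linarith
    then have "t * (\<bar>Im z\<bar> / h \<bar>Re z\<bar>) * h (t * \<bar>Re z\<bar>) < 1 * h (t * \<bar>Re z\<bar>)"
      using h0 by (intro mult_strict_right_mono) auto
    moreover have "\<bar>t * Im z * h (t * \<bar>Re z\<bar>) / h \<bar>Re z\<bar>\<bar> = t * (\<bar>Im z\<bar> / h \<bar>Re z\<bar>) * h (t * \<bar>Re z\<bar>)"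
      using t h0[of "t * \<bar>Re z\<bar>"] h0[of "\<bar>Re z\<bar>"] by (simp add: abs_mult abs_div)
    moreover have "\<bar>t * Re z\<bar> = t * \<bar>Re z\<bar>" using t by (simp add: abs_mult)
    ultimately show ?thesis using 1 by (simp add: Dom_def y_def)
  qed
  then have ev: "\<forall>\<^sub>F t in at_left 1. y t \<in> Dom"
    using eventually_at_left_real[of 0 "1::real"] by (auto elim!: eventually_mono)
  have "isCont y 1"
  proof -
    have ch: "isCont (\<lambda>t. h (t * \<bar>Re z\<bar>)) 1"
      by (rule isCont_o2[OF _ isConth]) (intro continuous_intros)
    have "isCont (\<lambda>t. t * Im z * h (t * \<bar>Re z\<bar>) / h \<bar>Re z\<bar>) 1"
      using h0[of "\<bar>Re z\<bar>"] by (intro isCont_divide isCont_mult ch continuous_ident continuous_const) auto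
    then show ?thesis unfolding y_def Complex_eq
      by (intro isCont_add isCont_mult isCont_of_real continuous_ident continuous_const)
  qed
  moreover have "y 1 = z" using h0[of "\<bar>Re z\<bar>"] by (simp add: y_def complex_eq_iff)
  ultimately have "(y \<longlongrightarrow> z) (at_left 1)" unfolding isCont_def by (metis Lim_at_imp_Lim_at_within)
  from Lim_in_closed_set[OF closed_closure _ trivial_limit_at_left_real this, of Dom] ev
  have "z \<in> closure Dom" using closure_subset[of Dom] by (simp add: eventually_mono subset_iff)
  then show False using z by simp
qed

lemma P_range: "z \<in> Tb \<Longrightarrow> 0 \<le> Re (P z) \<and> Re (P z) \<le> 1/2 \<and> 0 \<le> Im (P z) \<and> Im (P z) \<le> m/2 \<and> P z \<noteq> Complex (1/2) (m/2)"
proof -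
  assume "z \<in> Tb"
  then have "P z \<in> cbox 0 (Complex (1/2) (m/2)) - {Complex (1/2) (m/2)}" using imP by blast
  then show ?thesis by (auto simp: in_cbox_complex_iff)
qed

lemma cont_Phi: "continuous_on (- Dom) Phi"
proof -
  have "continuous_on (- Dom) quadrant_fold" unfolding quadrant_fold_def by (intro continuous_intros)
  then have c: "continuous_on (- Dom) (\<lambda>z. P (quadrant_fold z))"
    by (rule continuous_on_compose2[OF contP]) (auto simp: notDom_iff)
  have cR: "continuous_on A (\<lambda>z. Re (P (quadrant_fold z)))" "continuous_on A (\<lambda>z. Im (P (quadrant_fold z)))" if "A \<subseteq> - Dom" for A
    using continuous_on_subset[OF c that] by (auto intro!: continuous_intros)
  show ?thesis unfolding Phi_def
  proof (intro continuous_on_Complex continuous_on_cases_le)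
    show "1 - Re (P (quadrant_fold z)) = Re (P (quadrant_fold z))" if "z \<in> - Dom" "Im z = 0" for z
      using P_real[of "quadrant_fold z"] that by (simp add: notDom_iff)
    show "m - Im (P (quadrant_fold z)) = Im (P (quadrant_fold z))" if "z \<in> - Dom" "Re z = 0" for z
      using P_imag[of "quadrant_fold z"] that by (simp add: notDom_iff)
  qed (auto intro!: continuous_intros cR)
qed

text \<open>The position of the image relative to the midlines reveals the signs of both
  coordinates, which reduces injectivity of \<open>Phi\<close> to that of \<open>P\<close>.\<close>

lemma Phi_Re:
  assumes "z \<notin> Dom"
  shows "Re (Phi z) < 1/2 \<longleftrightarrow> 0 < Im z" "Im (Phi z) < m/2 \<longleftrightarrow> 0 < Re z"
    "1/2 < Re (Phi z) \<longleftrightarrow> Im z < 0" "m/2 < Im (Phi z) \<longleftrightarrow> Re z < 0"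
  using P_range[of "quadrant_fold z"] P_real[of "quadrant_fold z"] P_imag[of "quadrant_fold z"] assms unfolding notDom_iff Phi_def
  by (auto simp: less_le)

lemma inj_Phi: "inj_on Phi (- Dom)"
proof (rule inj_onI)
  fix z w assume zw: "z \<in> - Dom" "w \<in> - Dom" "Phi z = Phi w"
  have s: "(0 < Im z) = (0 < Im w)" "(0 < Re z) = (0 < Re w)" "(Im z < 0) = (Im w < 0)" "(Re z < 0) = (Re w < 0)"
    using Phi_Re[of z] Phi_Re[of w] zw by auto
  have "(Im z \<le> 0) = (Im w \<le> 0)" "(Re z \<le> 0) = (Re w \<le> 0)" using s by linarith+
  then have "P (quadrant_fold z) = P (quadrant_fold w)" using zw(3) unfolding Phi_def by (auto simp: complex_eq_iff split: if_splits)
  then have "quadrant_fold z = quadrant_fold w" using injP zw notDom_iff by (auto dest: inj_onD)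
  then have "\<bar>Re z\<bar> = \<bar>Re w\<bar>" "\<bar>Im z\<bar> = \<bar>Im w\<bar>" by (metis quadrant_fold_simps)+
  then show "z = w" using s by (auto simp: complex_eq_iff abs_if split: if_splits)
qed

lemma image_Phi: "Phi ` (- Dom) = cbox 0 (Complex 1 m) - {Complex (1/2) (m/2)}"
proof
  show "Phi ` (- Dom) \<subseteq> cbox 0 (Complex 1 m) - {Complex (1/2) (m/2)}"
  proof safe
    fix z assume z: "z \<notin> Dom"
    note r = P_range[OF z[unfolded notDom_iff]]
    show "Phi z \<in> cbox 0 (Complex 1 m)" using r m by (auto simp: in_cbox_complex_iff Phi_def)
    assume "Phi z = Complex (1/2) (m/2)"
    then show False using r by (auto simp: Phi_def complex_eq_iff split: if_splits)
  qed
  show "cbox 0 (Complex 1 m) - {Complex (1/2) (m/2)} \<subseteq> Phi ` (- Dom)"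
  proof
    fix w assume w: "w \<in> cbox 0 (Complex 1 m) - {Complex (1/2) (m/2)}"
    define r where "r = (if Re w \<le> 1/2 then Re w else 1 - Re w)"
    define s where "s = (if Im w \<le> m/2 then Im w else m - Im w)"
    have "Complex r s \<in> cbox 0 (Complex (1/2) (m/2)) - {Complex (1/2) (m/2)}"
      using w by (auto simp: in_cbox_complex_iff r_def s_def complex_eq_iff split: if_splits)
    then obtain p where p: "p \<in> Tb" "P p = Complex r s" using imP by (metis imageE)
    have p0: "0 \<le> Re p" "0 \<le> Im p" using p by (auto simp: Tb_def)
    define z where "z = Complex (if Im w \<le> m/2 then Re p else - Re p) (if Re w \<le> 1/2 then Im p else - Im p)"
    have qz: "quadrant_fold z = p" using p0 by (auto simp: z_def quadrant_fold_def complex_eq_iff)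
    have pr: "r = 1/2 \<longleftrightarrow> Im p = 0" "s = m/2 \<longleftrightarrow> Re p = 0" using P_real[OF p(1)] P_imag[OF p(1)] p(2) by auto
    have "Re (Phi z) = Re w"
    proof (cases "Re w \<le> 1/2")
      case True
      then have "r = Re w" "Im z = Im p" by (auto simp: r_def z_def)
      then show ?thesis using pr p0 unfolding Phi_def qz p(2) by auto
    next
      case False
      then have "r = 1 - Re w" "Im z \<le> 0" using p0 by (auto simp: r_def z_def)
      then show ?thesis unfolding Phi_def qz p(2) by auto
    qed
    moreover have "Im (Phi z) = Im w"
    proof (cases "Im w \<le> m/2")
      case True
      then have "s = Im w" "Re z = Re p" by (auto simp: s_def z_def)
      then show ?thesis using pr p0 unfolding Phi_def qz p(2) by auto
    next
      case False
      then have "s = m - Im w" "Re z \<le> 0" using p0 by (auto simp: s_def z_def)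
      then show ?thesis unfolding Phi_def qz p(2) by auto
    qed
    ultimately have "Phi z = w" by (simp add: complex_eq_iff)
    moreover have "z \<notin> Dom" using qz p(1) by (simp add: notDom_iff)
    ultimately show "w \<in> Phi ` (- Dom)" by blast
  qed
qed

lemma holomorphic_on_cnj_cnj:
  assumes "f holomorphic_on A" "open A"
  shows "(\<lambda>z. cnj (f (cnj z))) holomorphic_on (cnj ` A)"
proof -
  have "\<exists>D. ((\<lambda>z. cnj (f (cnj z))) has_field_derivative D) (at z within cnj ` A)" if "z \<in> cnj ` A" for z
  proof -
    have "cnj z \<in> A" using that by auto
    then obtain D where "(f has_field_derivative D) (at (cnj z))"
      using holomorphic_on_imp_differentiable_at[OF assms, of "cnj z"] unfolding field_differentiable_def by blast
    then have "((cnj \<circ> f \<circ> cnj) has_field_derivative cnj D) (at z)"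
      using has_field_derivative_cnj_cnj by fastforce
    then show ?thesis unfolding o_def by (meson DERIV_subset UNIV_I subsetI)
  qed
  then show ?thesis by (simp add: holomorphic_on_def field_differentiable_def)
qed

text \<open>In each open quadrant \<open>Phi\<close> is \<open>P\<close> combined with reflections,
  two of them antiholomorphic in the second and fourth quadrant. As \<open>Phi\<close> is continuous
  across the axes, the pieces are pasted along the real axis within the left and the right half
  plane, and these along the imaginary axis.\<close>

lemma hol_Phi: "Phi holomorphic_on (- closure Dom)"
proof -
  define U where "U = - closure Dom"
  have U: "open U" "U \<subseteq> - Dom" using closure_subset[of Dom] by (auto simp: U_def)
  have UT: "quadrant_fold z \<in> T" if "z \<in> U" "Re z \<noteq> 0" "Im z \<noteq> 0" for z using off_closure that by (simp add: U_def)
  have cont: "continuous_on A Phi" if "A \<subseteq> U" for A using continuous_on_subset[OF cont_Phi] that U by blast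
  have holc: "(\<lambda>z. cnj (P (cnj z))) holomorphic_on (cnj ` T)" by (rule holomorphic_on_cnj_cnj[OF holP open_T])
  have oL: "open (U \<inter> {z. Re z < 0})" "open (U \<inter> {z. 0 < Re z})"
    by (intro open_Int U open_halfspace_Re_lt open_halfspace_Re_gt)+
  have pp: "Phi holomorphic_on (U \<inter> {z. 0 < Re z} \<inter> {z. 0 < Im z})" (is "_ holomorphic_on ?A")
  proof (rule holomorphic_transform[of P])
    show "P holomorphic_on ?A" by (rule holomorphic_on_subset[OF holP]) (use UT in \<open>force simp: quadrant_fold_def\<close>)
    show "P z = Phi z" if "z \<in> ?A" for z using that by (simp add: Phi_def quadrant_fold_def)
  qed
  have pm: "Phi holomorphic_on (U \<inter> {z. 0 < Re z} \<inter> {z. Im z < 0})" (is "_ holomorphic_on ?A")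
  proof (rule holomorphic_transform[of "\<lambda>z. 1 - cnj (P (cnj z))"])
    show "(\<lambda>z. 1 - cnj (P (cnj z))) holomorphic_on ?A"
    proof (intro holomorphic_on_diff holomorphic_on_const holomorphic_on_subset[OF holc] subsetI)
      fix z assume z: "z \<in> ?A"
      then have "cnj z = quadrant_fold z" by (simp add: complex_eq_iff)
      then have "cnj z \<in> T" using z UT[of z] by simp
      then show "z \<in> cnj ` T" by (metis complex_cnj_cnj imageI)
    qed
    show "1 - cnj (P (cnj z)) = Phi z" if "z \<in> ?A" for z
    proof -
      have "cnj z = quadrant_fold z" using that by (simp add: complex_eq_iff)
      show ?thesis unfolding \<open>cnj z = quadrant_fold z\<close> using that by (simp add: Phi_def complex_eq_iff)
    qed
  qed
  have mp: "Phi holomorphic_on (U \<inter> {z. Re z < 0} \<inter> {z. 0 < Im z})" (is "_ holomorphic_on ?A")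
  proof (rule holomorphic_transform[of "\<lambda>z. \<i> * of_real m + cnj (P (cnj (- z)))"])
    have "(\<lambda>z. cnj (P (cnj (- z)))) holomorphic_on ?A"
    proof (rule holomorphic_on_compose_gen[of uminus _ "\<lambda>z. cnj (P (cnj z))" "cnj ` T", unfolded o_def])
      show "uminus ` ?A \<subseteq> cnj ` T"
      proof safe
        fix z assume z: "z \<in> U" "Re z < 0" "0 < Im z"
        then have "cnj (- z) = quadrant_fold z" by (simp add: complex_eq_iff)
        then have "cnj (- z) \<in> T" using z UT[of z] by simp
        then show "- z \<in> cnj ` T" by (metis complex_cnj_cnj imageI)
      qed
    qed (rule holc | intro holomorphic_on_minus holomorphic_on_ident)+
    then show "(\<lambda>z. \<i> * of_real m + cnj (P (cnj (- z)))) holomorphic_on ?A" by (intro holomorphic_on_add holomorphic_on_const)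
    show "\<i> * of_real m + cnj (P (cnj (- z))) = Phi z" if "z \<in> ?A" for z
    proof -
      have "cnj (- z) = quadrant_fold z" using that by (simp add: complex_eq_iff)
      show ?thesis unfolding \<open>cnj (- z) = quadrant_fold z\<close> using that by (simp add: Phi_def complex_eq_iff)
    qed
  qed
  have mm: "Phi holomorphic_on (U \<inter> {z. Re z < 0} \<inter> {z. Im z < 0})" (is "_ holomorphic_on ?A")
  proof (rule holomorphic_transform[of "\<lambda>z. 1 + \<i> * of_real m - P (- z)"])
    have "(\<lambda>z. P (- z)) holomorphic_on ?A"
    proof (rule holomorphic_on_compose_gen[of uminus _ P T, unfolded o_def])
      show "uminus ` ?A \<subseteq> T"
      proof safe
        fix z assume z: "z \<in> U" "Re z < 0" "Im z < 0"
        then have "- z = quadrant_fold z" by (simp add: complex_eq_iff)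
        then show "- z \<in> T" using z UT[of z] by simp
      qed
    qed (rule holP | intro holomorphic_on_minus holomorphic_on_ident)+
    then show "(\<lambda>z. 1 + \<i> * of_real m - P (- z)) holomorphic_on ?A" by (intro holomorphic_on_diff holomorphic_on_const)
    show "1 + \<i> * of_real m - P (- z) = Phi z" if "z \<in> ?A" for z
    proof -
      have "- z = quadrant_fold z" using that by (simp add: complex_eq_iff)
      show ?thesis unfolding \<open>- z = quadrant_fold z\<close> using that by (simp add: Phi_def complex_eq_iff)
    qed
  qed
  have iI: "\<i> \<bullet> z = Im z" "1 \<bullet> z = Re z" for z :: complex by (simp_all add: inner_complex_def)
  have l: "Phi holomorphic_on (U \<inter> {z. Re z < 0})"
    by (rule holomorphic_on_paste_across_line[OF oL(1), of \<i> _ 0]) (use mp mm cont in \<open>auto simp: iI\<close>)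
  have r: "Phi holomorphic_on (U \<inter> {z. 0 < Re z})"
    by (rule holomorphic_on_paste_across_line[OF oL(2), of \<i> _ 0]) (use pp pm cont in \<open>auto simp: iI\<close>)
  have "Phi holomorphic_on U"
    by (rule holomorphic_on_paste_across_line[OF U(1), of 1 _ 0]) (use l r cont in \<open>auto simp: iI\<close>)
  then show ?thesis by (simp add: U_def)
qed

lemma lim_Phi: "(Phi \<longlongrightarrow> Complex (1/2) (m/2)) at_infinity"
  unfolding Lim_at_infinity
proof (intro allI impI)
  fix e :: real assume "e > 0"
  then obtain R where R: "\<forall>z\<in>Tb. R < norm z \<longrightarrow> norm (P z - Complex (1/2) (m/2)) < e" using P_far by blast
  obtain K where K: "\<forall>z\<in>Dom. norm z \<le> K" using bounded_Dom by (auto simp: bounded_iff)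
  show "\<exists>b. \<forall>z. b \<le> norm z \<longrightarrow> dist (Phi z) (Complex (1/2) (m/2)) < e"
  proof (intro exI[of _ "max R K + 1"] allI impI)
    fix z :: complex assume z: "max R K + 1 \<le> norm z"
    then have "z \<notin> Dom" using K by force
    then have "norm (P (quadrant_fold z) - Complex (1/2) (m/2)) < e" using R z by (simp add: notDom_iff)
    moreover have "norm (Phi z - Complex (1/2) (m/2)) = norm (P (quadrant_fold z) - Complex (1/2) (m/2))"
    proof -
      have a: "(1 - x - 1/2)\<^sup>2 = (x - 1/2)\<^sup>2" for x :: real by (simp add: power2_eq_square algebra_simps)
      have b: "(m - x - m/2)\<^sup>2 = (x - m/2)\<^sup>2" for x :: real by (simp add: power2_eq_square algebra_simps)
      show ?thesis unfolding cmod_def Phi_def using a b by simp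
    qed
    ultimately show "dist (Phi z) (Complex (1/2) (m/2)) < e" by (simp add: dist_norm)
  qed
qed

lemma corners_Phi: "Phi (Complex L (h L)) = 0" "Phi (Complex L (- h L)) = 1"
  "Phi (Complex (- L) (- h L)) = Complex 1 m" "Phi (Complex (- L) (h L)) = Complex 0 m"
proof -
  have q: "quadrant_fold (Complex x y) = Complex L (h L)" if "\<bar>x\<bar> = L" "\<bar>y\<bar> = h L" for x y using that by (simp add: quadrant_fold_def)
  show "Phi (Complex L (h L)) = 0" "Phi (Complex L (- h L)) = 1"
    "Phi (Complex (- L) (- h L)) = Complex 1 m" "Phi (Complex (- L) (h L)) = Complex 0 m"
    using L hpos[of L] by (auto simp: Phi_def q P_corner complex_eq_iff)
qed

end

section \<open>Uniqueness of the exterior modulus\<close>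

text \<open>The property inside the definite description of \<open>ext_mod\<close>, named so that
  existence and uniqueness can be treated separately.\<close>

definition is_ext_mod :: "complex set \<Rightarrow> complex \<Rightarrow> complex \<Rightarrow> complex \<Rightarrow> complex \<Rightarrow> real \<Rightarrow> bool" where
  "is_ext_mod Q w1 w2 w3 w4 m \<longleftrightarrow> m > 0 \<and>
        (\<exists>\<Phi> c. c \<in> rect m \<and>
           continuous_on (- Q) \<Phi> \<and> inj_on \<Phi> (- Q) \<and>
           \<Phi> ` (- Q) = closure (rect m) - {c} \<and>
           \<Phi> holomorphic_on (- closure Q) \<and>
           (\<Phi> \<longlongrightarrow> c) at_infinity \<and>
           \<Phi> w4 = 0 \<and> \<Phi> w3 = 1 \<and> \<Phi> w2 = Complex 1 m \<and> \<Phi> w1 = Complex 0 m)"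

lemma closure_rect: "0 < m \<Longrightarrow> closure (rect m) = cbox 0 (Complex 1 m)"
proof -
  assume m: "0 < m"
  have "rect m = box 0 (Complex 1 m)" by (auto simp: rect_def in_box_complex_iff)
  moreover have "Complex (1/2) (m/2) \<in> box 0 (Complex 1 m)" using m by (simp add: in_box_complex_iff)
  then have "box 0 (Complex 1 m) \<noteq> {}" by blast
  ultimately show ?thesis by (simp add: closure_box)
qed

text \<open>The closed exterior in the coordinate \<open>1 / z\<close>, with 0 standing for
  infinity. It is compact when \<open>Q\<close> is an open neighbourhood of 0, which brings two
  exterior maps into the scope of \<open>rect_modulus_unique\<close>.\<close>

definition inv_ext :: "complex set \<Rightarrow> complex set" where
  "inv_ext Q = {\<zeta>. \<zeta> = 0 \<or> inverse \<zeta> \<notin> Q}"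

lemma open_inverse_preimage:
  fixes Q :: "complex set"
  assumes "open Q"
  shows "open {z \<in> - {0}. inverse z \<in> Q}"
proof -
  have "open (- {0} \<inter> inverse -` Q)"
    by (rule continuous_open_preimage[OF _ _ assms]) (auto intro!: continuous_intros)
  moreover have "- {0} \<inter> inverse -` Q = {z \<in> - {0}. inverse z \<in> Q}" by auto
  ultimately show ?thesis by simp
qed

lemma compact_inv_ext:
  assumes Q: "open Q" "0 \<in> Q"
  shows "compact (inv_ext Q)"
proof -
  obtain r where r: "r > 0" "ball 0 r \<subseteq> Q" using Q open_contains_ball by blast
  have "norm \<zeta> \<le> 1 / r" if "\<zeta> \<in> inv_ext Q" for \<zeta>
  proof (cases "\<zeta> = 0")
    case False
    then have "inverse \<zeta> \<notin> ball 0 r" using that r by (auto simp: inv_ext_def)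
    then have "r \<le> 1 / norm \<zeta>" by (simp add: norm_inverse norm_divide field_simps)
    then show ?thesis using False r(1) by (simp add: field_simps)
  qed (use r in simp)
  then have "bounded (inv_ext Q)" by (auto simp: bounded_iff)
  moreover have "open (- inv_ext Q)"
  proof -
    have "open {z \<in> - {0}. inverse z \<in> Q}"
      by (rule open_inverse_preimage[OF Q(1)])
    moreover have "{z \<in> - {0}. inverse z \<in> Q} = - inv_ext Q" by (auto simp: inv_ext_def)
    ultimately show ?thesis by simp
  qed
  ultimately show ?thesis by (simp add: compact_eq_bounded_closed closed_def)
qed

text \<open>The limit at infinity becomes continuity at 0, where the singularity is removable; so
  the map onto the rectangle without \<open>c\<close> fills in to a map onto the whole closed
  rectangle.\<close>

lemma inversion_of_exterior_map:
  assumes Q: "open Q" "0 \<in> Q"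
    and \<Phi>: "continuous_on (- Q) \<Phi>" "inj_on \<Phi> (- Q)" "\<Phi> ` (- Q) = B - {c}" "c \<in> B"
      "\<Phi> holomorphic_on (- closure Q)" "(\<Phi> \<longlongrightarrow> c) at_infinity"
  defines "F \<equiv> \<lambda>\<zeta>. if \<zeta> = 0 then c else \<Phi> (inverse \<zeta>)"
  shows "continuous_on (inv_ext Q) F" "inj_on F (inv_ext Q)" "F ` inv_ext Q = B" "F holomorphic_on interior (inv_ext Q)"
proof -
  let ?X = "inv_ext Q"
  have c0: "continuous_on (?X - {0}) F"
  proof -
    have "continuous_on (?X - {0}) (\<lambda>\<zeta>. \<Phi> (inverse \<zeta>))"
      by (rule continuous_on_compose2[OF \<Phi>(1)]) (auto simp: inv_ext_def intro!: continuous_intros)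
    then show ?thesis by (rule continuous_on_eq) (simp add: F_def)
  qed
  show cont: "continuous_on ?X F"
    unfolding continuous_on_def
  proof
    fix x assume x: "x \<in> ?X"
    show "(F \<longlongrightarrow> F x) (at x within ?X)"
    proof (cases "x = 0")
      case True
      have "((\<lambda>\<zeta>. \<Phi> (inverse \<zeta>)) \<longlongrightarrow> c) (at 0)" by (rule filterlim_compose[OF \<Phi>(6) filterlim_inverse_at_infinity])
      then have "(F \<longlongrightarrow> c) (at 0)"
        by (rule Lim_transform_eventually) (auto simp: eventually_at_filter F_def)
      then have "(F \<longlongrightarrow> c) (at 0 within ?X)" by (rule Lim_at_imp_Lim_at_within)
      then show ?thesis using True by (simp add: F_def)
    next
      case False
      then have "(F \<longlongrightarrow> F x) (at x within (?X - {0}))" using c0 x by (simp add: continuous_on_def)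
      moreover have "at x within ?X = at x within (?X - {0})"
        by (rule at_within_nhd[of x "- {0}"]) (use False in auto)
      ultimately show ?thesis by simp
    qed
  qed
  show "inj_on F ?X"
  proof (rule inj_onI)
    fix x y assume xy: "x \<in> ?X" "y \<in> ?X" "F x = F y"
    have ne: "\<Phi> (inverse x) \<noteq> c" if "x \<in> ?X" "x \<noteq> 0" for x using \<Phi>(3) that by (auto simp: inv_ext_def)
    show "x = y"
    proof (cases "x = 0 \<or> y = 0")
      case True then show ?thesis using xy ne[of x] ne[of y] by (auto simp: F_def split: if_splits)
    next
      case False
      then have "inverse x = inverse y" using xy \<Phi>(2) by (auto simp: F_def inv_ext_def dest: inj_onD)
      then show ?thesis by simp
    qed
  qed
  show "F ` ?X = B"
  proof
    show "F ` ?X \<subseteq> B" using \<Phi>(3,4) by (auto simp: F_def inv_ext_def)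
    show "B \<subseteq> F ` ?X"
    proof
      fix w assume w: "w \<in> B"
      show "w \<in> F ` ?X"
      proof (cases "w = c")
        case True then show ?thesis by (auto simp: F_def inv_ext_def intro!: image_eqI[of _ _ 0])
      next
        case False
        then obtain z where z: "z \<notin> Q" "\<Phi> z = w" using w \<Phi>(3) by (metis ComplD DiffI empty_iff imageE insertE)
        then have "z \<noteq> 0" using Q by auto
        then show ?thesis using z by (intro image_eqI[of _ _ "inverse z"]) (auto simp: F_def inv_ext_def)
      qed
    qed
  qed
  show "F holomorphic_on interior ?X"
  proof (rule no_isolated_singularity[of _ _ "{0}"])
    show "continuous_on (interior ?X) F" using continuous_on_subset[OF cont interior_subset] .
    have "(\<lambda>\<zeta>. \<Phi> (inverse \<zeta>)) holomorphic_on (interior ?X - {0})"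
    proof (rule holomorphic_on_compose_gen[of inverse _ \<Phi> "- closure Q", unfolded o_def])
      show "inverse holomorphic_on (interior ?X - {0})" by (intro holomorphic_on_inverse holomorphic_on_ident) auto
      show "\<Phi> holomorphic_on - closure Q" by (rule \<Phi>(5))
      have "open {z \<in> - {0}. inverse z \<in> interior ?X}"
        by (rule open_inverse_preimage[OF open_interior])
      moreover have "{z \<in> - {0}. inverse z \<in> interior ?X} \<subseteq> - Q"
        using interior_subset[of ?X] by (auto simp: inv_ext_def)
      ultimately have "{z \<in> - {0}. inverse z \<in> interior ?X} \<subseteq> interior (- Q)" by (rule interior_maximal[rotated])
      moreover have "inverse ` (interior ?X - {0}) \<subseteq> {z \<in> - {0}. inverse z \<in> interior ?X}" by auto
      ultimately show "inverse ` (interior ?X - {0}) \<subseteq> - closure Q" unfolding interior_complement by (rule order_trans[rotated])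
    qed
    then show "F holomorphic_on (interior ?X - {0})" by (rule holomorphic_transform) (simp add: F_def)
  qed auto
qed

lemma ext_mod_unique:
  assumes Q: "open Q" "0 \<in> Q" and w: "w1 \<notin> Q" "w2 \<notin> Q" "w3 \<notin> Q" "w4 \<notin> Q"
    and m: "is_ext_mod Q w1 w2 w3 w4 m" "is_ext_mod Q w1 w2 w3 w4 m'"
  shows "m = m'"
proof -
  have box: "c \<in> cbox 0 (Complex 1 m)" if "c \<in> rect m" for c m using that by (auto simp: rect_def in_cbox_complex_iff)
  obtain \<Phi> c where \<Phi>: "m > 0" "c \<in> rect m" "continuous_on (- Q) \<Phi>" "inj_on \<Phi> (- Q)" "\<Phi> ` (- Q) = closure (rect m) - {c}"
    "\<Phi> holomorphic_on (- closure Q)" "(\<Phi> \<longlongrightarrow> c) at_infinity" "\<Phi> w4 = 0" "\<Phi> w3 = 1" "\<Phi> w2 = Complex 1 m" "\<Phi> w1 = Complex 0 m"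
    using m(1) unfolding is_ext_mod_def by blast
  obtain \<Psi> d where \<Psi>: "m' > 0" "d \<in> rect m'" "continuous_on (- Q) \<Psi>" "inj_on \<Psi> (- Q)" "\<Psi> ` (- Q) = closure (rect m') - {d}"
    "\<Psi> holomorphic_on (- closure Q)" "(\<Psi> \<longlongrightarrow> d) at_infinity" "\<Psi> w4 = 0" "\<Psi> w3 = 1" "\<Psi> w2 = Complex 1 m'" "\<Psi> w1 = Complex 0 m'"
    using m(2) unfolding is_ext_mod_def by blast
  have w0: "w1 \<noteq> 0" "w2 \<noteq> 0" "w3 \<noteq> 0" "w4 \<noteq> 0" using w Q by auto
  note F = inversion_of_exterior_map[OF Q \<Phi>(3,4,5)[unfolded closure_rect[OF \<Phi>(1)]] box[OF \<Phi>(2)] \<Phi>(6,7)]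
  note G = inversion_of_exterior_map[OF Q \<Psi>(3,4,5)[unfolded closure_rect[OF \<Psi>(1)]] box[OF \<Psi>(2)] \<Psi>(6,7)]
  show ?thesis
    by (rule rect_modulus_unique[OF \<Phi>(1) \<Psi>(1) compact_inv_ext[OF Q] F G, of "inverse w4" "inverse w3" "inverse w2" "inverse w1"])
       (use w w0 \<Phi>(8-11) \<Psi>(8-11) in \<open>auto simp: inv_ext_def\<close>)
qed

lemma ext_mod_eqI:
  assumes Q: "open Q" "0 \<in> Q" and w: "w1 \<notin> Q" "w2 \<notin> Q" "w3 \<notin> Q" "w4 \<notin> Q"
    and m: "is_ext_mod Q w1 w2 w3 w4 m"
  shows "ext_mod Q w1 w2 w3 w4 = m"
  unfolding ext_mod_def is_ext_mod_def[symmetric]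
  by (rule the_equality[where P = "is_ext_mod Q w1 w2 w3 w4"]) (use m ext_mod_unique[OF Q w] in blast)+

lemma (in quarter_map) ext_mod_Dom:
  "ext_mod Dom (Complex (- L) (h L)) (Complex (- L) (- h L)) (Complex L (- h L)) (Complex L (h L)) = m"
proof (rule ext_mod_eqI[OF open_Dom])
  show "0 \<in> Dom" using L hpos[of 0] by (simp add: Dom_def)
  show "is_ext_mod Dom (Complex (- L) (h L)) (Complex (- L) (- h L)) (Complex L (- h L)) (Complex L (h L)) m"
    unfolding is_ext_mod_def closure_rect[OF m]
    using m cont_Phi inj_Phi image_Phi hol_Phi lim_Phi corners_Phi
    by (intro conjI exI[of _ Phi] exI[of _ "Complex (1/2) (m/2)"]) (auto simp: rect_def)
qed (use L in \<open>auto simp: Dom_def\<close>)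

section \<open>From the half plane to the quarter rectangle\<close>

text \<open>Restricted to the closed upper half plane, the principal root is continuous even along
  its cut; the right-hand side makes this evident.\<close>

lemma csqrt_upper: "0 \<le> Im z \<Longrightarrow> csqrt z = Complex (sqrt ((norm z + Re z) / 2)) (sqrt ((norm z - Re z) / 2))"
  by (auto simp: complex_eq_iff)

text \<open>The square root takes the half plane to a quadrant and the vertex to
  \<open>sqrt \<mu>\<close>, so the Schwarz--Christoffel map with this parameter sends the vertex to
  its corner \<open>a\<close>. The affine map \<open>F\<close> turns the rectangle by a right angle
  about \<open>a\<close> and divides by \<open>2 * b\<close>, which gives width 1/2 and moves
  \<open>\<i> * b\<close>, the value at infinity, to the corner opposite 0.\<close>

lemma (in corner_map) quarter_map_exists:
  "\<exists>P. quarter_map L h P (schwarz_christoffel.a (sqrt \<mu>) / schwarz_christoffel.b (sqrt \<mu>))"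
proof -
  interpret q: schwarz_christoffel "sqrt \<mu>" by unfold_locales (use \<mu> in auto)
  define v where "v z = csqrt (u z)" for z
  have Imu0: "0 \<le> Im (u z)" if "z \<in> Tb" for z using imTb that by blast
  have v2: "(v z)\<^sup>2 = u z" for z by (simp add: v_def)
  have v_eq: "v z = Complex (sqrt ((norm (u z) + Re (u z)) / 2)) (sqrt ((norm (u z) - Re (u z)) / 2))" if "z \<in> Tb" for z
    unfolding v_def by (rule csqrt_upper[OF Imu0[OF that]])
  have v_Qb: "v z \<in> q.Qb" if "z \<in> Tb" for z
    using abs_Re_le_cmod[of "u z"] unfolding v_eq[OF that] q.Qb_def by auto
  have vcont: "continuous_on Tb v"
  proof -
    have "continuous_on Tb (\<lambda>z. Complex (sqrt ((norm (u z) + Re (u z)) / 2)) (sqrt ((norm (u z) - Re (u z)) / 2)))"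
      by (intro continuous_intros contu) auto
    then show ?thesis by (rule continuous_on_eq) (simp add: v_eq)
  qed
  have vinj: "inj_on v Tb"
    using inju v2 by (metis inj_on_def)
  have vim: "v ` Tb = q.Qb"
  proof
    show "v ` Tb \<subseteq> q.Qb" using v_Qb by blast
    show "q.Qb \<subseteq> v ` Tb"
    proof
      fix w assume w: "w \<in> q.Qb"
      then have "0 \<le> Im (w\<^sup>2)" by (simp add: q.Qb_def power2_eq_square)
      then obtain z where z: "z \<in> Tb" "u z = w\<^sup>2" using imTb by (metis (mono_tags, lifting) imageE mem_Collect_eq)
      have "v z = w" unfolding v_def by (rule csqrt_unique) (use z w in \<open>auto simp: q.Qb_def\<close>)
      then show "w \<in> v ` Tb" using z by blast
    qed
  qed
  have vT: "v z \<in> q.Q" if z: "z \<in> T" for z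
  proof -
    have "0 < Im ((v z)\<^sup>2)" unfolding v2 by (rule Imu[OF z])
    then have "0 < Re (v z) * Im (v z)" by (simp add: power2_eq_square mult.commute)
    moreover have "0 \<le> Re (v z)" "0 \<le> Im (v z)" using v_Qb[of z] T_subset z by (auto simp: q.Qb_def)
    ultimately show ?thesis by (auto simp: q.Q_def zero_less_mult_iff)
  qed
  have vhol: "v holomorphic_on T" unfolding v_def
  proof (rule holomorphic_on_csqrt'[OF holu])
    show "u z \<notin> \<real>\<^sub>\<le>\<^sub>0" if "z \<in> T" for z using Imu[OF that] by (auto simp: complex_nonpos_Reals_iff)
  qed
  have axes: "(Im (v z) = 0 \<and> 1 \<le> Re (v z) \<longleftrightarrow> Im z = 0) \<and> (Re (v z) = 0 \<longleftrightarrow> Re z = 0)" if z: "z \<in> Tb" for z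
  proof (cases "z \<in> T")
    case True
    then show ?thesis using vT[OF True] by (auto simp: q.Q_def T_def)
  next
    case False
    define r where "r = Re (u z)"
    have "u z = of_real r" using ureal[OF z False] by (simp add: r_def complex_eq_iff)
    then have v: "v z = Complex (sqrt ((\<bar>r\<bar> + r) / 2)) (sqrt ((\<bar>r\<bar> - r) / 2))" using v_eq[OF z] by simp
    have "Im (v z) = 0 \<and> 1 \<le> Re (v z) \<longleftrightarrow> 1 \<le> r" "Re (v z) = 0 \<longleftrightarrow> r \<le> 0" unfolding v by (auto simp: abs_if)
    moreover have "(1 \<le> r \<longleftrightarrow> Im z = 0) \<and> (r \<le> 0 \<longleftrightarrow> Re z = 0)"
      using z False by (rule u_cases) (use \<mu> L hpos[of 0] hpos[of L] hpos[of "Re z"] in \<open>auto simp: r_def\<close>)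
    ultimately show ?thesis by blast
  qed
  define A where "A = q.a"
  define B where "B = q.b"
  have AB: "0 < A" "0 < B" using q.ab_pos by (auto simp: A_def B_def)
  define F where "F s = Complex (Im s / (2*B)) ((A - Re s) / (2*B))" for s
  have F: "F s = (s - of_real A) * (- \<i>) / of_real (2*B)" for s by (simp add: F_def complex_eq_iff diff_divide_distrib)
  have Fi: "s = t" if "F s = F t" for s t using that AB by (auto simp: F_def complex_eq_iff)
  define P where "P z = F (q.S (v z))" for z
  have "quarter_map L h P (A / B)"
  proof unfold_locales
    show "0 < A / B" using AB by simp
    have "continuous_on Tb (\<lambda>z. q.S (v z))" by (rule continuous_on_compose2[OF q.contS_Qb vcont]) (use v_Qb in blast)
    then show "continuous_on Tb P" unfolding P_def F using AB by (intro continuous_intros) auto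
    show "inj_on P Tb"
    proof (rule inj_onI)
      fix x y assume xy: "x \<in> Tb" "y \<in> Tb" "P x = P y"
      then have "q.S (v x) = q.S (v y)" using Fi by (simp add: P_def)
      then have "v x = v y" using q.S_inj v_Qb xy by (meson inj_onD)
      then show "x = y" using vinj xy by (meson inj_onD)
    qed
    have PS: "P ` Tb = F ` (cbox 0 (Complex A B) - {Complex 0 B})"
    proof -
      have "P ` Tb = F ` (q.S ` (v ` Tb))" by (auto simp: P_def)
      then show ?thesis unfolding vim q.S_image_closed A_def B_def by simp
    qed
    show "P ` Tb = cbox 0 (Complex (1/2) (A/B/2)) - {Complex (1/2) (A/B/2)}"
    proof
      show "P ` Tb \<subseteq> cbox 0 (Complex (1/2) (A/B/2)) - {Complex (1/2) (A/B/2)}"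
        unfolding PS using AB by (auto simp: F_def in_cbox_complex_iff complex_eq_iff field_simps)
      show "cbox 0 (Complex (1/2) (A/B/2)) - {Complex (1/2) (A/B/2)} \<subseteq> P ` Tb"
      proof
        fix p assume p: "p \<in> cbox 0 (Complex (1/2) (A/B/2)) - {Complex (1/2) (A/B/2)}"
        define s where "s = Complex (A - 2 * B * Im p) (2 * B * Re p)"
        have "F s = p" using AB by (simp add: F_def s_def complex_eq_iff)
        moreover have "s \<in> cbox 0 (Complex A B) - {Complex 0 B}"
          using p AB by (auto simp: s_def in_cbox_complex_iff complex_eq_iff field_simps)
        ultimately show "p \<in> P ` Tb" unfolding PS by blast
      qed
    qed
    have "(q.S \<circ> v) holomorphic_on T" by (rule holomorphic_on_compose_gen[OF vhol q.holS_Q]) (use vT in blast)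
    then show "P holomorphic_on T" unfolding P_def F o_def using AB by (intro holomorphic_on_divide holomorphic_on_mult holomorphic_on_diff holomorphic_on_const) auto
    show "Re (P z) = 1/2 \<longleftrightarrow> Im z = 0" if z: "z \<in> Tb" for z
    proof -
      have "Re (P z) = 1/2 \<longleftrightarrow> Im (q.S (v z)) = B" using AB by (auto simp: P_def F_def field_simps)
      then show ?thesis using q.S_sides(2)[OF v_Qb[OF z]] axes[OF z] by (simp add: B_def)
    qed
    show "Im (P z) = A/B/2 \<longleftrightarrow> Re z = 0" if z: "z \<in> Tb" for z
    proof -
      have "Im (P z) = A/B/2 \<longleftrightarrow> Re (q.S (v z)) = 0" using AB by (auto simp: P_def F_def field_simps)
      then show ?thesis using q.S_sides(1)[OF v_Qb[OF z]] axes[OF z] by simp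
    qed
    have "v (Complex L (h L)) = of_real (sqrt \<mu>)" unfolding v_def u\<mu> by (rule of_real_sqrt[symmetric]) (use \<mu> in simp)
    then show "P (Complex L (h L)) = 0" using q.S_l by (simp add: P_def F A_def)
    fix e :: real assume e: "e > 0"
    define K where "K = max 2 (2 / (B * e))"
    have K: "2 \<le> K" "2 / (B * e) \<le> K" by (auto simp: K_def)
    obtain R where R: "\<forall>z\<in>Tb. R < norm z \<longrightarrow> K\<^sup>2 < norm (u z)" using uinf by blast
    have "norm (P z - Complex (1/2) (A/B/2)) < e" if z: "z \<in> Tb" "R < norm z" for z
    proof -
      have "K\<^sup>2 < (norm (v z))\<^sup>2" using R z by (simp add: v2 flip: norm_power)
      then have n: "K < norm (v z)" by (rule power2_less_imp_less) simp
      have "P z - Complex (1/2) (A/B/2) = (q.S (v z) - Complex 0 B) * (- \<i>) / of_real (2*B)"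
        using AB by (simp add: P_def F_def complex_eq_iff diff_divide_distrib)
      then have "norm (P z - Complex (1/2) (A/B/2)) = norm (q.S (v z) - Complex 0 B) / (2 * B)"
        using AB by (simp add: norm_divide norm_mult)
      also have "\<dots> \<le> (4 / norm (v z)) / (2 * B)"
        using q.S_far[OF v_Qb[OF z(1)]] n K AB unfolding B_def by (intro divide_right_mono) auto
      also have "\<dots> = 2 / (B * norm (v z))" using AB by simp
      also have "\<dots> < e"
      proof -
        have "2 / (B * e) < norm (v z)" using n K by linarith
        then have "2 < norm (v z) * (B * e)" using AB e by (simp add: pos_divide_less_eq)
        moreover have "0 < norm (v z)" using n K by linarith
        ultimately show ?thesis using AB by (simp add: pos_divide_less_eq mult_ac)
      qed
      finally show ?thesis .
    qed
    then show "\<exists>R. \<forall>z\<in>Tb. R < norm z \<longrightarrow> norm (P z - Complex (1/2) (A/B/2)) < e" by blast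
  qed
  then show ?thesis by (auto simp: A_def B_def)
qed

text \<open>All that the asymptotics needs, in terms of \<open>L\<close> and \<open>h\<close> alone;
  the half-plane map and \<open>\<mu> = l\<^sup>2\<close> no longer occur.\<close>

lemma (in corner) ext_mod_formula:
  "\<exists>l. 0 < l \<and> l < 1 \<and>
     ext_mod {z. \<bar>Re z\<bar> < L \<and> \<bar>Im z\<bar> < h \<bar>Re z\<bar>} (Complex (- L) (h L)) (Complex (- L) (- h L)) (Complex L (- h L)) (Complex L (h L))
       = schwarz_christoffel.a l / schwarz_christoffel.b l \<and>
     (\<forall>M. 0 < M \<longrightarrow> M \<le> L \<longrightarrow> (\<forall>x. 0 \<le> x \<longrightarrow> x \<le> L \<longrightarrow> h x \<le> M) \<longrightarrow>
        (h L)\<^sup>2 * M / (4 + 2 * M\<^sup>2)\<^sup>2 / (25 * pi\<^sup>2) / L \<le> 1 - l\<^sup>2 \<and> 1 - l\<^sup>2 \<le> 240 * pi * h L / L)"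
proof -
  have "\<exists>u \<mu>. corner_map L h u \<mu>"
  proof (rule halfplane_map)
    fix u \<mu>
    assume f: "continuous_on Tb u" "inj_on u Tb" "u ` Tb = {w. 0 \<le> Im w}" "u holomorphic_on T"
    "u ` T = {w. 0 < Im w}" "\<And>R. \<exists>R'. \<forall>z\<in>Tb. R' < norm z \<longrightarrow> R < norm (u z)"
    "0 < \<mu>" "\<mu> < 1" "u (Complex 0 (h 0)) = 0" "u (Complex L (h L)) = of_real \<mu>" "u (Complex L 0) = 1"
    "\<And>z. z \<in> Tb \<Longrightarrow> z \<notin> T \<Longrightarrow> Im (u z) = 0"
    "\<And>y. h 0 < y \<Longrightarrow> Re (u (Complex 0 y)) < 0"
    "\<And>x. 0 < x \<Longrightarrow> x < L \<Longrightarrow> 0 < Re (u (Complex x (h x))) \<and> Re (u (Complex x (h x))) < \<mu>"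
    "\<And>y. 0 < y \<Longrightarrow> y < h L \<Longrightarrow> \<mu> < Re (u (Complex L y)) \<and> Re (u (Complex L y)) < 1"
    "\<And>x. L < x \<Longrightarrow> 1 < Re (u (Complex x 0))"
    have "corner_map L h u \<mu>"
      by (intro corner_map.intro corner_axioms corner_map_axioms.intro) (fact f)+
    then show ?thesis by blast
  qed
  then obtain u \<mu> where "corner_map L h u \<mu>" by blast
  then interpret corner_map L h u \<mu> .
  obtain P where "quarter_map L h P (schwarz_christoffel.a (sqrt \<mu>) / schwarz_christoffel.b (sqrt \<mu>))" using quarter_map_exists by blast
  then interpret quarter_map L h P "schwarz_christoffel.a (sqrt \<mu>) / schwarz_christoffel.b (sqrt \<mu>)" .
  show ?thesis
  proof (intro exI[of _ "sqrt \<mu>"] conjI allI impI)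
    fix M assume M: "0 < M" "M \<le> L" "\<forall>x. 0 \<le> x \<longrightarrow> x \<le> L \<longrightarrow> h x \<le> M"
    have sq: "(sqrt \<mu>)\<^sup>2 = \<mu>" using \<mu> by simp
    show "(h L)\<^sup>2 * M / (4 + 2 * M\<^sup>2)\<^sup>2 / (25 * pi\<^sup>2) / L \<le> 1 - (sqrt \<mu>)\<^sup>2"
      using one_minus_mu_bounds(1)[of M] M unfolding sq segment_const_def by blast
    show "1 - (sqrt \<mu>)\<^sup>2 \<le> 240 * pi * h L / L" using one_minus_mu_bounds(2)[of M] M unfolding sq by blast
  qed (use \<mu> ext_mod_Dom[unfolded Dom_def] in auto)
qed

section \<open>Asymptotics\<close>

lemma tendsto_divide_ln_at_top: "((\<lambda>H::real. k / ln H) \<longlongrightarrow> 0) at_top"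
  by (rule tendsto_divide_0[OF tendsto_const filterlim_at_top_imp_at_infinity[OF ln_at_top]])

lemma tendsto_divide_at_top_0: "((\<lambda>H::real. k / H) \<longlongrightarrow> 0) at_top"
  by (rule tendsto_divide_0[OF tendsto_const filterlim_at_top_imp_at_infinity[OF filterlim_ident]])

text \<open>A squeeze. As \<open>1 - l\<close> lies between constant multiples of
  \<open>1 / H\<close>, the bounds on \<open>a\<close> give \<open>(ln H + O(1)) / 2\<close> and
  those on \<open>b\<close> give \<open>pi/2\<close>, each up to a factor \<open>1 / l\<close>; and
  \<open>l\<close> is at least \<open>1 - D / H\<close>.\<close>

lemma sc_ratio_asymp:
  fixes l :: "real \<Rightarrow> real"
  assumes c: "0 < c" and ev: "\<forall>\<^sub>F H in at_top. 0 < l H \<and> l H < 1 \<and> c / H \<le> 1 - (l H)\<^sup>2 \<and> 1 - (l H)\<^sup>2 \<le> C / H \<and> E H = schwarz_christoffel.a (l H) / schwarz_christoffel.b (l H)"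
  shows "E \<sim>[at_top] (\<lambda>H. ln H / pi)"
proof -
  \<comment> \<open>The division by 2 in \<open>c/2\<close> comes from
    \<open>1 - l\<^sup>2 \<le> 2 * (1 - l)\<close>; the summand \<open>2 * ln 2 + 1\<close> comes
    from \<open>a_bounds\<close>.\<close>
  define k where "k = - ln (c/2) + 2 * ln 2 + 1"
  \<comment> \<open>Raised to at least 1, so that \<open>ln D\<close> has a positive
    argument.\<close>
  define D where "D = max C 1"
  have D: "0 < D" "C \<le> D" by (auto simp: D_def)
  define lo where "lo H = (1 - ln D / ln H) * (1 - D / H)" for H
  define up where "up H = (1 + k / ln H) / (1 - D / H)" for H
  have "\<forall>\<^sub>F H in at_top. lo H \<le> E H / (ln H / pi) \<and> E H / (ln H / pi) \<le> up H"
    using ev eventually_gt_at_top[of 1] eventually_gt_at_top[of D]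
  proof eventually_elim
    case (elim H)
    define x where "x = l H"
    have x: "0 < x" "x < 1" "c / H \<le> 1 - x\<^sup>2" "1 - x\<^sup>2 \<le> C / H" "E H = schwarz_christoffel.a x / schwarz_christoffel.b x" and H: "1 < H" "D < H"
      using elim by (auto simp: x_def)
    interpret q: schwarz_christoffel x by unfold_locales (use x in auto)
    have lnH: "0 < ln H" using H by simp
    have f: "1 - x\<^sup>2 = (1 - x) * (1 + x)" by (simp add: power2_eq_square algebra_simps)
    have "C / H \<le> D / H" using D H by (intro divide_right_mono) auto
    moreover have "1 - x \<le> 1 - x\<^sup>2" unfolding f using x by (simp add: mult_le_cancel_left1)
    ultimately have up1: "1 - x \<le> D / H" using x by linarith
    have "(1 - x) * (1 + x) \<le> (1 - x) * 2" using x by (intro mult_left_mono) auto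
    then have lo1: "c / 2 / H \<le> 1 - x" using x f by simp
    have "ln (1 - x) \<le> ln (D / H)" using up1 x by simp
    then have l1: "ln H - ln D \<le> - ln (1 - x)" using D H by (simp add: ln_div)
    have "ln (c / 2 / H) \<le> ln (1 - x)" using lo1 c H x by (intro ln_mono) auto
    moreover have "ln (y / H) = ln y - ln H" if "0 < y" for y using that H by (simp add: ln_div)
    ultimately have l2: "- ln (1 - x) \<le> ln H - ln (c/2)" unfolding \<open>\<And>y. 0 < y \<Longrightarrow> ln (y / H) = ln y - ln H\<close>[OF half_gt_zero[OF c]] by linarith
    have DH: "0 < 1 - D / H" "1 - D / H \<le> x" using D H up1 by (auto simp: field_simps)
    define a where "a = q.a"
    define b where "b = q.b"
    have ab: "0 < a" "0 < b" using q.ab_pos by (auto simp: a_def b_def)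
    have bounds: "- ln (1 - x) / 2 \<le> a" "a \<le> (- ln (1 - x) + 2 * ln 2 + 1) / (2 * x)" "pi/2 \<le> b" "b \<le> pi / (2 * x)"
      unfolding a_def b_def by (rule q.a_bounds q.b_bounds)+
    have Eab: "E H = a / b" using x(5) by (simp add: a_def b_def)
    have lD: "ln D < ln H" using D H by simp
    have two: "(y / (2 * x)) / (pi / 2) = y / x / pi" for y :: real by simp
    have "a / b \<le> ((ln H + k) / (2 * x)) / (pi / 2)"
    proof (rule frac_le)
      have "a \<le> (- ln (1 - x) + 2 * ln 2 + 1) / (2 * x)" by (rule bounds(2))
      also have "\<dots> \<le> (ln H + k) / (2 * x)" using l2 x by (intro divide_right_mono) (auto simp: k_def)
      finally show "a \<le> (ln H + k) / (2 * x)" .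
      then show "0 \<le> (ln H + k) / (2 * x)" using ab by linarith
    qed (use bounds(3) in auto)
    also have "\<dots> = (ln H + k) / x / pi" by (rule two)
    finally have u1: "a / b / (ln H / pi) \<le> ((ln H + k) / x / pi) / (ln H / pi)" using lnH by (intro divide_right_mono) auto
    have "0 \<le> - ln (1 - x)" using x by simp
    then have hk: "0 \<le> ln H + k" using l2 ln_gt_zero[of "2::real"] unfolding k_def by linarith
    have three: "(y / r / pi) / (z / pi) = (y / z) / r" for y z r :: real by simp
    have "((ln H + k) / x / pi) / (ln H / pi) = ((ln H + k) / ln H) / x" by (rule three)
    also have "\<dots> \<le> ((ln H + k) / ln H) / (1 - D / H)"
      using hk lnH DH x by (intro divide_left_mono mult_pos_pos divide_nonneg_pos) auto
    also have "\<dots> = up H" using lnH by (simp add: up_def add_divide_distrib)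
    finally have U: "E H / (ln H / pi) \<le> up H" using u1 unfolding Eab by linarith
    have "((ln H - ln D) / 2) / (pi / (2 * x)) \<le> a / b"
      using bounds(1,4) l1 ab by (intro frac_le) auto
    moreover have "((ln H - ln D) / 2) / (pi / (2 * x)) = (ln H - ln D) * x / pi" using x by simp
    moreover have "(ln H - ln D) * (1 - D / H) / pi \<le> (ln H - ln D) * x / pi"
      using DH lD by (intro divide_right_mono mult_left_mono) auto
    ultimately have "(ln H - ln D) * (1 - D / H) / pi \<le> a / b" by linarith
    then have "(ln H - ln D) * (1 - D / H) / pi / (ln H / pi) \<le> a / b / (ln H / pi)" using lnH by (intro divide_right_mono) auto
    moreover have "(ln H - ln D) * (1 - D / H) / pi / (ln H / pi) = ((ln H - ln D) / ln H) * (1 - D / H)" by simp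
    moreover have "(ln H - ln D) / ln H = 1 - ln D / ln H" using lnH by (simp add: diff_divide_distrib)
    ultimately have "lo H \<le> E H / (ln H / pi)" unfolding Eab lo_def by simp
    then show ?case using U by simp
  qed
  then have e: "\<forall>\<^sub>F H in at_top. lo H \<le> E H / (ln H / pi)" "\<forall>\<^sub>F H in at_top. E H / (ln H / pi) \<le> up H"
    by (auto elim: eventually_mono)
  have "(lo \<longlongrightarrow> (1 - 0) * (1 - 0)) at_top" unfolding lo_def
    by (intro tendsto_mult tendsto_diff tendsto_const tendsto_divide_ln_at_top tendsto_divide_at_top_0)
  then have lo: "(lo \<longlongrightarrow> 1) at_top" by simp
  have "(up \<longlongrightarrow> (1 + 0) / (1 - 0)) at_top" unfolding up_def
    by (intro tendsto_divide tendsto_add tendsto_diff tendsto_const tendsto_divide_ln_at_top tendsto_divide_at_top_0) simp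
  then have up: "(up \<longlongrightarrow> 1) at_top" by simp
  have "((\<lambda>H. E H / (ln H / pi)) \<longlongrightarrow> 1) at_top" by (rule tendsto_sandwich[OF e lo up])
  then show ?thesis by (rule asymp_equivI'[rotated]) 
qed

section \<open>Symmetric graph domains\<close>

text \<open>If one end were farther from 0, points close to it would be reflected out of the
  interval. This serves both for \<open>(a, b)\<close> and for each vertical section
  \<open>(f x, g x)\<close>.\<close>

lemma interval_symmetric:
  fixes a b :: real
  assumes "a < b" and s: "\<And>x. a < x \<Longrightarrow> x < b \<Longrightarrow> a < - x \<and> - x < b"
  shows "a = - b"
proof (rule ccontr)
  assume "a \<noteq> - b"
  then consider "a < - b" | "- b < a" by linarith
  then show False
  proof cases
    case 1
    then obtain x where "a < x" "x < min b (- b)" using dense[of a "min b (- b)"] \<open>a < b\<close> by auto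
    then show False using s[of x] by auto
  next
    case 2
    then obtain x where "max a (- a) < x" "x < b" using dense[of "max a (- a)" b] \<open>a < b\<close> by auto
    then show False using s[of x] by auto
  qed
qed

text \<open>The open domain determines \<open>f\<close> and \<open>g\<close> on the open interval
  only; the end points, over which the vertices lie, follow by continuity.\<close>

lemma symmetric_graph_domain:
  assumes ab: "a < b" and cf: "continuous_on {a..b} f" and cg: "continuous_on {a..b} g"
    and fg: "\<forall>x\<in>{a..b}. f x < g x"
    and s1: "\<forall>z\<in>graph_domain a b f g. cnj z \<in> graph_domain a b f g"
    and s2: "\<forall>z\<in>graph_domain a b f g. - cnj z \<in> graph_domain a b f g"
  shows "a = - b" "\<And>x. x \<in> {a..b} \<Longrightarrow> f x = - g x" "\<And>x. x \<in> {a..b} \<Longrightarrow> g (- x) = g x"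
proof -
  have inD: "Complex x y \<in> graph_domain a b f g \<longleftrightarrow> a < x \<and> x < b \<and> f x < y \<and> y < g x" for x y
    by (auto simp: graph_domain_def)
  have refl: "a < - x \<and> - x < b \<and> f (- x) < y \<and> y < g (- x)" if "a < x" "x < b" "f x < y" "y < g x" for x y
    using s2[rule_format, of "Complex x y"] that inD[of x y] inD[of "- x" y] by (simp add: complex_eq_iff graph_domain_def)
  have cnj: "f x < - y \<and> - y < g x" if "a < x" "x < b" "f x < y" "y < g x" for x y
    using s1[rule_format, of "Complex x y"] that inD[of x y] by (simp add: graph_domain_def)
  have ex: "\<exists>y. f x < y \<and> y < g x" if "a < x" "x < b" for x using dense[of "f x" "g x"] fg that by auto
  show a: "a = - b" by (rule interval_symmetric[OF ab]) (use ex refl in blast)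
  have 1: "f x = - g x" if x: "x \<in> {a<..<b}" for x
    by (rule interval_symmetric) (use fg cnj[of x] x in auto)
  have le: "g x \<le> g (- x)" if x: "x \<in> {a<..<b}" for x
  proof (rule dense_le_bounded[of "f x"])
    show "f x < g x" using fg x by auto
    show "y \<le> g (- x)" if "f x < y" "y < g x" for y using refl[of x y] that x by auto
  qed
  have 2: "g x - g (- x) = 0" if x: "x \<in> {a<..<b}" for x
    using le[OF x] le[of "- x"] x a by auto
  have cl: "closure {a<..<b} = {a..b}" using ab by simp
  show "f x = - g x" if "x \<in> {a..b}" for x
  proof -
    have "f x + g x = 0"
      by (rule continuous_constant_on_closure[of "{a<..<b}" "\<lambda>x. f x + g x"])
         (use cl that 1 in \<open>auto intro!: continuous_on_add cf cg\<close>)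
    then show ?thesis by simp
  qed
  show "g (- x) = g x" if "x \<in> {a..b}" for x
  proof -
    have "continuous_on {a..b} (\<lambda>x. g (- x))" by (rule continuous_on_compose2[OF cg]) (use a in \<open>auto intro!: continuous_intros\<close>)
    then have c: "continuous_on {a..b} (\<lambda>x. g x - g (- x))" by (intro continuous_on_diff cg)
    have "g x - g (- x) = 0"
      by (rule continuous_constant_on_closure[of "{a<..<b}" "\<lambda>x. g x - g (- x)"])
         (use cl that 2 c in auto)
    then show ?thesis by simp
  qed
qed

theorem theorem3:
  fixes a b :: real and f g :: "real \<Rightarrow> real"
  assumes "a < b"
    and "continuous_on {a..b} f" and "continuous_on {a..b} g"
    and "\<forall>x\<in>{a..b}. f x < g x"
    and "\<forall>z\<in>graph_domain a b f g. cnj z \<in> graph_domain a b f g"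
    and "\<forall>z\<in>graph_domain a b f g. - cnj z \<in> graph_domain a b f g"
  shows "(\<lambda>H. ext_mod (stretch H ` graph_domain a b f g)
                 (stretch H (Complex a (g a))) (stretch H (Complex a (f a)))
                 (stretch H (Complex b (f b))) (stretch H (Complex b (g b))))
         \<sim>[at_top] (\<lambda>H. ln H / pi)" (is "?E \<sim>[at_top] _")
proof -
  note sym = symmetric_graph_domain[OF assms]
  have b: "0 < b" using sym(1) assms(1) by simp
  have ab: "{a..b} = {- b..b}" using sym(1) by simp
  have f: "f x = - g x" if "x \<in> {- b..b}" for x using sym(2) that ab by blast
  have g: "g (- x) = g x" "0 < g x" if "x \<in> {- b..b}" for x
    using sym(3)[of x] f[OF that] assms(4) that ab by force+
  obtain M0 where M0: "\<And>x. x \<in> {- b..b} \<Longrightarrow> g x \<le> M0"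
  proof -
    have "compact (g ` {- b..b})" using assms(3) ab by (intro compact_continuous_image) auto
    then have "bdd_above (g ` {- b..b})" by (intro bounded_imp_bdd_above compact_imp_bounded)
    then obtain M where "\<forall>y\<in>g ` {- b..b}. y \<le> M" unfolding bdd_above_def by blast
    then show thesis by (intro that[of M]) blast
  qed
  have M0p: "0 < M0" using M0[of b] g(2)[of b] b by auto
  \<comment> \<open>The stretched upper graph, continued constantly beyond
    \<open>[- H * b, H * b]\<close>, so that it is continuous and positive on the whole line as
    \<open>corner\<close> demands.\<close>
  define h where "h H x = g (max (- b) (min b (x / H)))" for H x
  have cor: "corner (H * b) (h H)" if H: "0 < H" for H
  proof
    show "0 < H * b" using H b by simp
    have "continuous_on {- b..b} g" using assms(3) ab by simp
    then show "continuous_on UNIV (h H)" unfolding h_def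
      by (rule continuous_on_compose2) (use H b in \<open>auto intro!: continuous_intros\<close>)
    show "0 < h H x" for x unfolding h_def using b by (intro g(2)) auto
  qed
  have hb: "h H (H * b) = g b" if "0 < H" for H using that b by (simp add: h_def)
  have dom: "stretch H ` graph_domain a b f g = {z. \<bar>Re z\<bar> < H * b \<and> \<bar>Im z\<bar> < h H \<bar>Re z\<bar>}" if H: "0 < H" for H
  proof -
    have inD: "z \<in> graph_domain a b f g \<longleftrightarrow> \<bar>Re z\<bar> < b \<and> \<bar>Im z\<bar> < g \<bar>Re z\<bar>" for z
    proof (cases "\<bar>Re z\<bar> < b")
      case True
      then have x: "Re z \<in> {- b..b}" by auto
      have "g \<bar>Re z\<bar> = g (Re z)" using g(1)[OF x] by (simp add: abs_if)
      then show ?thesis using f[OF x] sym(1) True by (auto simp: graph_domain_def)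
    next
      case False
      then show ?thesis using sym(1) by (auto simp: graph_domain_def)
    qed
    have mem: "Complex (H * Re z) (Im z) \<in> {z. \<bar>Re z\<bar> < H * b \<and> \<bar>Im z\<bar> < h H \<bar>Re z\<bar>} \<longleftrightarrow> z \<in> graph_domain a b f g" for z
    proof -
      have "\<bar>H * Re z\<bar> = H * \<bar>Re z\<bar>" using H by (simp add: abs_mult)
      moreover have "h H (H * \<bar>Re z\<bar>) = g \<bar>Re z\<bar>" if "\<bar>Re z\<bar> < b"
      proof -
        have "- b \<le> \<bar>Re z\<bar>" using b by linarith
        then show ?thesis using H that by (simp add: h_def min_def max_def)
      qed
      ultimately show ?thesis using H inD[of z] by auto
    qed
    show ?thesis
    proof
      show "stretch H ` graph_domain a b f g \<subseteq> {z. \<bar>Re z\<bar> < H * b \<and> \<bar>Im z\<bar> < h H \<bar>Re z\<bar>}"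
        using mem by (force simp: stretch_def)
      show "{z. \<bar>Re z\<bar> < H * b \<and> \<bar>Im z\<bar> < h H \<bar>Re z\<bar>} \<subseteq> stretch H ` graph_domain a b f g"
      proof
        fix w assume w: "w \<in> {z. \<bar>Re z\<bar> < H * b \<and> \<bar>Im z\<bar> < h H \<bar>Re z\<bar>}"
        define z where "z = Complex (Re w / H) (Im w)"
        have "stretch H z = w" using H by (simp add: z_def stretch_def)
        moreover have "z \<in> graph_domain a b f g" using mem[of z] w H by (simp add: z_def)
        ultimately show "w \<in> stretch H ` graph_domain a b f g" by blast
      qed
    qed
  qed
  have E: "?E H = ext_mod {z. \<bar>Re z\<bar> < H * b \<and> \<bar>Im z\<bar> < h H \<bar>Re z\<bar>} (Complex (- (H * b)) (h H (H * b)))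
      (Complex (- (H * b)) (- h H (H * b))) (Complex (H * b) (- h H (H * b))) (Complex (H * b) (h H (H * b)))" if "0 < H" for H
    unfolding dom[OF that] hb[OF that] using sym(1) f[of b] f[of "- b"] g(1)[of b] b by (simp add: stretch_def)
  have "\<forall>H. \<exists>l. 0 < H \<longrightarrow> 0 < l \<and> l < 1 \<and> ?E H = schwarz_christoffel.a l / schwarz_christoffel.b l \<and>
     (\<forall>M. 0 < M \<longrightarrow> M \<le> H * b \<longrightarrow> (\<forall>x. 0 \<le> x \<longrightarrow> x \<le> H * b \<longrightarrow> h H x \<le> M) \<longrightarrow>
        (h H (H * b))\<^sup>2 * M / (4 + 2 * M\<^sup>2)\<^sup>2 / (25 * pi\<^sup>2) / (H * b) \<le> 1 - l\<^sup>2 \<and> 1 - l\<^sup>2 \<le> 240 * pi * h H (H * b) / (H * b))"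
    (is "\<forall>H. \<exists>l. 0 < H \<longrightarrow> ?p H l")
  proof
    fix H
    show "\<exists>l. 0 < H \<longrightarrow> ?p H l"
    proof (cases "0 < H")
      case True
      from corner.ext_mod_formula[OF cor[OF True]] have "\<exists>l. ?p H l" unfolding E[OF True] .
      then show ?thesis by blast
    qed simp
  qed
  from choice[OF this] obtain l where l: "\<And>H. 0 < H \<Longrightarrow> ?p H (l H)" by blast
  \<comment> \<open>Stretching changes the length \<open>L = H * b\<close> but neither the end
    height \<open>h L = g b\<close> nor the bound \<open>M0\<close> on all heights, so the bounds in
    \<open>ext_mod_formula\<close> become constants divided by \<open>H\<close>.\<close>
  define c where "c = (g b)\<^sup>2 * M0 / (4 + 2 * M0\<^sup>2)\<^sup>2 / (25 * pi\<^sup>2) / b"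
  define C where "C = 240 * pi * g b / b"
  have gb: "0 < g b" using g(2)[of b] b by simp
  show ?thesis
  proof (rule sc_ratio_asymp[of c l C])
    have "0 < 4 + 2 * M0\<^sup>2" using zero_le_power2[of M0] by linarith
    then show "0 < c" unfolding c_def using gb M0p b by (intro divide_pos_pos mult_pos_pos zero_less_power) auto
    show "\<forall>\<^sub>F H in at_top. 0 < l H \<and> l H < 1 \<and> c / H \<le> 1 - (l H)\<^sup>2 \<and> 1 - (l H)\<^sup>2 \<le> C / H \<and> ?E H = schwarz_christoffel.a (l H) / schwarz_christoffel.b (l H)"
      using eventually_gt_at_top[of 0] eventually_ge_at_top[of "M0 / b"]
    proof eventually_elim
      case (elim H)
      have hM: "\<forall>x. 0 \<le> x \<longrightarrow> x \<le> H * b \<longrightarrow> h H x \<le> M0" unfolding h_def using b by (intro allI impI M0) auto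
      \<comment> \<open>For such \<open>H\<close> the half-length exceeds all heights, which is the
        condition \<open>M \<le> L\<close> of the estimates.\<close>
      have "M0 \<le> H * b" using elim(2) b by (simp add: pos_divide_le_eq)
      with l[OF elim(1)] hM M0p
      have "(g b)\<^sup>2 * M0 / (4 + 2 * M0\<^sup>2)\<^sup>2 / (25 * pi\<^sup>2) / (H * b) \<le> 1 - (l H)\<^sup>2" "1 - (l H)\<^sup>2 \<le> 240 * pi * g b / (H * b)"
        unfolding hb[OF elim(1)] by blast+
      then have "c / H \<le> 1 - (l H)\<^sup>2" "1 - (l H)\<^sup>2 \<le> C / H" by (simp_all add: c_def C_def mult_ac)
      then show ?case using l[OF elim(1)] by blast
    qed
  qed
qed

end
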